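(* Let $0<\rho<1$, let $\Lambda\subset\mathbb N_{\ge1}$ be a finite (possibly empty) set, let $\beta_\ell>0$ for $\ell\in\Lambda$, and for $n\ge1$ let \[ T_n=Q_0-\rho\Pi_1-\sum_{\ell\in\Lambda}\beta_\ell Q_\ell \] on $L_2(\gamma_n)$. Let $W:[0,\infty)\to(0,\infty)$ be measurable with $\mu_W=\int_0^\infty W(r^2)\,\mathrm d\nu(r)<\infty$ and such that all entries of the matrices $\mathcal M^{p,q}(W)$ (for all $p,q\in\mathbb N_0$ with $\mathcal I^\Lambda_{p,q}\neq\varnothing$) are finite. Suppose that \[ \mathcal M^{p,q}(W)\preceq I\quad\text{for every } p,q\in\mathbb N_0 \text{ with } \mathcal I_{p,q}^{\Lambda}\neq\varnothing, \] and that $S\le1$. Then, for every $n\ge1$, \[ \|T_n\|_{\infty\to1}\le\rho+\mu_W . \] Consequently, \[ K_G^{\mathbb C}\ge\frac{1-\rho}{\rho+\mu_W}. \]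
   Context: Complex inner products are linear in the first variable. Grothendieck constant: $K_G^{\mathbb C}$ is the least $K$ such that $|\sum_{i,j} a_{ij}\langle x_i,y_j\rangle|\le K\max_{|\varepsilon_i|=|\delta_j|=1}|\sum_{i,j}a_{ij}\varepsilon_i\overline{\delta_j}|$ for all positive integers $m,n,d$, all $A\in\mathbb C^{m\times n}$, and all unit vectors $x_i,y_j\in\mathbb C^d$ (scalars $\varepsilon_i,\delta_j\in\mathbb C$). Gaussian measure and Hermite projections: $\mathrm d\gamma_n(z)=\pi^{-n}e^{-\|z\|_2^2}\,\mathrm dz$ on $\mathbb C^n$ ($\mathrm dz$ is $2n$-dimensional Lebesgue measure). For $p,q\in\mathbb N_0$, $h_{p,q}(z)=\frac1{\sqrt{p!q!}}\sum_{j=0}^{\min(p,q)}(-1)^jj!\binom pj\binom qj z^{p-j}\overline z^{\,q-j}$ for $z\in\mathbb C$. For $\alpha,\beta\in\mathbb N_0^n$, $h_{\alpha,\beta}(z)=\prod_{j=1}^nh_{\alpha_j,\beta_j}(z_j)$; these form an orthonormal basis of $L_2(\gamma_n)$. $P_{p,q}^{(n)}$ is the orthogonal projection of $L_2(\gamma_n)$ onto $\operatorname{span}\{h_{\alpha,\beta}:|\alpha|=p,|\beta|=q\}$. $Q_\ell=P^{(n)}_{\ell+1,\ell}$ for $\ell\ge0$, and $\Pi_1=\sum_{\ell\ge0}Q_\ell$ (strong convergence). The norm is $\|T\|_{\infty\to1}=\sup\{|\langle Tf,g\rangle|: f,g\text{ measurable},\ |f|,|g|\le1\}$. Radial data: $\mathrm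 d\nu(r)=2re^{-r^2}\,\mathrm dr$ on $[0,\infty)$. The real functions $e_{a,b}$ are defined by $h_{a,b}(re^{i\theta})=e^{i(a-b)\theta}e_{a,b}(r)$, and $\phi_\ell=e_{\ell+1,\ell}$ (so $\phi_0(r)=r$). Gram matrices: for $p,q\in\mathbb N_0$, $\mathcal I_{p,q}^\Lambda=\{\ell\in\Lambda:p\le\ell+1,\ q\le\ell\}$, and when this is nonempty, for $\ell,m\in\mathcal I_{p,q}^\Lambda$, \[ \mathcal M^{p,q}_{\ell m}(W)=\sqrt{\beta_\ell\beta_m}\int_0^\infty\frac{e_{\ell+1-p,\ell-q}(r)\,e_{m+1-p,m-q}(r)}{W(r^2)}\,\mathrm d\nu(r). \] $A\preceq B$ means $B-A$ is positive semidefinite. Schur scalar: with $D(r)=2\rho+W(r^2)$ and $B=\operatorname{diag}(\beta_\ell)_{\ell\in\Lambda}$, put $R=\int_0^\infty\frac{r^2}{D(r)}\,\mathrm d\nu(r)$, $b_\ell=\int_0^\infty\frac{r\phi_\ell(r)}{D(r)}\,\mathrm d\nu(r)$, $G_{\ell m}=\int_0^\infty\frac{\phi_\ell(r)\phi_m(r)}{D(r)}\,\mathrm d\nu(r)$ for $\ell,m\in\Lambda$, $\boldsymbol b=(b_\ell)_{\ell\in\Lambda}$, $G=(G_{\ell m})_{\ell,m\in\Lambda}$, and $S=R-\boldsymbol b^T(B^{-1}+G)^{-1}\boldsymbol b$ (with $S=R$ if $\Lambda=\varnothing$). *)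

theory Defs
  imports "HOL-Analysis.Analysis"
begin

section \<open>The complex Grothendieck constant\<close>

text \<open>Matrices and vectors are functions on \<^typ>\<open>nat\<close> of which only the entries with index below
  the stated dimension are used.\<close>

definition cvec_inner :: "nat \<Rightarrow> (nat \<Rightarrow> complex) \<Rightarrow> (nat \<Rightarrow> complex) \<Rightarrow> complex" where
  "cvec_inner d x y = (\<Sum>k<d. x k * cnj (y k))"

definition unit_cvec :: "nat \<Rightarrow> (nat \<Rightarrow> complex) \<Rightarrow> bool" where
  "unit_cvec d x \<longleftrightarrow> sqrt (\<Sum>k<d. (cmod (x k))\<^sup>2) = 1"

text \<open>The supremum is a maximum, since the set is the continuous image of a nonempty compact torus.\<close>

definition unimodular_max :: "nat \<Rightarrow> nat \<Rightarrow> (nat \<Rightarrow> nat \<Rightarrow> complex) \<Rightarrow> real" where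
  "unimodular_max m n A = Sup {cmod (\<Sum>i<m. \<Sum>j<n. A i j * \<epsilon> i * cnj (\<delta> j)) | \<epsilon> \<delta>.
     (\<forall>i<m. cmod (\<epsilon> i) = 1) \<and> (\<forall>j<n. cmod (\<delta> j) = 1)}"

definition grothendieck_bound :: "real \<Rightarrow> bool" where
  "grothendieck_bound K \<longleftrightarrow>
     (\<forall>m>0. \<forall>n>0. \<forall>d>0. \<forall>A x y.
        (\<forall>i<m. unit_cvec d (x i)) \<longrightarrow> (\<forall>j<n. unit_cvec d (y j)) \<longrightarrow>
        cmod (\<Sum>i<m. \<Sum>j<n. A i j * cvec_inner d (x i) (y j)) \<le> K * unimodular_max m n A)"

text \<open>The admissible constants form a closed set that is bounded below, so the infimum is the least
  one. It is taken in \<^typ>\<open>ereal\<close>, where it is meaningful without first knowing that an admissible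
  constant exists.\<close>

definition complex_grothendieck_constant :: ereal where
  "complex_grothendieck_constant = Inf {ereal K | K. grothendieck_bound K}"


section \<open>Gaussian measure and complex Hermite functions\<close>

text \<open>Points of the $n$-dimensional complex space are the elements of \<open>{..<n} \<rightarrow>\<^sub>E UNIV\<close>, the
  space of \<open>PiM {..<n} (\<lambda>_. lborel)\<close>; there \<^term>\<open>lborel :: complex measure\<close> is planar Lebesgue
  measure.\<close>

definition gauss :: "nat \<Rightarrow> (nat \<Rightarrow> complex) measure" where
  "gauss n = density (PiM {..<n} (\<lambda>_. lborel))
     (\<lambda>z. ennreal (exp (- (\<Sum>j<n. (cmod (z j))\<^sup>2)) / pi ^ n))"

definition hermite1 :: "nat \<Rightarrow> nat \<Rightarrow> complex \<Rightarrow> complex" where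
  "hermite1 p q z = 1 / of_real (sqrt (fact p * fact q)) *
     (\<Sum>j\<le>min p q. (- 1) ^ j * fact j * of_nat (p choose j) * of_nat (q choose j) *
        z ^ (p - j) * cnj z ^ (q - j))"

definition hermite :: "nat \<Rightarrow> (nat \<Rightarrow> nat) \<Rightarrow> (nat \<Rightarrow> nat) \<Rightarrow> (nat \<Rightarrow> complex) \<Rightarrow> complex" where
  "hermite n \<alpha> \<beta> z = (\<Prod>j<n. hermite1 (\<alpha> j) (\<beta> j) (z j))"

definition multi_indices :: "nat \<Rightarrow> nat \<Rightarrow> (nat \<Rightarrow> nat) set" where
  "multi_indices n p = {\<alpha> \<in> {..<n} \<rightarrow>\<^sub>E UNIV. (\<Sum>j<n. \<alpha> j) = p}"


section \<open>Operators on \<open>L\<^sub>2\<close> of the Gaussian measure\<close>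

text \<open>Elements of \<open>L\<^sub>2\<close> are represented by functions. The operators below choose a representative of
  the result, which is unique up to almost everywhere equality; the inner products and norms do not
  depend on that choice.\<close>

definition L2 :: "nat \<Rightarrow> ((nat \<Rightarrow> complex) \<Rightarrow> complex) set" where
  "L2 n = {f \<in> borel_measurable (gauss n). integrable (gauss n) (\<lambda>z. (cmod (f z))\<^sup>2)}"

definition L2_inner ::
  "nat \<Rightarrow> ((nat \<Rightarrow> complex) \<Rightarrow> complex) \<Rightarrow> ((nat \<Rightarrow> complex) \<Rightarrow> complex) \<Rightarrow> complex" where
  "L2_inner n f g = (\<integral>z. f z * cnj (g z) \<partial>gauss n)"

definition L2_norm :: "nat \<Rightarrow> ((nat \<Rightarrow> complex) \<Rightarrow> complex) \<Rightarrow> real" where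
  "L2_norm n f = sqrt (\<integral>z. (cmod (f z))\<^sup>2 \<partial>gauss n)"

definition hermite_span :: "nat \<Rightarrow> nat \<Rightarrow> nat \<Rightarrow> ((nat \<Rightarrow> complex) \<Rightarrow> complex) set" where
  "hermite_span n p q =
     {\<lambda>z. \<Sum>\<alpha>\<in>multi_indices n p. \<Sum>\<beta>\<in>multi_indices n q. c \<alpha> \<beta> * hermite n \<alpha> \<beta> z | c. True}"

definition orth_proj ::
  "nat \<Rightarrow> ((nat \<Rightarrow> complex) \<Rightarrow> complex) set \<Rightarrow> ((nat \<Rightarrow> complex) \<Rightarrow> complex) \<Rightarrow> (nat \<Rightarrow> complex) \<Rightarrow> complex"
  where
  "orth_proj n V f = (SOME g. g \<in> V \<and> (\<forall>v\<in>V. L2_inner n (\<lambda>z. f z - g z) v = 0))"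

definition hermite_proj ::
  "nat \<Rightarrow> nat \<Rightarrow> nat \<Rightarrow> ((nat \<Rightarrow> complex) \<Rightarrow> complex) \<Rightarrow> (nat \<Rightarrow> complex) \<Rightarrow> complex" where
  "hermite_proj n p q = orth_proj n (hermite_span n p q)"

definition Q_op :: "nat \<Rightarrow> nat \<Rightarrow> ((nat \<Rightarrow> complex) \<Rightarrow> complex) \<Rightarrow> (nat \<Rightarrow> complex) \<Rightarrow> complex" where
  "Q_op n l = hermite_proj n (l + 1) l"

definition Pi1_op :: "nat \<Rightarrow> ((nat \<Rightarrow> complex) \<Rightarrow> complex) \<Rightarrow> (nat \<Rightarrow> complex) \<Rightarrow> complex" where
  "Pi1_op n f = (SOME g. g \<in> L2 n \<and>
     (\<lambda>N. L2_norm n (\<lambda>z. (\<Sum>l<N. Q_op n l f z) - g z)) \<longlonglongrightarrow> 0)"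

definition T_op ::
  "real \<Rightarrow> nat set \<Rightarrow> (nat \<Rightarrow> real) \<Rightarrow> nat \<Rightarrow> ((nat \<Rightarrow> complex) \<Rightarrow> complex) \<Rightarrow> (nat \<Rightarrow> complex) \<Rightarrow> complex"
  where
  "T_op \<rho> \<Lambda> \<beta> n f z =
     Q_op n 0 f z - of_real \<rho> * Pi1_op n f z - (\<Sum>l\<in>\<Lambda>. of_real (\<beta> l) * Q_op n l f z)"

definition inf_one_norm ::
  "nat \<Rightarrow> (((nat \<Rightarrow> complex) \<Rightarrow> complex) \<Rightarrow> (nat \<Rightarrow> complex) \<Rightarrow> complex) \<Rightarrow> ereal" where
  "inf_one_norm n T = Sup {ereal (cmod (L2_inner n (T f) g)) | f g.
     f \<in> borel_measurable (gauss n) \<and> g \<in> borel_measurable (gauss n) \<and>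
     (\<forall>z\<in>space (gauss n). cmod (f z) \<le> 1) \<and> (\<forall>z\<in>space (gauss n). cmod (g z) \<le> 1)}"


section \<open>Radial data\<close>

definition radial_measure :: "real measure" where
  "radial_measure = density lborel (\<lambda>r. ennreal (indicator {0..} r * (2 * r * exp (- r\<^sup>2))))"

text \<open>The radial part of \<^const>\<open>hermite1\<close> is its restriction to the positive real axis, where the
  angular factor is 1.\<close>

definition hermite_radial :: "nat \<Rightarrow> nat \<Rightarrow> real \<Rightarrow> real" where
  "hermite_radial a b r = Re (hermite1 a b (of_real r))"

lemma hermite1_polar:
  "hermite1 a b (of_real r * cis \<theta>) = cis ((real a - real b) * \<theta>) * of_real (hermite_radial a b r)"
proof -
  let ?c = "\<lambda>j. (- 1) ^ j * fact j * real (a choose j) * real (b choose j)"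
  let ?s = "\<Sum>j\<le>min a b. ?c j * r ^ (a - j) * r ^ (b - j)"
  have summand: "(- 1) ^ j * fact j * of_nat (a choose j) * of_nat (b choose j) *
        (of_real r * cis t) ^ (a - j) * cnj (of_real r * cis t) ^ (b - j)
      = cis ((real a - real b) * t) * of_real (?c j * r ^ (a - j) * r ^ (b - j))"
    if "j \<le> min a b" for j t
  proof -
    have "real (a - j) * t + real (b - j) * (- t) = (real a - real b) * t"
      using that by (simp add: of_nat_diff algebra_simps)
    then have "cis t ^ (a - j) * cnj (cis t) ^ (b - j) = cis ((real a - real b) * t)"
      by (simp only: cis_cnj Complex.DeMoivre cis_mult)
    then show ?thesis
      by (simp add: power_mult_distrib mult_ac)
  qed
  have polar: "hermite1 a b (of_real r * cis t) =
      cis ((real a - real b) * t) * of_real (1 / sqrt (fact a * fact b) * ?s)" for t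
  proof -
    have "(\<Sum>j\<le>min a b. (- 1) ^ j * fact j * of_nat (a choose j) * of_nat (b choose j) *
        (of_real r * cis t) ^ (a - j) * cnj (of_real r * cis t) ^ (b - j))
      = (\<Sum>j\<le>min a b. cis ((real a - real b) * t) * of_real (?c j * r ^ (a - j) * r ^ (b - j)))"
      by (rule sum.cong[OF refl], rule summand) simp
    also have "\<dots> = cis ((real a - real b) * t) * of_real ?s"
      unfolding of_real_sum sum_distrib_left ..
    finally show ?thesis
      unfolding hermite1_def by (simp only: of_real_mult of_real_divide of_real_1 mult_ac)
  qed
  have "hermite_radial a b r = 1 / sqrt (fact a * fact b) * ?s"
    using arg_cong[OF polar[of 0], of Re] unfolding hermite_radial_def
    by (simp only: mult_zero_right cis_zero mult_1_right mult_1_left Re_complex_of_real)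
  then show ?thesis
    using polar[of \<theta>] by simp
qed

definition radial_phi :: "nat \<Rightarrow> real \<Rightarrow> real" where
  "radial_phi l = hermite_radial (l + 1) l"

definition mu_W :: "(real \<Rightarrow> real) \<Rightarrow> real" where
  "mu_W W = (\<integral>r. W (r\<^sup>2) \<partial>radial_measure)"


section \<open>Gram matrices and the Schur scalar\<close>

text \<open>A real matrix indexed by a finite set \<open>I\<close> is a function of two arguments of which only the
  values on \<open>I \<times> I\<close> are used.\<close>

definition psd_on :: "nat set \<Rightarrow> (nat \<Rightarrow> nat \<Rightarrow> real) \<Rightarrow> bool" where
  "psd_on I A \<longleftrightarrow> (\<forall>l\<in>I. \<forall>m\<in>I. A l m = A m l) \<and>
     (\<forall>x. 0 \<le> (\<Sum>l\<in>I. \<Sum>m\<in>I. x l * A l m * x m))"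

definition loewner_le_on ::
  "nat set \<Rightarrow> (nat \<Rightarrow> nat \<Rightarrow> real) \<Rightarrow> (nat \<Rightarrow> nat \<Rightarrow> real) \<Rightarrow> bool" where
  "loewner_le_on I A B \<longleftrightarrow> psd_on I (\<lambda>l m. B l m - A l m)"

definition diag_mat :: "(nat \<Rightarrow> real) \<Rightarrow> nat \<Rightarrow> nat \<Rightarrow> real" where
  "diag_mat d l m = (if l = m then d l else 0)"

definition id_mat :: "nat \<Rightarrow> nat \<Rightarrow> real" where
  "id_mat = diag_mat (\<lambda>_. 1)"

definition mat_mult_on ::
  "nat set \<Rightarrow> (nat \<Rightarrow> nat \<Rightarrow> real) \<Rightarrow> (nat \<Rightarrow> nat \<Rightarrow> real) \<Rightarrow> nat \<Rightarrow> nat \<Rightarrow> real" where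
  "mat_mult_on I A B l m = (\<Sum>k\<in>I. A l k * B k m)"

text \<open>For a matrix that is invertible on \<open>I\<close>, the entries of the inverse on \<open>I \<times> I\<close> are uniquely
  determined.\<close>

definition mat_inv_on :: "nat set \<Rightarrow> (nat \<Rightarrow> nat \<Rightarrow> real) \<Rightarrow> nat \<Rightarrow> nat \<Rightarrow> real" where
  "mat_inv_on I A = (SOME X. \<forall>l\<in>I. \<forall>m\<in>I.
     mat_mult_on I A X l m = id_mat l m \<and> mat_mult_on I X A l m = id_mat l m)"

definition gram_index :: "nat set \<Rightarrow> nat \<Rightarrow> nat \<Rightarrow> nat set" where
  "gram_index \<Lambda> p q = {l \<in> \<Lambda>. p \<le> l + 1 \<and> q \<le> l}"

definition gram_integrand ::
  "(real \<Rightarrow> real) \<Rightarrow> nat \<Rightarrow> nat \<Rightarrow> nat \<Rightarrow> nat \<Rightarrow> real \<Rightarrow> real" where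
  "gram_integrand W p q l m r =
     hermite_radial (l + 1 - p) (l - q) r * hermite_radial (m + 1 - p) (m - q) r / W (r\<^sup>2)"

definition gram_mat ::
  "(nat \<Rightarrow> real) \<Rightarrow> (real \<Rightarrow> real) \<Rightarrow> nat \<Rightarrow> nat \<Rightarrow> nat \<Rightarrow> nat \<Rightarrow> real" where
  "gram_mat \<beta> W p q l m =
     sqrt (\<beta> l * \<beta> m) * (\<integral>r. gram_integrand W p q l m r \<partial>radial_measure)"

definition schur_D :: "real \<Rightarrow> (real \<Rightarrow> real) \<Rightarrow> real \<Rightarrow> real" where
  "schur_D \<rho> W r = 2 * \<rho> + W (r\<^sup>2)"

definition schur_R :: "real \<Rightarrow> (real \<Rightarrow> real) \<Rightarrow> real" where
  "schur_R \<rho> W = (\<integral>r. r\<^sup>2 / schur_D \<rho> W r \<partial>radial_measure)"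

definition schur_b :: "real \<Rightarrow> (real \<Rightarrow> real) \<Rightarrow> nat \<Rightarrow> real" where
  "schur_b \<rho> W l = (\<integral>r. r * radial_phi l r / schur_D \<rho> W r \<partial>radial_measure)"

definition schur_G :: "real \<Rightarrow> (real \<Rightarrow> real) \<Rightarrow> nat \<Rightarrow> nat \<Rightarrow> real" where
  "schur_G \<rho> W l m = (\<integral>r. radial_phi l r * radial_phi m r / schur_D \<rho> W r \<partial>radial_measure)"

text \<open>For empty \<open>\<Lambda>\<close> the double sum vanishes and the scalar is \<^const>\<open>schur_R\<close>.\<close>

definition schur_scalar ::
  "real \<Rightarrow> nat set \<Rightarrow> (nat \<Rightarrow> real) \<Rightarrow> (real \<Rightarrow> real) \<Rightarrow> real" where
  "schur_scalar \<rho> \<Lambda> \<beta> W = schur_R \<rho> W -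
     (\<Sum>l\<in>\<Lambda>. \<Sum>m\<in>\<Lambda>. schur_b \<rho> W l *
        mat_inv_on \<Lambda> (\<lambda>k k'. mat_inv_on \<Lambda> (diag_mat \<beta>) k k' + schur_G \<rho> W k k') l m *
        schur_b \<rho> W m)"

end

theory Submission
  imports Defs "HOL-Probability.Probability"
begin

text \<open>The sum of the \<open>Q\<^sub>l\<close> is the projection \<open>E\<^sub>1\<close> onto functions of angular degree one, an average of rotations
  that maps functions bounded by 1 to functions bounded by 1. Only angular degree one matters for
  \<open>\<langle>T f, g\<rangle>\<close>, and polarization with \<open>h = E\<^sub>1 f + E\<^sub>1 g\<close> and \<open>k = E\<^sub>1 f - E\<^sub>1 g\<close> reduces its real part to
  quadratic forms. A unitary change of variables makes the linear part of \<open>h\<close> a multiple of \<open>z\<^sub>0\<close>.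
  By weighted Cauchy--Schwarz, the Gram condition then yields
  \<open>\<Sum>\<^sub>l \<beta>\<^sub>l \<langle>Q\<^sub>l k, k\<rangle> \<le> \<integral> W(|z\<^sub>0|\<^sup>2) |k|\<^sup>2\<close> and the Schur condition yields
  \<open>\<langle>Q\<^sub>0 h, h\<rangle> \<le> \<integral> (2\<rho> + W(|z\<^sub>0|\<^sup>2)) |h|\<^sup>2 + \<Sum>\<^sub>l \<beta>\<^sub>l \<langle>Q\<^sub>l h, h\<rangle>\<close>. Since \<open>|h|\<^sup>2 + |k|\<^sup>2 \<le> 4\<close>
  pointwise, adding them gives the bound on \<open>T\<close>.

  For the Grothendieck constant, discretize the unit vector field \<open>z / \<parallel>z\<parallel>\<close>. As \<open>n\<close> grows its
  components lose no mass outside the range of \<open>Q\<^sub>0\<close>, so the vector-valued form of \<open>T\<^sub>n\<close> tends to a value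
  of at least \<open>1 - \<rho>\<close>.\<close>

subsection \<open>Radial and planar Gaussian measures\<close>

text \<open>The 2\<rho> in \<open>schur_D\<close> balances the two halves of the polarization. The
  half with \<open>h\<close> contains -\<rho> times its squared norm, so a bound on \<langle>Q_0 h,
  h\<rangle> with 2\<rho> leaves +\<rho>, which is also what the half with \<open>k\<close>
  contains. Both halves are then at most the integral of \<rho> + W times the squared modulus, and
  the pointwise bound 4 on the sum of the two squared moduli cancels the 4 of the polarization
  identity. \<open>E1\<close> is introduced because a single \<open>Q_op\<close> does not preserve
  the bound 1. That it agrees with the strong sum in \<open>Pi1_op\<close> amounts to completeness
  of the Hermite system, which is obtained by approximating bounded functions with polynomials. The
  coordinates may be fitted to \<open>h\<close> because the Gram estimate for \<open>k\<close> holds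
  in all of them, although W looks at the first coordinate only. Gram matrices with positive p and q
  appear there because the other coordinates may absorb part of the degree. In the lower bound the
  \<beta> terms vanish in the limit since \<Lambda> omits 0: what lies in the range of Q_0 is
  missing from the other levels.\<close>

definition gauss1 :: "complex measure" where
  "gauss1 = density lborel (\<lambda>z. ennreal (exp (- (cmod z)\<^sup>2) / pi))"

lemma sets_gauss1 [measurable_cong, simp]: "sets gauss1 = sets borel"
  by (simp add: gauss1_def)

lemma space_gauss1 [simp]: "space gauss1 = UNIV"
  by (simp add: gauss1_def)

lemma Complex_measurable [measurable]:
  assumes "f \<in> borel_measurable M" "g \<in> borel_measurable M"
  shows "(\<lambda>x. Complex (f x) (g x)) \<in> borel_measurable M"
  unfolding Complex_eq using assms by measurable

text \<open>Lebesgue measure on \<open>complex\<close> is determined by open boxes, and a box in the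
  basis 1, \<i> is a product of two intervals. This gives Fubini in the real and imaginary
  parts.\<close>

lemma lborel_complex_eq:
  "(lborel :: complex measure) = distr (lborel \<Otimes>\<^sub>M lborel) borel (\<lambda>(x, y). Complex x y)"
proof (rule lborel_eqI)
  fix l u :: complex
  assume le: "\<And>b. b \<in> Basis \<Longrightarrow> l \<bullet> b \<le> u \<bullet> b"
  from le[of 1] le[of \<i>] have lu: "Re l \<le> Re u" "Im l \<le> Im u"
    by (auto simp: Basis_complex_def)
  have pre: "(\<lambda>(x, y). Complex x y) -` box l u \<inter> space (lborel \<Otimes>\<^sub>M lborel)
      = {Re l<..<Re u} \<times> {Im l<..<Im u}"
    by (auto simp: box_def Basis_complex_def space_pair_measure)
  have "emeasure (distr (lborel \<Otimes>\<^sub>M lborel) borel (\<lambda>(x, y). Complex x y)) (box l u)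
      = emeasure (lborel \<Otimes>\<^sub>M lborel) ({Re l<..<Re u} \<times> {Im l<..<Im u})"
    by (subst emeasure_distr) (auto simp: pre)
  also have "\<dots> = emeasure lborel {Re l<..<Re u} * emeasure lborel {Im l<..<Im u}"
    by (intro lborel.emeasure_pair_measure_Times) auto
  also have "\<dots> = ennreal (\<Prod>b\<in>Basis. (u - l) \<bullet> b)"
    using lu by (simp add: Basis_complex_def ennreal_mult)
  finally show "emeasure (distr (lborel \<Otimes>\<^sub>M lborel) borel (\<lambda>(x, y). Complex x y)) (box l u)
      = (\<Prod>b\<in>Basis. (u - l) \<bullet> b)" .
qed simp

text \<open>Both orders of integration are wanted: a shear translates the inner variable, which is
  the real part for one kind of shear and the imaginary part for the other.\<close>

lemma nn_integral_lborel_complex: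
  fixes f :: "complex \<Rightarrow> ennreal"
  assumes [measurable]: "f \<in> borel_measurable borel"
  shows "(\<integral>\<^sup>+z. f z \<partial>lborel) = (\<integral>\<^sup>+x. \<integral>\<^sup>+y. f (Complex x y) \<partial>lborel \<partial>lborel)"
    and "(\<integral>\<^sup>+z. f z \<partial>lborel) = (\<integral>\<^sup>+y. \<integral>\<^sup>+x. f (Complex x y) \<partial>lborel \<partial>lborel)"
proof -
  have "(\<integral>\<^sup>+z. f z \<partial>lborel) = (\<integral>\<^sup>+p. f (case p of (x, y) \<Rightarrow> Complex x y) \<partial>(lborel \<Otimes>\<^sub>M lborel))"
    by (subst lborel_complex_eq, subst nn_integral_distr) auto
  also have "\<dots> = (\<integral>\<^sup>+x. \<integral>\<^sup>+y. f (Complex x y) \<partial>lborel \<partial>lborel)"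
    by (subst lborel.nn_integral_fst[symmetric]) auto
  finally show 1: "(\<integral>\<^sup>+z. f z \<partial>lborel) = (\<integral>\<^sup>+x. \<integral>\<^sup>+y. f (Complex x y) \<partial>lborel \<partial>lborel)" .
  also have "\<dots> = (\<integral>\<^sup>+y. \<integral>\<^sup>+x. f (Complex x y) \<partial>lborel \<partial>lborel)"
    by (subst lborel_pair.Fubini'[symmetric]) auto
  finally show "(\<integral>\<^sup>+z. f z \<partial>lborel) = (\<integral>\<^sup>+y. \<integral>\<^sup>+x. f (Complex x y) \<partial>lborel \<partial>lborel)" .
qed

section \<open>Shears and rotations preserve planar Lebesgue measure\<close>

lemma nn_integral_lborel_add:
  fixes f :: "'a::euclidean_space \<Rightarrow> ennreal"
  assumes [measurable]: "f \<in> borel_measurable borel"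
  shows "(\<integral>\<^sup>+x. f (x + c) \<partial>lborel) = (\<integral>\<^sup>+x. f x \<partial>lborel)"
  by (subst (2) lborel_distr_plus[of c, symmetric], subst nn_integral_distr) (auto simp: add.commute)

lemma nn_integral_lborel_shear_Re:
  fixes f :: "complex \<Rightarrow> ennreal"
  assumes [measurable]: "f \<in> borel_measurable borel"
  shows "(\<integral>\<^sup>+z. f (Complex (Re z + a * Im z) (Im z)) \<partial>lborel) = (\<integral>\<^sup>+z. f z \<partial>lborel)"
proof -
  have "(\<integral>\<^sup>+z. f (Complex (Re z + a * Im z) (Im z)) \<partial>lborel)
      = (\<integral>\<^sup>+y. \<integral>\<^sup>+x. f (Complex (x + a * y) y) \<partial>lborel \<partial>lborel)"
    by (subst nn_integral_lborel_complex(2)) auto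
  also have "\<dots> = (\<integral>\<^sup>+y. \<integral>\<^sup>+x. f (Complex x y) \<partial>lborel \<partial>lborel)"
    by (intro nn_integral_cong nn_integral_lborel_add[where f = "\<lambda>x. f (Complex x _)"]) auto
  finally show ?thesis by (simp add: nn_integral_lborel_complex(2))
qed

lemma nn_integral_lborel_shear_Im:
  fixes f :: "complex \<Rightarrow> ennreal"
  assumes [measurable]: "f \<in> borel_measurable borel"
  shows "(\<integral>\<^sup>+z. f (Complex (Re z) (Im z + a * Re z)) \<partial>lborel) = (\<integral>\<^sup>+z. f z \<partial>lborel)"
proof -
  have "(\<integral>\<^sup>+z. f (Complex (Re z) (Im z + a * Re z)) \<partial>lborel)
      = (\<integral>\<^sup>+x. \<integral>\<^sup>+y. f (Complex x (y + a * x)) \<partial>lborel \<partial>lborel)"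
    by (subst nn_integral_lborel_complex(1)) auto
  also have "\<dots> = (\<integral>\<^sup>+x. \<integral>\<^sup>+y. f (Complex x y) \<partial>lborel \<partial>lborel)"
    by (intro nn_integral_cong nn_integral_lborel_add[where f = "\<lambda>x. f (Complex _ x)"]) auto
  finally show ?thesis by (simp add: nn_integral_lborel_complex(1))
qed

text \<open>A rotation with nonzero sine is a product of three shears.\<close>

lemma nn_integral_lborel_rotate:
  fixes f :: "complex \<Rightarrow> ennreal"
  assumes f [measurable]: "f \<in> borel_measurable borel" and u: "cmod u = 1"
  shows "(\<integral>\<^sup>+z. f (u * z) \<partial>lborel) = (\<integral>\<^sup>+z. f z \<partial>lborel)"
proof -
  have gen: "(\<integral>\<^sup>+z. f (u * z) \<partial>lborel) = (\<integral>\<^sup>+z. f z \<partial>lborel)"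
    if u: "cmod u = 1" and s: "Im u \<noteq> 0" and [measurable]: "f \<in> borel_measurable borel"
    for u and f :: "complex \<Rightarrow> ennreal"
  proof -
    \<comment> \<open>For \<open>u = cis \<theta>\<close> this is minus the tangent of \<theta>/2,
      the coefficient of the two outer shears. The middle shear has the coefficient sin
      \<theta>.\<close>
    define a where "a = (Re u - 1) / Im u"
    define g1 where "g1 z = Complex (Re z + a * Im z) (Im z)" for z
    define g2 where "g2 z = Complex (Re z) (Im z + Im u * Re z)" for z
    have [measurable]: "g1 \<in> borel_measurable borel" "g2 \<in> borel_measurable borel"
      unfolding g1_def[abs_def] g2_def[abs_def] by auto
    have uu: "(Re u)\<^sup>2 + (Im u)\<^sup>2 = 1"
      using u by (metis cmod_power2 power_one)
    have 1: "1 + a * Im u = Re u" using s by (simp add: a_def)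
    have 3: "a * Im u = Re u - 1" using 1 by linarith
    have "a * (1 + Re u) * Im u = (a * Im u) * (1 + Re u)" by simp
    also have "\<dots> = (Re u)\<^sup>2 - 1"
      unfolding 3 by (simp add: power2_eq_square algebra_simps)
    also have "\<dots> = - Im u * Im u" using uu by (simp add: power2_eq_square)
    finally have "a * (1 + Re u) * Im u = - Im u * Im u" .
    with s have 2: "a * (1 + Re u) = - Im u" by (metis mult_right_cancel)
    have "g1 (g2 (g1 z)) = u * z" for z
    proof (rule complex_eqI)
      have "Re (g1 (g2 (g1 z))) = (1 + a * Im u) * Re z + a * (1 + (1 + a * Im u)) * Im z"
        by (simp add: g1_def g2_def algebra_simps)
      then show "Re (g1 (g2 (g1 z))) = Re (u * z)" by (simp add: 1 2)
      have "Im (g1 (g2 (g1 z))) = (1 + a * Im u) * Im z + Im u * Re z"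
        by (simp add: g1_def g2_def algebra_simps)
      then show "Im (g1 (g2 (g1 z))) = Im (u * z)" by (simp add: 1)
    qed
    then have "(\<integral>\<^sup>+z. f (u * z) \<partial>lborel) = (\<integral>\<^sup>+z. f (g1 (g2 (g1 z))) \<partial>lborel)" by simp
    also have "\<dots> = (\<integral>\<^sup>+z. f (g1 (g2 z)) \<partial>lborel)"
      using nn_integral_lborel_shear_Re[where f = "\<lambda>z. f (g1 (g2 z))" and a = a]
      by (simp add: g1_def)
    also have "\<dots> = (\<integral>\<^sup>+z. f (g1 z) \<partial>lborel)"
      using nn_integral_lborel_shear_Im[where f = "\<lambda>z. f (g1 z)" and a = "Im u"]
      by (simp add: g2_def)
    also have "\<dots> = (\<integral>\<^sup>+z. f z \<partial>lborel)"
      using nn_integral_lborel_shear_Re[where f = f and a = a]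
      by (simp add: g1_def)
    finally show ?thesis .
  qed
  show ?thesis
  proof (cases "Im u = 0")
    case False
    then show ?thesis using gen u f by blast
  next
    case True
    \<comment> \<open>Here \<open>u\<close> is 1 or -1, so it is split into the quarter turns
      \<open>u * \<i>\<close> and \<open>- \<i>\<close>, whose sines are not zero.\<close>
    then have *: "Im (u * \<i>) \<noteq> 0" "cmod (u * \<i>) = 1" using u by (auto simp: norm_mult cmod_def)
    have "u * z = u * \<i> * (- \<i> * z)" for z by (simp add: complex_eq_iff)
    then have "(\<integral>\<^sup>+z. f (u * z) \<partial>lborel) = (\<integral>\<^sup>+z. f (u * \<i> * (- \<i> * z)) \<partial>lborel)" by metis
    also have "\<dots> = (\<integral>\<^sup>+z. f (u * \<i> * z) \<partial>lborel)"
      by (rule gen[where f = "\<lambda>z. f (u * \<i> * z)"]) auto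
    also have "\<dots> = (\<integral>\<^sup>+z. f z \<partial>lborel)" using * by (intro gen) auto
    finally show ?thesis .
  qed
qed

lemma nn_integral_gauss1_rotate:
  assumes [measurable]: "f \<in> borel_measurable borel" and u: "cmod u = 1"
  shows "(\<integral>\<^sup>+z. f (u * z) \<partial>gauss1) = (\<integral>\<^sup>+z. f z \<partial>gauss1)"
  using nn_integral_lborel_rotate[where f = "\<lambda>z. ennreal (exp (- (cmod z)\<^sup>2) / pi) * f z" and u = u] u
  by (simp add: gauss1_def nn_integral_density norm_mult)

lemma distr_gauss1_rotate:
  assumes u: "cmod u = 1"
  shows "distr gauss1 gauss1 (\<lambda>z. u * z) = gauss1"
proof (rule measure_eqI)
  fix A assume "A \<in> sets (distr gauss1 gauss1 (\<lambda>z. u * z))"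
  then have A [measurable]: "A \<in> sets borel" by simp
  have "emeasure (distr gauss1 gauss1 (\<lambda>z. u * z)) A = (\<integral>\<^sup>+z. indicator A (u * z) \<partial>gauss1)"
    by (subst nn_integral_indicator[symmetric], simp, subst nn_integral_distr) auto
  also have "\<dots> = (\<integral>\<^sup>+z. indicator A z \<partial>gauss1)"
    using u by (intro nn_integral_gauss1_rotate) auto
  finally show "emeasure (distr gauss1 gauss1 (\<lambda>z. u * z)) A = emeasure gauss1 A" by simp
qed simp

section \<open>Polar coordinates: the law of the modulus\<close>

lemma nn_integral_2pir:
  assumes "0 \<le> a"
  shows "(\<integral>\<^sup>+r. ennreal (2 * pi * r) * indicator {0..a} r \<partial>lborel) = ennreal (pi * a\<^sup>2)"
proof -
  have "(\<integral>\<^sup>+r. ennreal (2 * pi * r) * indicator {0..a} r \<partial>lborel) = ennreal (pi * a\<^sup>2 - pi * 0\<^sup>2)"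
    using assms by (intro nn_integral_FTC_Icc) (auto intro!: derivative_eq_intros)
  then show ?thesis by simp
qed

text \<open>Half-lines generate the Borel sets, and the preimage of one under the modulus is a disk.
  Its area \<pi>a^2 has the derivative 2\<pi>a, so no change of variables is involved.\<close>

lemma distr_lborel_cmod:
  "distr lborel borel cmod = density lborel (\<lambda>r. ennreal (indicator {0..} r * (2 * pi * r)))"
  (is "?L = ?R")
proof (rule measure_eqI_generator_eq[where E = "range atMost" and \<Omega> = UNIV
      and A = "\<lambda>i::nat. {..real i}"])
  have em: "emeasure ?L {..a} = ennreal (pi * (max 0 a)\<^sup>2)" for a :: real
  proof (cases "0 \<le> a")
    case True
    have "emeasure ?L {..a} = emeasure lborel (cball (0::complex) a)"
      by (subst emeasure_distr) (auto intro!: arg_cong[where f = "emeasure lborel"])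
    also have "\<dots> = ennreal (pi * a\<^sup>2)"
      using True by (simp add: emeasure_cball unit_ball_vol_2)
    finally show ?thesis using True by (simp add: max_def)
  next
    case False
    have "cmod -` {..a} = {}"
    proof safe
      fix x assume "cmod x \<le> a" then show "x \<in> {}" using False norm_ge_zero[of x] by linarith
    qed
    then show ?thesis using False by (subst emeasure_distr) (auto simp: max_def)
  qed
  have em2: "emeasure ?R {..a} = ennreal (pi * (max 0 a)\<^sup>2)" for a :: real
  proof -
    have "emeasure ?R {..a} = (\<integral>\<^sup>+r. ennreal (2 * pi * r) * indicator {0..max 0 a} r \<partial>lborel)"
      by (subst emeasure_density)
        (auto intro!: nn_integral_cong simp: indicator_def max_def)
    also have "\<dots> = ennreal (pi * (max 0 a)\<^sup>2)"
      by (rule nn_integral_2pir) simp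
    finally show ?thesis .
  qed
  show "emeasure ?L X = emeasure ?R X" if "X \<in> range atMost" for X
    using that em em2 by auto
  show "emeasure ?L {..real i} \<noteq> \<infinity>" for i
    by (simp add: em)
  show "Int_stable (range atMost :: real set set)"
    by (auto simp: Int_stable_def)
  show "sets ?L = sigma_sets UNIV (range atMost)" "sets ?R = sigma_sets UNIV (range atMost)"
    by (simp_all add: borel_eq_atMost)
  show "(\<Union>i. {..real i}) = UNIV"
    using real_arch_simple by auto
qed auto

lemma sets_radial [measurable_cong, simp]: "sets radial_measure = sets borel"
  by (simp add: radial_measure_def)

lemma space_radial [simp]: "space radial_measure = UNIV"
  by (simp add: radial_measure_def)

text \<open>The \<pi> from the circles cancels the one in the Gaussian density. Hence every radial
  integral of the statement is an expectation over one complex Gaussian coordinate.\<close>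

lemma distr_gauss1_cmod: "distr gauss1 borel cmod = radial_measure"
proof -
  have "distr gauss1 borel cmod = density (distr lborel borel cmod) (\<lambda>r. ennreal (exp (- r\<^sup>2) / pi))"
    unfolding gauss1_def by (subst density_distr) auto
  also have "\<dots> = density lborel (\<lambda>r. ennreal (indicator {0..} r * (2 * pi * r)) * ennreal (exp (- r\<^sup>2) / pi))"
    unfolding distr_lborel_cmod by (subst density_density_eq) auto
  also have "\<dots> = radial_measure"
    unfolding radial_measure_def
    by (intro density_cong) (auto simp: ennreal_mult'' [symmetric] indicator_def field_simps)
  finally show ?thesis .
qed

text \<open>The factor 2r of the radial density turns an even moment into twice an odd Gaussian
  moment.\<close>

lemma has_bochner_integral_radial_even:
  "has_bochner_integral radial_measure (\<lambda>r. r ^ (2 * k)) (fact k)"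
proof -
  have "has_bochner_integral lborel (\<lambda>x::real. 2 *\<^sub>R (indicator {0..} x *\<^sub>R (exp (-x\<^sup>2)*x^(2 * k + 1))))
     (2 *\<^sub>R (fact k / 2))"
    by (intro has_bochner_integral_scaleR_right gaussian_moment_odd_pos)
  then have "has_bochner_integral lborel
     (\<lambda>r. (indicator {0..} r * (2 * r * exp (- r\<^sup>2))) *\<^sub>R (r ^ (2 * k) :: real)) (fact k)"
    by (simp add: mult_ac)
  then show ?thesis unfolding radial_measure_def
    by (intro has_bochner_integral_density) (auto simp: indicator_def)
qed

lemma prob_space_radial: "prob_space radial_measure"
proof
  have "(\<integral>\<^sup>+r. ennreal 1 \<partial>radial_measure) = ennreal 1"
    using has_bochner_integral_radial_even[of 0]
    by (subst nn_integral_eq_integral) (auto simp: has_bochner_integral_iff)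
  then show "emeasure radial_measure (space radial_measure) = 1"
    by simp
qed

lemma prob_space_gauss1: "prob_space gauss1"
proof
  have "emeasure gauss1 UNIV = emeasure (distr gauss1 borel cmod) UNIV"
    by (subst emeasure_distr) auto
  also have "\<dots> = 1" unfolding distr_gauss1_cmod
    using prob_space.emeasure_space_1[OF prob_space_radial] by simp
  finally show "emeasure gauss1 (space gauss1) = 1" by simp
qed

interpretation radial: prob_space radial_measure by (rule prob_space_radial)
interpretation gauss1: prob_space gauss1 by (rule prob_space_gauss1)

lemma radial_integrable_power: "integrable radial_measure (\<lambda>r. r ^ k)"
proof (rule Bochner_Integration.integrable_bound)
  show "integrable radial_measure (\<lambda>r. 1 + r ^ (2 * k))"
    using has_bochner_integral_radial_even[of k] by (auto simp: has_bochner_integral_iff)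
  have "\<bar>r ^ k\<bar> \<le> 1 + r ^ (2 * k)" for r :: real
  proof -
    have "0 \<le> (\<bar>r ^ k\<bar> - 1)\<^sup>2" by simp
    then have "2 * \<bar>r ^ k\<bar> \<le> 1 + (r ^ k)\<^sup>2" by (simp add: power2_eq_square algebra_simps)
    then show ?thesis by (simp add: power_mult [symmetric] mult.commute power_even_eq) 
  qed
  then show "AE r in radial_measure. norm (r ^ k) \<le> norm (1 + r ^ (2 * k))"
    by (auto simp: order_trans[OF _ abs_ge_self])
qed auto

lemma integral_gauss1_cmod:
  fixes F :: "real \<Rightarrow> 'a::{banach, second_countable_topology}"
  assumes [measurable]: "F \<in> borel_measurable borel"
  shows "(\<integral>z. F (cmod z) \<partial>gauss1) = (\<integral>r. F r \<partial>radial_measure)"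
    and "integrable gauss1 (\<lambda>z. F (cmod z)) \<longleftrightarrow> integrable radial_measure F"
  unfolding distr_gauss1_cmod[symmetric]
  by (auto simp: integral_distr integrable_distr_eq)

lemma integral_gauss1_rotate:
  fixes f :: "complex \<Rightarrow> complex"
  assumes [measurable]: "f \<in> borel_measurable borel" and u: "cmod u = 1"
  shows "(\<integral>z. f (u * z) \<partial>gauss1) = (\<integral>z. f z \<partial>gauss1)"
  by (subst (2) distr_gauss1_rotate[OF u, symmetric], subst integral_distr) auto

text \<open>Rotation by the angle \<pi>/k multiplies \<open>f\<close> by \<open>cis pi\<close>,
  which is -1, so the integral equals its own negative.\<close>

lemma integral_gauss1_eq_0:
  fixes f :: "complex \<Rightarrow> complex"
  assumes [measurable]: "f \<in> borel_measurable borel"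
    and hom: "\<And>\<theta> z. f (cis \<theta> * z) = cis (k * \<theta>) * f z" and "k \<noteq> 0"
  shows "(\<integral>z. f z \<partial>gauss1) = 0"
proof -
  have "(\<integral>z. f z \<partial>gauss1) = (\<integral>z. f (cis (pi / k) * z) \<partial>gauss1)"
    by (rule integral_gauss1_rotate[symmetric]) auto
  also have "\<dots> = (\<integral>z. - f z \<partial>gauss1)" using \<open>k \<noteq> 0\<close> by (simp add: hom)
  finally show ?thesis by simp
qed

subsection \<open>Hermite functions in one variable\<close>

lemma sum_choose_Suc:
  fixes f :: "nat \<Rightarrow> 'a::comm_semiring_1"
  shows "(\<Sum>j\<le>Suc q. of_nat (Suc q choose j) * f j)
       = (\<Sum>j\<le>q. of_nat (q choose j) * f j) + (\<Sum>j\<le>q. of_nat (q choose j) * f (Suc j))"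
proof -
  have 1: "(\<Sum>j\<le>Suc q. of_nat (Suc q choose j) * f j)
      = f 0 + (\<Sum>j\<le>q. of_nat (q choose j) * f (Suc j)) + (\<Sum>j\<le>q. of_nat (q choose Suc j) * f (Suc j))"
    by (simp add: sum.atMost_Suc_shift sum.distrib distrib_right add.assoc del: sum.atMost_Suc)
  have "f 0 + (\<Sum>j\<le>q. of_nat (q choose Suc j) * f (Suc j)) = (\<Sum>j\<le>Suc q. of_nat (q choose j) * f j)"
    by (simp add: sum.atMost_Suc_shift del: sum.atMost_Suc)
  also have "\<dots> = (\<Sum>j\<le>q. of_nat (q choose j) * f j)" by (simp add: binomial_eq_0)
  finally have 2: "f 0 + (\<Sum>j\<le>q. of_nat (q choose Suc j) * f (Suc j)) = (\<Sum>j\<le>q. of_nat (q choose j) * f j)" .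
  show ?thesis unfolding 1 2[symmetric] by (simp only: add_ac)
qed

text \<open>The sum is a q-th finite difference of a binomial coefficient in its upper index. By
  Pascal's rule each difference lowers the lower index by one.\<close>

lemma alternating_choose_sum:
  "(\<Sum>j\<le>q. real (q choose j) * ((- 1) ^ j * real ((a + q - j) choose b)))
     = (if q \<le> b then real (a choose (b - q)) else 0)"
proof (induction q arbitrary: a)
  case (Suc q)
  have "(\<Sum>j\<le>Suc q. real (Suc q choose j) * ((- 1) ^ j * real ((a + Suc q - j) choose b)))
      = (\<Sum>j\<le>q. real (q choose j) * ((- 1) ^ j * real ((Suc a + q - j) choose b)))
        - (\<Sum>j\<le>q. real (q choose j) * ((- 1) ^ j * real ((a + q - j) choose b)))"
    unfolding sum_choose_Suc by (simp add: sum_negf)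
  also have "\<dots> = (if q \<le> b then real (Suc a choose (b - q)) else 0)
      - (if q \<le> b then real (a choose (b - q)) else 0)"
    unfolding Suc.IH ..
  also have "\<dots> = (if Suc q \<le> b then real (a choose (b - Suc q)) else 0)"
  proof (cases "q < b")
    case True
    then have "b - q = Suc (b - Suc q)" by simp
    then show ?thesis using True by simp
  qed auto
  finally show ?case .
qed simp

text \<open>The left side is the Gaussian integral of an unnormalized Hermite polynomial against a
  monomial. Pulling out \<open>fact p * fact b\<close> leaves a finite difference, and its vanishing
  for b < q is the orthogonality to monomials of lower degree.\<close>

lemma hermite_moment_sum:
  assumes "p + b = a + q"
  shows "(\<Sum>j\<le>min p q. (- 1) ^ j * fact j * real (p choose j) * real (q choose j) * fact (p + b - j))
     = (if q \<le> b then fact p * fact b * real (a choose (b - q)) else 0)"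
proof -
  have "(\<Sum>j\<le>min p q. (- 1) ^ j * fact j * real (p choose j) * real (q choose j) * fact (p + b - j))
    = (\<Sum>j\<le>min p q. fact p * fact b * (real (q choose j) * ((- 1) ^ j * real ((a + q - j) choose b))))"
  proof (rule sum.cong[OF refl])
    fix j assume "j \<in> {..min p q}"
    then have j: "j \<le> p" by simp
    have 1: "fact j * real (p choose j) * fact (p - j) = fact p"
      using binomial_fact_lemma[OF j, THEN arg_cong[where f = real]] by (simp add: mult_ac)
    have "b \<le> p + b - j" "p + b - j - b = p - j" using j by auto
    then have 2: "fact (p + b - j) = fact b * fact (p - j) * real ((p + b - j) choose b)"
      using binomial_fact_lemma[of b "p + b - j", THEN arg_cong[where f = real]] by (simp only: of_nat_mult of_nat_fact)
    have "(- 1) ^ j * fact j * real (p choose j) * real (q choose j) * fact (p + b - j)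
      = (- 1) ^ j * (fact j * real (p choose j) * fact (p - j)) * fact b * real (q choose j) * real ((p + b - j) choose b)"
      unfolding 2 by simp
    then show "(- 1) ^ j * fact j * real (p choose j) * real (q choose j) * fact (p + b - j)
      = fact p * fact b * (real (q choose j) * ((- 1) ^ j * real ((a + q - j) choose b)))"
      unfolding 1 assms by simp
  qed
  \<comment> \<open>The range may grow to q: for p < j the upper index \<open>a + q - j\<close>
    drops below \<open>b\<close>, so the binomial coefficient is zero.\<close>
  also have "\<dots> = (\<Sum>j\<le>q. fact p * fact b * (real (q choose j) * ((- 1) ^ j * real ((a + q - j) choose b))))"
  proof (rule sum.mono_neutral_left)
    show "\<forall>i\<in>{..q} - {..min p q}. fact p * fact b * (real (q choose i) * ((- 1) ^ i * real (a + q - i choose b))) = 0"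
    proof
      fix j assume "j \<in> {..q} - {..min p q}"
      then have "p < j" "j \<le> q" by auto
      then have "a + q - j < b" using assms by linarith
      then show "fact p * fact b * (real (q choose j) * ((- 1) ^ j * real (a + q - j choose b))) = 0"
        by (simp add: binomial_eq_0)
    qed
  qed auto
  also have "\<dots> = (if q \<le> b then fact p * fact b * real (a choose (b - q)) else 0)"
    unfolding sum_distrib_left[symmetric] alternating_choose_sum by simp
  finally show ?thesis .
qed

section \<open>Moments and orthogonality in one complex variable\<close>

lemma cnj_measurable [measurable]: "cnj \<in> borel_measurable borel"
  by (intro borel_measurable_continuous_onI continuous_intros)

lemma integrable_gauss1_monomial: "integrable gauss1 (\<lambda>z. z ^ a * cnj z ^ b)"
proof (rule Bochner_Integration.integrable_bound)
  show "integrable gauss1 (\<lambda>z. cmod z ^ (a + b))"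
    using radial_integrable_power[of "a + b"] by (subst integral_gauss1_cmod(2)) auto
  show "(\<lambda>z. z ^ a * cnj z ^ b) \<in> borel_measurable gauss1"
    by measurable
qed (auto simp: norm_mult norm_power power_add)

lemma integral_gauss1_monomial:
  "(\<integral>z. z ^ a * cnj z ^ b \<partial>gauss1) = (if a = b then fact a else 0)"
proof (cases "a = b")
  case True
  have "(\<integral>z. z ^ a * cnj z ^ b \<partial>gauss1) = (\<integral>z. complex_of_real (cmod z ^ (2 * a)) \<partial>gauss1)"
    unfolding True power_mult_distrib[symmetric] complex_norm_square[symmetric]
    by (simp add: power_mult)
  also have "\<dots> = complex_of_real (\<integral>r. r ^ (2 * a) \<partial>radial_measure)"
    by (subst integral_complex_of_real, subst integral_gauss1_cmod) auto
  finally show ?thesis using has_bochner_integral_radial_even[of a] True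
    by (simp add: has_bochner_integral_iff)
next
  case False
  have "(\<integral>z. z ^ a * cnj z ^ b \<partial>gauss1) = 0"
  proof (rule integral_gauss1_eq_0[where k = "real a - real b"])
    have *: "cis (\<theta> * real a) * cis (- (\<theta> * real b)) = cis ((real a - real b) * \<theta>)" for \<theta>
      by (simp add: cis_mult algebra_simps)
    show "(cis \<theta> * z) ^ a * cnj (cis \<theta> * z) ^ b = cis ((real a - real b) * \<theta>) * (z ^ a * cnj z ^ b)" for \<theta> z
      unfolding *[symmetric] by (simp add: power_mult_distrib Complex.DeMoivre cis_cnj mult_ac)
  qed (use False in auto)
  then show ?thesis using False by simp
qed

definition hermite_unnormalized :: "nat \<Rightarrow> nat \<Rightarrow> complex \<Rightarrow> complex" where
  "hermite_unnormalized p q z = (\<Sum>j\<le>min p q. of_real ((- 1) ^ j * fact j * real (p choose j) * real (q choose j)) *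
        (z ^ (p - j) * cnj z ^ (q - j)))"

lemma hermite1_eq: "hermite1 p q z = hermite_unnormalized p q z / of_real (sqrt (fact p * fact q))"
  by (simp add: hermite1_def hermite_unnormalized_def mult_ac)

lemma cnj_hermite1: "cnj (hermite1 p q z) = hermite1 q p z"
  by (simp add: hermite1_def min.commute mult_ac)

lemma hermite1_measurable [measurable]: "hermite1 p q \<in> borel_measurable borel"
proof -
  have "continuous_on UNIV (hermite1 p q)"
    unfolding hermite1_def[abs_def] by (intro continuous_intros) auto
  then show ?thesis by (rule borel_measurable_continuous_onI)
qed

lemma hermite1_0_0 [simp]: "hermite1 0 0 z = 1"
  by (simp add: hermite1_def)

lemma hermite1_1_0: "hermite1 (Suc 0) 0 z = z"
  by (simp add: hermite1_def)

lemma hermite_unnormalized_inner_monomial: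
  shows "integrable gauss1 (\<lambda>z. hermite_unnormalized p q z * (cnj z ^ a * z ^ b))"
    and "(\<integral>z. hermite_unnormalized p q z * (cnj z ^ a * z ^ b) \<partial>gauss1)
      = (if p + b = a + q \<and> q \<le> b then of_real (fact p * fact b * real (a choose (b - q))) else 0)"
proof -
  define c where "c j = (- 1) ^ j * fact j * real (p choose j) * real (q choose j)" for j
  have eq: "hermite_unnormalized p q z * (cnj z ^ a * z ^ b)
     = (\<Sum>j\<le>min p q. of_real (c j) * (z ^ (p - j + b) * cnj z ^ (q - j + a)))" for z
    unfolding hermite_unnormalized_def c_def sum_distrib_right
    by (rule sum.cong[OF refl]) (simp only: power_add mult_ac)
  show "integrable gauss1 (\<lambda>z. hermite_unnormalized p q z * (cnj z ^ a * z ^ b))"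
    unfolding eq by (intro Bochner_Integration.integrable_sum integrable_mult_right integrable_gauss1_monomial)
  have "(\<integral>z. hermite_unnormalized p q z * (cnj z ^ a * z ^ b) \<partial>gauss1)
    = (\<Sum>j\<le>min p q. of_real (c j) * (if p - j + b = q - j + a then fact (p - j + b) else 0))"
    unfolding eq
    by (subst Bochner_Integration.integral_sum)
      (simp_all only: integrable_gauss1_monomial integral_gauss1_monomial integral_mult_right_zero integrable_mult_right)
  also have "\<dots> = (\<Sum>j\<le>min p q. if p + b = a + q then of_real (c j * fact (p + b - j)) else 0)"
  proof (rule sum.cong[OF refl])
    fix j assume "j \<in> {..min p q}"
    then have "(p - j + b = q - j + a) = (p + b = a + q)" "p - j + b = p + b - j" by auto
    then show "of_real (c j) * (if p - j + b = q - j + a then fact (p - j + b) else 0)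
        = (if p + b = a + q then complex_of_real (c j * fact (p + b - j)) else 0)"
      by simp
  qed
  also have "\<dots> = (if p + b = a + q then of_real (\<Sum>j\<le>min p q. c j * fact (p + b - j)) else 0)"
    by simp
  also have "\<dots> = (if p + b = a + q \<and> q \<le> b then of_real (fact p * fact b * real (a choose (b - q))) else 0)"
    unfolding c_def using hermite_moment_sum[of p b a q] by simp
  finally show "(\<integral>z. hermite_unnormalized p q z * (cnj z ^ a * z ^ b) \<partial>gauss1)
      = (if p + b = a + q \<and> q \<le> b then of_real (fact p * fact b * real (a choose (b - q))) else 0)" .
qed

text \<open>If \<open>q' \<le> q\<close>, only the leading monomial (j = 0) of the second factor has
  degree high enough to pair with the first. The opposite case is reduced to this one by conjugation
  in \<open>hermite1_inner\<close>.\<close>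

lemma hermite_unnormalized_inner:
  shows "integrable gauss1 (\<lambda>z. hermite_unnormalized p q z * cnj (hermite_unnormalized p' q' z))"
    and "q' \<le> q \<Longrightarrow> (\<integral>z. hermite_unnormalized p q z * cnj (hermite_unnormalized p' q' z) \<partial>gauss1)
      = (if p = p' \<and> q = q' then of_real (fact p * fact q) else 0)"
proof -
  define c where "c j = (- 1) ^ j * fact j * real (p' choose j) * real (q' choose j)" for j
  have eq: "hermite_unnormalized p q z * cnj (hermite_unnormalized p' q' z)
     = (\<Sum>j\<le>min p' q'. of_real (c j) * (hermite_unnormalized p q z * (cnj z ^ (p' - j) * z ^ (q' - j))))" for z
    unfolding hermite_unnormalized_def[of p' q'] c_def cnj_sum sum_distrib_left
    by (intro sum.cong) (auto simp: mult_ac)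
  show "integrable gauss1 (\<lambda>z. hermite_unnormalized p q z * cnj (hermite_unnormalized p' q' z))"
    unfolding eq
    by (intro Bochner_Integration.integrable_sum integrable_mult_right hermite_unnormalized_inner_monomial)
  assume q: "q' \<le> q"
  have "(\<integral>z. hermite_unnormalized p q z * cnj (hermite_unnormalized p' q' z) \<partial>gauss1)
     = (\<Sum>j\<le>min p' q'. of_real (c j) * (if p + (q' - j) = (p' - j) + q \<and> q \<le> q' - j
          then of_real (fact p * fact (q' - j) * real ((p' - j) choose (q' - j - q))) else 0))"
    unfolding eq
    by (subst Bochner_Integration.integral_sum)
      (simp_all add: hermite_unnormalized_inner_monomial)
  also have "\<dots> = (\<Sum>j\<le>min p' q'. if j = 0 then (if p = p' \<and> q = q' then of_real (fact p * fact q) else 0) else 0)"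
    using q by (intro sum.cong) (auto simp: c_def)
  also have "\<dots> = (if p = p' \<and> q = q' then of_real (fact p * fact q) else 0)"
    by simp
  finally show "(\<integral>z. hermite_unnormalized p q z * cnj (hermite_unnormalized p' q' z) \<partial>gauss1)
      = (if p = p' \<and> q = q' then of_real (fact p * fact q) else 0)" .
qed

lemma hermite1_inner:
  shows "integrable gauss1 (\<lambda>z. hermite1 p q z * cnj (hermite1 p' q' z))"
    and "(\<integral>z. hermite1 p q z * cnj (hermite1 p' q' z) \<partial>gauss1) = (if p = p' \<and> q = q' then 1 else 0)"
proof -
  show "integrable gauss1 (\<lambda>z. hermite1 p q z * cnj (hermite1 p' q' z))" for p q p' q'
    using hermite_unnormalized_inner(1)[of p q p' q'] by (simp add: hermite1_eq)
  have *: "(\<integral>z. hermite1 p q z * cnj (hermite1 p' q' z) \<partial>gauss1) = (if p = p' \<and> q = q' then 1 else 0)"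
    if "q' \<le> q" for p q p' q'
  proof -
    have "of_real (sqrt (fact p * fact q)) * of_real (sqrt (fact p * fact q)) = (of_real (fact p * fact q) :: complex)"
      by (subst of_real_mult[symmetric]) (simp del: of_real_mult of_real_fact)
    then show ?thesis
      using hermite_unnormalized_inner(2)[OF that, of p p'] by (auto simp: hermite1_eq)
  qed
  show "(\<integral>z. hermite1 p q z * cnj (hermite1 p' q' z) \<partial>gauss1) = (if p = p' \<and> q = q' then 1 else 0)"
  proof (cases "q' \<le> q")
    case False
    have "(\<integral>z. hermite1 p q z * cnj (hermite1 p' q' z) \<partial>gauss1)
        = (\<integral>z. cnj (hermite1 p' q' z * cnj (hermite1 p q z)) \<partial>gauss1)"
      by (simp add: mult.commute)
    also have "\<dots> = cnj (\<integral>z. hermite1 p' q' z * cnj (hermite1 p q z) \<partial>gauss1)"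
      by (rule Bochner_Integration.integral_cnj)
    finally show ?thesis using *[of q q' p' p] False by auto
  qed (rule *)
qed

section \<open>Ladder recurrence and angular behaviour\<close>

lemma hermite_unnormalized_atMost:
  "hermite_unnormalized p q z = (\<Sum>j\<le>q. of_real ((- 1) ^ j * fact j * real (p choose j) * real (q choose j)) *
        (z ^ (p - j) * cnj z ^ (q - j)))"
  unfolding hermite_unnormalized_def by (intro sum.mono_neutral_left) (auto simp: binomial_eq_0)

text \<open>Multiplication by z is a raising plus a lowering operator. This is what keeps finite
  Hermite combinations closed under multiplication by a coordinate.\<close>

lemma hermite_unnormalized_recurrence:
  "z * hermite_unnormalized a b z = hermite_unnormalized (Suc a) b z + of_nat b * hermite_unnormalized a (b - 1) z"
proof (cases b)
  case 0
  then show ?thesis by (simp add: hermite_unnormalized_def)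
next
  case (Suc b')
  let ?m = "\<lambda>j. z ^ (a - j) * cnj z ^ (b' - j)"
  \<comment> \<open>Term j + 1 of the left side is matched with term j + 1 of the first and term j
    of the second summand on the right; Pascal's rule splits the coefficient, and the factor b is
    absorbed by \<open>Suc_times_binomial\<close>.\<close>
  have "z * (of_real ((- 1) ^ Suc j * fact (Suc j) * real (a choose Suc j) * real (Suc b' choose Suc j)) *
        (z ^ (a - Suc j) * cnj z ^ (Suc b' - Suc j)))
    = of_real ((- 1) ^ Suc j * fact (Suc j) * real (Suc a choose Suc j) * real (Suc b' choose Suc j)) *
        (z ^ (Suc a - Suc j) * cnj z ^ (Suc b' - Suc j)) +
      of_nat (Suc b') * (of_real ((- 1) ^ j * fact j * real (a choose j) * real (b' choose j)) * ?m j)" for j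
  proof -
    have 1: "z * (of_real ((- 1) ^ Suc j * fact (Suc j) * real (a choose Suc j) * real (Suc b' choose Suc j)) *
        (z ^ (a - Suc j) * cnj z ^ (Suc b' - Suc j)))
      = of_real ((- 1) ^ Suc j * fact (Suc j) * real (a choose Suc j) * real (Suc b' choose Suc j)) * ?m j"
    proof (cases "Suc j \<le> a")
      case True
      then have "a - j = Suc (a - Suc j)" by simp
      then show ?thesis by simp
    qed (simp add: binomial_eq_0)
    have 2: "real (Suc b') * real (b' choose j) = real (Suc j) * real (Suc b' choose Suc j)"
      unfolding of_nat_mult[symmetric] Suc_times_binomial ..
    have 3: "of_nat (Suc b') * (of_real ((- 1) ^ j * fact j * real (a choose j) * real (b' choose j)) * ?m j)
      = of_real ((- 1) ^ j * fact j * real (a choose j) * (real (Suc b') * real (b' choose j))) * ?m j"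
      by simp
    show ?thesis unfolding 1 3 2 by (simp add: algebra_simps)
  qed
  then show ?thesis
    unfolding Suc hermite_unnormalized_atMost
    by (simp add: sum.atMost_Suc_shift sum_distrib_left sum.distrib distrib_left del: sum.atMost_Suc)
qed

lemma hermite1_recurrence:
  "z * hermite1 a b z = of_real (sqrt (real (Suc a))) * hermite1 (Suc a) b z
      + of_real (sqrt (real b)) * hermite1 a (b - 1) z"
proof -
  define s where "s = sqrt (fact a * fact b)"
  have s: "s > 0" by (simp add: s_def)
  have 1: "of_real (sqrt (real (Suc a))) * hermite1 (Suc a) b z = hermite_unnormalized (Suc a) b z / of_real s"
  proof -
    have "sqrt (fact (Suc a) * fact b) = sqrt (real (Suc a)) * s"
      by (simp add: s_def real_sqrt_mult mult_ac)
    then show ?thesis by (simp add: hermite1_eq field_simps del: of_nat_Suc)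
  qed
  have 2: "of_real (sqrt (real b)) * hermite1 a (b - 1) z = of_nat b * hermite_unnormalized a (b - 1) z / of_real s"
  proof (cases b)
    case (Suc b')
    have "s = sqrt (real b) * sqrt (fact a * fact b')"
      by (simp add: s_def real_sqrt_mult Suc mult_ac)
    moreover have "of_nat b = of_real (sqrt (real b)) * (of_real (sqrt (real b)) :: complex)"
      by (subst of_real_mult[symmetric]) simp
    ultimately show ?thesis using Suc by (simp add: hermite1_eq field_simps del: of_nat_Suc)
  qed simp
  show ?thesis unfolding 1 2 unfolding hermite1_eq s_def[symmetric]
    using hermite_unnormalized_recurrence[of z a b] by (simp add: add_divide_distrib)
qed

lemma hermite1_cis:
  "hermite1 a b (cis \<theta> * z) = cis ((real a - real b) * \<theta>) * hermite1 a b z"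
proof -
  have z: "z = of_real (cmod z) * cis (Arg z)"
    using rcis_cmod_Arg[of z] by (simp add: rcis_def)
  have "cis \<theta> * z = of_real (cmod z) * cis (\<theta> + Arg z)"
    by (subst z) (simp add: cis_mult[symmetric] mult_ac)
  then have "hermite1 a b (cis \<theta> * z) = cis ((real a - real b) * (\<theta> + Arg z)) * of_real (hermite_radial a b (cmod z))"
    by (simp add: hermite1_polar)
  also have "\<dots> = cis ((real a - real b) * \<theta>) * hermite1 a b z"
    by (subst (2) z) (simp add: hermite1_polar distrib_left cis_mult[symmetric])
  finally show ?thesis .
qed

text \<open>Equal angular degrees make the phases cancel, which is why the Gram entries are real
  radial integrals.\<close>

lemma hermite1_mult_cnj:
  assumes "real a - real b = real a' - real b'"
  shows "hermite1 a b z * cnj (hermite1 a' b' z)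
    = of_real (hermite_radial a b (cmod z) * hermite_radial a' b' (cmod z))"
proof -
  have z: "z = of_real (cmod z) * cis (Arg z)"
    using rcis_cmod_Arg[of z] by (simp add: rcis_def)
  have "hermite1 a b z * cnj (hermite1 a' b' z)
    = (cis ((real a' - real b') * Arg z) * cnj (cis ((real a' - real b') * Arg z))) *
       of_real (hermite_radial a b (cmod z) * hermite_radial a' b' (cmod z))"
    by (subst (1 2) z) (simp add: hermite1_polar assms )
  then show ?thesis by (simp add: complex_norm_square[symmetric])
qed

subsection \<open>The Gaussian measure as a product\<close>

interpretation gauss_prod: product_prob_space "\<lambda>_::nat. gauss1" UNIV
  by unfold_locales

lemma sets_gauss_PiM_lborel: "sets (gauss n) = sets (PiM {..<n} (\<lambda>_. lborel))"
  by (simp add: gauss_def)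

lemma sets_gauss [measurable_cong]: "sets (gauss n) = sets (PiM {..<n} (\<lambda>_. borel))"
  unfolding sets_gauss_PiM_lborel by (rule sets_PiM_cong) auto

lemma space_gauss: "space (gauss n) = {..<n} \<rightarrow>\<^sub>E UNIV"
  by (simp add: gauss_def space_PiM)

text \<open>The density and the indicator of a box both factor over the coordinates, and the product
  measure is determined by its values on boxes.\<close>

lemma gauss_eq_PiM: "gauss n = PiM {..<n} (\<lambda>_. gauss1)"
proof (rule gauss_prod.PiM_eqI)
  interpret lb: product_sigma_finite "\<lambda>_::nat. lborel :: complex measure"
    by unfold_locales
  show "sets (gauss n) = sets (PiM {..<n} (\<lambda>_. gauss1))"
    unfolding sets_gauss by (rule sets_PiM_cong) auto
  fix A :: "nat \<Rightarrow> complex set" assume "\<And>i. i \<in> {..<n} \<Longrightarrow> A i \<in> sets gauss1"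
  then have A: "\<And>i. i < n \<Longrightarrow> A i \<in> sets borel" by auto
  have AP: "Pi\<^sub>E {..<n} A \<in> sets (PiM {..<n} (\<lambda>_. lborel))"
    using A by (intro sets_PiM_I_finite) auto
  have "emeasure (gauss n) (Pi\<^sub>E {..<n} A)
    = (\<integral>\<^sup>+z. ennreal (exp (- (\<Sum>j<n. (cmod (z j))\<^sup>2)) / pi ^ n) * indicator (Pi\<^sub>E {..<n} A) z \<partial>PiM {..<n} (\<lambda>_. lborel))"
    unfolding gauss_def using AP by (subst emeasure_density) auto
  also have "\<dots> = (\<integral>\<^sup>+z. (\<Prod>j<n. ennreal (exp (- (cmod (z j))\<^sup>2) / pi) * indicator (A j) (z j)) \<partial>PiM {..<n} (\<lambda>_. lborel))"
  proof (rule nn_integral_cong)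
    fix z :: "nat \<Rightarrow> complex" assume "z \<in> space (PiM {..<n} (\<lambda>_. lborel))"
    then have z: "z \<in> extensional {..<n}" by (auto simp: space_PiM PiE_def)
    have 1: "ennreal (exp (- (\<Sum>j<n. (cmod (z j))\<^sup>2)) / pi ^ n) = (\<Prod>j<n. ennreal (exp (- (cmod (z j))\<^sup>2) / pi))"
      by (subst prod_ennreal) (auto simp: exp_sum sum_negf[symmetric] prod_dividef)
    have 2: "indicator (Pi\<^sub>E {..<n} A) z = (\<Prod>j<n. indicator (A j) (z j) :: ennreal)"
    proof (cases "z \<in> Pi\<^sub>E {..<n} A")
      case False
      then obtain j where "j < n" "z j \<notin> A j" using z by (auto simp: PiE_def)
      then have "(\<Prod>j<n. indicator (A j) (z j) :: ennreal) = 0"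
        by (intro prod_zero) (auto intro!: bexI[of _ j])
      with False show ?thesis by simp
    qed (auto simp: PiE_def Pi_def)
    show "ennreal (exp (- (\<Sum>j<n. (cmod (z j))\<^sup>2)) / pi ^ n) * indicator (Pi\<^sub>E {..<n} A) z
        = (\<Prod>j<n. ennreal (exp (- (cmod (z j))\<^sup>2) / pi) * indicator (A j) (z j))"
      unfolding 1 2 prod.distrib ..
  qed
  also have "\<dots> = (\<Prod>j<n. \<integral>\<^sup>+z. ennreal (exp (- (cmod z)\<^sup>2) / pi) * indicator (A j) z \<partial>lborel)"
    using A by (subst lb.product_nn_integral_prod) auto
  also have "\<dots> = (\<Prod>j<n. emeasure gauss1 (A j))"
    unfolding gauss1_def using A by (intro prod.cong) (auto simp: emeasure_density)
  finally show "emeasure (gauss n) (Pi\<^sub>E {..<n} A) = (\<Prod>i\<in>{..<n}. emeasure gauss1 (A i))" .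
qed simp

lemma prob_space_gauss: "prob_space (gauss n)"
  unfolding gauss_eq_PiM by (intro prob_space_PiM prob_space_gauss1)

interpretation gauss: prob_space "gauss n" for n by (rule prob_space_gauss)

lemma integrable_gauss_prod:
  fixes f :: "nat \<Rightarrow> complex \<Rightarrow> complex"
  assumes "\<And>j. j < n \<Longrightarrow> integrable gauss1 (f j)"
  shows "integrable (gauss n) (\<lambda>z. \<Prod>j<n. f j (z j))"
  unfolding gauss_eq_PiM using assms by (intro gauss_prod.product_integrable_prod) auto

lemma integral_gauss_prod:
  fixes f :: "nat \<Rightarrow> complex \<Rightarrow> complex"
  assumes "\<And>j. j < n \<Longrightarrow> integrable gauss1 (f j)"
  shows "(\<integral>z. (\<Prod>j<n. f j (z j)) \<partial>gauss n) = (\<Prod>j<n. \<integral>z. f j z \<partial>gauss1)"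
  unfolding gauss_eq_PiM using assms by (intro gauss_prod.product_integral_prod) auto

lemma distr_gauss_component:
  assumes "i < n"
  shows "distr (gauss n) gauss1 (\<lambda>z. z i) = gauss1"
  unfolding gauss_eq_PiM using assms by (intro distr_PiM_component prob_space_gauss1) auto

lemma gauss_component_measurable: "i < n \<Longrightarrow> (\<lambda>z. z i) \<in> borel_measurable (gauss n)"
  by (subst measurable_cong_sets[OF sets_gauss refl]) (auto intro: measurable_component_singleton)

lemma integral_gauss_component:
  fixes f :: "complex \<Rightarrow> 'a::{banach, second_countable_topology}"
  assumes "i < n" and [measurable]: "f \<in> borel_measurable borel"
  shows "(\<integral>z. f (z i) \<partial>gauss n) = (\<integral>z. f z \<partial>gauss1)"
    and "integrable (gauss n) (\<lambda>z. f (z i)) \<longleftrightarrow> integrable gauss1 f"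
proof -
  have f1: "f \<in> borel_measurable gauss1" by measurable
  have [measurable]: "(\<lambda>z. z i) \<in> measurable (gauss n) gauss1"
    using gauss_component_measurable[OF assms(1)] by simp
  show "(\<integral>z. f (z i) \<partial>gauss n) = (\<integral>z. f z \<partial>gauss1)"
    using integral_distr[of "\<lambda>z. z i" "gauss n" gauss1 f] by (simp add: f1 distr_gauss_component[OF assms(1)])
  show "integrable (gauss n) (\<lambda>z. f (z i)) \<longleftrightarrow> integrable gauss1 f"
    using integrable_distr_eq[of "\<lambda>z. z i" "gauss n" gauss1 f] by (simp add: f1 distr_gauss_component[OF assms(1)])
qed

subsection \<open>Square integrable functions\<close>

lemma L2_measurable: "f \<in> L2 n \<Longrightarrow> f \<in> borel_measurable (gauss n)"
  by (simp add: L2_def)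

lemma L2_integrable: "f \<in> L2 n \<Longrightarrow> integrable (gauss n) (\<lambda>z. (cmod (f z))\<^sup>2)"
  by (simp add: L2_def)

lemma cmod_add_sq_le: "(cmod (a + b))\<^sup>2 \<le> 2 * (cmod a)\<^sup>2 + 2 * (cmod b)\<^sup>2"
proof -
  have "(cmod (a + b))\<^sup>2 \<le> (cmod a + cmod b)\<^sup>2" by (intro power_mono norm_triangle_ineq) auto
  also have "\<dots> \<le> 2 * (cmod a)\<^sup>2 + 2 * (cmod b)\<^sup>2"
    using sum_squares_bound[of "cmod a" "cmod b"] by (simp add: power2_sum)
  finally show ?thesis .
qed

lemma L2_add [intro]:
  assumes "f \<in> L2 n" "g \<in> L2 n"
  shows "(\<lambda>z. f z + g z) \<in> L2 n"
  unfolding L2_def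
proof safe
  note [measurable] = assms[THEN L2_measurable]
  show "(\<lambda>z. f z + g z) \<in> borel_measurable (gauss n)" by measurable
  show "integrable (gauss n) (\<lambda>z. (cmod (f z + g z))\<^sup>2)"
  proof (rule Bochner_Integration.integrable_bound)
    show "integrable (gauss n) (\<lambda>z. 2 * (cmod (f z))\<^sup>2 + 2 * (cmod (g z))\<^sup>2)"
      using assms[THEN L2_integrable] by simp
  qed (auto simp: cmod_add_sq_le)
qed

lemma L2_cmult [intro]: "f \<in> L2 n \<Longrightarrow> (\<lambda>z. c * f z) \<in> L2 n"
  by (auto simp: L2_def norm_mult power_mult_distrib)

lemma L2_uminus [intro]: "f \<in> L2 n \<Longrightarrow> (\<lambda>z. - f z) \<in> L2 n"
  by (auto simp: L2_def)

lemma L2_diff [intro]: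
  assumes "f \<in> L2 n" "g \<in> L2 n"
  shows "(\<lambda>z. f z - g z) \<in> L2 n"
  using L2_add[OF assms(1) L2_uminus[OF assms(2)]] by simp

lemma L2_zero [simp]: "(\<lambda>z. 0) \<in> L2 n"
  by (simp add: L2_def)

lemma L2_sum [intro]:
  assumes "\<And>i. i \<in> I \<Longrightarrow> f i \<in> L2 n"
  shows "(\<lambda>z. \<Sum>i\<in>I. f i z) \<in> L2 n"
  using assms by (induction I rule: infinite_finite_induct) auto

lemma mult_le_sum_squares:
  fixes a b :: real
  assumes "0 \<le> a" "0 \<le> b"
  shows "a * b \<le> a\<^sup>2 + b\<^sup>2"
  using sum_squares_bound[of a b] mult_nonneg_nonneg[OF assms] by linarith

lemma L2_integrable_inner:
  assumes "f \<in> L2 n" "g \<in> L2 n"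
  shows "integrable (gauss n) (\<lambda>z. f z * cnj (g z))"
proof (rule Bochner_Integration.integrable_bound)
  note [measurable] = assms[THEN L2_measurable]
  show "integrable (gauss n) (\<lambda>z. (cmod (f z))\<^sup>2 + (cmod (g z))\<^sup>2)"
    using assms[THEN L2_integrable] by simp
  show "(\<lambda>z. f z * cnj (g z)) \<in> borel_measurable (gauss n)" by measurable
  have "cmod (f z * cnj (g z)) \<le> norm ((cmod (f z))\<^sup>2 + (cmod (g z))\<^sup>2)" for z
    using mult_le_sum_squares[of "cmod (f z)" "cmod (g z)"] by (simp add: norm_mult)
  then show "AE z in gauss n. norm (f z * cnj (g z)) \<le> norm ((cmod (f z))\<^sup>2 + (cmod (g z))\<^sup>2)"
    by (intro AE_I2) blast
qed

lemma L2_inner_add_left: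
  assumes "f \<in> L2 n" "g \<in> L2 n" "h \<in> L2 n"
  shows "L2_inner n (\<lambda>z. f z + g z) h = L2_inner n f h + L2_inner n g h"
  unfolding L2_inner_def using assms by (simp add: L2_integrable_inner distrib_right)

lemma L2_inner_diff_left:
  assumes "f \<in> L2 n" "g \<in> L2 n" "h \<in> L2 n"
  shows "L2_inner n (\<lambda>z. f z - g z) h = L2_inner n f h - L2_inner n g h"
  unfolding L2_inner_def using assms by (simp add: L2_integrable_inner left_diff_distrib)

lemma L2_inner_cmult_left: "L2_inner n (\<lambda>z. c * f z) h = c * L2_inner n f h"
  unfolding L2_inner_def by (simp add: mult.assoc)

lemma L2_inner_commute: "L2_inner n f g = cnj (L2_inner n g f)"
  unfolding L2_inner_def by (subst Bochner_Integration.integral_cnj[symmetric]) (simp add: mult.commute)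

lemma L2_inner_sum_left:
  assumes "\<And>i. i \<in> I \<Longrightarrow> f i \<in> L2 n" "h \<in> L2 n"
  shows "L2_inner n (\<lambda>z. \<Sum>i\<in>I. f i z) h = (\<Sum>i\<in>I. L2_inner n (f i) h)"
  unfolding L2_inner_def sum_distrib_right using assms
  by (intro Bochner_Integration.integral_sum) (auto intro: L2_integrable_inner)

lemma L2_inner_add_right:
  assumes "f \<in> L2 n" "g \<in> L2 n" "h \<in> L2 n"
  shows "L2_inner n h (\<lambda>z. f z + g z) = L2_inner n h f + L2_inner n h g"
  unfolding L2_inner_def using assms by (simp add: L2_integrable_inner distrib_left)

lemma L2_inner_diff_right:
  assumes "f \<in> L2 n" "g \<in> L2 n" "h \<in> L2 n"
  shows "L2_inner n h (\<lambda>z. f z - g z) = L2_inner n h f - L2_inner n h g"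
  unfolding L2_inner_def using assms by (simp add: L2_integrable_inner right_diff_distrib)

lemma L2_inner_cmult_right: "L2_inner n h (\<lambda>z. c * f z) = cnj c * L2_inner n h f"
  by (subst (1 2) L2_inner_commute) (simp add: L2_inner_cmult_left)

lemma L2_inner_sum_right:
  assumes "\<And>i. i \<in> I \<Longrightarrow> f i \<in> L2 n" "h \<in> L2 n"
  shows "L2_inner n h (\<lambda>z. \<Sum>i\<in>I. f i z) = (\<Sum>i\<in>I. L2_inner n h (f i))"
  by (subst L2_inner_commute, subst L2_inner_sum_left) (use assms in \<open>auto simp: L2_inner_commute[symmetric]\<close>)

definition sqnorm :: "nat \<Rightarrow> ((nat \<Rightarrow> complex) \<Rightarrow> complex) \<Rightarrow> real" where
  "sqnorm n f = (\<integral>z. (cmod (f z))\<^sup>2 \<partial>gauss n)"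

lemma sqnorm_nonneg [simp]: "0 \<le> sqnorm n f"
  by (simp add: sqnorm_def)

lemma L2_norm_eq: "L2_norm n f = sqrt (sqnorm n f)"
  by (simp add: L2_norm_def sqnorm_def)

lemma L2_inner_self: "L2_inner n f f = of_real (sqnorm n f)"
  unfolding L2_inner_def sqnorm_def complex_norm_square[symmetric] by (rule integral_complex_of_real)

lemma sqnorm_add_le:
  assumes "f \<in> L2 n" "g \<in> L2 n"
  shows "sqnorm n (\<lambda>z. f z + g z) \<le> 2 * sqnorm n f + 2 * sqnorm n g"
proof -
  have "sqnorm n (\<lambda>z. f z + g z) \<le> (\<integral>z. 2 * (cmod (f z))\<^sup>2 + 2 * (cmod (g z))\<^sup>2 \<partial>gauss n)"
    unfolding sqnorm_def using assms[THEN L2_integrable] L2_add[OF assms, THEN L2_integrable]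
    by (intro integral_mono) (auto simp: cmod_add_sq_le)
  then show ?thesis unfolding sqnorm_def using assms[THEN L2_integrable] by simp
qed

text \<open>Cauchy--Schwarz, from nonnegativity of the squared norm of what is left of
  \<open>f\<close> after projecting onto \<open>g\<close>. If \<open>g\<close> has norm zero it
  vanishes almost everywhere and the inner product is zero.\<close>

lemma L2_inner_bound:
  assumes "f \<in> L2 n" "g \<in> L2 n"
  shows "(cmod (L2_inner n f g))\<^sup>2 \<le> sqnorm n f * sqnorm n g"
proof (cases "sqnorm n g = 0")
  case True
  have "AE z in gauss n. (cmod (g z))\<^sup>2 = 0"
    using True L2_integrable[OF assms(2)] unfolding sqnorm_def
    by (subst (asm) integral_nonneg_eq_0_iff_AE) auto
  then have "L2_inner n f g = 0"
    unfolding L2_inner_def by (intro integral_eq_zero_AE) auto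
  then show ?thesis by simp
next
  case False
  then have pos: "0 < sqnorm n g" using sqnorm_nonneg[of n g] by linarith
  define c where "c = L2_inner n f g / of_real (sqnorm n g)"
  have cg: "(\<lambda>z. c * g z) \<in> L2 n" using assms by auto
  have "of_real (sqnorm n (\<lambda>z. f z - c * g z)) = L2_inner n (\<lambda>z. f z - c * g z) (\<lambda>z. f z - c * g z)"
    by (rule L2_inner_self[symmetric])
  also have "\<dots> = L2_inner n f f - cnj c * L2_inner n f g - (c * L2_inner n g f - c * cnj c * L2_inner n g g)"
    using assms cg L2_diff[OF assms(1) cg]
    by (simp add: L2_inner_diff_left L2_inner_diff_right L2_inner_cmult_left L2_inner_cmult_right algebra_simps)
  also have "\<dots> = of_real (sqnorm n f) - L2_inner n f g * cnj (L2_inner n f g) / of_real (sqnorm n g)"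
    using pos by (subst (2) L2_inner_commute) (simp add: L2_inner_self c_def field_simps)
  also have "\<dots> = of_real (sqnorm n f - (cmod (L2_inner n f g))\<^sup>2 / sqnorm n g)"
    unfolding complex_norm_square[symmetric] by simp
  finally have "sqnorm n (\<lambda>z. f z - c * g z) = sqnorm n f - (cmod (L2_inner n f g))\<^sup>2 / sqnorm n g"
    using of_real_eq_iff by blast
  then have "(cmod (L2_inner n f g))\<^sup>2 / sqnorm n g \<le> sqnorm n f"
    using sqnorm_nonneg[of n "\<lambda>z. f z - c * g z"] by linarith
  then show ?thesis using pos by (simp add: field_simps)
qed

subsection \<open>Orthonormality of the Hermite functions\<close>

lemma hermite_measurable [measurable]: "hermite n \<alpha> \<beta> \<in> borel_measurable (gauss n)"
  unfolding hermite_def[abs_def]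
  by (intro borel_measurable_prod measurable_compose[OF gauss_component_measurable hermite1_measurable]) auto

lemma hermite_inner_prod:
  "hermite n \<alpha> \<beta> z * cnj (hermite n \<alpha>' \<beta>' z) = (\<Prod>j<n. hermite1 (\<alpha> j) (\<beta> j) (z j) * cnj (hermite1 (\<alpha>' j) (\<beta>' j) (z j)))"
  by (simp add: hermite_def prod.distrib)

lemma hermite_L2 [simp, intro]: "hermite n \<alpha> \<beta> \<in> L2 n"
proof -
  have "integrable (gauss n) (\<lambda>z. hermite n \<alpha> \<beta> z * cnj (hermite n \<alpha> \<beta> z))"
    unfolding hermite_inner_prod by (intro integrable_gauss_prod[where f = "\<lambda>j z. hermite1 (\<alpha> j) (\<beta> j) z * cnj (hermite1 (\<alpha> j) (\<beta> j) z)"] hermite1_inner)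
  then have "integrable (gauss n) (\<lambda>z. Re (hermite n \<alpha> \<beta> z * cnj (hermite n \<alpha> \<beta> z)))" by (rule integrable_Re)
  then show ?thesis
    unfolding complex_norm_square[symmetric] by (simp add: L2_def)
qed

lemma hermite_inner_01:
  "L2_inner n (hermite n \<alpha> \<beta>) (hermite n \<alpha>' \<beta>') = (if \<forall>j<n. \<alpha> j = \<alpha>' j \<and> \<beta> j = \<beta>' j then 1 else 0)"
proof -
  have "L2_inner n (hermite n \<alpha> \<beta>) (hermite n \<alpha>' \<beta>')
    = (\<Prod>j<n. if \<alpha> j = \<alpha>' j \<and> \<beta> j = \<beta>' j then 1 else 0)"
    unfolding L2_inner_def hermite_inner_prod
    by (subst integral_gauss_prod[where f = "\<lambda>j z. hermite1 (\<alpha> j) (\<beta> j) z * cnj (hermite1 (\<alpha>' j) (\<beta>' j) z)"])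
      (simp_all add: hermite1_inner)
  also have "\<dots> = (if \<forall>j<n. \<alpha> j = \<alpha>' j \<and> \<beta> j = \<beta>' j then 1 else 0)"
  proof (cases "\<forall>j<n. \<alpha> j = \<alpha>' j \<and> \<beta> j = \<beta>' j")
    case False
    then show ?thesis by (auto intro!: prod_zero)
  qed (auto intro!: prod.neutral)
  finally show ?thesis .
qed

lemma hermite_inner:
  assumes "\<alpha> \<in> extensional {..<n}" "\<alpha>' \<in> extensional {..<n}" "\<beta> \<in> extensional {..<n}" "\<beta>' \<in> extensional {..<n}"
  shows "L2_inner n (hermite n \<alpha> \<beta>) (hermite n \<alpha>' \<beta>') = (if (\<alpha>, \<beta>) = (\<alpha>', \<beta>') then 1 else 0)"
proof -
  have "(\<alpha> = \<alpha>' \<and> \<beta> = \<beta>') = (\<forall>j<n. \<alpha> j = \<alpha>' j \<and> \<beta> j = \<beta>' j)"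
    using assms extensionalityI[of \<alpha> "{..<n}" \<alpha>'] extensionalityI[of \<beta> "{..<n}" \<beta>'] by auto
  then show ?thesis by (simp add: hermite_inner_01)
qed

section \<open>Hermite coefficients, finite combinations and Bessel's inequality\<close>

definition coef :: "nat \<Rightarrow> (nat \<Rightarrow> nat) \<times> (nat \<Rightarrow> nat) \<Rightarrow> ((nat \<Rightarrow> complex) \<Rightarrow> complex) \<Rightarrow> complex" where
  "coef n \<kappa> f = L2_inner n f (hermite n (fst \<kappa>) (snd \<kappa>))"

abbreviation herm :: "nat \<Rightarrow> (nat \<Rightarrow> nat) \<times> (nat \<Rightarrow> nat) \<Rightarrow> (nat \<Rightarrow> complex) \<Rightarrow> complex" where
  "herm n \<kappa> \<equiv> hermite n (fst \<kappa>) (snd \<kappa>)"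

text \<open>\<open>hermite\<close> reads only the exponents below \<open>n\<close>. Extensional
  pairs are canonical representatives, so that distinct indices belong to distinct, hence
  orthogonal, functions.\<close>

definition ext_pairs :: "nat \<Rightarrow> ((nat \<Rightarrow> nat) \<times> (nat \<Rightarrow> nat)) set" where
  "ext_pairs n = extensional {..<n} \<times> extensional {..<n}"

lemma coef_herm:
  assumes "\<kappa> \<in> ext_pairs n" "\<kappa>' \<in> ext_pairs n"
  shows "coef n \<kappa> (herm n \<kappa>') = (if \<kappa> = \<kappa>' then 1 else 0)"
  using assms unfolding coef_def ext_pairs_def
  by (subst hermite_inner) (auto simp: prod_eq_iff)

lemma coef_add: "f \<in> L2 n \<Longrightarrow> g \<in> L2 n \<Longrightarrow> coef n \<kappa> (\<lambda>z. f z + g z) = coef n \<kappa> f + coef n \<kappa> g"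
  by (simp add: coef_def L2_inner_add_left)

lemma coef_diff: "f \<in> L2 n \<Longrightarrow> g \<in> L2 n \<Longrightarrow> coef n \<kappa> (\<lambda>z. f z - g z) = coef n \<kappa> f - coef n \<kappa> g"
  by (simp add: coef_def L2_inner_diff_left)

lemma coef_cmult: "coef n \<kappa> (\<lambda>z. c * f z) = c * coef n \<kappa> f"
  by (simp add: coef_def L2_inner_cmult_left)

lemma coef_sum: "(\<And>i. i \<in> I \<Longrightarrow> f i \<in> L2 n) \<Longrightarrow> coef n \<kappa> (\<lambda>z. \<Sum>i\<in>I. f i z) = (\<Sum>i\<in>I. coef n \<kappa> (f i))"
  by (simp add: coef_def L2_inner_sum_left)

definition hermite_comb :: "nat \<Rightarrow> ((nat \<Rightarrow> nat) \<times> (nat \<Rightarrow> nat)) set \<Rightarrow> ((nat \<Rightarrow> nat) \<times> (nat \<Rightarrow> nat) \<Rightarrow> complex) \<Rightarrow> (nat \<Rightarrow> complex) \<Rightarrow> complex" where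
  "hermite_comb n K c z = (\<Sum>\<kappa>\<in>K. c \<kappa> * herm n \<kappa> z)"

lemma hermite_comb_L2 [simp]: "hermite_comb n K c \<in> L2 n"
  unfolding hermite_comb_def[abs_def] by (intro L2_sum L2_cmult hermite_L2)

lemma L2_inner_hermite_comb_right:
  assumes "f \<in> L2 n"
  shows "L2_inner n f (hermite_comb n K c) = (\<Sum>\<kappa>\<in>K. cnj (c \<kappa>) * coef n \<kappa> f)"
  unfolding hermite_comb_def[abs_def] coef_def using assms
  by (subst L2_inner_sum_right) (auto simp: L2_inner_cmult_right)

lemma coef_hermite_comb:
  assumes "finite K" "K \<subseteq> ext_pairs n" "\<kappa> \<in> ext_pairs n"
  shows "coef n \<kappa> (hermite_comb n K c) = (if \<kappa> \<in> K then c \<kappa> else 0)"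
proof -
  have "coef n \<kappa> (hermite_comb n K c) = (\<Sum>\<kappa>'\<in>K. c \<kappa>' * coef n \<kappa> (herm n \<kappa>'))"
    unfolding hermite_comb_def[abs_def] by (subst coef_sum) (auto simp: coef_cmult)
  also have "\<dots> = (\<Sum>\<kappa>'\<in>K. if \<kappa> = \<kappa>' then c \<kappa>' else 0)"
    by (intro sum.cong refl) (simp add: coef_herm subsetD[OF assms(2)] assms(3))
  finally show ?thesis using assms(1) by simp
qed

lemma L2_inner_hermite_comb:
  assumes "finite K" "K \<subseteq> ext_pairs n"
  shows "L2_inner n (hermite_comb n K c) (hermite_comb n K d) = (\<Sum>\<kappa>\<in>K. c \<kappa> * cnj (d \<kappa>))"
  unfolding L2_inner_hermite_comb_right[OF hermite_comb_L2]
  using assms by (intro sum.cong) (auto simp: coef_hermite_comb subset_iff mult.commute)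

lemma sqnorm_hermite_comb:
  assumes "finite K" "K \<subseteq> ext_pairs n"
  shows "sqnorm n (hermite_comb n K c) = (\<Sum>\<kappa>\<in>K. (cmod (c \<kappa>))\<^sup>2)"
proof -
  have "complex_of_real (sqnorm n (hermite_comb n K c)) = of_real (\<Sum>\<kappa>\<in>K. (cmod (c \<kappa>))\<^sup>2)"
    unfolding L2_inner_self[symmetric] L2_inner_hermite_comb[OF assms] of_real_sum complex_norm_square ..
  then show ?thesis using of_real_eq_iff by blast
qed

lemma sqnorm_diff:
  assumes "f \<in> L2 n" "g \<in> L2 n"
  shows "sqnorm n (\<lambda>z. f z - g z) = sqnorm n f - 2 * Re (L2_inner n f g) + sqnorm n g"
proof -
  have "complex_of_real (sqnorm n (\<lambda>z. f z - g z))
    = of_real (sqnorm n f) - (L2_inner n f g + cnj (L2_inner n f g)) + of_real (sqnorm n g)"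
    unfolding L2_inner_self[symmetric] using assms L2_diff[OF assms]
    by (simp add: L2_inner_diff_left L2_inner_diff_right L2_inner_commute[symmetric])
  then have "complex_of_real (sqnorm n (\<lambda>z. f z - g z)) = of_real (sqnorm n f - 2 * Re (L2_inner n f g) + sqnorm n g)"
    unfolding complex_add_cnj by simp
  then show ?thesis using of_real_eq_iff by blast
qed

text \<open>Completing the square in each coefficient. Only the last sum depends on
  \<open>c\<close>, so the true coefficients give the best approximation.\<close>

lemma sqnorm_diff_hermite_comb:
  assumes "finite K" "K \<subseteq> ext_pairs n" "f \<in> L2 n"
  shows "sqnorm n (\<lambda>z. f z - hermite_comb n K c z)
    = sqnorm n f - (\<Sum>\<kappa>\<in>K. (cmod (coef n \<kappa> f))\<^sup>2) + (\<Sum>\<kappa>\<in>K. (cmod (coef n \<kappa> f - c \<kappa>))\<^sup>2)"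
proof -
  have *: "(cmod (a - b))\<^sup>2 - (cmod a)\<^sup>2 = (cmod b)\<^sup>2 - 2 * Re (cnj b * a)" for a b
    unfolding cmod_power2 by (simp add: power2_eq_square algebra_simps)
  have "(\<Sum>\<kappa>\<in>K. (cmod (coef n \<kappa> f - c \<kappa>))\<^sup>2) - (\<Sum>\<kappa>\<in>K. (cmod (coef n \<kappa> f))\<^sup>2)
     = (\<Sum>\<kappa>\<in>K. (cmod (c \<kappa>))\<^sup>2) - 2 * Re (\<Sum>\<kappa>\<in>K. cnj (c \<kappa>) * coef n \<kappa> f)"
    unfolding sum_subtractf[symmetric] * by (simp add: sum_subtractf sum_distrib_left)
  then show ?thesis
    unfolding sqnorm_diff[OF assms(3) hermite_comb_L2] L2_inner_hermite_comb_right[OF assms(3)]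
      sqnorm_hermite_comb[OF assms(1,2)] by linarith
qed

lemma sqnorm_diff_projection:
  assumes "finite K" "K \<subseteq> ext_pairs n" "f \<in> L2 n"
  shows "sqnorm n (\<lambda>z. f z - hermite_comb n K (\<lambda>\<kappa>. coef n \<kappa> f) z)
    = sqnorm n f - (\<Sum>\<kappa>\<in>K. (cmod (coef n \<kappa> f))\<^sup>2)"
  using sqnorm_diff_hermite_comb[OF assms, of "\<lambda>\<kappa>. coef n \<kappa> f"] by simp

lemma bessel:
  assumes "finite K" "K \<subseteq> ext_pairs n" "f \<in> L2 n"
  shows "(\<Sum>\<kappa>\<in>K. (cmod (coef n \<kappa> f))\<^sup>2) \<le> sqnorm n f"
  using sqnorm_diff_projection[OF assms] sqnorm_nonneg[of n "\<lambda>z. f z - hermite_comb n K (\<lambda>\<kappa>. coef n \<kappa> f) z"]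
  by linarith

definition pair_indices :: "nat \<Rightarrow> nat \<Rightarrow> nat \<Rightarrow> ((nat \<Rightarrow> nat) \<times> (nat \<Rightarrow> nat)) set" where
  "pair_indices n p q = multi_indices n p \<times> multi_indices n q"

lemma finite_multi_indices_le: "finite {\<alpha> \<in> {..<n} \<rightarrow>\<^sub>E (UNIV :: nat set). (\<Sum>j<n. \<alpha> j) \<le> p}" for n :: nat
proof (rule finite_subset)
  show "{\<alpha> \<in> {..<n} \<rightarrow>\<^sub>E (UNIV :: nat set). (\<Sum>j<n. \<alpha> j) \<le> p} \<subseteq> {..<n} \<rightarrow>\<^sub>E {..p}"
  proof
    fix \<alpha> assume a: "\<alpha> \<in> {\<alpha> \<in> {..<n} \<rightarrow>\<^sub>E (UNIV :: nat set). (\<Sum>j<n. \<alpha> j) \<le> p}"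
    have "\<alpha> j \<le> p" if "j < n" for j
    proof -
      have "\<alpha> j \<le> (\<Sum>j<n. \<alpha> j)" using that by (intro member_le_sum) auto
      with a show ?thesis by simp
    qed
    with a show "\<alpha> \<in> {..<n} \<rightarrow>\<^sub>E {..p}" by (auto simp: PiE_iff)
  qed
qed (intro finite_PiE, auto)

lemma finite_multi_indices [simp]: "finite (multi_indices n p)"
  unfolding multi_indices_def by (rule finite_subset[OF _ finite_multi_indices_le[of n p]]) auto

lemma finite_pair_indices [simp]: "finite (pair_indices n p q)"
  by (simp add: pair_indices_def)

lemma pair_indices_ext: "pair_indices n p q \<subseteq> ext_pairs n"
  unfolding pair_indices_def ext_pairs_def multi_indices_def PiE_def by blast

lemma hermite_comb_single:
  assumes "finite K" "\<kappa> \<in> K"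
  shows "hermite_comb n K (\<lambda>\<kappa>'. if \<kappa>' = \<kappa> then c else 0) = (\<lambda>z. c * herm n \<kappa> z)"
proof
  fix z
  have "hermite_comb n K (\<lambda>\<kappa>'. if \<kappa>' = \<kappa> then c else 0) z = (\<Sum>\<kappa>'\<in>K. if \<kappa>' = \<kappa> then c * herm n \<kappa> z else 0)"
    unfolding hermite_comb_def by (intro sum.cong refl) simp
  also have "\<dots> = c * herm n \<kappa> z" using assms by simp
  finally show "hermite_comb n K (\<lambda>\<kappa>'. if \<kappa>' = \<kappa> then c else 0) z = c * herm n \<kappa> z" .
qed

lemma hermite_span_eq: "hermite_span n p q = range (hermite_comb n (pair_indices n p q))"
proof -
  have eq: "(\<lambda>z. \<Sum>\<alpha>\<in>multi_indices n p. \<Sum>\<beta>\<in>multi_indices n q. c \<alpha> \<beta> * hermite n \<alpha> \<beta> z)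
     = hermite_comb n (pair_indices n p q) (\<lambda>\<kappa>. c (fst \<kappa>) (snd \<kappa>))" for c
    unfolding hermite_comb_def[abs_def] pair_indices_def sum.cartesian_product by (simp add: case_prod_beta)
  show ?thesis
  proof (intro equalityI subsetI)
    fix g assume "g \<in> range (hermite_comb n (pair_indices n p q))"
    then obtain c where "g = hermite_comb n (pair_indices n p q) c" by blast
    then have "g = (\<lambda>z. \<Sum>\<alpha>\<in>multi_indices n p. \<Sum>\<beta>\<in>multi_indices n q. c (\<alpha>, \<beta>) * hermite n \<alpha> \<beta> z)"
      unfolding eq[of "\<lambda>\<alpha> \<beta>. c (\<alpha>, \<beta>)"] by simp
    then show "g \<in> hermite_span n p q" unfolding hermite_span_def
      by (intro CollectI exI[of _ "\<lambda>\<alpha> \<beta>. c (\<alpha>, \<beta>)"] conjI TrueI)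
  qed (auto simp: hermite_span_def eq)
qed

text \<open>\<open>orth_proj\<close> makes an arbitrary choice. The span consists of actual
  functions determined by their coefficients, so the choice is unique and the equation holds
  everywhere, not only almost everywhere.\<close>

lemma hermite_proj_eq:
  assumes f: "f \<in> L2 n"
  shows "hermite_proj n p q f = hermite_comb n (pair_indices n p q) (\<lambda>\<kappa>. coef n \<kappa> f)"
proof -
  let ?K = "pair_indices n p q"
  let ?P = "\<lambda>g. g \<in> hermite_span n p q \<and> (\<forall>v\<in>hermite_span n p q. L2_inner n (\<lambda>z. f z - g z) v = 0)"
  have "L2_inner n (\<lambda>z. f z - hermite_comb n ?K (\<lambda>\<kappa>. coef n \<kappa> f) z) (hermite_comb n ?K d) = 0" for d
  proof -
    have "L2_inner n (hermite_comb n ?K (\<lambda>\<kappa>. coef n \<kappa> f)) (hermite_comb n ?K d) = L2_inner n f (hermite_comb n ?K d)"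
      unfolding L2_inner_hermite_comb_right[OF f] L2_inner_hermite_comb[OF finite_pair_indices pair_indices_ext]
      by (simp add: mult.commute)
    then show ?thesis by (simp add: L2_inner_diff_left f)
  qed
  then have "?P (hermite_comb n ?K (\<lambda>\<kappa>. coef n \<kappa> f))"
    unfolding hermite_span_eq by blast
  then have P: "?P (hermite_proj n p q f)"
    unfolding hermite_proj_def orth_proj_def by (rule someI[where P = ?P])
  then obtain c where c: "hermite_proj n p q f = hermite_comb n ?K c"
    unfolding hermite_span_eq by auto
  have "c \<kappa> = coef n \<kappa> f" if k: "\<kappa> \<in> ?K" for \<kappa>
  proof -
    have "herm n \<kappa> = hermite_comb n ?K (\<lambda>\<kappa>'. if \<kappa>' = \<kappa> then 1 else 0)"
      using hermite_comb_single[OF finite_pair_indices k, of n 1] by simp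
    then have "herm n \<kappa> \<in> hermite_span n p q" unfolding hermite_span_eq by blast
    then have "coef n \<kappa> (\<lambda>z. f z - hermite_comb n ?K c z) = 0"
      using P unfolding coef_def c by blast
    then show ?thesis using f k subsetD[OF pair_indices_ext k]
      by (simp add: coef_diff coef_hermite_comb pair_indices_ext)
  qed
  then have "hermite_comb n ?K c z = hermite_comb n ?K (\<lambda>\<kappa>. coef n \<kappa> f) z" for z
    unfolding hermite_comb_def by (intro sum.cong refl) simp
  then show ?thesis unfolding c by blast
qed

subsection \<open>Polynomials in the coordinates and their conjugates\<close>

text \<open>Polynomials in the coordinates and their conjugates, where \<open>p\<close> and
  \<open>q\<close> only bound the two degrees. The class refers to no basis and is preserved by
  substituting linear forms, which makes it the tool for unitary changes of variables.\<close>

inductive bipoly :: "nat \<Rightarrow> nat \<Rightarrow> nat \<Rightarrow> ((nat \<Rightarrow> complex) \<Rightarrow> complex) \<Rightarrow> bool" for n where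
  const: "bipoly n p q (\<lambda>_. c)"
| add: "bipoly n p q f \<Longrightarrow> bipoly n p q g \<Longrightarrow> bipoly n p q (\<lambda>z. f z + g z)"
| coord: "bipoly n p q f \<Longrightarrow> i < n \<Longrightarrow> bipoly n (Suc p) q (\<lambda>z. z i * f z)"
| cnj_coord: "bipoly n p q f \<Longrightarrow> i < n \<Longrightarrow> bipoly n p (Suc q) (\<lambda>z. cnj (z i) * f z)"

lemma bipoly_scale: "bipoly n p q f \<Longrightarrow> bipoly n p q (\<lambda>z. c * f z)"
proof (induction rule: bipoly.induct)
  case (add p q f g)
  then show ?case using bipoly.add[OF add.IH] by (simp add: distrib_left)
next
  case (coord p q f i)
  then show ?case using bipoly.coord[OF coord.IH] by (simp add: mult.left_commute)
next
  case (cnj_coord p q f i)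
  then show ?case using bipoly.cnj_coord[OF cnj_coord.IH] by (simp add: mult.left_commute)
qed (rule bipoly.const)

lemma bipoly_mono: "bipoly n p q f \<Longrightarrow> p \<le> p' \<Longrightarrow> q \<le> q' \<Longrightarrow> bipoly n p' q' f"
proof (induction arbitrary: p' q' rule: bipoly.induct)
  case (coord p q f i)
  then obtain p'' where "p' = Suc p''" "p \<le> p''" by (cases p') auto
  then show ?case using bipoly.coord[OF coord.IH[of p'' q'] coord.hyps(2)] coord.prems by simp
next
  case (cnj_coord p q f i)
  then obtain q'' where "q' = Suc q''" "q \<le> q''" by (cases q') auto
  then show ?case using bipoly.cnj_coord[OF cnj_coord.IH[of p' q''] cnj_coord.hyps(2)] cnj_coord.prems by simp
next
  case (add p q f g)
  then show ?case using bipoly.add[OF add.IH] by simp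
qed (rule bipoly.const)

lemma bipoly_mult: "bipoly n p q f \<Longrightarrow> bipoly n r s g \<Longrightarrow> bipoly n (p + r) (q + s) (\<lambda>z. f z * g z)"
proof (induction rule: bipoly.induct)
  case (const p q c)
  then show ?case by (intro bipoly_scale) (rule bipoly_mono, auto)
next
  case (add p q f g')
  then show ?case using bipoly.add[OF add.IH] by (simp add: distrib_right)
next
  case (coord p q f i)
  then show ?case using bipoly.coord[OF coord.IH(1)[OF coord.prems]] by (simp add: mult.assoc)
next
  case (cnj_coord p q f i)
  then show ?case using bipoly.cnj_coord[OF cnj_coord.IH(1)[OF cnj_coord.prems]] by (simp add: mult.assoc)
qed

lemma bipoly_cnj: "bipoly n p q f \<Longrightarrow> bipoly n q p (\<lambda>z. cnj (f z))"
proof (induction rule: bipoly.induct)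
  case (const p q c)
  show ?case by (rule bipoly.const)
next
  case (add p q f g)
  then show ?case using bipoly.add[OF add.IH] by simp
next
  case (coord p q f i)
  then show ?case using bipoly.cnj_coord[OF coord.IH coord.hyps(2)] by simp
next
  case (cnj_coord p q f i)
  then show ?case using bipoly.coord[OF cnj_coord.IH cnj_coord.hyps(2)] by simp
qed

lemma bipoly_sum: "(\<And>i. i \<in> I \<Longrightarrow> bipoly n p q (f i)) \<Longrightarrow> bipoly n p q (\<lambda>z. \<Sum>i\<in>I. f i z)"
proof (induction I rule: infinite_finite_induct)
  case (insert i I)
  then show ?case using bipoly.add[of n p q "f i" "\<lambda>z. \<Sum>i\<in>I. f i z"] by simp
qed (simp_all add: bipoly.const)

lemma bipoly_prod:
  "(\<And>i. i \<in> I \<Longrightarrow> bipoly n (p i) (q i) (f i)) \<Longrightarrow> bipoly n (\<Sum>i\<in>I. p i) (\<Sum>i\<in>I. q i) (\<lambda>z. \<Prod>i\<in>I. f i z)"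
proof (induction I rule: infinite_finite_induct)
  case (insert i I)
  then show ?case using bipoly_mult[of n "p i" "q i" "f i" "\<Sum>i\<in>I. p i" "\<Sum>i\<in>I. q i" "\<lambda>z. \<Prod>i\<in>I. f i z"] by simp
qed (simp_all add: bipoly.const)

lemma bipoly_coord: "i < n \<Longrightarrow> bipoly n (Suc 0) 0 (\<lambda>z. z i)"
  using bipoly.coord[OF bipoly.const[of n 0 0 1]] by simp

lemma bipoly_power: "bipoly n p q f \<Longrightarrow> bipoly n (k * p) (k * q) (\<lambda>z. f z ^ k)"
  using bipoly_prod[of "{..<k}" n "\<lambda>_. p" "\<lambda>_. q" "\<lambda>_. f"] by simp

lemma bipoly_hermite1:
  assumes "i < n"
  shows "bipoly n p q (\<lambda>z. hermite1 p q (z i))"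
proof -
  have "bipoly n p q (\<lambda>z. (- 1) ^ j * fact j * of_nat (p choose j) * of_nat (q choose j) * z i ^ (p - j) * cnj (z i) ^ (q - j))"
    if "j \<le> min p q" for j
  proof -
    have "bipoly n ((p - j) * Suc 0 + (q - j) * 0) ((p - j) * 0 + (q - j) * Suc 0) (\<lambda>z. z i ^ (p - j) * cnj (z i) ^ (q - j))"
      using assms by (intro bipoly_mult bipoly_power bipoly_coord bipoly_cnj)
    then have "bipoly n p q (\<lambda>z. z i ^ (p - j) * cnj (z i) ^ (q - j))"
      by (rule bipoly_mono) auto
    from bipoly_scale[OF this, of "(- 1) ^ j * fact j * of_nat (p choose j) * of_nat (q choose j)"]
    show ?thesis by (simp add: mult.assoc)
  qed
  then show ?thesis unfolding hermite1_def by (intro bipoly_scale bipoly_sum) auto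
qed

lemma bipoly_hermite: "bipoly n (\<Sum>j<n. \<alpha> j) (\<Sum>j<n. \<beta> j) (hermite n \<alpha> \<beta>)"
  unfolding hermite_def[abs_def] by (intro bipoly_prod bipoly_hermite1) auto

text \<open>Hermite combinations built one term at a time, with repetitions allowed, so that closure
  under the operations of \<open>bipoly\<close> is a plain induction. The passage to a finite index
  set is postponed to \<open>hermite_le_comb\<close>.\<close>

inductive hermite_le :: "nat \<Rightarrow> nat \<Rightarrow> nat \<Rightarrow> ((nat \<Rightarrow> complex) \<Rightarrow> complex) \<Rightarrow> bool" for n p q where
  zero: "hermite_le n p q (\<lambda>_. 0)"
| add: "hermite_le n p q f \<Longrightarrow> \<kappa> \<in> ext_pairs n \<Longrightarrow> (\<Sum>j<n. fst \<kappa> j) \<le> p \<Longrightarrow> (\<Sum>j<n. snd \<kappa> j) \<le> q \<Longrightarrow>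
    hermite_le n p q (\<lambda>z. f z + c * herm n \<kappa> z)"

lemma hermite_le_add: "hermite_le n p q f \<Longrightarrow> hermite_le n p q g \<Longrightarrow> hermite_le n p q (\<lambda>z. f z + g z)"
proof (induction rule: hermite_le.induct)
  case (add f \<kappa> c)
  then show ?case using hermite_le.add[OF add.IH(1)[OF add.prems] add.hyps(2-4), of c] by (simp add: add_ac)
qed simp

text \<open>The one-variable recurrence in coordinate \<open>i\<close>. If \<open>\<beta> i\<close>
  is zero, the truncated predecessor does no harm because its coefficient is zero.\<close>

lemma hermite_coord_eq:
  assumes i: "i < n"
  shows "z i * hermite n \<alpha> \<beta> z = of_real (sqrt (real (Suc (\<alpha> i)))) * hermite n (\<alpha>(i := Suc (\<alpha> i))) \<beta> z
     + of_real (sqrt (real (\<beta> i))) * hermite n \<alpha> (\<beta>(i := \<beta> i - 1)) z"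
proof -
  define R where "R = (\<Prod>j\<in>{..<n} - {i}. hermite1 (\<alpha> j) (\<beta> j) (z j))"
  have split: "hermite n \<alpha>' \<beta>' z = hermite1 (\<alpha>' i) (\<beta>' i) (z i) * R"
    if "\<And>j. j \<noteq> i \<Longrightarrow> \<alpha>' j = \<alpha> j \<and> \<beta>' j = \<beta> j" for \<alpha>' \<beta>'
    unfolding hermite_def R_def using i that by (subst prod.remove[of _ i]) (auto intro!: prod.cong)
  show ?thesis
    using arg_cong[OF hermite1_recurrence[of "z i" "\<alpha> i" "\<beta> i"], of "\<lambda>x. x * R"]
    by (subst (1 2 3) split) (simp_all add: algebra_simps)
qed

lemma sum_upd_Suc: "i < n \<Longrightarrow> (\<Sum>j<n. (\<alpha>(i := Suc (\<alpha> i))) j) = Suc (\<Sum>j<n. \<alpha> j)" for \<alpha> :: "nat \<Rightarrow> nat"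
  by (subst (1 2) sum.remove[of _ i]) auto

lemma sum_upd_pred: "(\<Sum>j<n. (\<beta>(i := \<beta> i - 1)) j) \<le> (\<Sum>j<n. \<beta> j)" for \<beta> :: "nat \<Rightarrow> nat"
  by (intro sum_mono) auto

lemma hermite_le_coord: "hermite_le n p q f \<Longrightarrow> i < n \<Longrightarrow> hermite_le n (Suc p) q (\<lambda>z. z i * f z)"
proof (induction rule: hermite_le.induct)
  case zero
  then show ?case by (simp add: hermite_le.zero)
next
  case (add f \<kappa> c)
  let ?\<kappa>1 = "((fst \<kappa>)(i := Suc (fst \<kappa> i)), snd \<kappa>)" and ?\<kappa>2 = "(fst \<kappa>, (snd \<kappa>)(i := snd \<kappa> i - 1))"
  have "hermite_le n (Suc p) q (\<lambda>z. z i * f z + (c * of_real (sqrt (real (Suc (fst \<kappa> i))))) * herm n ?\<kappa>1 z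
     + (c * of_real (sqrt (real (snd \<kappa> i)))) * herm n ?\<kappa>2 z)"
    using add sum_upd_Suc[of i n "fst \<kappa>"] order_trans[OF sum_upd_pred[of "snd \<kappa>" i n] add.hyps(4)]
    by (intro hermite_le.add) (auto simp: ext_pairs_def extensional_def)
  then show ?case
    using hermite_coord_eq[OF add.prems, of _ "fst \<kappa>" "snd \<kappa>"] by (simp add: algebra_simps)
qed

lemma cnj_hermite: "cnj (hermite n \<alpha> \<beta> z) = hermite n \<beta> \<alpha> z"
  by (simp add: hermite_def cnj_hermite1)

lemma hermite_le_cnj: "hermite_le n p q f \<Longrightarrow> hermite_le n q p (\<lambda>z. cnj (f z))"
proof (induction rule: hermite_le.induct)
  case zero
  then show ?case by (simp add: hermite_le.zero)
next
  case (add f \<kappa> c)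
  then show ?case using hermite_le.add[OF add.IH, of "prod.swap \<kappa>" "cnj c"]
    by (auto simp: cnj_hermite ext_pairs_def)
qed

text \<open>Constants are multiples of the Hermite function with zero exponents, and the recurrence
  treats multiplication by a coordinate. A conjugate coordinate is treated by conjugating, which
  exchanges the two degrees.\<close>

lemma bipoly_hermite_le: "bipoly n p q f \<Longrightarrow> hermite_le n p q f"
proof (induction rule: bipoly.induct)
  case (const p q c)
  let ?\<kappa> = "(restrict (\<lambda>_. 0) {..<n}, restrict (\<lambda>_. 0) {..<n}) :: (nat \<Rightarrow> nat) \<times> (nat \<Rightarrow> nat)"
  have "hermite_le n p q (\<lambda>z. 0 + c * herm n ?\<kappa> z)"
    by (intro hermite_le.add hermite_le.zero) (auto simp: ext_pairs_def)
  then show ?case by (simp add: hermite_def)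
next
  case (cnj_coord p q f i)
  then have "hermite_le n p (Suc q) (\<lambda>z. cnj (z i * cnj (f z)))"
    by (intro hermite_le_cnj hermite_le_coord)
  then show ?case by simp
next
  case (add p q f g)
  then show ?case by (intro hermite_le_add)
next
  case (coord p q f i)
  then show ?case by (intro hermite_le_coord)
qed

definition le_indices :: "nat \<Rightarrow> nat \<Rightarrow> nat \<Rightarrow> ((nat \<Rightarrow> nat) \<times> (nat \<Rightarrow> nat)) set" where
  "le_indices n p q = {\<kappa> \<in> ext_pairs n. (\<Sum>j<n. fst \<kappa> j) \<le> p \<and> (\<Sum>j<n. snd \<kappa> j) \<le> q}"

lemma finite_le_indices [simp]: "finite (le_indices n p q)"
  by (rule finite_subset[OF _ finite_cartesian_product[OF finite_multi_indices_le[of n p] finite_multi_indices_le[of n q]]])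
    (auto simp: le_indices_def ext_pairs_def PiE_def)

lemma le_indices_ext: "le_indices n p q \<subseteq> ext_pairs n"
  by (auto simp: le_indices_def)

lemma pair_indices_iff:
  "\<kappa> \<in> pair_indices n p q \<longleftrightarrow> \<kappa> \<in> ext_pairs n \<and> (\<Sum>j<n. fst \<kappa> j) = p \<and> (\<Sum>j<n. snd \<kappa> j) = q"
  by (cases \<kappa>) (auto simp: pair_indices_def ext_pairs_def multi_indices_def PiE_def)

lemma hermite_le_comb: "hermite_le n p q f \<Longrightarrow> \<exists>c. f = hermite_comb n (le_indices n p q) c"
proof (induction rule: hermite_le.induct)
  case zero
  have "(\<lambda>_. 0) = hermite_comb n (le_indices n p q) (\<lambda>_. 0)"
    by (simp add: hermite_comb_def fun_eq_iff)
  then show ?case by blast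
next
  case (add f \<kappa> c)
  then obtain d where d: "f = hermite_comb n (le_indices n p q) d" by blast
  have "\<kappa> \<in> le_indices n p q" using add by (simp add: le_indices_def)
  then have "(\<lambda>z. f z + c * herm n \<kappa> z) = hermite_comb n (le_indices n p q) (\<lambda>\<kappa>'. d \<kappa>' + (if \<kappa>' = \<kappa> then c else 0))"
    using hermite_comb_single[of "le_indices n p q" \<kappa> n c]
    unfolding d hermite_comb_def[abs_def] by (simp add: fun_eq_iff distrib_right sum.distrib)
  then show ?case by blast
qed

lemma bipoly_comb:
  assumes "bipoly n p q f"
  obtains c where "f = hermite_comb n (le_indices n p q) c"
  using hermite_le_comb[OF bipoly_hermite_le[OF assms]] by blast

lemma bipoly_L2: "bipoly n p q f \<Longrightarrow> f \<in> L2 n"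
  by (erule bipoly_comb) simp

lemma bipoly_herm_pair: "\<kappa> \<in> pair_indices n p q \<Longrightarrow> bipoly n p q (herm n \<kappa>)"
  using bipoly_hermite[of n "fst \<kappa>" "snd \<kappa>"] by (simp add: pair_indices_iff)

text \<open>A description without Hermite functions: bounded bidegree, and orthogonality to
  everything of smaller bidegree. Both properties survive unitary substitutions, so the projections
  commute with them.\<close>

lemma hermite_span_iff:
  "g \<in> hermite_span n p q \<longleftrightarrow>
    bipoly n p q g \<and> (\<forall>r s v. r \<le> p \<and> s \<le> q \<and> (r, s) \<noteq> (p, q) \<and> bipoly n r s v \<longrightarrow> L2_inner n g v = 0)"
proof
  assume "g \<in> hermite_span n p q"
  then obtain c where g: "g = hermite_comb n (pair_indices n p q) c"
    unfolding hermite_span_eq by blast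
  have "bipoly n p q g"
    unfolding g hermite_comb_def[abs_def] by (intro bipoly_sum bipoly_scale bipoly_herm_pair)
  moreover have "L2_inner n g v = 0" if "r \<le> p" "s \<le> q" "(r, s) \<noteq> (p, q)" and v: "bipoly n r s v" for r s v
  proof -
    obtain d where v: "v = hermite_comb n (le_indices n r s) d" using bipoly_comb[OF v] by blast
    have "coef n \<kappa> g = 0" if k: "\<kappa> \<in> le_indices n r s" for \<kappa>
    proof -
      have "\<kappa> \<notin> pair_indices n p q"
        using k \<open>r \<le> p\<close> \<open>s \<le> q\<close> \<open>(r, s) \<noteq> (p, q)\<close> by (auto simp: pair_indices_iff le_indices_def)
      then show ?thesis unfolding g using k
        by (subst coef_hermite_comb) (auto simp: pair_indices_ext le_indices_def)
    qed
    then show ?thesis unfolding v by (subst L2_inner_hermite_comb_right) (auto simp: g)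
  qed
  ultimately show "bipoly n p q g \<and> (\<forall>r s v. r \<le> p \<and> s \<le> q \<and> (r, s) \<noteq> (p, q) \<and> bipoly n r s v \<longrightarrow> L2_inner n g v = 0)"
    by blast
next
  assume *: "bipoly n p q g \<and> (\<forall>r s v. r \<le> p \<and> s \<le> q \<and> (r, s) \<noteq> (p, q) \<and> bipoly n r s v \<longrightarrow> L2_inner n g v = 0)"
  then have "bipoly n p q g" by blast
  then obtain c where g: "g = hermite_comb n (le_indices n p q) c" by (rule bipoly_comb)
  \<comment> \<open>An index outside the top bidegree belongs to a Hermite function that is itself
    an admissible test polynomial.\<close>
  have c0: "c \<kappa> = 0" if k: "\<kappa> \<in> le_indices n p q - pair_indices n p q" for \<kappa>
  proof -
    have ke: "\<kappa> \<in> ext_pairs n" using k by (auto simp: le_indices_def)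
    have "coef n \<kappa> g = 0"
      unfolding coef_def
    proof (rule *[THEN conjunct2, rule_format])
      show "(\<Sum>j<n. fst \<kappa> j) \<le> p \<and> (\<Sum>j<n. snd \<kappa> j) \<le> q \<and> (\<Sum>j<n. fst \<kappa> j, \<Sum>j<n. snd \<kappa> j) \<noteq> (p, q)
          \<and> bipoly n (\<Sum>j<n. fst \<kappa> j) (\<Sum>j<n. snd \<kappa> j) (herm n \<kappa>)"
        using k bipoly_hermite[of n "fst \<kappa>" "snd \<kappa>"] by (simp add: le_indices_def pair_indices_iff)
    qed
    then show ?thesis unfolding g using k ke by (simp add: coef_hermite_comb le_indices_ext)
  qed
  have "hermite_comb n (le_indices n p q) c z = hermite_comb n (pair_indices n p q) c z" for z
    unfolding hermite_comb_def
  proof (rule sum.mono_neutral_right)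
    show "pair_indices n p q \<subseteq> le_indices n p q"
    proof
      fix \<kappa> assume "\<kappa> \<in> pair_indices n p q"
      then show "\<kappa> \<in> le_indices n p q" by (simp add: le_indices_def pair_indices_iff)
    qed
  qed (simp_all add: c0)
  then have "g = hermite_comb n (pair_indices n p q) c" unfolding g by blast
  then show "g \<in> hermite_span n p q" unfolding hermite_span_eq by blast
qed

subsection \<open>Density of the polynomials\<close>

definition bdd_meas :: "nat \<Rightarrow> ((nat \<Rightarrow> complex) \<Rightarrow> complex) \<Rightarrow> bool" where
  "bdd_meas n f \<longleftrightarrow> f \<in> borel_measurable (gauss n) \<and> (\<exists>C. \<forall>z\<in>space (gauss n). cmod (f z) \<le> C)"

lemma bdd_measI:
  "f \<in> borel_measurable (gauss n) \<Longrightarrow> (\<And>z. z \<in> space (gauss n) \<Longrightarrow> cmod (f z) \<le> C) \<Longrightarrow> bdd_meas n f"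
  unfolding bdd_meas_def by blast

lemma bdd_meas_measurable: "bdd_meas n f \<Longrightarrow> f \<in> borel_measurable (gauss n)"
  by (simp add: bdd_meas_def)

lemma bdd_meas_bound:
  assumes "bdd_meas n f"
  obtains C where "0 \<le> C" "\<And>z. z \<in> space (gauss n) \<Longrightarrow> cmod (f z) \<le> C"
proof -
  obtain C where "\<forall>z\<in>space (gauss n). cmod (f z) \<le> C" using assms by (auto simp: bdd_meas_def)
  then have "\<And>z. z \<in> space (gauss n) \<Longrightarrow> cmod (f z) \<le> \<bar>C\<bar>" by fastforce
  then show ?thesis by (intro that[of "\<bar>C\<bar>"]) auto
qed

lemma bdd_meas_const: "bdd_meas n (\<lambda>_. c)"
  by (rule bdd_measI[where C = "cmod c"]) auto

lemma bdd_meas_add: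
  assumes "bdd_meas n f" "bdd_meas n g"
  shows "bdd_meas n (\<lambda>z. f z + g z)"
proof -
  note [measurable] = assms[THEN bdd_meas_measurable]
  obtain C D where C: "\<And>z. z \<in> space (gauss n) \<Longrightarrow> cmod (f z) \<le> C"
      "\<And>z. z \<in> space (gauss n) \<Longrightarrow> cmod (g z) \<le> D"
    using assms[THEN bdd_meas_bound] by metis
  show ?thesis
  proof (rule bdd_measI)
    show "cmod (f z + g z) \<le> C + D" if "z \<in> space (gauss n)" for z
      using C[OF that] norm_triangle_ineq[of "f z" "g z"] by linarith
  qed measurable
qed

lemma bdd_meas_mult:
  assumes "bdd_meas n f" "bdd_meas n g"
  shows "bdd_meas n (\<lambda>z. f z * g z)"
proof -
  note [measurable] = assms[THEN bdd_meas_measurable]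
  obtain C where C: "0 \<le> C" "\<And>z. z \<in> space (gauss n) \<Longrightarrow> cmod (f z) \<le> C"
    using bdd_meas_bound[OF assms(1)] by metis
  obtain D where D: "0 \<le> D" "\<And>z. z \<in> space (gauss n) \<Longrightarrow> cmod (g z) \<le> D"
    using bdd_meas_bound[OF assms(2)] by metis
  show ?thesis
  proof (rule bdd_measI)
    show "cmod (f z * g z) \<le> C * D" if "z \<in> space (gauss n)" for z
      unfolding norm_mult using C D that by (intro mult_mono) auto
  qed measurable
qed

lemma bdd_meas_cmult: "bdd_meas n f \<Longrightarrow> bdd_meas n (\<lambda>z. c * f z)"
  by (intro bdd_meas_mult bdd_meas_const)

lemma bdd_meas_diff: "bdd_meas n f \<Longrightarrow> bdd_meas n g \<Longrightarrow> bdd_meas n (\<lambda>z. f z - g z)"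
  using bdd_meas_add[of n f "\<lambda>z. (- 1) * g z"] bdd_meas_cmult[of n g "- 1"] by simp

lemma bdd_mult_L2:
  assumes "f \<in> borel_measurable (gauss n)" "\<And>z. z \<in> space (gauss n) \<Longrightarrow> cmod (f z) \<le> C" "g \<in> L2 n"
  shows "(\<lambda>z. f z * g z) \<in> L2 n" and "sqnorm n (\<lambda>z. f z * g z) \<le> C\<^sup>2 * sqnorm n g"
proof -
  note [measurable] = assms(1) L2_measurable[OF assms(3)]
  have b: "(cmod (f z * g z))\<^sup>2 \<le> C\<^sup>2 * (cmod (g z))\<^sup>2" if "z \<in> space (gauss n)" for z
    unfolding norm_mult power_mult_distrib using assms(2)[OF that] by (intro mult_right_mono power_mono) auto
  have i: "integrable (gauss n) (\<lambda>z. C\<^sup>2 * (cmod (g z))\<^sup>2)"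
    using L2_integrable[OF assms(3)] by simp
  have j: "integrable (gauss n) (\<lambda>z. (cmod (f z * g z))\<^sup>2)"
  proof (rule Bochner_Integration.integrable_bound[OF i])
    show "AE z in gauss n. norm ((cmod (f z * g z))\<^sup>2) \<le> norm (C\<^sup>2 * (cmod (g z))\<^sup>2)"
      using b by (intro AE_I2) simp
  qed measurable
  then show "(\<lambda>z. f z * g z) \<in> L2 n" by (simp add: L2_def)
  have "sqnorm n (\<lambda>z. f z * g z) \<le> (\<integral>z. C\<^sup>2 * (cmod (g z))\<^sup>2 \<partial>gauss n)"
    unfolding sqnorm_def using i j b by (intro integral_mono) auto
  then show "sqnorm n (\<lambda>z. f z * g z) \<le> C\<^sup>2 * sqnorm n g" by (simp add: sqnorm_def)
qed

lemma bdd_meas_mult_L2: "bdd_meas n f \<Longrightarrow> g \<in> L2 n \<Longrightarrow> (\<lambda>z. f z * g z) \<in> L2 n"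
  using bdd_mult_L2(1) by (metis bdd_meas_bound bdd_meas_measurable)

lemma const_L2: "(\<lambda>_. c) \<in> L2 n"
  by (simp add: L2_def)

lemma bdd_meas_L2: "bdd_meas n f \<Longrightarrow> f \<in> L2 n"
  using bdd_meas_mult_L2[OF _ const_L2[of 1]] by simp

lemma sqnorm_cmult: "sqnorm n (\<lambda>z. c * f z) = (cmod c)\<^sup>2 * sqnorm n f"
  by (simp add: sqnorm_def norm_mult power_mult_distrib)

section \<open>The closure of the polynomials and its bounded multipliers\<close>

definition approximable :: "nat \<Rightarrow> ((nat \<Rightarrow> complex) \<Rightarrow> complex) \<Rightarrow> bool" where
  "approximable n f \<longleftrightarrow> (\<forall>\<epsilon>>0. \<exists>p q g. bipoly n p q g \<and> sqnorm n (\<lambda>z. f z - g z) < \<epsilon>)"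

lemma approximableE:
  assumes "approximable n f" "0 < \<epsilon>"
  obtains p q g where "bipoly n p q g" "sqnorm n (\<lambda>z. f z - g z) < \<epsilon>"
  using assms unfolding approximable_def by blast

lemma approximable_closed:
  assumes f: "f \<in> L2 n" and "\<And>\<epsilon>. 0 < \<epsilon> \<Longrightarrow> \<exists>g\<in>L2 n. approximable n g \<and> sqnorm n (\<lambda>z. f z - g z) < \<epsilon>"
  shows "approximable n f"
  unfolding approximable_def
proof (intro allI impI)
  fix \<epsilon> :: real assume e: "0 < \<epsilon>"
  then obtain g where g: "g \<in> L2 n" "approximable n g" "sqnorm n (\<lambda>z. f z - g z) < \<epsilon> / 4"
    using assms(2)[of "\<epsilon> / 4"] by auto
  obtain p q h where h: "bipoly n p q h" "sqnorm n (\<lambda>z. g z - h z) < \<epsilon> / 4"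
    using approximableE[OF g(2), of "\<epsilon> / 4"] e by auto
  have "sqnorm n (\<lambda>z. (f z - g z) + (g z - h z)) \<le> 2 * sqnorm n (\<lambda>z. f z - g z) + 2 * sqnorm n (\<lambda>z. g z - h z)"
    using f g(1) bipoly_L2[OF h(1)] by (intro sqnorm_add_le L2_diff)
  then have "sqnorm n (\<lambda>z. f z - h z) < \<epsilon>" using g(3) h(2) by simp
  then show "\<exists>p q g. bipoly n p q g \<and> sqnorm n (\<lambda>z. f z - g z) < \<epsilon>" using h(1) by blast
qed

lemma bipoly_approximable: "bipoly n p q f \<Longrightarrow> approximable n f"
  unfolding approximable_def
  by (intro allI impI exI[of _ p] exI[of _ q] exI[of _ f]) (simp add: sqnorm_def)

lemma approximable_add:
  assumes "f \<in> L2 n" "g \<in> L2 n" "approximable n f" "approximable n g"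
  shows "approximable n (\<lambda>z. f z + g z)"
  unfolding approximable_def
proof (intro allI impI)
  fix \<epsilon> :: real assume e: "0 < \<epsilon>"
  obtain p q f' where f': "bipoly n p q f'" "sqnorm n (\<lambda>z. f z - f' z) < \<epsilon> / 4"
    using approximableE[OF assms(3), of "\<epsilon> / 4"] e by auto
  obtain r s g' where g': "bipoly n r s g'" "sqnorm n (\<lambda>z. g z - g' z) < \<epsilon> / 4"
    using approximableE[OF assms(4), of "\<epsilon> / 4"] e by auto
  have "sqnorm n (\<lambda>z. (f z - f' z) + (g z - g' z)) \<le> 2 * sqnorm n (\<lambda>z. f z - f' z) + 2 * sqnorm n (\<lambda>z. g z - g' z)"
    using assms(1,2) bipoly_L2[OF f'(1)] bipoly_L2[OF g'(1)] by (intro sqnorm_add_le L2_diff)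
  then have "sqnorm n (\<lambda>z. f z + g z - (f' z + g' z)) < \<epsilon>"
    using f'(2) g'(2) by (simp add: algebra_simps)
  moreover have "bipoly n (max p r) (max q s) (\<lambda>z. f' z + g' z)"
    using bipoly_mono[OF f'(1)] bipoly_mono[OF g'(1)] by (intro bipoly.add) auto
  ultimately show "\<exists>p q h. bipoly n p q h \<and> sqnorm n (\<lambda>z. f z + g z - h z) < \<epsilon>" by blast
qed

lemma approximable_cmult:
  assumes "approximable n f"
  shows "approximable n (\<lambda>z. c * f z)"
  unfolding approximable_def
proof (intro allI impI)
  fix \<epsilon> :: real assume e: "0 < \<epsilon>"
  have c: "0 < (cmod c)\<^sup>2 + 1" by (simp add: add_nonneg_pos)
  obtain p q g where g: "bipoly n p q g" "sqnorm n (\<lambda>z. f z - g z) < \<epsilon> / ((cmod c)\<^sup>2 + 1)"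
    using approximableE[OF assms, of "\<epsilon> / ((cmod c)\<^sup>2 + 1)"] e c by auto
  have "sqnorm n (\<lambda>z. c * f z - c * g z) = (cmod c)\<^sup>2 * sqnorm n (\<lambda>z. f z - g z)"
    using sqnorm_cmult[of n c "\<lambda>z. f z - g z"] by (simp add: right_diff_distrib)
  also have "\<dots> \<le> ((cmod c)\<^sup>2 + 1) * sqnorm n (\<lambda>z. f z - g z)"
    by (intro mult_right_mono) auto
  also have "\<dots> < \<epsilon>" using g(2) c by (simp add: field_simps)
  finally show "\<exists>p q h. bipoly n p q h \<and> sqnorm n (\<lambda>z. c * f z - h z) < \<epsilon>"
    using bipoly_scale[OF g(1)] by blast
qed

text \<open>Bounded multipliers of the closure of the polynomials. They form an algebra that is closed
  under bounded pointwise limits, which makes the passage from exponentials to indicator functions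
  elementary.\<close>

definition multiplier :: "nat \<Rightarrow> ((nat \<Rightarrow> complex) \<Rightarrow> complex) \<Rightarrow> bool" where
  "multiplier n f \<longleftrightarrow> bdd_meas n f \<and> (\<forall>p q r. bipoly n p q r \<longrightarrow> approximable n (\<lambda>z. f z * r z))"

lemma multiplier_bdd: "multiplier n f \<Longrightarrow> bdd_meas n f"
  by (simp add: multiplier_def)

lemma multiplier_const: "multiplier n (\<lambda>_. c)"
  unfolding multiplier_def using bdd_meas_const approximable_cmult bipoly_approximable by blast

lemma multiplier_add: "multiplier n f \<Longrightarrow> multiplier n g \<Longrightarrow> multiplier n (\<lambda>z. f z + g z)"
  unfolding multiplier_def distrib_right
  using bdd_meas_add approximable_add bdd_meas_mult_L2 bipoly_L2 by simp

text \<open>First \<open>g * r\<close> is replaced by a nearby polynomial \<open>s\<close>;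
  boundedness of \<open>f\<close> controls the error, and \<open>f * s\<close> is approximable
  because \<open>f\<close> is a multiplier.\<close>

lemma multiplier_mult:
  assumes "multiplier n f" "multiplier n g"
  shows "multiplier n (\<lambda>z. f z * g z)"
  unfolding multiplier_def
proof (intro conjI allI impI)
  show "bdd_meas n (\<lambda>z. f z * g z)"
    using assms by (intro bdd_meas_mult multiplier_bdd)
  obtain C where C: "0 \<le> C" "\<And>z. z \<in> space (gauss n) \<Longrightarrow> cmod (f z) \<le> C"
    using bdd_meas_bound[OF multiplier_bdd[OF assms(1)]] by metis
  fix p q r assume r: "bipoly n p q r"
  have L: "(\<lambda>z. g z * r z) \<in> L2 n"
    using bdd_meas_mult_L2[OF multiplier_bdd[OF assms(2)] bipoly_L2[OF r]] .
  show "approximable n (\<lambda>z. f z * g z * r z)"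
  proof (rule approximable_closed)
    show "(\<lambda>z. f z * g z * r z) \<in> L2 n"
      using bdd_meas_mult_L2[OF multiplier_bdd[OF assms(1)] L] by (simp add: mult.assoc)
    fix \<epsilon> :: real assume e: "0 < \<epsilon>"
    have c: "0 < C\<^sup>2 + 1" by (simp add: add_nonneg_pos)
    have "approximable n (\<lambda>z. g z * r z)" using assms(2) r unfolding multiplier_def by blast
    then obtain p' q' s where s: "bipoly n p' q' s" "sqnorm n (\<lambda>z. g z * r z - s z) < \<epsilon> / (C\<^sup>2 + 1)"
      using approximableE[of n _ "\<epsilon> / (C\<^sup>2 + 1)"] e c by (metis divide_pos_pos)
    have "sqnorm n (\<lambda>z. f z * (g z * r z - s z)) \<le> C\<^sup>2 * sqnorm n (\<lambda>z. g z * r z - s z)"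
      using C bdd_meas_measurable[OF multiplier_bdd[OF assms(1)]] L bipoly_L2[OF s(1)]
      by (intro bdd_mult_L2) auto
    also have "\<dots> \<le> (C\<^sup>2 + 1) * sqnorm n (\<lambda>z. g z * r z - s z)"
      by (intro mult_right_mono) auto
    also have "\<dots> < \<epsilon>" using s(2) c by (simp add: field_simps)
    finally have "sqnorm n (\<lambda>z. f z * g z * r z - f z * s z) < \<epsilon>"
      by (simp add: right_diff_distrib mult.assoc)
    moreover have "approximable n (\<lambda>z. f z * s z)" using assms(1) s(1) unfolding multiplier_def by blast
    moreover have "(\<lambda>z. f z * s z) \<in> L2 n"
      using bdd_meas_mult_L2[OF multiplier_bdd[OF assms(1)] bipoly_L2[OF s(1)]] .
    ultimately show "\<exists>g'\<in>L2 n. approximable n g' \<and> sqnorm n (\<lambda>z. f z * g z * r z - g' z) < \<epsilon>"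
      by blast
  qed
qed

lemma multiplier_cmult: "multiplier n f \<Longrightarrow> multiplier n (\<lambda>z. c * f z)"
  by (intro multiplier_mult multiplier_const)

lemma multiplier_sum: "(\<And>i. i \<in> I \<Longrightarrow> multiplier n (f i)) \<Longrightarrow> multiplier n (\<lambda>z. \<Sum>i\<in>I. f i z)"
proof (induction I rule: infinite_finite_induct)
  case (insert i I)
  then show ?case using multiplier_add[of n "f i" "\<lambda>z. \<Sum>i\<in>I. f i z"] by simp
qed (simp_all add: multiplier_const)

text \<open>Dominated convergence: the difference of \<open>f\<close> and \<open>F k\<close> is at
  most 2C, and \<open>r\<close> is square integrable.\<close>

lemma multiplier_lim:
  assumes F: "\<And>k::nat. multiplier n (F k)"
    and C: "\<And>k z. z \<in> space (gauss n) \<Longrightarrow> cmod (F k z) \<le> C"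
    and lim: "\<And>z. z \<in> space (gauss n) \<Longrightarrow> (\<lambda>k. F k z) \<longlonglongrightarrow> f z"
  shows "multiplier n f"
proof -
  have [measurable]: "F k \<in> borel_measurable (gauss n)" for k
    using bdd_meas_measurable[OF multiplier_bdd[OF F]] .
  have fm [measurable]: "f \<in> borel_measurable (gauss n)"
    by (rule borel_measurable_LIMSEQ_metric[of F]) (use lim in auto)
  have fC: "cmod (f z) \<le> C" if "z \<in> space (gauss n)" for z
    using tendsto_norm[OF lim[OF that]] by (rule LIMSEQ_le_const2) (use C[OF that] in auto)
  have bf: "bdd_meas n f" using fm fC by (rule bdd_measI)
  have "approximable n (\<lambda>z. f z * r z)" if r: "bipoly n p q r" for p q r
  proof (rule approximable_closed)
    have rL: "r \<in> L2 n" using bipoly_L2[OF r] .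
    have [measurable]: "r \<in> borel_measurable (gauss n)" using L2_measurable[OF rL] .
    show "(\<lambda>z. f z * r z) \<in> L2 n" using bdd_meas_mult_L2[OF bf rL] .
    fix \<epsilon> :: real assume e: "0 < \<epsilon>"
    have "(\<lambda>k. \<integral>z. (cmod (f z * r z - F k z * r z))\<^sup>2 \<partial>gauss n) \<longlonglongrightarrow> (\<integral>z. 0 \<partial>gauss n)"
    proof (rule integral_dominated_convergence[where w = "\<lambda>z. (2 * C)\<^sup>2 * (cmod (r z))\<^sup>2"])
      show "integrable (gauss n) (\<lambda>z. (2 * C)\<^sup>2 * (cmod (r z))\<^sup>2)" using L2_integrable[OF rL] by simp
      show "AE z in gauss n. (\<lambda>k. (cmod (f z * r z - F k z * r z))\<^sup>2) \<longlonglongrightarrow> 0"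
      proof (rule AE_I2)
        fix z assume z: "z \<in> space (gauss n)"
        have "(\<lambda>k. (cmod (f z * r z - F k z * r z))\<^sup>2) \<longlonglongrightarrow> (cmod (f z * r z - f z * r z))\<^sup>2"
          by (intro tendsto_intros lim z)
        then show "(\<lambda>k. (cmod (f z * r z - F k z * r z))\<^sup>2) \<longlonglongrightarrow> 0" by simp
      qed
      show "AE z in gauss n. norm ((cmod (f z * r z - F k z * r z))\<^sup>2) \<le> (2 * C)\<^sup>2 * (cmod (r z))\<^sup>2" for k
      proof (rule AE_I2)
        fix z assume z: "z \<in> space (gauss n)"
        have "cmod (f z - F k z) \<le> 2 * C"
          using norm_triangle_ineq4[of "f z" "F k z"] fC[OF z] C[OF z, of k] by linarith
        then have "(cmod ((f z - F k z) * r z))\<^sup>2 \<le> (2 * C)\<^sup>2 * (cmod (r z))\<^sup>2"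
          unfolding norm_mult power_mult_distrib[of "cmod (f z - F k z)"] by (intro mult_right_mono power_mono) auto
        then show "norm ((cmod (f z * r z - F k z * r z))\<^sup>2) \<le> (2 * C)\<^sup>2 * (cmod (r z))\<^sup>2"
          by (simp add: left_diff_distrib)
      qed
    qed auto
    then have "(\<lambda>k. sqnorm n (\<lambda>z. f z * r z - F k z * r z)) \<longlonglongrightarrow> 0" by (simp add: sqnorm_def)
    then have "eventually (\<lambda>k. sqnorm n (\<lambda>z. f z * r z - F k z * r z) < \<epsilon>) sequentially"
      using e by (rule order_tendstoD)
    then obtain k where "sqnorm n (\<lambda>z. f z * r z - F k z * r z) < \<epsilon>"
      by (auto simp: eventually_sequentially)
    then show "\<exists>g\<in>L2 n. approximable n g \<and> sqnorm n (\<lambda>z. f z * r z - g z) < \<epsilon>"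
      using F[of k] r bdd_meas_mult_L2[OF multiplier_bdd[OF F[of k]] rL]
      by (intro bexI[of _ "\<lambda>z. F k z * r z"]) (auto simp: multiplier_def)
  qed
  then show ?thesis using bf unfolding multiplier_def by blast
qed

lemma multiplier_cong:
  assumes "multiplier n f" "\<And>z. z \<in> space (gauss n) \<Longrightarrow> f z = g z"
  shows "multiplier n g"
proof -
  obtain C where C: "\<And>z. z \<in> space (gauss n) \<Longrightarrow> cmod (f z) \<le> C"
    using bdd_meas_bound[OF multiplier_bdd[OF assms(1)]] by metis
  show ?thesis
    by (rule multiplier_lim[of n "\<lambda>_. f" C]) (use assms C in auto)
qed

lemma sqnorm_coord_power:
  assumes "i < n"
  shows "sqnorm n (\<lambda>z. z i ^ m) = fact m"
proof -
  have "complex_of_real (sqnorm n (\<lambda>z. z i ^ m)) = (\<integral>z. z i ^ m * cnj (z i) ^ m \<partial>gauss n)"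
    unfolding L2_inner_self[symmetric] L2_inner_def by simp
  also have "\<dots> = (\<integral>z. z ^ m * cnj z ^ m \<partial>gauss1)"
    by (rule integral_gauss_component[OF assms, where f = "\<lambda>z. z ^ m * cnj z ^ m"]) measurable
  also have "\<dots> = of_real (fact m)" by (simp add: integral_gauss1_monomial)
  finally show ?thesis using of_real_eq_iff by blast
qed

text \<open>The middle binomial coefficient is at most 4^m. This turns the moment (2m)! into the
  square of 2^m m!.\<close>

lemma fact_double_le: "fact (2 * m) \<le> (4 ^ m * (fact m)\<^sup>2 :: real)"
proof -
  have "fact m * fact (2 * m - m) * ((2 * m) choose m) = fact (2 * m)"
    by (rule binomial_fact_lemma) simp
  then have "real (fact m * fact m * ((2 * m) choose m)) = fact (2 * m)"
    by simp
  then have "(fact (2 * m) :: real) = (fact m)\<^sup>2 * real ((2 * m) choose m)"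
    by (simp add: power2_eq_square)
  also have "\<dots> \<le> (fact m)\<^sup>2 * 2 ^ (2 * m)"
    using binomial_le_pow2[of "2 * m" m] by (intro mult_left_mono) (metis of_nat_le_iff of_nat_numeral of_nat_power, simp)
  also have "(2::real) ^ (2 * m) = 4 ^ m" by (simp add: power_mult)
  finally show ?thesis by (simp add: mult.commute)
qed

text \<open>Cauchy--Schwarz separates the power of \<open>z i\<close> from \<open>r\<close>. The
  growth in \<open>m\<close> is only 2^m m!, which the squared factorial in the Taylor remainder of
  the exponential beats for every frequency.\<close>

lemma weighted_moment_bound:
  assumes "i < n" "bipoly n p q r"
  shows "integrable (gauss n) (\<lambda>z. cmod (z i) ^ (2 * m) * (cmod (r z))\<^sup>2)"
    and "(\<integral>z. cmod (z i) ^ (2 * m) * (cmod (r z))\<^sup>2 \<partial>gauss n) \<le> 2 ^ m * fact m * sqrt (sqnorm n (\<lambda>z. r z * cnj (r z)))"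
proof -
  let ?f = "\<lambda>z. z i ^ m * cnj (z i ^ m)" and ?g = "\<lambda>z. r z * cnj (r z)"
  have b: "bipoly n (m * Suc 0) (m * 0) (\<lambda>z. z i ^ m)"
    using assms(1) by (intro bipoly_power bipoly_coord)
  have L: "?f \<in> L2 n" "?g \<in> L2 n"
    by (rule bipoly_L2[OF bipoly_mult[OF b bipoly_cnj[OF b]]])
      (rule bipoly_L2[OF bipoly_mult[OF assms(2) bipoly_cnj[OF assms(2)]]])
  have eq: "?f z * cnj (?g z) = of_real (cmod (z i) ^ (2 * m) * (cmod (r z))\<^sup>2)" for z
    unfolding complex_norm_square[symmetric] by (simp add: norm_power power_mult[symmetric] mult.commute)
  have "integrable (gauss n) (\<lambda>z. Re (?f z * cnj (?g z)))"
    by (rule integrable_Re[OF L2_integrable_inner[OF L]])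
  then show "integrable (gauss n) (\<lambda>z. cmod (z i) ^ (2 * m) * (cmod (r z))\<^sup>2)"
    unfolding eq by simp
  have I: "L2_inner n ?f ?g = of_real (\<integral>z. cmod (z i) ^ (2 * m) * (cmod (r z))\<^sup>2 \<partial>gauss n)"
    unfolding L2_inner_def eq by (rule integral_complex_of_real)
  have f: "sqnorm n ?f = fact (2 * m)"
  proof -
    have "sqnorm n ?f = sqnorm n (\<lambda>z. z i ^ (2 * m))"
      unfolding sqnorm_def by (intro Bochner_Integration.integral_cong) (auto simp: norm_mult norm_power power_add[symmetric] mult_2)
    then show ?thesis by (simp add: sqnorm_coord_power assms(1))
  qed
  have "(\<integral>z. cmod (z i) ^ (2 * m) * (cmod (r z))\<^sup>2 \<partial>gauss n)\<^sup>2 \<le> fact (2 * m) * sqnorm n ?g"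
    using L2_inner_bound[OF L] unfolding I f by (simp add: power2_abs)
  also have "\<dots> \<le> (4 ^ m * (fact m)\<^sup>2) * sqnorm n ?g"
    by (intro mult_right_mono fact_double_le) auto
  also have "\<dots> = (2 ^ m * fact m * sqrt (sqnorm n ?g))\<^sup>2"
  proof -
    have "(4::real) ^ m = (2 ^ m)\<^sup>2" by (simp add: power2_eq_square power_mult_distrib[symmetric])
    then show ?thesis by (simp add: power_mult_distrib)
  qed
  finally show "(\<integral>z. cmod (z i) ^ (2 * m) * (cmod (r z))\<^sup>2 \<partial>gauss n) \<le> 2 ^ m * fact m * sqrt (sqnorm n ?g)"
    by (rule power2_le_imp_le) auto
qed

text \<open>The Taylor polynomials of the exponential, multiplied by \<open>r\<close>, converge in
  square mean. The squared remainder has m! twice in the denominator and the moment bound uses up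
  one of them.\<close>

lemma multiplier_iexp:
  assumes i: "i < n" and X: "bipoly n 1 1 (\<lambda>z. of_real (X z))" and le: "\<And>z. \<bar>X z\<bar> \<le> cmod (z i)"
  shows "multiplier n (\<lambda>z. exp (\<i> * of_real (t * X z)))"
proof -
  have "(\<lambda>z. Re (of_real (X z))) \<in> borel_measurable (gauss n)"
    using L2_measurable[OF bipoly_L2[OF X]] by measurable
  then have [measurable]: "X \<in> borel_measurable (gauss n)" by simp
  let ?f = "\<lambda>z. exp (\<i> * of_real (t * X z))"
  have bf: "bdd_meas n ?f" by (rule bdd_measI[where C = 1]) auto
  have "approximable n (\<lambda>z. ?f z * r z)" if r: "bipoly n p q r" for p q r
    unfolding approximable_def
  proof (intro allI impI)
    have rL: "r \<in> L2 n" using bipoly_L2[OF r] .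
    have [measurable]: "r \<in> borel_measurable (gauss n)" using L2_measurable[OF rL] .
    define A where "A = sqrt (sqnorm n (\<lambda>z. r z * cnj (r z)))"
    define S where "S m z = (\<Sum>k\<le>m. (\<i> * of_real (t * X z)) ^ k / fact k)" for m z
    have S: "bipoly n m m (S m)" for m
    proof -
      have "bipoly n m m (\<lambda>z. (\<i> * of_real (t * X z)) ^ k / fact k)" if "k \<le> m" for k
      proof -
        have "bipoly n (k * 1) (k * 1) (\<lambda>z. of_real (X z) ^ k)" by (rule bipoly_power[OF X])
        then have "bipoly n m m (\<lambda>z. of_real (X z) ^ k)" by (rule bipoly_mono) (use that in auto)
        from bipoly_scale[OF this, of "(\<i> * of_real t) ^ k / fact k"] show ?thesis
          by (simp add: power_mult_distrib mult_ac)
      qed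
      then show ?thesis unfolding S_def[abs_def] by (intro bipoly_sum) auto
    qed
    have bound: "sqnorm n (\<lambda>z. ?f z * r z - S m z * r z) \<le> (2 * t\<^sup>2) ^ Suc m / fact (Suc m) * A" for m
    proof -
      define c where "c = (\<bar>t\<bar> ^ Suc m / fact (Suc m))\<^sup>2"
      have pw: "(cmod (?f z * r z - S m z * r z))\<^sup>2 \<le> c * (cmod (z i) ^ (2 * Suc m) * (cmod (r z))\<^sup>2)" for z
      proof -
        have "cmod (?f z - S m z) \<le> \<bar>t * X z\<bar> ^ Suc m / fact (Suc m)"
          unfolding S_def using iexp_approx1[of "t * X z" m] by simp
        also have "\<dots> \<le> \<bar>t\<bar> ^ Suc m / fact (Suc m) * cmod (z i) ^ Suc m"
        proof -
          have "\<bar>t * X z\<bar> ^ Suc m \<le> \<bar>t\<bar> ^ Suc m * cmod (z i) ^ Suc m"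
            unfolding abs_mult power_mult_distrib by (intro mult_left_mono power_mono le) auto
          from divide_right_mono[OF this fact_ge_zero[of "Suc m"]] show ?thesis
            by (simp only: times_divide_eq_left)
        qed
        finally have "(cmod (?f z - S m z))\<^sup>2 \<le> (\<bar>t\<bar> ^ Suc m / fact (Suc m) * cmod (z i) ^ Suc m)\<^sup>2"
          by (intro power_mono) auto
        also have "\<dots> = c * cmod (z i) ^ (2 * Suc m)"
          unfolding c_def power_mult_distrib by (simp only: power_mult[symmetric] mult.commute)
        finally have "(cmod (?f z - S m z))\<^sup>2 * (cmod (r z))\<^sup>2 \<le> c * cmod (z i) ^ (2 * Suc m) * (cmod (r z))\<^sup>2"
          by (intro mult_right_mono) auto
        then show ?thesis
          unfolding left_diff_distrib[symmetric] norm_mult power_mult_distrib by (simp only: mult.assoc)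
      qed
      have "sqnorm n (\<lambda>z. ?f z * r z - S m z * r z) \<le> (\<integral>z. c * (cmod (z i) ^ (2 * Suc m) * (cmod (r z))\<^sup>2) \<partial>gauss n)"
        unfolding sqnorm_def
      proof (rule integral_mono)
        show "integrable (gauss n) (\<lambda>z. (cmod (?f z * r z - S m z * r z))\<^sup>2)"
          using bdd_meas_mult_L2[OF bf rL] bipoly_L2[OF bipoly_mult[OF S r]] by (intro L2_integrable L2_diff)
        show "integrable (gauss n) (\<lambda>z. c * (cmod (z i) ^ (2 * Suc m) * (cmod (r z))\<^sup>2))"
          by (intro integrable_mult_right weighted_moment_bound(1)[OF i r])
      qed (rule pw)
      also have "\<dots> = c * (\<integral>z. cmod (z i) ^ (2 * Suc m) * (cmod (r z))\<^sup>2 \<partial>gauss n)"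
        by (rule integral_mult_right_zero)
      also have "\<dots> \<le> c * (2 ^ Suc m * fact (Suc m) * A)"
        unfolding A_def by (intro mult_left_mono weighted_moment_bound(2)[OF i r]) (auto simp: c_def)
      also have "\<dots> = (2 * t\<^sup>2) ^ Suc m / fact (Suc m) * A"
      proof -
        have "(\<bar>t\<bar> ^ Suc m)\<^sup>2 = (t\<^sup>2) ^ Suc m"
          by (metis power2_abs power_commutes power_even_eq power_mult mult.commute)
        then have "c = (t\<^sup>2) ^ Suc m / (fact (Suc m) * fact (Suc m))"
          unfolding c_def power_divide by (simp only: power2_eq_square)
        then show ?thesis by (simp add: power_mult_distrib del: fact_Suc power_Suc)
      qed
      finally show ?thesis .
    qed
    \<comment> \<open>The error bounds are, up to the factor \<open>A\<close>, the terms of the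
      series of the exponential at \<open>2 * t\<^sup>2\<close>.\<close>
    have "(\<lambda>m. inverse (fact m) * (2 * t\<^sup>2) ^ m) \<longlonglongrightarrow> 0"
      by (rule summable_LIMSEQ_zero[OF summable_exp])
    then have "(\<lambda>m. inverse (fact (Suc m)) * (2 * t\<^sup>2) ^ Suc m * A) \<longlonglongrightarrow> 0 * A"
      by (intro tendsto_mult tendsto_const) (rule LIMSEQ_Suc)
    then have lim: "(\<lambda>m. (2 * t\<^sup>2) ^ Suc m / fact (Suc m) * A) \<longlonglongrightarrow> 0"
      by (simp add: divide_inverse mult_ac del: fact_Suc power_Suc)
    fix \<epsilon> :: real assume "0 < \<epsilon>"
    then obtain m where "(2 * t\<^sup>2) ^ Suc m / fact (Suc m) * A < \<epsilon>"
      using order_tendstoD(2)[OF lim] by (auto simp: eventually_sequentially)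
    then have "sqnorm n (\<lambda>z. ?f z * r z - S m z * r z) < \<epsilon>" using bound[of m] by linarith
    then show "\<exists>p q g. bipoly n p q g \<and> sqnorm n (\<lambda>z. ?f z * r z - g z) < \<epsilon>"
      using bipoly_mult[OF S r] by blast
  qed
  then show ?thesis using bf unfolding multiplier_def by blast
qed

lemma multiplier_real_polynomial:
  assumes u: "multiplier n (\<lambda>z. of_real (u z))" and p: "real_polynomial_function p"
  shows "multiplier n (\<lambda>z. of_real (p (u z)))"
  using p
proof (induction p)
  case (linear f)
  then obtain c where "f = (\<lambda>x. x * c)" unfolding real_bounded_linear by blast
  then show ?case using multiplier_mult[OF u multiplier_const[of n "of_real c"]] by simp
next
  case (const c)
  show ?case by (rule multiplier_const)
next
  case (add f g)
  then show ?case using multiplier_add[OF add.IH] by simp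
next
  case (mult f g)
  then show ?case using multiplier_mult[OF mult.IH] by simp
qed

text \<open>Weierstrass approximation on a compact interval that contains the values of
  \<open>u\<close>, followed by a bounded limit.\<close>

lemma multiplier_continuous:
  fixes \<phi> :: "real \<Rightarrow> real"
  assumes u: "multiplier n (\<lambda>z. of_real (u z))" and \<phi>: "continuous_on UNIV \<phi>"
  shows "multiplier n (\<lambda>z. of_real (\<phi> (u z)))"
proof -
  obtain B where B: "\<And>z. z \<in> space (gauss n) \<Longrightarrow> \<bar>u z\<bar> \<le> B"
    using bdd_meas_bound[OF multiplier_bdd[OF u]] by (metis norm_of_real)
  have "\<exists>p. real_polynomial_function p \<and> (\<forall>x\<in>{-B..B}. \<bar>\<phi> x - p x\<bar> < inverse (real (Suc k)))" for k
    using Stone_Weierstrass_real_polynomial_function[of "{-B..B}" \<phi> "inverse (real (Suc k))"]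
      continuous_on_subset[OF \<phi>] by (metis compact_Icc inverse_positive_iff_positive of_nat_0_less_iff subset_UNIV zero_less_Suc)
  then obtain p where p: "\<And>k. real_polynomial_function (p k)"
      "\<And>k x. x \<in> {-B..B} \<Longrightarrow> \<bar>\<phi> x - p k x\<bar> < inverse (real (Suc k))"
    by metis
  have uB: "u z \<in> {-B..B}" if "z \<in> space (gauss n)" for z using B[OF that] by (auto simp: abs_le_iff)
  have "compact (\<phi> ` {-B..B})"
    by (intro compact_continuous_image continuous_on_subset[OF \<phi>]) auto
  then obtain D where D: "\<And>x. x \<in> {-B..B} \<Longrightarrow> \<bar>\<phi> x\<bar> \<le> D"
    using compact_imp_bounded bounded_iff by (metis image_eqI real_norm_def)
  show ?thesis
  proof (rule multiplier_lim[where F = "\<lambda>k z. of_real (p k (u z))" and C = "D + 1"])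
    show "multiplier n (\<lambda>z. of_real (p k (u z)))" for k
      by (rule multiplier_real_polynomial[OF u p(1)])
    fix z assume z: "z \<in> space (gauss n)"
    have "inverse (real (Suc k)) \<le> 1" for k by (simp add: field_simps)
    then show "cmod (of_real (p k (u z))) \<le> D + 1" for k
      using p(2)[OF uB[OF z], of k] D[OF uB[OF z]] by (smt (verit) norm_of_real)
    have "(\<lambda>k. \<phi> (u z) - p k (u z)) \<longlonglongrightarrow> 0"
      by (rule Lim_null_comparison[OF _ LIMSEQ_inverse_real_of_nat])
        (use p(2)[OF uB[OF z]] in \<open>auto intro!: always_eventually less_imp_le\<close>)
    from tendsto_diff[OF tendsto_const[of "\<phi> (u z)"] this]
    have "(\<lambda>k. p k (u z)) \<longlonglongrightarrow> \<phi> (u z)" by simp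
    then show "(\<lambda>k. complex_of_real (p k (u z))) \<longlonglongrightarrow> of_real (\<phi> (u z))" by (rule tendsto_of_real)
  qed
qed

lemma abs_sin_minus_le: "\<bar>sin y - y\<bar> \<le> y\<^sup>2 / 2" for y :: real
proof -
  have "\<bar>Im (exp (\<i> * of_real y) - (\<Sum>k\<le>1. (\<i> * of_real y) ^ k / fact k))\<bar> \<le> \<bar>y\<bar> ^ 2 / 2"
    using order_trans[OF abs_Im_le_cmod iexp_approx1[of y 1]] by (simp add: numeral_2_eq_2)
  then show ?thesis by (simp add: Im_exp)
qed

text \<open>\<open>X\<close> is unbounded and not itself available as a multiplier. It is reached
  through bounded functions of it, made from exponentials, and the indicator is a limit of
  continuous cutoffs.\<close>

lemma multiplier_indicator_greater:
  assumes i: "i < n" and X: "bipoly n 1 1 (\<lambda>z. of_real (X z))" and le: "\<And>z. \<bar>X z\<bar> \<le> cmod (z i)"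
  shows "multiplier n (indicator {z \<in> space (gauss n). a < X z})"
proof -
  have sin: "multiplier n (\<lambda>z. of_real (sin (t * X z)))" for t
  proof -
    have eq: "complex_of_real (sin y) = (- \<i> / 2) * exp (\<i> * of_real y) + (\<i> / 2) * exp (\<i> * of_real (- y))" for y
      by (simp add: complex_eq_iff Re_exp Im_exp)
    have "multiplier n (\<lambda>z. (- \<i> / 2) * exp (\<i> * of_real (t * X z)) + (\<i> / 2) * exp (\<i> * of_real ((- t) * X z)))"
      by (intro multiplier_add multiplier_cmult multiplier_iexp[OF i X le])
    then show ?thesis unfolding eq by simp
  qed
  \<comment> \<open>Bounded for each \<open>m\<close>, and tending to \<open>X z\<close> because sin
    y is y up to a quadratic error.\<close>
  define u where "u m z = real (Suc m) * sin (1 / real (Suc m) * X z)" for m z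
  have u: "multiplier n (\<lambda>z. of_real (u m z))" for m
    unfolding u_def of_real_mult by (intro multiplier_cmult sin)
  have u_lim: "(\<lambda>m. u m z) \<longlonglongrightarrow> X z" for z
  proof -
    have b: "\<bar>u m z - X z\<bar> \<le> (X z)\<^sup>2 / 2 * inverse (real (Suc m))" for m
    proof -
      define s where "s = real (Suc m)"
      have s: "0 < s" by (simp add: s_def)
      have "\<bar>u m z - X z\<bar> = s * \<bar>sin (1 / s * X z) - 1 / s * X z\<bar>"
      proof -
        have "u m z - X z = s * (sin (1 / s * X z) - 1 / s * X z)"
        proof -
          have "u m z = s * sin (1 / s * X z)" by (simp only: u_def s_def)
          then show ?thesis using s by (simp add: right_diff_distrib)
        qed
        then show ?thesis using s by (simp add: abs_mult)
      qed
      also have "\<dots> \<le> s * ((1 / s * X z)\<^sup>2 / 2)"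
        using s by (intro mult_left_mono abs_sin_minus_le) auto
      also have "\<dots> = (X z)\<^sup>2 / 2 * inverse s" using s by (simp add: power2_eq_square field_simps)
      finally show ?thesis by (simp add: s_def)
    qed
    have l: "(\<lambda>m. (X z)\<^sup>2 / 2 * inverse (real (Suc m))) \<longlonglongrightarrow> (X z)\<^sup>2 / 2 * 0"
      by (intro tendsto_intros LIMSEQ_inverse_real_of_nat)
    have "(\<lambda>m. u m z - X z) \<longlonglongrightarrow> 0"
    proof (rule Lim_null_comparison)
      show "eventually (\<lambda>m. norm (u m z - X z) \<le> (X z)\<^sup>2 / 2 * inverse (real (Suc m))) sequentially"
        unfolding real_norm_def by (intro always_eventually allI b)
      show "(\<lambda>m. (X z)\<^sup>2 / 2 * inverse (real (Suc m))) \<longlonglongrightarrow> 0"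
        using l by (simp only: mult_zero_right)
    qed
    then show ?thesis by (simp add: LIM_zero_iff)
  qed
  \<comment> \<open>A ramp that is 0 up to \<open>a\<close> and, for positive \<open>k\<close>,
    reaches 1 at a + 1/k, so the limit is the indicator of the strict inequality.\<close>
  define \<phi> where "\<phi> k s = min 1 (max 0 (real k * (s - a)))" for k s
  have \<phi>_cont: "continuous_on UNIV (\<phi> k)" for k
    unfolding \<phi>_def[abs_def] by (intro continuous_intros)
  have \<phi>_bd: "\<bar>\<phi> k s\<bar> \<le> 1" for k s by (auto simp: \<phi>_def)
  have \<phi>X: "multiplier n (\<lambda>z. of_real (\<phi> k (X z)))" for k
  proof (rule multiplier_lim[where F = "\<lambda>m z. of_real (\<phi> k (u m z))" and C = 1])
    show "multiplier n (\<lambda>z. of_real (\<phi> k (u m z)))" for m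
      by (rule multiplier_continuous[OF u \<phi>_cont])
    show "cmod (of_real (\<phi> k (u m z))) \<le> 1" for m z using \<phi>_bd by simp
    have "isCont (\<phi> k) (X z)" for z using \<phi>_cont by (simp add: continuous_on_eq_continuous_at)
    then show "(\<lambda>m. complex_of_real (\<phi> k (u m z))) \<longlonglongrightarrow> of_real (\<phi> k (X z))" for z
      by (intro tendsto_of_real isCont_tendsto_compose[OF _ u_lim])
  qed
  show ?thesis
  proof (rule multiplier_lim[where F = "\<lambda>k z. of_real (\<phi> k (X z))" and C = 1])
    show "cmod (of_real (\<phi> k (X z))) \<le> 1" for k z using \<phi>_bd by simp
    fix z assume z: "z \<in> space (gauss n)"
    show "(\<lambda>k. complex_of_real (\<phi> k (X z))) \<longlonglongrightarrow> indicator {z \<in> space (gauss n). a < X z} z"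
    proof (cases "a < X z")
      case True
      obtain N :: nat where N: "1 / (X z - a) \<le> real N" using real_arch_simple by blast
      have "\<phi> k (X z) = 1" if "N \<le> k" for k
      proof -
        have "1 / (X z - a) \<le> real k" using N that by linarith
        then have "1 \<le> real k * (X z - a)" using True by (simp add: field_simps)
        then show ?thesis by (simp add: \<phi>_def)
      qed
      then have "eventually (\<lambda>k. complex_of_real (\<phi> k (X z)) = 1) sequentially"
        by (auto simp: eventually_sequentially)
      then show ?thesis using True z by (simp add: tendsto_eventually)
    next
      case False
      then have "real k * (X z - a) \<le> 0" for k by (simp add: mult_nonneg_nonpos)
      then have "\<phi> k (X z) = 0" for k by (simp add: \<phi>_def max_absorb1)
      then show ?thesis using False by simp
    qed
  qed (rule \<phi>X)
qed

text \<open>Closure under products, complements and bounded limits makes the sets whose indicators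
  are multipliers a \<sigma>-algebra. It contains all half-spaces in the real and imaginary parts of
  the coordinates, hence every measurable set.\<close>

lemma multiplier_indicator:
  assumes A: "A \<in> sets (gauss n)"
  shows "multiplier n (indicator A)"
proof -
  define \<S> where "\<S> = {A \<in> sets (gauss n). multiplier n (indicator A)}"
  have un: "A \<union> B \<in> \<S>" if "A \<in> \<S>" "B \<in> \<S>" for A B
  proof -
    have "multiplier n (\<lambda>z. (indicator A z + indicator B z) + (- 1) * (indicator A z * indicator B z))"
      using that unfolding \<S>_def by (intro multiplier_add multiplier_mult multiplier_const) auto
    also have "(\<lambda>z. (indicator A z + indicator B z) + (- 1) * (indicator A z * indicator B z)) = (indicator (A \<union> B) :: _ \<Rightarrow> complex)"
      by (auto simp: fun_eq_iff indicator_def)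
    finally show ?thesis using that by (simp add: \<S>_def sets.Un)
  qed
  have emp: "{} \<in> \<S>" using multiplier_const[of n 0] by (simp add: \<S>_def indicator_def[abs_def])
  have fin: "(\<Union>i<k. A i) \<in> \<S>" if "range A \<subseteq> \<S>" for A :: "nat \<Rightarrow> _" and k
  proof (induction k)
    case (Suc k)
    then show ?case using un[of "A k" "\<Union>i<k. A i"] that by (auto simp: lessThan_Suc)
  qed (simp add: emp)
  interpret S: sigma_algebra "space (gauss n)" \<S>
    unfolding sigma_algebra_iff2
  proof (intro conjI ballI allI impI emp)
    show "\<S> \<subseteq> Pow (space (gauss n))" using sets.sets_into_space by (auto simp: \<S>_def)
    show "space (gauss n) - A \<in> \<S>" if "A \<in> \<S>" for A
    proof -
      have "multiplier n (\<lambda>z. 1 + (- 1) * indicator A z)"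
        using that unfolding \<S>_def by (intro multiplier_add multiplier_mult multiplier_const) auto
      then have "multiplier n (indicator (space (gauss n) - A))"
        by (rule multiplier_cong) (auto simp: indicator_def)
      then show ?thesis using that by (auto simp: \<S>_def)
    qed
    show "(\<Union>i. A i) \<in> \<S>" if "range A \<subseteq> \<S>" for A :: "nat \<Rightarrow> _"
    proof -
      have "multiplier n (indicator (\<Union>i. A i))"
      proof (rule multiplier_lim[where F = "\<lambda>k. indicator (\<Union>i<k. A i)" and C = 1])
        show "multiplier n (indicator (\<Union>i<k. A i))" for k using fin[OF that, of k] by (simp add: \<S>_def)
        show "cmod (indicator (\<Union>i<k. A i) z) \<le> 1" for k z by (simp add: indicator_def)
        show "(\<lambda>k. indicator (\<Union>i<k. A i) z) \<longlonglongrightarrow> (indicator (\<Union>i. A i) z :: complex)" for z by (rule LIMSEQ_indicator_UN)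
      qed
      moreover have "(\<Union>i. A i) \<in> sets (gauss n)" using that by (intro sets.countable_UN) (auto simp: \<S>_def)
      ultimately show ?thesis by (simp add: \<S>_def)
    qed
  qed
  \<comment> \<open>The good sets become the \<sigma>-algebra of a measure space, so that the claim
    can be read as measurability of the coordinates on \<open>N\<close>.\<close>
  define N where "N = sigma (space (gauss n)) \<S>"
  have sN: "space N = space (gauss n)" unfolding N_def by (rule S.space_measure_of_eq)
  have setsN: "sets N = \<S>" unfolding N_def by (rule S.sets_measure_of_eq)
  have gr: "X \<in> borel_measurable N" if "i < n" and X: "bipoly n 1 1 (\<lambda>z. of_real (X z))" and "\<And>z. \<bar>X z\<bar> \<le> cmod (z i)"
    for X :: "(nat \<Rightarrow> complex) \<Rightarrow> real" and i
    unfolding borel_measurable_iff_greater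
  proof
    fix a
    have "(\<lambda>z. Re (of_real (X z))) \<in> borel_measurable (gauss n)"
      using L2_measurable[OF bipoly_L2[OF X]] by measurable
    then have [measurable]: "X \<in> borel_measurable (gauss n)" by simp
    have "{z \<in> space (gauss n). a < X z} \<in> sets (gauss n)" by measurable
    then show "{w \<in> space N. a < X w} \<in> sets N"
      unfolding setsN sN \<S>_def using multiplier_indicator_greater[OF that] by simp
  qed
  have comp: "(\<lambda>z. z i) \<in> borel_measurable N" if i: "i < n" for i
  proof -
    have b: "bipoly n 1 1 (\<lambda>z. z i)" "bipoly n 1 1 (\<lambda>z. cnj (z i))"
      using bipoly_mono[OF bipoly_coord[OF i]] bipoly_mono[OF bipoly_cnj[OF bipoly_coord[OF i]]] by auto
    have "complex_of_real (Re w) = (1 / 2) * w + (1 / 2) * cnj w"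
         "complex_of_real (Im w) = (- \<i> / 2) * w + (\<i> / 2) * cnj w" for w
      by (simp_all add: complex_eq_iff)
    then have "bipoly n 1 1 (\<lambda>z. of_real (Re (z i)))" "bipoly n 1 1 (\<lambda>z. of_real (Im (z i)))"
      using b by (simp_all only:) (intro bipoly.add bipoly_scale; assumption)+
    then have [measurable]: "(\<lambda>z. Re (z i)) \<in> borel_measurable N" "(\<lambda>z. Im (z i)) \<in> borel_measurable N"
      using gr[OF i] abs_Re_le_cmod abs_Im_le_cmod by auto
    have "(\<lambda>z. Complex (Re (z i)) (Im (z i))) \<in> borel_measurable N" by measurable
    then show ?thesis by simp
  qed
  \<comment> \<open>Measurability of the identity from \<open>N\<close> to the product space says
    that every measurable set is good.\<close>
  have "(\<lambda>z i. z i) \<in> measurable N (PiM {..<n} (\<lambda>_. borel))"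
    using comp by (intro measurable_PiM_single') (auto simp: sN space_gauss)
  then have "(\<lambda>z. z) -` A \<inter> space N \<in> sets N"
    using A unfolding sets_gauss by (rule measurable_sets)
  moreover have "A \<subseteq> space N" unfolding sN using A by (rule sets.sets_into_space)
  ultimately have "A \<in> \<S>" unfolding setsN by (simp add: Int_absorb2)
  then show ?thesis by (simp add: \<S>_def)
qed

lemma bdd_meas_multiplier:
  assumes "bdd_meas n f"
  shows "multiplier n f"
proof -
  have [measurable]: "f \<in> borel_measurable (gauss n)" by (rule bdd_meas_measurable[OF assms])
  obtain C where C: "\<And>z. z \<in> space (gauss n) \<Longrightarrow> cmod (f z) \<le> C"
    using bdd_meas_bound[OF assms] by metis
  obtain F where F0: "\<forall>k. simple_function (gauss n) (F k)"
      "\<forall>z\<in>space (gauss n). (\<lambda>k. F k z) \<longlonglongrightarrow> f z"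
      "\<forall>k. \<forall>z\<in>space (gauss n). dist (F k z) 0 \<le> 2 * dist (f z) 0"
    using borel_measurable_implies_sequence_metric[of f "gauss n" 0] assms bdd_meas_measurable by blast
  have F: "\<And>k. simple_function (gauss n) (F k)"
      "\<And>z. z \<in> space (gauss n) \<Longrightarrow> (\<lambda>k. F k z) \<longlonglongrightarrow> f z"
      "\<And>k z. z \<in> space (gauss n) \<Longrightarrow> dist (F k z) 0 \<le> 2 * dist (f z) 0"
    using F0 by blast+
  show ?thesis
  proof (rule multiplier_lim[where F = F and C = "2 * C"])
    show "multiplier n (F k)" for k
    proof (rule multiplier_cong)
      show "multiplier n (\<lambda>z. \<Sum>y\<in>F k ` space (gauss n). indicator (F k -` {y} \<inter> space (gauss n)) z * y)"
        using simple_functionD(2)[OF F(1)] by (intro multiplier_sum multiplier_mult multiplier_const multiplier_indicator)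
      show "(\<Sum>y\<in>F k ` space (gauss n). indicator (F k -` {y} \<inter> space (gauss n)) z * y) = F k z" if "z \<in> space (gauss n)" for z
        unfolding simple_function_indicator_representation_banach[OF F(1) that]
        by (intro sum.cong refl) (auto simp: indicator_def)
    qed
    show "cmod (F k z) \<le> 2 * C" if "z \<in> space (gauss n)" for k z
      using F(3)[OF that, of k] C[OF that] by simp
  qed (rule F(2))
qed

lemma bdd_meas_approximable:
  assumes "bdd_meas n f"
  shows "approximable n f"
proof -
  have "approximable n (\<lambda>z. f z * 1)"
    using bdd_meas_multiplier[OF assms] bipoly.const[of n 0 0 1] unfolding multiplier_def by blast
  then show ?thesis by simp
qed

subsection \<open>Angular averages\<close>

definition rot :: "nat \<Rightarrow> complex \<Rightarrow> (nat \<Rightarrow> complex) \<Rightarrow> nat \<Rightarrow> complex" where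
  "rot n u z = (\<lambda>j\<in>{..<n}. u * z j)"

lemma rot_space [simp]: "rot n u z \<in> space (gauss n)"
  by (simp add: rot_def space_gauss)

text \<open>The rotation is treated jointly in angle and point because \<open>E1\<close> integrates
  over the angle and Fubini is applied to both.\<close>

lemma rot_measurable_pair:
  assumes "(\<lambda>x. u x) \<in> borel_measurable M" "f \<in> measurable M (gauss n)"
  shows "(\<lambda>x. rot n (u x) (f x)) \<in> measurable M (gauss n)"
proof -
  have "(\<lambda>x. u x * f x i) \<in> borel_measurable M" if "i < n" for i
    using assms(1) measurable_compose[OF assms(2) gauss_component_measurable[OF that]] by measurable
  then have "(\<lambda>x. \<lambda>i\<in>{..<n}. u x * f x i) \<in> measurable M (PiM {..<n} (\<lambda>_. borel))"
    by (intro measurable_restrict) auto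
  then show ?thesis unfolding rot_def by (subst measurable_cong_sets[OF refl sets_gauss])
qed

lemma rot_measurable [measurable]: "rot n u \<in> measurable (gauss n) (gauss n)"
  using rot_measurable_pair[of "\<lambda>_. u" "gauss n" "\<lambda>z. z" n] by simp

lemma distr_gauss_rot:
  assumes u: "cmod u = 1"
  shows "distr (gauss n) (gauss n) (rot n u) = gauss n"
proof -
  have "distr (gauss n) (gauss n) (rot n u) = PiM {..<n} (\<lambda>_. gauss1)"
  proof (rule gauss_prod.PiM_eqI)
    show "sets (distr (gauss n) (gauss n) (rot n u)) = sets (PiM {..<n} (\<lambda>_. gauss1))"
      by (simp add: gauss_eq_PiM)
    fix A :: "nat \<Rightarrow> complex set" assume A: "\<And>i. i \<in> {..<n} \<Longrightarrow> A i \<in> sets gauss1"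
    have AP: "Pi\<^sub>E {..<n} A \<in> sets (gauss n)"
      unfolding gauss_eq_PiM using A by (intro sets_PiM_I_finite) auto
    define B where "B i = (\<lambda>z. u * z) -` A i" for i
    have B: "B i \<in> sets gauss1" if "i < n" for i
    proof -
      have "(\<lambda>z. u * z) -` A i \<inter> space borel \<in> sets borel"
        using A[of i] that by (intro measurable_sets[where M = borel and A = borel]) auto
      then show ?thesis by (simp add: B_def)
    qed
    have "emeasure (distr (gauss n) (gauss n) (rot n u)) (Pi\<^sub>E {..<n} A) = emeasure (gauss n) (rot n u -` Pi\<^sub>E {..<n} A \<inter> space (gauss n))"
      using AP by (intro emeasure_distr) auto
    also have "rot n u -` Pi\<^sub>E {..<n} A \<inter> space (gauss n) = Pi\<^sub>E {..<n} B"
    proof (rule set_eqI)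
      show "z \<in> rot n u -` Pi\<^sub>E {..<n} A \<inter> space (gauss n) \<longleftrightarrow> z \<in> Pi\<^sub>E {..<n} B" for z
        by (simp add: rot_def space_gauss PiE_iff B_def)
    qed
    also have "emeasure (gauss n) (Pi\<^sub>E {..<n} B) = (\<Prod>i<n. emeasure gauss1 (B i))"
      unfolding gauss_eq_PiM using B by (intro gauss_prod.emeasure_PiM) auto
    also have "\<dots> = (\<Prod>i<n. emeasure gauss1 (A i))"
    proof (rule prod.cong[OF refl])
      fix i assume "i \<in> {..<n}"
      then have "emeasure (distr gauss1 gauss1 (\<lambda>z. u * z)) (A i) = emeasure gauss1 (B i)"
        using A[of i] by (subst emeasure_distr) (auto simp: B_def)
      then show "emeasure gauss1 (B i) = emeasure gauss1 (A i)" by (simp add: distr_gauss1_rotate[OF u])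
    qed
    finally show "emeasure (distr (gauss n) (gauss n) (rot n u)) (Pi\<^sub>E {..<n} A) = (\<Prod>i\<in>{..<n}. emeasure gauss1 (A i))" .
  qed simp
  then show ?thesis by (simp add: gauss_eq_PiM)
qed

lemma integral_gauss_rot:
  fixes f :: "(nat \<Rightarrow> complex) \<Rightarrow> complex"
  assumes "cmod u = 1" and f: "f \<in> borel_measurable (gauss n)"
  shows "(\<integral>z. f (rot n u z) \<partial>gauss n) = (\<integral>z. f z \<partial>gauss n)"
  using integral_distr[OF rot_measurable f, of u] by (simp add: distr_gauss_rot[OF assms(1)])

lemma hermite1_unimodular:
  assumes "cmod u = 1"
  shows "hermite1 a b (u * z) = u ^ a * cnj u ^ b * hermite1 a b z"
proof -
  have u: "u = cis (Arg u)" using rcis_cmod_Arg[of u] assms by (simp add: rcis_def)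
  have "cis ((real a - real b) * Arg u) = cis (Arg u) ^ a * cnj (cis (Arg u)) ^ b"
    unfolding cis_cnj Complex.DeMoivre cis_mult by (simp add: algebra_simps)
  then show ?thesis using hermite1_cis[of a b "Arg u" z] u by metis
qed

lemma hermite_rot:
  assumes "cmod u = 1"
  shows "hermite n \<alpha> \<beta> (rot n u z) = u ^ (\<Sum>j<n. \<alpha> j) * cnj u ^ (\<Sum>j<n. \<beta> j) * hermite n \<alpha> \<beta> z"
  unfolding hermite_def power_sum prod.distrib[symmetric]
  by (intro prod.cong) (auto simp: rot_def hermite1_unimodular[OF assms])

text \<open>The projection onto functions of angular degree one. The angle is sampled from a planar
  Gaussian variable \<open>w\<close>; the null event \<open>w = 0\<close> is harmless because \<^term>\<open>sgn 0 = 0\<close>.\<close>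

definition E1 :: "nat \<Rightarrow> ((nat \<Rightarrow> complex) \<Rightarrow> complex) \<Rightarrow> (nat \<Rightarrow> complex) \<Rightarrow> complex" where
  "E1 n f z = (\<integral>w. cnj (sgn w) * f (rot n (sgn w) z) \<partial>gauss1)"

lemma cmod_sgn: "cmod (sgn w) \<le> 1"
  by (simp add: norm_sgn)

lemma E1_joint_measurable:
  assumes "f \<in> borel_measurable (gauss n)"
  shows "(\<lambda>(z, w). cnj (sgn w) * f (rot n (sgn w) z)) \<in> borel_measurable (gauss n \<Otimes>\<^sub>M gauss1)"
proof -
  have "(\<lambda>p. rot n (sgn (snd p)) (fst p)) \<in> measurable (gauss n \<Otimes>\<^sub>M gauss1) (gauss n)"
    by (intro rot_measurable_pair) measurable
  from measurable_compose[OF this assms]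
  have [measurable]: "(\<lambda>p. f (rot n (sgn (snd p)) (fst p))) \<in> borel_measurable (gauss n \<Otimes>\<^sub>M gauss1)" .
  show ?thesis unfolding split_beta' by measurable
qed

lemma E1_integrable:
  assumes "bdd_meas n f"
  shows "integrable gauss1 (\<lambda>w. cnj (sgn w) * f (rot n (sgn w) z))"
proof -
  obtain C where C: "0 \<le> C" "\<And>z. z \<in> space (gauss n) \<Longrightarrow> cmod (f z) \<le> C"
    using bdd_meas_bound[OF assms] by metis
  \<comment> \<open>\<open>z\<close> need not lie in the space of the Gaussian measure. Its
    restriction does, and the rotation does not distinguish the two.\<close>
  have *: "rot n u (restrict z {..<n}) = rot n u z" for u by (auto simp: rot_def)
  have "restrict z {..<n} \<in> space (gauss n)" by (simp add: space_gauss)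
  from measurable_compose[OF measurable_Pair1'[OF this, of gauss1] E1_joint_measurable[OF bdd_meas_measurable[OF assms]]]
  have m: "(\<lambda>w. cnj (sgn w) * f (rot n (sgn w) z)) \<in> borel_measurable gauss1"
    by (simp add: *)
  have "cmod (cnj (sgn w) * f (rot n (sgn w) z)) \<le> 1 * C" for w
    unfolding norm_mult using C cmod_sgn by (intro mult_mono) auto
  then show ?thesis using m by (intro gauss1.integrable_const_bound[where B = C]) auto
qed

lemma E1_bound:
  assumes "bdd_meas n f" and C: "\<And>z. z \<in> space (gauss n) \<Longrightarrow> cmod (f z) \<le> C"
  shows "cmod (E1 n f z) \<le> C"
proof -
  have C0: "0 \<le> C" using C[OF rot_space[of n 0 z]] norm_ge_zero order_trans by blast
  have "cmod (cnj (sgn w) * f (rot n (sgn w) z)) \<le> 1 * C" for w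
    unfolding norm_mult using C cmod_sgn C0 by (intro mult_mono) auto
  then have "(\<integral>w. cmod (cnj (sgn w) * f (rot n (sgn w) z)) \<partial>gauss1) \<le> (\<integral>w. C \<partial>gauss1)"
    using E1_integrable[OF assms(1)] by (intro integral_mono integrable_norm) auto
  also have "\<dots> = C" using gauss1.prob_space by simp
  finally have le: "(\<integral>w. cmod (cnj (sgn w) * f (rot n (sgn w) z)) \<partial>gauss1) \<le> C" .
  show ?thesis unfolding E1_def by (rule order_trans[OF integral_norm_bound le])
qed

lemma E1_bdd_meas:
  assumes "bdd_meas n f"
  shows "bdd_meas n (E1 n f)"
proof -
  obtain C where C: "\<And>z. z \<in> space (gauss n) \<Longrightarrow> cmod (f z) \<le> C"
    using bdd_meas_bound[OF assms] by metis
  show ?thesis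
  proof (rule bdd_measI)
    show "E1 n f \<in> borel_measurable (gauss n)"
      unfolding E1_def[abs_def]
      using gauss1.borel_measurable_lebesgue_integral[OF E1_joint_measurable[OF bdd_meas_measurable[OF assms]]] by simp
    show "cmod (E1 n f z) \<le> C" for z by (rule E1_bound[OF assms C])
  qed
qed

lemma E1_sum:
  assumes "\<And>i. i \<in> I \<Longrightarrow> bdd_meas n (f i)"
  shows "E1 n (\<lambda>z. \<Sum>i\<in>I. c i * f i z) z = (\<Sum>i\<in>I. c i * E1 n (f i) z)"
proof -
  have "E1 n (\<lambda>z. \<Sum>i\<in>I. c i * f i z) z = (\<integral>w. (\<Sum>i\<in>I. c i * (cnj (sgn w) * f i (rot n (sgn w) z))) \<partial>gauss1)"
    unfolding E1_def
    by (intro Bochner_Integration.integral_cong refl) (simp only: sum_distrib_left mult.left_commute)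
  also have "\<dots> = (\<Sum>i\<in>I. \<integral>w. c i * (cnj (sgn w) * f i (rot n (sgn w) z)) \<partial>gauss1)"
    using assms by (intro Bochner_Integration.integral_sum integrable_mult_right E1_integrable)
  also have "\<dots> = (\<Sum>i\<in>I. c i * E1 n (f i) z)"
    unfolding E1_def by (intro sum.cong refl integral_mult_right_zero)
  finally show ?thesis .
qed

lemma sgn_cis_mult: "sgn (cis \<theta> * w) = cis \<theta> * sgn w"
  by (simp add: sgn_mult)

lemma AE_gauss1_nonzero: "AE w in gauss1. w \<noteq> 0"
  unfolding gauss1_def by (subst AE_density) (auto simp: AE_lborel_singleton)

text \<open>Orthogonality of the characters of the circle, the angle being that of a Gaussian
  variable. The first factor comes from the definition of \<open>E1\<close> and selects the degree
  difference one.\<close>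

lemma integral_sgn_power:
  "(\<integral>w. cnj (sgn w) * sgn w ^ p * cnj (sgn w) ^ q \<partial>gauss1) = (if p = Suc q then 1 else 0)"
proof (cases "p = Suc q")
  case True
  have "(\<integral>w. cnj (sgn w) * sgn w ^ p * cnj (sgn w) ^ q \<partial>gauss1) = (\<integral>w. 1 \<partial>gauss1)"
  proof (rule integral_cong_AE)
    show "AE w in gauss1. cnj (sgn w) * sgn w ^ p * cnj (sgn w) ^ q = 1"
      using AE_gauss1_nonzero
    proof eventually_elim
      case (elim w)
      have "sgn w * cnj (sgn w) = 1"
        unfolding complex_norm_square[symmetric] using elim by (simp add: norm_sgn)
      then have "(sgn w * cnj (sgn w)) ^ Suc q = 1" by simp
      then show ?case unfolding True power_mult_distrib by (simp add: mult_ac)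
    qed
  qed measurable
  also have "\<dots> = 1" using gauss1.prob_space by simp
  finally show ?thesis using True by simp
next
  case False
  have "(\<integral>w. cnj (sgn w) * sgn w ^ p * cnj (sgn w) ^ q \<partial>gauss1) = 0"
  proof (rule integral_gauss1_eq_0[where k = "real p - real q - 1"])
    show "real p - real q - 1 \<noteq> 0" using False by linarith
    fix \<theta> z
    have "cis (- \<theta>) * (cis (real p * \<theta>) * cis (real q * (- \<theta>))) = cis ((real p - real q - 1) * \<theta>)"
      by (simp add: cis_mult algebra_simps)
    then have *: "cnj (cis \<theta>) * (cis \<theta> ^ p * cnj (cis \<theta>) ^ q) = cis ((real p - real q - 1) * \<theta>)"
      by (simp add: Complex.DeMoivre cis_cnj)
    show "cnj (sgn (cis \<theta> * z)) * sgn (cis \<theta> * z) ^ p * cnj (sgn (cis \<theta> * z)) ^ q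
      = cis ((real p - real q - 1) * \<theta>) * (cnj (sgn z) * sgn z ^ p * cnj (sgn z) ^ q)"
      unfolding *[symmetric] sgn_cis_mult complex_cnj_mult power_mult_distrib by (simp only: mult_ac)
  qed measurable
  then show ?thesis using False by simp
qed

text \<open>After Fubini, invariance of the Gaussian measure moves the rotation from
  \<open>f\<close> to the Hermite function, where it acts as a scalar. The average of this scalar is
  1 or 0.\<close>

lemma coef_E1:
  assumes f: "bdd_meas n f" and \<kappa>: "\<kappa> \<in> pair_indices n p q"
  shows "coef n \<kappa> (E1 n f) = (if p = Suc q then coef n \<kappa> f else 0)"
proof -
  interpret P: pair_prob_space "gauss n" gauss1 ..
  have [measurable]: "f \<in> borel_measurable (gauss n)" by (rule bdd_meas_measurable[OF f])
  obtain C where C: "0 \<le> C" "\<And>z. z \<in> space (gauss n) \<Longrightarrow> cmod (f z) \<le> C"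
    using bdd_meas_bound[OF f] by metis
  define F where "F z w = cnj (sgn w) * f (rot n (sgn w) z) * cnj (herm n \<kappa> z)" for z w
  have Fm: "(\<lambda>(z, w). F z w) \<in> borel_measurable (gauss n \<Otimes>\<^sub>M gauss1)"
  proof -
    have "(\<lambda>p. (case p of (z, w) \<Rightarrow> cnj (sgn w) * f (rot n (sgn w) z)) * cnj (herm n \<kappa> (fst p))) \<in> borel_measurable (gauss n \<Otimes>\<^sub>M gauss1)"
      using E1_joint_measurable[of f n] by measurable
    then show ?thesis unfolding F_def by (simp add: split_beta')
  qed
  have h1: "integrable (gauss n) (\<lambda>z. cmod (herm n \<kappa> z))"
    using integrable_norm[OF L2_integrable_inner[OF hermite_L2 const_L2[of 1]]] by simp
  have Fi: "integrable (gauss n \<Otimes>\<^sub>M gauss1) (\<lambda>(z, w). F z w)"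
  proof (rule Bochner_Integration.integrable_bound)
    show "integrable (gauss n \<Otimes>\<^sub>M gauss1) (\<lambda>(z, w). C * cmod (herm n \<kappa> z))"
    proof (rule P.Fubini_integrable)
      show "integrable (gauss n) (\<lambda>z. \<integral>w. norm (case (z, w) of (z, w) \<Rightarrow> C * cmod (herm n \<kappa> z)) \<partial>gauss1)"
        using h1 gauss1.prob_space by (simp add: abs_mult)
    qed auto
    have "cmod (F z w) \<le> (1 * C) * cmod (herm n \<kappa> z)" for z w
      unfolding F_def norm_mult using C cmod_sgn[of w] by (intro mult_mono) auto
    then show "AE p in gauss n \<Otimes>\<^sub>M gauss1. norm (case p of (z, w) \<Rightarrow> F z w) \<le> norm (case p of (z, w) \<Rightarrow> C * cmod (herm n \<kappa> z))"
      using C(1) by (intro AE_I2) (auto simp: abs_mult)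
  qed (rule Fm)
  \<comment> \<open>For w = 0 both sides vanish because \<open>sgn 0\<close> is 0; otherwise
    \<open>sgn w\<close> is unimodular and the measure is invariant.\<close>
  have inner: "(\<integral>z. F z w \<partial>gauss n) = cnj (sgn w) * sgn w ^ p * cnj (sgn w) ^ q * coef n \<kappa> f" for w
  proof (cases "w = 0")
    case False
    define u where "u = sgn w"
    have u: "cmod u = 1" using False by (simp add: u_def norm_sgn)
    have uu: "u * cnj u = 1" unfolding complex_norm_square[symmetric] u by simp
    have hz: "herm n \<kappa> z = cnj u ^ p * u ^ q * herm n \<kappa> (rot n u z)" for z
    proof -
      have "cnj u ^ p * u ^ q * herm n \<kappa> (rot n u z) = (u * cnj u) ^ p * (u * cnj u) ^ q * herm n \<kappa> z"
        using hermite_rot[OF u, of n "fst \<kappa>" "snd \<kappa>" z] \<kappa> by (simp add: pair_indices_iff power_mult_distrib mult_ac)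
      then show ?thesis by (simp add: uu)
    qed
    have "(\<integral>z. F z w \<partial>gauss n) = (\<integral>z. (cnj u * u ^ p * cnj u ^ q) * (f (rot n u z) * cnj (herm n \<kappa> (rot n u z))) \<partial>gauss n)"
      unfolding F_def u_def[symmetric] by (subst hz) (simp add: mult_ac)
    also have "\<dots> = (cnj u * u ^ p * cnj u ^ q) * (\<integral>z. f (rot n u z) * cnj (herm n \<kappa> (rot n u z)) \<partial>gauss n)"
      by (rule integral_mult_right_zero)
    also have "(\<integral>z. f (rot n u z) * cnj (herm n \<kappa> (rot n u z)) \<partial>gauss n) = coef n \<kappa> f"
      unfolding coef_def L2_inner_def
      by (rule integral_gauss_rot[OF u, where f = "\<lambda>z. f z * cnj (herm n \<kappa> z)"]) measurable
    finally show ?thesis by (simp add: u_def)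
  qed (simp add: F_def)
  have "coef n \<kappa> (E1 n f) = (\<integral>z. \<integral>w. F z w \<partial>gauss1 \<partial>gauss n)"
    unfolding coef_def L2_inner_def E1_def F_def integral_mult_left_zero ..
  also have "\<dots> = (\<integral>w. \<integral>z. F z w \<partial>gauss n \<partial>gauss1)"
    by (rule P.Fubini_integral[OF Fi, symmetric])
  also have "\<dots> = (if p = Suc q then 1 else 0) * coef n \<kappa> f"
    unfolding inner integral_sgn_power[symmetric] by (rule integral_mult_left_zero)
  finally show ?thesis by simp
qed

subsection \<open>The operators\<close>

definition deg1_indices :: "nat \<Rightarrow> nat \<Rightarrow> ((nat \<Rightarrow> nat) \<times> (nat \<Rightarrow> nat)) set" where
  "deg1_indices n N = (\<Union>l<N. pair_indices n (Suc l) l)"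

lemma finite_deg1_indices [simp]: "finite (deg1_indices n N)"
  by (simp add: deg1_indices_def)

lemma deg1_indices_ext: "deg1_indices n N \<subseteq> ext_pairs n"
  using pair_indices_ext by (auto simp only: deg1_indices_def)

lemma coef_E1_deg1:
  assumes f: "bdd_meas n f" and \<kappa>: "\<kappa> \<in> deg1_indices n N"
  shows "coef n \<kappa> (E1 n f) = coef n \<kappa> f"
proof -
  obtain l where "\<kappa> \<in> pair_indices n (Suc l) l" using \<kappa> unfolding deg1_indices_def by blast
  from coef_E1[OF f this] show ?thesis by simp
qed

lemma pair_indices_disjoint: "(p, q) \<noteq> (p', q') \<Longrightarrow> pair_indices n p q \<inter> pair_indices n p' q' = {}"
  by (auto simp only: pair_indices_iff)

lemma sum_deg1_indices: "(\<Sum>\<kappa>\<in>deg1_indices n N. g \<kappa>) = (\<Sum>l<N. \<Sum>\<kappa>\<in>pair_indices n (Suc l) l. g \<kappa>)"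
  unfolding deg1_indices_def
proof (rule sum.UNION_disjoint)
  show "\<forall>i\<in>{..<N}. \<forall>j\<in>{..<N}. i \<noteq> j \<longrightarrow> pair_indices n (Suc i) i \<inter> pair_indices n (Suc j) j = {}"
    using pair_indices_disjoint by simp
qed simp_all

abbreviation deg1_partial :: "nat \<Rightarrow> nat \<Rightarrow> ((nat \<Rightarrow> complex) \<Rightarrow> complex) \<Rightarrow> (nat \<Rightarrow> complex) \<Rightarrow> complex" where
  "deg1_partial n N f \<equiv> hermite_comb n (deg1_indices n N) (\<lambda>\<kappa>. coef n \<kappa> f)"

lemma Q_op_eq:
  "f \<in> L2 n \<Longrightarrow> Q_op n l f = hermite_comb n (pair_indices n (Suc l) l) (\<lambda>\<kappa>. coef n \<kappa> f)"
  by (simp add: Q_op_def hermite_proj_eq)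

lemma sum_Q_op: "f \<in> L2 n \<Longrightarrow> (\<Sum>l<N. Q_op n l f z) = deg1_partial n N f z"
  by (simp add: Q_op_eq hermite_comb_def sum_deg1_indices)

lemma deg1_partial_E1: "bdd_meas n f \<Longrightarrow> deg1_partial n N (E1 n f) = deg1_partial n N f"
  unfolding hermite_comb_def[abs_def] by (intro ext sum.cong refl) (simp add: coef_E1_deg1)

text \<open>Completeness for angular degree one. A polynomial close to \<open>E1 n f\<close> shows
  that finitely many coefficients carry its squared norm up to \<epsilon>; those off degree one
  vanish, and the rest belong to the partial sums eventually.\<close>

lemma E1_convergence:
  assumes f: "bdd_meas n f"
  shows "(\<lambda>N. sqnorm n (\<lambda>z. deg1_partial n N f z - E1 n f z)) \<longlonglongrightarrow> 0"
proof (rule LIMSEQ_I)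
  fix \<epsilon> :: real assume e: "0 < \<epsilon>"
  let ?g = "E1 n f"
  have g: "bdd_meas n ?g" by (rule E1_bdd_meas[OF f])
  have gL: "?g \<in> L2 n" by (rule bdd_meas_L2[OF g])
  obtain p q h where h: "bipoly n p q h" "sqnorm n (\<lambda>z. ?g z - h z) < \<epsilon>"
    using approximableE[OF bdd_meas_approximable[OF g] e] by metis
  obtain c where c: "h = hermite_comb n (le_indices n p q) c" by (rule bipoly_comb[OF h(1)])
  have "sqnorm n ?g - (\<Sum>\<kappa>\<in>le_indices n p q. (cmod (coef n \<kappa> ?g))\<^sup>2) \<le> sqnorm n (\<lambda>z. ?g z - h z)"
    unfolding c sqnorm_diff_hermite_comb[OF finite_le_indices le_indices_ext gL]
    by (simp add: sum_nonneg)
  then have le: "sqnorm n ?g - (\<Sum>\<kappa>\<in>le_indices n p q. (cmod (coef n \<kappa> ?g))\<^sup>2) < \<epsilon>" using h(2) by linarith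
  \<comment> \<open>A degree-one index of bidegree (s + 1, s) below the polynomial has s + 1 at most
    \<open>p\<close>, so s < N.\<close>
  have "norm (sqnorm n (\<lambda>z. deg1_partial n N f z - ?g z) - 0) < \<epsilon>" if N: "p \<le> N" for N
  proof -
    have "(\<Sum>\<kappa>\<in>le_indices n p q. (cmod (coef n \<kappa> ?g))\<^sup>2) = (\<Sum>\<kappa>\<in>le_indices n p q \<inter> deg1_indices n N. (cmod (coef n \<kappa> ?g))\<^sup>2)"
    proof (rule sum.mono_neutral_right)
      show "\<forall>\<kappa>\<in>le_indices n p q - le_indices n p q \<inter> deg1_indices n N. (cmod (coef n \<kappa> ?g))\<^sup>2 = 0"
      proof
        fix \<kappa> assume k: "\<kappa> \<in> le_indices n p q - le_indices n p q \<inter> deg1_indices n N"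
        define r s where "r = (\<Sum>j<n. fst \<kappa> j)" and "s = (\<Sum>j<n. snd \<kappa> j)"
        have kp: "\<kappa> \<in> pair_indices n r s" using k by (simp add: pair_indices_iff le_indices_def r_def s_def)
        have "r \<noteq> Suc s"
        proof
          assume rs: "r = Suc s"
          have "r \<le> p" using k by (simp add: le_indices_def r_def)
          then have "s < N" using rs N by simp
          then have "\<kappa> \<in> deg1_indices n N" using kp unfolding rs deg1_indices_def by blast
          then show False using k by blast
        qed
        then show "(cmod (coef n \<kappa> ?g))\<^sup>2 = 0" using coef_E1[OF f kp] by simp
      qed
    qed simp_all
    also have "\<dots> \<le> (\<Sum>\<kappa>\<in>deg1_indices n N. (cmod (coef n \<kappa> ?g))\<^sup>2)"
      by (intro sum_mono2) auto
    finally have "sqnorm n ?g - (\<Sum>\<kappa>\<in>deg1_indices n N. (cmod (coef n \<kappa> ?g))\<^sup>2) < \<epsilon>" using le by linarith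
    then have "sqnorm n (\<lambda>z. ?g z - deg1_partial n N ?g z) < \<epsilon>"
      by (simp only: sqnorm_diff_projection[OF finite_deg1_indices deg1_indices_ext gL])
    then show ?thesis unfolding deg1_partial_E1[OF f] by (simp add: sqnorm_def norm_minus_commute)
  qed
  then show "\<exists>no. \<forall>N\<ge>no. norm (sqnorm n (\<lambda>z. deg1_partial n N f z - ?g z) - 0) < \<epsilon>" by blast
qed

lemma L2_inner_tendsto:
  assumes "\<And>N. F N \<in> L2 n" "f \<in> L2 n" "g \<in> L2 n"
    and "(\<lambda>N. sqnorm n (\<lambda>z. F N z - f z)) \<longlonglongrightarrow> 0"
  shows "(\<lambda>N. L2_inner n (F N) g) \<longlonglongrightarrow> L2_inner n f g"
proof -
  have "(\<lambda>N. sqrt (sqnorm n (\<lambda>z. F N z - f z) * sqnorm n g)) \<longlonglongrightarrow> sqrt (0 * sqnorm n g)"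
    by (intro tendsto_intros assms)
  then have l: "(\<lambda>N. sqrt (sqnorm n (\<lambda>z. F N z - f z) * sqnorm n g)) \<longlonglongrightarrow> 0" by simp
  have "(\<lambda>N. L2_inner n (F N) g - L2_inner n f g) \<longlonglongrightarrow> 0"
  proof (rule Lim_null_comparison[OF _ l])
    have "cmod (L2_inner n (F N) g - L2_inner n f g) \<le> sqrt (sqnorm n (\<lambda>z. F N z - f z) * sqnorm n g)" for N
      using L2_inner_bound[OF L2_diff[OF assms(1,2)] assms(3), of N] assms
      by (intro real_le_rsqrt) (simp add: L2_inner_diff_left)
    then show "\<forall>\<^sub>F N in sequentially. norm (L2_inner n (F N) g - L2_inner n f g) \<le> sqrt (sqnorm n (\<lambda>z. F N z - f z) * sqnorm n g)"
      by simp
  qed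
  then show ?thesis by (rule LIM_zero_cancel)
qed

text \<open>\<open>Pi1_op\<close> chooses one of several almost everywhere equal limits, so only its
  inner products can be identified. It and \<open>E1\<close> are limits in norm of the same partial
  sums.\<close>

lemma Pi1_op_inner:
  assumes f: "bdd_meas n f" and g: "g \<in> L2 n"
  shows "Pi1_op n f \<in> L2 n" and "L2_inner n (Pi1_op n f) g = L2_inner n (E1 n f) g"
proof -
  have fL: "f \<in> L2 n" by (rule bdd_meas_L2[OF f])
  have eL: "E1 n f \<in> L2 n" by (rule bdd_meas_L2[OF E1_bdd_meas[OF f]])
  let ?P = "\<lambda>g. g \<in> L2 n \<and> (\<lambda>N. L2_norm n (\<lambda>z. (\<Sum>l<N. Q_op n l f z) - g z)) \<longlonglongrightarrow> 0"
  have "(\<lambda>N. sqrt (sqnorm n (\<lambda>z. deg1_partial n N f z - E1 n f z))) \<longlonglongrightarrow> sqrt 0"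
    by (intro tendsto_real_sqrt E1_convergence f)
  then have "?P (E1 n f)" using eL by (simp add: L2_norm_eq sum_Q_op[OF fL])
  then have P: "?P (Pi1_op n f)" unfolding Pi1_op_def by (rule someI[where P = ?P])
  then show pL: "Pi1_op n f \<in> L2 n" by blast
  have "(\<lambda>N. (L2_norm n (\<lambda>z. (\<Sum>l<N. Q_op n l f z) - Pi1_op n f z))\<^sup>2) \<longlonglongrightarrow> 0\<^sup>2"
    using P by (intro tendsto_power) blast
  then have c: "(\<lambda>N. sqnorm n (\<lambda>z. deg1_partial n N f z - Pi1_op n f z)) \<longlonglongrightarrow> 0"
    by (simp add: L2_norm_eq sum_Q_op[OF fL])
  show "L2_inner n (Pi1_op n f) g = L2_inner n (E1 n f) g"
    using L2_inner_tendsto[OF hermite_comb_L2 pL g c] L2_inner_tendsto[OF hermite_comb_L2 eL g E1_convergence[OF f]]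
    by (rule LIMSEQ_unique)
qed

section \<open>Sesquilinear forms of the operators on bounded functions\<close>

definition qform :: "nat \<Rightarrow> nat \<Rightarrow> ((nat \<Rightarrow> complex) \<Rightarrow> complex) \<Rightarrow> ((nat \<Rightarrow> complex) \<Rightarrow> complex) \<Rightarrow> complex" where
  "qform n l f g = (\<Sum>\<kappa>\<in>pair_indices n (Suc l) l. coef n \<kappa> f * cnj (coef n \<kappa> g))"

lemma Q_op_inner: "f \<in> L2 n \<Longrightarrow> g \<in> L2 n \<Longrightarrow> L2_inner n (Q_op n l f) g = qform n l f g"
  unfolding qform_def Q_op_eq
  by (subst L2_inner_commute) (simp add: L2_inner_hermite_comb_right mult.commute)

lemma T_op_inner:
  assumes f: "bdd_meas n f" and g: "bdd_meas n g" and "finite \<Lambda>"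
  shows "L2_inner n (T_op \<rho> \<Lambda> \<beta> n f) g
    = qform n 0 f g - of_real \<rho> * L2_inner n (E1 n f) g - (\<Sum>l\<in>\<Lambda>. of_real (\<beta> l) * qform n l f g)"
proof -
  have fL: "f \<in> L2 n" and gL: "g \<in> L2 n" using f g by (auto intro: bdd_meas_L2)
  have Q: "Q_op n l f \<in> L2 n" for l by (simp add: Q_op_eq[OF fL])
  have P: "Pi1_op n f \<in> L2 n" by (rule Pi1_op_inner(1)[OF f gL])
  have "L2_inner n (T_op \<rho> \<Lambda> \<beta> n f) g
    = L2_inner n (Q_op n 0 f) g - L2_inner n (\<lambda>z. of_real \<rho> * Pi1_op n f z) g
      - L2_inner n (\<lambda>z. \<Sum>l\<in>\<Lambda>. of_real (\<beta> l) * Q_op n l f z) g"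
    unfolding T_op_def[abs_def]
    by (subst L2_inner_diff_left, (intro L2_diff L2_sum L2_cmult Q P gL)+,
        subst L2_inner_diff_left, (intro L2_diff L2_sum L2_cmult Q P gL)+, rule refl)
  also have "L2_inner n (\<lambda>z. \<Sum>l\<in>\<Lambda>. of_real (\<beta> l) * Q_op n l f z) g = (\<Sum>l\<in>\<Lambda>. L2_inner n (\<lambda>z. of_real (\<beta> l) * Q_op n l f z) g)"
    by (intro L2_inner_sum_left L2_cmult Q gL)
  finally show ?thesis
    by (simp add: L2_inner_cmult_left Q_op_inner[OF fL gL] Pi1_op_inner(2)[OF f gL])
qed

lemma qform_E1:
  assumes "bdd_meas n f" "bdd_meas n g"
  shows "qform n l f g = qform n l (E1 n f) (E1 n g)"
  unfolding qform_def using assms by (intro sum.cong refl) (simp add: coef_E1)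

text \<open>This expresses that \<open>E1\<close> is an orthogonal projection. The partial sums see
  only the degree-one coefficients of \<open>g\<close>, which \<open>E1\<close> leaves unchanged,
  and the limit inherits this.\<close>

lemma E1_inner:
  assumes f: "bdd_meas n f" and g: "bdd_meas n g"
  shows "L2_inner n (E1 n f) g = L2_inner n (E1 n f) (E1 n g)"
proof -
  have L: "E1 n f \<in> L2 n" "g \<in> L2 n" "E1 n g \<in> L2 n"
    using f g by (auto intro: bdd_meas_L2 E1_bdd_meas)
  have "L2_inner n (deg1_partial n N f) g = L2_inner n (deg1_partial n N f) (E1 n g)" for N
    by (subst (1 2) L2_inner_commute)
      (simp add: L2_inner_hermite_comb_right L coef_E1_deg1[OF g])
  then show ?thesis
    using L2_inner_tendsto[OF hermite_comb_L2 L(1) L(2) E1_convergence[OF f]]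
      L2_inner_tendsto[OF hermite_comb_L2 L(1) L(3) E1_convergence[OF f]] LIMSEQ_unique by simp
qed

lemma sqnorm_E1_le:
  assumes f: "bdd_meas n f"
  shows "sqnorm n (E1 n f) \<le> sqnorm n f"
proof -
  have L: "E1 n f \<in> L2 n" "f \<in> L2 n" using f by (auto intro: bdd_meas_L2 E1_bdd_meas)
  have "(sqnorm n (E1 n f))\<^sup>2 \<le> sqnorm n (E1 n f) * sqnorm n f"
    using L2_inner_bound[OF L] unfolding E1_inner[OF f f] L2_inner_self by simp
  then show ?thesis
    using sqnorm_nonneg[of n "E1 n f"] sqnorm_nonneg[of n f]
    by (cases "sqnorm n (E1 n f) = 0") (auto simp: power2_eq_square)
qed

subsection \<open>Unitary changes of variables\<close>

text \<open>With the other coordinates fixed this is a translation, so it preserves Lebesgue measure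
  by Fubini. Composing shears avoids a change of variables with a determinant.\<close>

definition shear :: "nat \<Rightarrow> nat \<Rightarrow> complex \<Rightarrow> (nat \<Rightarrow> complex) \<Rightarrow> nat \<Rightarrow> complex" where
  "shear i j c z = z(i := z i + c * z j)"

lemma shear_measurable:
  assumes "i < n" "j < n"
  shows "shear i j c \<in> measurable (PiM {..<n} (\<lambda>_. lborel)) (PiM {..<n} (\<lambda>_. lborel))"
  unfolding shear_def[abs_def]
proof (rule measurable_fun_upd[where J = "{..<n}"])
  show "{..<n} = {..<n} \<union> {i}" using assms by auto
  have [measurable]: "(\<lambda>z. z i) \<in> borel_measurable (PiM {..<n} (\<lambda>_. lborel))" "(\<lambda>z. z j) \<in> borel_measurable (PiM {..<n} (\<lambda>_. lborel))"
    using assms by auto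
  have "(\<lambda>z. z i + c * z j) \<in> borel_measurable (PiM {..<n} (\<lambda>_. lborel))" by measurable
  then show "(\<lambda>z. z i + c * z j) \<in> measurable (PiM {..<n} (\<lambda>_. lborel)) lborel" by simp
qed simp

lemma nn_integral_shear:
  assumes ij: "i < n" "j < n" "i \<noteq> j" and F: "F \<in> borel_measurable (PiM {..<n} (\<lambda>_. lborel))"
  shows "(\<integral>\<^sup>+z. F (shear i j c z) \<partial>PiM {..<n} (\<lambda>_. lborel)) = (\<integral>\<^sup>+z. F z \<partial>PiM {..<n} (\<lambda>_. lborel))"
proof -
  interpret lb: product_sigma_finite "\<lambda>_::nat. lborel :: complex measure"
    by unfold_locales
  define I where "I = {..<n} - {i}"
  have I: "{..<n} = insert i I" "finite I" "i \<notin> I" using ij by (auto simp: I_def)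
  have F': "F \<in> borel_measurable (PiM (insert i I) (\<lambda>_. lborel))" using F by (simp add: I(1))
  have FS: "(\<lambda>z. F (shear i j c z)) \<in> borel_measurable (PiM (insert i I) (\<lambda>_. lborel))"
    using measurable_compose[OF shear_measurable[OF ij(1,2)] F] by (simp add: I(1))
  have "(\<integral>\<^sup>+z. F (shear i j c z) \<partial>PiM {..<n} (\<lambda>_. lborel))
    = (\<integral>\<^sup>+x. \<integral>\<^sup>+y. F (shear i j c (x(i := y))) \<partial>lborel \<partial>PiM I (\<lambda>_. lborel))"
    unfolding I(1) by (rule lb.product_nn_integral_insert[OF I(2,3) FS])
  also have "\<dots> = (\<integral>\<^sup>+x. \<integral>\<^sup>+y. F (x(i := y)) \<partial>lborel \<partial>PiM I (\<lambda>_. lborel))"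
  proof (rule nn_integral_cong)
    fix x :: "nat \<Rightarrow> complex" assume x: "x \<in> space (PiM I (\<lambda>_. lborel))"
    have "(\<lambda>y. x(i := y)) \<in> measurable lborel (PiM (insert i I) (\<lambda>_. lborel))"
      using x by (intro measurable_fun_upd[where J = I]) auto
    from measurable_compose[OF this F'] have m: "(\<lambda>y. F (x(i := y))) \<in> borel_measurable borel" by simp
    have "shear i j c (x(i := y)) = x(i := y + c * x j)" for y
      using ij(3) by (simp add: shear_def fun_upd_def fun_eq_iff)
    then show "(\<integral>\<^sup>+y. F (shear i j c (x(i := y))) \<partial>lborel) = (\<integral>\<^sup>+y. F (x(i := y)) \<partial>lborel)"
      using nn_integral_lborel_add[OF m, of "c * x j"] by simp
  qed
  also have "\<dots> = (\<integral>\<^sup>+z. F z \<partial>PiM {..<n} (\<lambda>_. lborel))"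
    unfolding I(1) by (rule lb.product_nn_integral_insert[OF I(2,3) F', symmetric])
  finally show ?thesis .
qed

definition givens :: "nat \<Rightarrow> complex \<Rightarrow> complex \<Rightarrow> (nat \<Rightarrow> complex) \<Rightarrow> nat \<Rightarrow> complex" where
  "givens j c s z = z(0 := c * z 0 + s * z j, j := - cnj s * z 0 + cnj c * z j)"

text \<open>The complex analogue of the three-shear form of a plane rotation. The two coefficients
  are fixed by the diagonal entries \<open>cnj c\<close> and \<open>c\<close>; the entry
  \<open>s\<close> then comes out by unitarity.\<close>

lemma givens_shears:
  assumes j: "j \<noteq> 0" and cs: "(cmod c)\<^sup>2 + (cmod s)\<^sup>2 = 1" and s: "s \<noteq> 0"
  shows "givens j c s z = shear 0 j ((1 - c) / cnj s) (shear j 0 (- cnj s) (shear 0 j ((1 - cnj c) / cnj s) z))"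
proof -
  define x y where "x = (1 - cnj c) / cnj s" and "y = (1 - c) / cnj s"
  have cs': "cnj s \<noteq> 0" using s by simp
  have x: "1 - cnj s * x = cnj c" and y: "1 - y * cnj s = c" using cs' by (simp_all add: x_def y_def)
  have cs1: "c * cnj c + s * cnj s = 1"
    unfolding complex_norm_square[symmetric] of_real_add[symmetric] cs by simp
  have x1: "x * cnj s = 1 - cnj c" and y1: "y * cnj s = 1 - c" using cs' by (simp_all add: x_def y_def)
  have "(x + y * cnj c) * cnj s = x * cnj s + (y * cnj s) * cnj c" by (simp add: algebra_simps)
  also have "\<dots> = 1 - c * cnj c" unfolding x1 y1 by (simp add: algebra_simps)
  also have "\<dots> = s * cnj s" using cs1 by (metis add_diff_cancel_left')
  finally have xy: "x + y * cnj c = s" using cs' by simp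
  define w0 wj where "w0 = z 0 + x * z j" and "wj = z j - cnj s * w0"
  have wj: "wj = - cnj s * z 0 + cnj c * z j"
    unfolding wj_def w0_def x[symmetric] by (simp add: algebra_simps)
  have "w0 + y * wj = (1 - y * cnj s) * z 0 + (x + y * cnj c) * z j"
    unfolding wj w0_def x[symmetric] by (simp add: algebra_simps)
  then have w0: "w0 + y * wj = c * z 0 + s * z j" unfolding xy y .
  have "shear 0 j x z = z(0 := w0)" by (simp add: shear_def w0_def)
  moreover have "shear j 0 (- cnj s) (z(0 := w0)) = z(0 := w0, j := wj)"
    using j by (simp add: shear_def wj_def)
  moreover have "shear 0 j y (z(0 := w0, j := wj)) = z(0 := w0 + y * wj, j := wj)"
    using j by (simp add: shear_def fun_eq_iff)
  ultimately show ?thesis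
    unfolding x_def[symmetric] y_def[symmetric] givens_def w0[symmetric] wj[symmetric] by simp
qed

lemma givens_inverse:
  assumes j: "j \<noteq> 0" and cs: "(cmod c)\<^sup>2 + (cmod s)\<^sup>2 = 1"
  shows "givens j c s (givens j (cnj c) (- s) z) = z"
proof
  fix k
  have cs1: "c * cnj c + s * cnj s = 1"
    unfolding complex_norm_square[symmetric] of_real_add[symmetric] cs by simp
  have 0: "c * (cnj c * z 0 + (- s) * z j) + s * (cnj s * z 0 + c * z j) = z 0"
  proof -
    have "c * (cnj c * z 0 + (- s) * z j) + s * (cnj s * z 0 + c * z j) = (c * cnj c + s * cnj s) * z 0"
      by (simp add: algebra_simps)
    then show ?thesis by (simp add: cs1)
  qed
  have 1: "- cnj s * (cnj c * z 0 + (- s) * z j) + cnj c * (cnj s * z 0 + c * z j) = z j"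
  proof -
    have "- cnj s * (cnj c * z 0 + (- s) * z j) + cnj c * (cnj s * z 0 + c * z j) = (c * cnj c + s * cnj s) * z j"
      by (simp add: algebra_simps)
    then show ?thesis by (simp add: cs1)
  qed
  show "givens j c s (givens j (cnj c) (- s) z) k = z k"
    using j 0 1 by (simp add: givens_def)
qed

text \<open>Just the properties of a unitary matrix that enter: preservation of the Gaussian
  measure, a two-sided inverse, and coordinates of bidegree at most (1, 0) both ways. The last
  condition makes substitution preserve bidegrees.\<close>

definition unitary_map :: "nat \<Rightarrow> ((nat \<Rightarrow> complex) \<Rightarrow> nat \<Rightarrow> complex) \<Rightarrow> ((nat \<Rightarrow> complex) \<Rightarrow> nat \<Rightarrow> complex) \<Rightarrow> bool" where
  "unitary_map n U V \<longleftrightarrow>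
     U \<in> measurable (gauss n) (gauss n) \<and> distr (gauss n) (gauss n) U = gauss n \<and>
     (\<forall>z. U (V z) = z) \<and> (\<forall>z. V (U z) = z) \<and>
     (\<forall>k<n. bipoly n (Suc 0) 0 (\<lambda>z. U z k)) \<and> (\<forall>k<n. bipoly n (Suc 0) 0 (\<lambda>z. V z k))"

text \<open>The shears preserve Lebesgue measure and unitarity preserves the Gaussian density. The
  decomposition into shears divides by \<open>cnj s\<close>.\<close>

lemma givens_unitary:
  assumes j: "0 < j" "j < n" and cs: "(cmod c)\<^sup>2 + (cmod s)\<^sup>2 = 1" and s: "s \<noteq> 0"
  shows "unitary_map n (givens j c s) (givens j (cnj c) (- s))"
proof -
  let ?L = "PiM {..<n} (\<lambda>_. lborel :: complex measure)"
  let ?x = "(1 - cnj c) / cnj s" and ?y = "(1 - c) / cnj s"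
  have n: "0 < n" using j by simp
  have eq: "givens j c s = (\<lambda>z. shear 0 j ?y (shear j 0 (- cnj s) (shear 0 j ?x z)))"
    using givens_shears[OF _ cs s] j by auto
  have mL: "givens j c s \<in> measurable ?L ?L"
    unfolding eq
    by (rule measurable_compose[OF measurable_compose[OF shear_measurable[OF n j(2)] shear_measurable[OF j(2) n]] shear_measurable[OF n j(2)]])
  have m: "givens j c s \<in> measurable (gauss n) (gauss n)"
    using mL by (subst measurable_cong_sets[OF sets_gauss_PiM_lborel sets_gauss_PiM_lborel])
  have nn: "(\<integral>\<^sup>+z. F (givens j c s z) \<partial>?L) = (\<integral>\<^sup>+z. F z \<partial>?L)" if F: "F \<in> borel_measurable ?L" for F
  proof -
    have m1: "(\<lambda>z. F (shear 0 j ?y z)) \<in> borel_measurable ?L"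
      by (rule measurable_compose[OF shear_measurable[OF n j(2)] F])
    have m2: "(\<lambda>z. F (shear 0 j ?y (shear j 0 (- cnj s) z))) \<in> borel_measurable ?L"
      by (rule measurable_compose[OF shear_measurable[OF j(2) n] m1])
    show ?thesis unfolding eq
      using nn_integral_shear[OF n j(2) _ m2, of ?x] nn_integral_shear[OF j(2) n _ m1, of "- cnj s"]
        nn_integral_shear[OF n j(2) _ F, of ?y] j by simp
  qed
  define w where "w z = ennreal (exp (- (\<Sum>k<n. (cmod (z k))\<^sup>2)) / pi ^ n)" for z :: "nat \<Rightarrow> complex"
  have wm: "w \<in> borel_measurable ?L"
  proof -
    have "(\<lambda>z. \<Sum>k<n. (cmod (z k))\<^sup>2) \<in> borel_measurable ?L"
      by (intro borel_measurable_sum borel_measurable_power borel_measurable_norm) auto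
    then show ?thesis unfolding w_def[abs_def] by measurable
  qed
  \<comment> \<open>The density depends on the Euclidean norm alone, to which the two mixed
    coordinates contribute the same sum as before.\<close>
  have wG: "w (givens j c s z) = w z" for z
  proof -
    have split: "(\<Sum>k<n. (cmod (u k))\<^sup>2) = (cmod (u 0))\<^sup>2 + ((cmod (u j))\<^sup>2 + (\<Sum>k\<in>{..<n} - {0} - {j}. (cmod (u k))\<^sup>2))"
      for u :: "nat \<Rightarrow> complex"
      using j n by (subst sum.remove[of _ 0], simp, simp, subst sum.remove[of _ j]) auto
    have rest: "(\<Sum>k\<in>{..<n} - {0} - {j}. (cmod (givens j c s z k))\<^sup>2) = (\<Sum>k\<in>{..<n} - {0} - {j}. (cmod (z k))\<^sup>2)"
      by (intro sum.cong refl) (auto simp: givens_def)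
    have "(cmod (c * a + s * b))\<^sup>2 + (cmod (- cnj s * a + cnj c * b))\<^sup>2 = ((cmod c)\<^sup>2 + (cmod s)\<^sup>2) * ((cmod a)\<^sup>2 + (cmod b)\<^sup>2)" for a b
      unfolding cmod_power2 by (simp add: power2_eq_square algebra_simps)
    then have "(cmod (givens j c s z 0))\<^sup>2 + (cmod (givens j c s z j))\<^sup>2 = (cmod (z 0))\<^sup>2 + (cmod (z j))\<^sup>2"
      using j(1) cs by (simp add: givens_def)
    then show ?thesis unfolding w_def split rest by (simp add: add.assoc[symmetric])
  qed
  have d: "distr (gauss n) (gauss n) (givens j c s) = gauss n"
  proof (rule measure_eqI)
    fix A assume "A \<in> sets (distr (gauss n) (gauss n) (givens j c s))"
    then have A: "A \<in> sets (gauss n)" and AL: "A \<in> sets ?L" by (auto simp: sets_gauss_PiM_lborel)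
    have iA: "indicator A \<in> borel_measurable ?L" using AL by simp
    have "emeasure (distr (gauss n) (gauss n) (givens j c s)) A = (\<integral>\<^sup>+z. indicator A z \<partial>distr (gauss n) (gauss n) (givens j c s))"
      using A by simp
    also have "\<dots> = (\<integral>\<^sup>+z. indicator A (givens j c s z) \<partial>gauss n)"
      using A m by (intro nn_integral_distr) auto
    also have "\<dots> = (\<integral>\<^sup>+z. w z * indicator A (givens j c s z) \<partial>?L)"
      unfolding gauss_def w_def[symmetric] using wm measurable_compose[OF mL iA] by (intro nn_integral_density) auto
    also have "\<dots> = (\<integral>\<^sup>+z. (\<lambda>z. w z * indicator A z) (givens j c s z) \<partial>?L)"
      by (simp add: wG)
    also have "\<dots> = (\<integral>\<^sup>+z. w z * indicator A z \<partial>?L)"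
      by (rule nn) (rule borel_measurable_times_ennreal[OF wm iA])
    also have "\<dots> = (\<integral>\<^sup>+z. indicator A z \<partial>gauss n)"
      unfolding gauss_def w_def[symmetric] using wm iA by (intro nn_integral_density[symmetric]) auto
    finally show "emeasure (distr (gauss n) (gauss n) (givens j c s)) A = emeasure (gauss n) A"
      using A by simp
  qed simp
  have lin: "bipoly n (Suc 0) 0 (\<lambda>z. givens j a b z k)" if "k < n" for a b k
  proof -
    have "bipoly n (Suc 0) 0 (\<lambda>z. a * z 0 + b * z j)" "bipoly n (Suc 0) 0 (\<lambda>z. - cnj b * z 0 + cnj a * z j)"
      using j n by (intro bipoly.add bipoly_scale bipoly_coord; simp)+
    then show ?thesis using bipoly_coord[OF that] j unfolding givens_def
      by (cases "k = j"; cases "k = 0") simp_all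
  qed
  have inv1: "givens j c s (givens j (cnj c) (- s) z) = z" for z
    using givens_inverse[OF _ cs] j by simp
  have inv2: "givens j (cnj c) (- s) (givens j c s z) = z" for z
    using givens_inverse[of j "cnj c" "- s"] j cs by simp
  show ?thesis unfolding unitary_map_def using m d inv1 inv2 lin by blast
qed

lemma bipoly_subst:
  assumes "bipoly n p q f" and U: "\<And>k. k < n \<Longrightarrow> bipoly n (Suc 0) 0 (\<lambda>z. U z k)"
  shows "bipoly n p q (\<lambda>z. f (U z))"
  using assms(1)
proof (induction rule: bipoly.induct)
  case (const p q c)
  show ?case by (rule bipoly.const)
next
  case (add p q f g)
  then show ?case by (intro bipoly.add)
next
  case (coord p q f i)
  show ?case using bipoly_mult[OF U[OF coord.hyps(2)] coord.IH] by simp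
next
  case (cnj_coord p q f i)
  show ?case using bipoly_mult[OF bipoly_cnj[OF U[OF cnj_coord.hyps(2)]] cnj_coord.IH] by simp
qed

lemma unitary_map_id: "unitary_map n (\<lambda>z. z) (\<lambda>z. z)"
  by (simp add: unitary_map_def distr_id2 bipoly_coord)

lemma unitary_map_comp:
  assumes "unitary_map n U V" "unitary_map n U' V'"
  shows "unitary_map n (\<lambda>z. U (U' z)) (\<lambda>z. V' (V z))"
proof -
  have m: "U \<in> measurable (gauss n) (gauss n)" "U' \<in> measurable (gauss n) (gauss n)"
    using assms unfolding unitary_map_def by blast+
  have "distr (gauss n) (gauss n) (U \<circ> U') = distr (distr (gauss n) (gauss n) U') (gauss n) U"
    using m by (intro distr_distr[symmetric])
  also have "\<dots> = gauss n" using assms unfolding unitary_map_def by metis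
  finally have d: "distr (gauss n) (gauss n) (\<lambda>z. U (U' z)) = gauss n" by (simp add: comp_def)
  have b: "bipoly n (Suc 0) 0 (\<lambda>z. U (U' z) k)" "bipoly n (Suc 0) 0 (\<lambda>z. V' (V z) k)" if "k < n" for k
    using bipoly_subst[of n "Suc 0" 0 "\<lambda>z. U z k" U'] bipoly_subst[of n "Suc 0" 0 "\<lambda>z. V' z k" V]
      assms that unfolding unitary_map_def by auto
  have "(\<lambda>z. U (U' z)) \<in> measurable (gauss n) (gauss n)" using m by measurable
  then show ?thesis using d b assms unfolding unitary_map_def by simp
qed

context
  fixes n U V assumes U: "unitary_map n U V"
begin

lemma unitary_measurable: "U \<in> measurable (gauss n) (gauss n)"
  using U unfolding unitary_map_def by blast

lemma unitary_integral:
  fixes F :: "_ \<Rightarrow> 'b::{banach, second_countable_topology}"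
  assumes F: "F \<in> borel_measurable (gauss n)"
  shows "(\<integral>z. F (U z) \<partial>gauss n) = (\<integral>z. F z \<partial>gauss n)"
    and "integrable (gauss n) (\<lambda>z. F (U z)) \<longleftrightarrow> integrable (gauss n) F"
proof -
  have d: "distr (gauss n) (gauss n) U = gauss n" using U unfolding unitary_map_def by blast
  show "(\<integral>z. F (U z) \<partial>gauss n) = (\<integral>z. F z \<partial>gauss n)"
    using integral_distr[OF unitary_measurable F] by (simp add: d)
  show "integrable (gauss n) (\<lambda>z. F (U z)) \<longleftrightarrow> integrable (gauss n) F"
    using integrable_distr_eq[OF unitary_measurable F] by (simp add: d)
qed

lemma unitary_L2:
  assumes "f \<in> L2 n"
  shows "(\<lambda>z. f (U z)) \<in> L2 n"
proof -
  note [measurable] = L2_measurable[OF assms] unitary_measurable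
  have "integrable (gauss n) (\<lambda>z. (cmod (f (U z)))\<^sup>2)"
    by (subst unitary_integral(2)[where F = "\<lambda>z. (cmod (f z))\<^sup>2"]) (use L2_integrable[OF assms] in auto)
  then show ?thesis by (simp add: L2_def)
qed

lemma unitary_bdd_meas: "bdd_meas n f \<Longrightarrow> bdd_meas n (\<lambda>z. f (U z))"
  using measurable_compose[OF unitary_measurable] measurable_space[OF unitary_measurable]
  unfolding bdd_meas_def by blast

lemma unitary_L2_inner:
  assumes "f \<in> L2 n" "g \<in> L2 n"
  shows "L2_inner n (\<lambda>z. f (U z)) (\<lambda>z. g (U z)) = L2_inner n f g"
proof -
  note [measurable] = assms[THEN L2_measurable]
  show ?thesis unfolding L2_inner_def by (rule unitary_integral(1)[where F = "\<lambda>z. f z * cnj (g z)"]) measurable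
qed

end

section \<open>Commutation of the projections with unitary substitutions\<close>

lemma unitary_map_sym:
  assumes U: "unitary_map n U V" and "f \<in> L2 n" and g: "bipoly n p q g"
  shows "L2_inner n (\<lambda>z. f (U z)) g = L2_inner n f (\<lambda>z. g (V z))" and "bipoly n p q (\<lambda>z. g (V z))"
proof -
  show b: "bipoly n p q (\<lambda>z. g (V z))"
    using U unfolding unitary_map_def by (intro bipoly_subst[OF g]) blast
  have "V (U z) = z" for z using U unfolding unitary_map_def by blast
  then show "L2_inner n (\<lambda>z. f (U z)) g = L2_inner n f (\<lambda>z. g (V z))"
    using unitary_L2_inner[OF U assms(2) bipoly_L2[OF b]] by simp
qed

lemma unitary_hermite_span:
  assumes U: "unitary_map n U V" and g: "g \<in> hermite_span n p q"
  shows "(\<lambda>z. g (U z)) \<in> hermite_span n p q"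
  unfolding hermite_span_iff
proof (intro conjI allI impI)
  have gb: "bipoly n p q g" and orth: "\<And>r s v. r \<le> p \<Longrightarrow> s \<le> q \<Longrightarrow> (r, s) \<noteq> (p, q) \<Longrightarrow> bipoly n r s v \<Longrightarrow> L2_inner n g v = 0"
    using g unfolding hermite_span_iff by blast+
  show "bipoly n p q (\<lambda>z. g (U z))"
    using U unfolding unitary_map_def by (intro bipoly_subst[OF gb]) blast
  fix r s v assume v: "r \<le> p \<and> s \<le> q \<and> (r, s) \<noteq> (p, q) \<and> bipoly n r s v"
  then have vb: "bipoly n r s v" by blast
  have "L2_inner n (\<lambda>z. g (U z)) v = L2_inner n g (\<lambda>z. v (V z))"
    by (rule unitary_map_sym(1)[OF U bipoly_L2[OF gb] vb])
  also have "\<dots> = 0"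
    using orth[OF _ _ _ unitary_map_sym(2)[OF U bipoly_L2[OF gb] vb]] v by blast
  finally show "L2_inner n (\<lambda>z. g (U z)) v = 0" .
qed

lemma herm_in_span:
  assumes "\<kappa> \<in> pair_indices n p q"
  shows "herm n \<kappa> \<in> hermite_span n p q"
  unfolding hermite_span_eq
proof (rule range_eqI)
  show "herm n \<kappa> = hermite_comb n (pair_indices n p q) (\<lambda>\<kappa>'. if \<kappa>' = \<kappa> then 1 else 0)"
    using hermite_comb_single[OF finite_pair_indices assms, of n 1] by simp
qed

text \<open>The projection composed with \<open>U\<close> lies again in the span. Its coefficients
  are computed by moving \<open>U\<close> to the Hermite function as \<open>V\<close>, which stays
  in the span, where \<open>f\<close> and its projection have equal inner products.\<close>

lemma unitary_projection:
  assumes U: "unitary_map n U V" and f: "f \<in> L2 n"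
  shows "hermite_comb n (pair_indices n p q) (\<lambda>\<kappa>. coef n \<kappa> (\<lambda>z. f (U z)))
    = (\<lambda>z. hermite_comb n (pair_indices n p q) (\<lambda>\<kappa>. coef n \<kappa> f) (U z))"
proof -
  let ?K = "pair_indices n p q"
  let ?P = "hermite_comb n ?K (\<lambda>\<kappa>. coef n \<kappa> f)"
  have "?P \<in> hermite_span n p q" unfolding hermite_span_eq by blast
  then have "(\<lambda>z. ?P (U z)) \<in> hermite_span n p q" by (rule unitary_hermite_span[OF U])
  then obtain c where c: "(\<lambda>z. ?P (U z)) = hermite_comb n ?K c" unfolding hermite_span_eq by blast
  have PL: "?P \<in> L2 n" by simp
  have "c \<kappa> = coef n \<kappa> (\<lambda>z. f (U z))" if k: "\<kappa> \<in> ?K" for \<kappa>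
  proof -
    have hb: "bipoly n p q (herm n \<kappa>)" by (rule bipoly_herm_pair[OF k])
    have hP: "(\<lambda>z. herm n \<kappa> (V z)) = hermite_comb n ?K d \<Longrightarrow> L2_inner n ?P (\<lambda>z. herm n \<kappa> (V z)) = L2_inner n f (\<lambda>z. herm n \<kappa> (V z))" for d
      by (simp add: L2_inner_hermite_comb_right[OF f] L2_inner_hermite_comb pair_indices_ext mult.commute)
    have "(\<lambda>z. herm n \<kappa> (V z)) \<in> hermite_span n p q"
      unfolding hermite_span_iff
    proof (intro conjI allI impI)
      show "bipoly n p q (\<lambda>z. herm n \<kappa> (V z))" by (rule unitary_map_sym(2)[OF U f hb])
      fix r s v assume v: "r \<le> p \<and> s \<le> q \<and> (r, s) \<noteq> (p, q) \<and> bipoly n r s v"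
      then have vb: "bipoly n r s v" by blast
      have "L2_inner n v (\<lambda>z. herm n \<kappa> (V z)) = L2_inner n (\<lambda>z. v (U z)) (herm n \<kappa>)"
        by (rule unitary_map_sym(1)[OF U bipoly_L2[OF vb] hb, symmetric])
      also have "\<dots> = cnj (L2_inner n (herm n \<kappa>) (\<lambda>z. v (U z)))" by (rule L2_inner_commute)
      also have "L2_inner n (herm n \<kappa>) (\<lambda>z. v (U z)) = 0"
      proof -
        have "bipoly n r s (\<lambda>z. v (U z))"
          using U unfolding unitary_map_def by (intro bipoly_subst[OF vb]) blast
        then show ?thesis using herm_in_span[OF k] v unfolding hermite_span_iff by blast
      qed
      finally show "L2_inner n (\<lambda>z. herm n \<kappa> (V z)) v = 0" by (subst L2_inner_commute) simp
    qed
    then have "L2_inner n ?P (\<lambda>z. herm n \<kappa> (V z)) = L2_inner n f (\<lambda>z. herm n \<kappa> (V z))"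
      unfolding hermite_span_eq using hP by blast
    then have "L2_inner n (\<lambda>z. ?P (U z)) (herm n \<kappa>) = L2_inner n (\<lambda>z. f (U z)) (herm n \<kappa>)"
      using unitary_map_sym(1)[OF U PL hb] unitary_map_sym(1)[OF U f hb] by simp
    then have "coef n \<kappa> (\<lambda>z. ?P (U z)) = coef n \<kappa> (\<lambda>z. f (U z))"
      by (simp only: coef_def[of n \<kappa> "\<lambda>z. ?P (U z)"] coef_def[of n \<kappa> "\<lambda>z. f (U z)"])
    then show ?thesis
      unfolding c using k subsetD[OF pair_indices_ext k] by (simp add: coef_hermite_comb pair_indices_ext)
  qed
  then show ?thesis unfolding c by (simp add: hermite_comb_def fun_eq_iff)
qed

lemma qform_eq_inner: "f \<in> L2 n \<Longrightarrow> g \<in> L2 n \<Longrightarrow>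
  qform n l f g = L2_inner n (hermite_comb n (pair_indices n (Suc l) l) (\<lambda>\<kappa>. coef n \<kappa> f)) g"
  using Q_op_inner[of f n g l] by (simp add: Q_op_eq)

lemma unitary_qform:
  assumes U: "unitary_map n U V" and f: "f \<in> L2 n" and g: "g \<in> L2 n"
  shows "qform n l (\<lambda>z. f (U z)) (\<lambda>z. g (U z)) = qform n l f g"
  unfolding qform_eq_inner[OF f g] qform_eq_inner[OF unitary_L2[OF U f] unitary_L2[OF U g]]
    unitary_projection[OF U f]
  by (rule unitary_L2_inner[OF U hermite_comb_L2 g])

lemma coord_L2: "i < n \<Longrightarrow> (\<lambda>z. z i) \<in> L2 n"
  by (rule bipoly_L2[OF bipoly_coord])

text \<open>One Givens rotation for each coordinate moves the linear coefficient of that coordinate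
  into coordinate 0 and leaves those already cleared at zero.\<close>

lemma align_linear_part:
  assumes h: "h \<in> L2 n" and m: "m \<le> n"
  shows "\<exists>U V. unitary_map n U V \<and> (\<forall>j. 0 < j \<longrightarrow> j < m \<longrightarrow> L2_inner n (\<lambda>z. h (U z)) (\<lambda>z. z j) = 0)"
proof -
  define A where "A k U V \<longleftrightarrow> unitary_map n U V \<and> (\<forall>j. 0 < j \<longrightarrow> j < k \<longrightarrow> L2_inner n (\<lambda>z. h (U z)) (\<lambda>z. z j) = 0)" for k U V
  have "\<exists>U V. A m U V"
    using m
  proof (induction m)
    case 0
    have "A 0 (\<lambda>z. z) (\<lambda>z. z)" using unitary_map_id by (simp add: A_def)
    then show ?case by blast
  next
    case (Suc m)
    from Suc.prems have "m \<le> n" by simp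
    from Suc.IH[OF this] obtain U V where UV: "A m U V" by blast
    have U: "unitary_map n U V" using UV by (simp add: A_def)
    have z: "L2_inner n (\<lambda>z. h (U z)) (\<lambda>z. z j) = 0" if "0 < j" "j < m" for j
      using UV that by (simp add: A_def)
    define f where "f = (\<lambda>z. h (U z))"
    have fL: "f \<in> L2 n" unfolding f_def by (rule unitary_L2[OF U h])
    define a0 am where "a0 = L2_inner n f (\<lambda>z. z 0)" and "am = L2_inner n f (\<lambda>z. z m)"
    show ?case
    \<comment> \<open>A coefficient that is zero already needs no rotation, and
      \<open>givens_unitary\<close> requires a nonzero \<open>s\<close>.\<close>
    proof (cases "m = 0 \<or> am = 0")
      case True
      have "L2_inner n (\<lambda>z. h (U z)) (\<lambda>z. z j) = 0" if j: "0 < j" "j < Suc m" for j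
      proof (cases "j < m")
        case False
        then have "j = m" using j by simp
        then show ?thesis using True j unfolding am_def f_def by simp
      qed (use z j in simp)
      then have "A (Suc m) U V" using U by (simp add: A_def)
      then show ?thesis by blast
    next
      case False
      then have m: "0 < m" "m < n" and am: "am \<noteq> 0" using Suc.prems by auto
      define N where "N = sqrt ((cmod a0)\<^sup>2 + (cmod am)\<^sup>2)"
      have "0 < (cmod a0)\<^sup>2 + (cmod am)\<^sup>2" using am by (simp add: add_nonneg_pos)
      then have N: "0 < N" "N\<^sup>2 = (cmod a0)\<^sup>2 + (cmod am)\<^sup>2" by (auto simp: N_def)
      \<comment> \<open>Chosen so that the pair of linear coefficients \<open>(a0, am)\<close> is
        sent to \<open>(N, 0)\<close>.\<close>
      define c s where "c = cnj a0 / of_real N" and "s = - am / of_real N"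
      have s: "s \<noteq> 0" using am N by (simp add: s_def)
      have cs: "(cmod c)\<^sup>2 + (cmod s)\<^sup>2 = 1"
      proof -
        have "(cmod c)\<^sup>2 + (cmod s)\<^sup>2 = ((cmod a0)\<^sup>2 + (cmod am)\<^sup>2) / N\<^sup>2"
          by (simp add: c_def s_def norm_divide power_divide add_divide_distrib)
        then show ?thesis unfolding N(2)[symmetric] using N(1) by simp
      qed
      have G: "unitary_map n (givens m c s) (givens m (cnj c) (- s))"
        by (rule givens_unitary[OF m cs s])
      have inner: "L2_inner n (\<lambda>z. f (givens m c s z)) (\<lambda>z. z j) = L2_inner n f (\<lambda>z. givens m (cnj c) (- s) z j)" if "j < n" for j
        by (rule unitary_map_sym(1)[OF G fL bipoly_coord[OF that]])
      have "L2_inner n (\<lambda>z. f (givens m c s z)) (\<lambda>z. z j) = 0" if j: "0 < j" "j < Suc m" for j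
      proof (cases "j = m")
        case True
        have "L2_inner n (\<lambda>z. f (givens m c s z)) (\<lambda>z. z m) = L2_inner n f (\<lambda>z. cnj s * z 0 + c * z m)"
          using inner[OF m(2)] by (simp add: givens_def)
        also have "\<dots> = s * a0 + cnj c * am"
          unfolding a0_def am_def using fL m
          by (simp add: L2_inner_add_right L2_cmult coord_L2 L2_inner_cmult_right)
        also have "\<dots> = 0" by (simp add: s_def c_def)
        finally show ?thesis using True by simp
      next
        case False
        then show ?thesis using inner[of j] z[of j] j m unfolding f_def by (simp add: givens_def)
      qed
      then have "A (Suc m) (\<lambda>z. U (givens m c s z)) (\<lambda>z. givens m (cnj c) (- s) (V z))"
        using unitary_map_comp[OF U G] by (simp add: A_def f_def)
      then show ?thesis by blast
    qed
  qed
  then show ?thesis unfolding A_def .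
qed

subsection \<open>Positive definite matrices\<close>

definition posdef_on :: "nat set \<Rightarrow> (nat \<Rightarrow> nat \<Rightarrow> real) \<Rightarrow> bool" where
  "posdef_on I A \<longleftrightarrow> (\<forall>l\<in>I. \<forall>m\<in>I. A l m = A m l) \<and>
     (\<forall>x. (\<exists>l\<in>I. x l \<noteq> 0) \<longrightarrow> 0 < (\<Sum>l\<in>I. \<Sum>m\<in>I. x l * A l m * x m))"

lemma posdef_on_sym: "posdef_on I A \<Longrightarrow> l \<in> I \<Longrightarrow> m \<in> I \<Longrightarrow> A l m = A m l"
  by (simp add: posdef_on_def)

lemma posdef_on_pos: "posdef_on I A \<Longrightarrow> l \<in> I \<Longrightarrow> x l \<noteq> 0 \<Longrightarrow> 0 < (\<Sum>l\<in>I. \<Sum>m\<in>I. x l * A l m * x m)"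
  unfolding posdef_on_def by blast

text \<open>Gaussian elimination: the Schur complement of a diagonal entry is again positive definite.\<close>

lemma posdef_solve:
  assumes "finite I" "posdef_on I A"
  shows "\<exists>x. \<forall>l\<in>I. (\<Sum>m\<in>I. A l m * x m) = (b l :: real)"
  using assms
proof (induction I arbitrary: A b rule: finite_induct)
  case (insert k I)
  note pd = insert.prems
  have sym: "A l k = A k l" if "l \<in> I" for l using posdef_on_sym[OF pd] that by simp
  define a where "a = A k k"
  have quad: "(\<Sum>l\<in>insert k I. \<Sum>m\<in>insert k I. x l * A l m * x m)
      = a * (x k)\<^sup>2 + 2 * x k * (\<Sum>m\<in>I. A k m * x m) + (\<Sum>l\<in>I. \<Sum>m\<in>I. x l * A l m * x m)" for x
  proof -
    have "(\<Sum>l\<in>I. x l * A l k * x k) = x k * (\<Sum>m\<in>I. A k m * x m)"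
      unfolding sum_distrib_left by (intro sum.cong refl) (simp add: sym)
    moreover have "(\<Sum>m\<in>I. x k * A k m * x m) = x k * (\<Sum>m\<in>I. A k m * x m)"
      unfolding sum_distrib_left by (intro sum.cong refl) simp
    ultimately show ?thesis using insert.hyps
      by (simp add: sum.distrib a_def power2_eq_square algebra_simps)
  qed
  have a: "0 < a"
  proof -
    have "0 < (\<Sum>l\<in>insert k I. \<Sum>m\<in>insert k I. (\<lambda>j. if j = k then 1 else 0) l * A l m * (\<lambda>j. if j = k then 1 else 0) m)"
      using posdef_on_pos[OF pd, of k "\<lambda>j. if j = k then 1 else 0"] by simp
    also have "\<dots> = a"
    proof -
      have "(\<Sum>m\<in>I. A k m * (if m = k then 1 else 0)) = 0"
        "(\<Sum>l\<in>I. \<Sum>m\<in>I. (if l = k then 1 else 0) * A l m * (if m = k then 1 else 0)) = 0"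
        using insert.hyps by (auto intro!: sum.neutral)
      then show ?thesis unfolding quad by simp
    qed
    finally show ?thesis .
  qed
  define A' where "A' l m = A l m - A l k * A k m / a" for l m
  have "posdef_on I A'"
    unfolding posdef_on_def
  proof (intro conjI ballI allI impI)
    show "A' l m = A' m l" if "l \<in> I" "m \<in> I" for l m
      using that posdef_on_sym[OF pd, of l m] sym by (simp add: A'_def)
    fix y :: "nat \<Rightarrow> real" assume y: "\<exists>l\<in>I. y l \<noteq> 0"
    define s where "s = (\<Sum>m\<in>I. A k m * y m)"
    \<comment> \<open>The value at \<open>k\<close> that minimizes the quadratic form for given
      \<open>y\<close>. The form of \<open>A\<close> at \<open>x\<close> is then that of the Schur
      complement at \<open>y\<close>.\<close>
    define x where "x = y(k := - s / a)"
    have xI: "x m = y m" if "m \<in> I" for m using that insert.hyps by (auto simp: x_def)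
    obtain l where l: "l \<in> I" "y l \<noteq> 0" using y by blast
    have "0 < (\<Sum>l\<in>insert k I. \<Sum>m\<in>insert k I. x l * A l m * x m)"
      by (rule posdef_on_pos[OF pd, of l]) (use l xI in auto)
    also have "\<dots> = (\<Sum>l\<in>I. \<Sum>m\<in>I. y l * A l m * y m) - s\<^sup>2 / a"
    proof -
      have e1: "(\<Sum>m\<in>I. A k m * x m) = s"
        and e2: "(\<Sum>l\<in>I. \<Sum>m\<in>I. x l * A l m * x m) = (\<Sum>l\<in>I. \<Sum>m\<in>I. y l * A l m * y m)"
        unfolding s_def by (simp_all add: xI)
      have e3: "x k = - s / a" by (simp add: x_def)
      show ?thesis unfolding quad e1 e2 e3 using a by (simp add: power2_eq_square field_simps)
    qed
    also have "\<dots> = (\<Sum>l\<in>I. \<Sum>m\<in>I. y l * A' l m * y m)"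
    proof -
      have "(\<Sum>l\<in>I. \<Sum>m\<in>I. y l * (A l k * A k m / a) * y m) = s * s / a"
        unfolding s_def sum_product sum_divide_distrib
        by (intro sum.cong refl) (simp add: sym)
      then show ?thesis
        by (simp add: A'_def right_diff_distrib left_diff_distrib sum_subtractf power2_eq_square)
    qed
    finally show "0 < (\<Sum>l\<in>I. \<Sum>m\<in>I. y l * A' l m * y m)" .
  qed
  from insert.IH[OF this, of "\<lambda>l. b l - A l k * b k / a"] obtain y where
    y: "\<And>l. l \<in> I \<Longrightarrow> (\<Sum>m\<in>I. A' l m * y m) = b l - A l k * b k / a" by blast
  define s where "s = (\<Sum>m\<in>I. A k m * y m)"
  \<comment> \<open>Back substitution: the equation in row \<open>k\<close> solved for the
    eliminated unknown.\<close>
  define x where "x = y(k := (b k - s) / a)"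
  have xI: "x m = y m" if "m \<in> I" for m using that insert.hyps by (auto simp: x_def)
  have xk: "x k = (b k - s) / a" by (simp add: x_def)
  have sx: "(\<Sum>m\<in>I. B m * x m) = (\<Sum>m\<in>I. B m * y m)" for B by (simp add: xI)
  have "(\<Sum>m\<in>insert k I. A l m * x m) = b l" if "l \<in> insert k I" for l
  proof (cases "l = k")
    case True
    then show ?thesis using insert.hyps a by (simp add: sx xk s_def[symmetric] a_def[symmetric])
  next
    case False
    then have l: "l \<in> I" using that by simp
    have "(\<Sum>m\<in>I. A' l m * y m) = (\<Sum>m\<in>I. A l m * y m) - A l k * s / a"
      unfolding A'_def s_def
      by (simp add: left_diff_distrib sum_subtractf sum_distrib_left sum_divide_distrib mult.assoc)
    then have "(\<Sum>m\<in>I. A l m * y m) = b l - A l k * b k / a + A l k * s / a" using y[OF l] by simp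
    then show ?thesis using insert.hyps a by (simp add: sx xk right_diff_distrib diff_divide_distrib)
  qed
  then show ?case by blast
qed simp

text \<open>Solving column by column gives a right inverse. \<open>mat_inv_on\<close> asks for a
  two-sided one, and symmetry of the matrix supplies the other side.\<close>

lemma mat_inv_on_posdef:
  assumes I: "finite I" and A: "posdef_on I A"
  shows "\<forall>l\<in>I. \<forall>m\<in>I. mat_mult_on I A (mat_inv_on I A) l m = id_mat l m"
proof -
  have "\<exists>x. \<forall>m. \<forall>l\<in>I. (\<Sum>k\<in>I. A l k * x m k) = id_mat l m"
  proof (rule choice, rule allI)
    show "\<exists>x. \<forall>l\<in>I. (\<Sum>k\<in>I. A l k * x k) = id_mat l m" for m by (rule posdef_solve[OF I A])
  qed
  then obtain x where x: "\<And>m l. l \<in> I \<Longrightarrow> (\<Sum>k\<in>I. A l k * x m k) = id_mat l m" by blast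
  define X where "X k m = x m k" for k m
  have AX: "(\<Sum>k\<in>I. A l k * X k m) = id_mat l m" if "l \<in> I" for l m using x[OF that] by (simp add: X_def)
  have id1: "(\<Sum>k\<in>I. f k * id_mat k m) = f m" if "m \<in> I" for f :: "nat \<Rightarrow> real" and m
    using I that by (simp add: id_mat_def diag_mat_def if_distrib[of "\<lambda>x. _ * x"] cong: if_cong)
  have id2: "(\<Sum>k\<in>I. id_mat k m * f k) = f m" if "m \<in> I" for f :: "nat \<Rightarrow> real" and m
    using id1[OF that, of f] by (simp add: mult.commute)
  have tr: "(\<Sum>k\<in>I. X k l * A k m) = id_mat m l" if "m \<in> I" for l m
    using AX[OF that, of l] posdef_on_sym[OF A that] by (simp add: mult.commute)
  \<comment> \<open>The product of the transpose of \<open>X\<close>, \<open>A\<close> and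
    \<open>X\<close>, evaluated with either bracketing.\<close>
  have Xsym: "X l m = X m l" if "l \<in> I" "m \<in> I" for l m
  proof -
    have "X m l = (\<Sum>k\<in>I. X k l * id_mat k m)" using id1[OF that(2), of "\<lambda>k. X k l"] by simp
    also have "\<dots> = (\<Sum>k\<in>I. \<Sum>j\<in>I. X k l * (A k j * X j m))"
      by (intro sum.cong refl) (simp add: AX[symmetric] sum_distrib_left)
    also have "\<dots> = (\<Sum>j\<in>I. \<Sum>k\<in>I. X k l * A k j * X j m)"
      by (subst sum.swap) (simp add: mult.assoc)
    also have "\<dots> = (\<Sum>j\<in>I. id_mat j l * X j m)"
      by (intro sum.cong refl) (simp add: tr[symmetric] sum_distrib_right)
    also have "\<dots> = X l m" by (rule id2[OF that(1)])
    finally show ?thesis by simp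
  qed
  have XA: "(\<Sum>k\<in>I. X l k * A k m) = id_mat l m" if "l \<in> I" "m \<in> I" for l m
  proof -
    have "(\<Sum>k\<in>I. X l k * A k m) = (\<Sum>k\<in>I. X k l * A k m)"
      by (intro sum.cong refl) (simp add: Xsym that)
    then show ?thesis using tr[OF that(2), of l] by (simp add: id_mat_def diag_mat_def)
  qed
  have "\<exists>X. \<forall>l\<in>I. \<forall>m\<in>I. mat_mult_on I A X l m = id_mat l m \<and> mat_mult_on I X A l m = id_mat l m"
    using AX XA by (intro exI[of _ X]) (simp add: mat_mult_on_def)
  then have "\<forall>l\<in>I. \<forall>m\<in>I. mat_mult_on I A (mat_inv_on I A) l m = id_mat l m \<and> mat_mult_on I (mat_inv_on I A) A l m = id_mat l m"
    unfolding mat_inv_on_def by (rule someI_ex)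
  then show ?thesis by blast
qed

lemma posdef_diag:
  assumes I: "finite I" and "\<And>l. l \<in> I \<Longrightarrow> 0 < d l"
  shows "posdef_on I (diag_mat d)"
  unfolding posdef_on_def
proof (intro conjI ballI allI impI)
  fix x :: "nat \<Rightarrow> real" assume "\<exists>l\<in>I. x l \<noteq> 0"
  then obtain l where l: "l \<in> I" "x l \<noteq> 0" by blast
  have "(\<Sum>l\<in>I. \<Sum>m\<in>I. x l * diag_mat d l m * x m) = (\<Sum>l\<in>I. d l * (x l)\<^sup>2)"
  proof (rule sum.cong[OF refl])
    fix l assume "l \<in> I"
    have "(\<Sum>m\<in>I. x l * diag_mat d l m * x m) = (\<Sum>m\<in>I. if l = m then d l * (x l)\<^sup>2 else 0)"
      by (intro sum.cong refl) (simp add: diag_mat_def power2_eq_square)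
    then show "(\<Sum>m\<in>I. x l * diag_mat d l m * x m) = d l * (x l)\<^sup>2" using I \<open>l \<in> I\<close> by simp
  qed
  also have "\<dots> > 0"
    using l assms(2) by (intro sum_pos2[OF I l(1)]) (auto intro!: mult_nonneg_nonneg intro: less_imp_le)
  finally show "0 < (\<Sum>l\<in>I. \<Sum>m\<in>I. x l * diag_mat d l m * x m)" .
qed (simp add: diag_mat_def)

lemma mat_inv_on_diag:
  assumes I: "finite I" and d: "\<And>l. l \<in> I \<Longrightarrow> 0 < d l" and lm: "l \<in> I" "m \<in> I"
  shows "mat_inv_on I (diag_mat d) l m = (if l = m then 1 / d l else 0)"
proof -
  have "mat_mult_on I (diag_mat d) (mat_inv_on I (diag_mat d)) l m = id_mat l m"
    using mat_inv_on_posdef[OF I posdef_diag[where d = d, OF I d]] lm by blast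
  moreover have "mat_mult_on I (diag_mat d) (mat_inv_on I (diag_mat d)) l m = d l * mat_inv_on I (diag_mat d) l m"
  proof -
    have "mat_mult_on I (diag_mat d) (mat_inv_on I (diag_mat d)) l m
      = (\<Sum>k\<in>I. if l = k then d l * mat_inv_on I (diag_mat d) l m else 0)"
      unfolding mat_mult_on_def by (intro sum.cong refl) (simp add: diag_mat_def)
    then show ?thesis using I lm by simp
  qed
  ultimately have "d l * mat_inv_on I (diag_mat d) l m = (if l = m then 1 else 0)"
    by (simp add: id_mat_def diag_mat_def)
  then show ?thesis using d[OF lm(1)] by (auto simp: field_simps split: if_splits)
qed

subsection \<open>The Schur scalar\<close>

lemma hermite_radial_measurable [measurable]: "hermite_radial a b \<in> borel_measurable borel"
  unfolding hermite_radial_def[abs_def] by measurable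

lemma hermite1_norm_sq: "(cmod (hermite1 a b z))\<^sup>2 = (hermite_radial a b (cmod z))\<^sup>2"
proof -
  have "complex_of_real ((cmod (hermite1 a b z))\<^sup>2) = of_real ((hermite_radial a b (cmod z))\<^sup>2)"
    unfolding complex_norm_square hermite1_mult_cnj[OF refl] by (simp add: power2_eq_square)
  then show ?thesis using of_real_eq_iff by blast
qed

lemma radial_sq_integrable: "integrable radial_measure (\<lambda>r. (hermite_radial a b r)\<^sup>2)"
proof -
  have "integrable gauss1 (\<lambda>z. Re (hermite1 a b z * cnj (hermite1 a b z)))"
    by (intro integrable_Re hermite1_inner(1))
  then have "integrable gauss1 (\<lambda>z. (hermite_radial a b (cmod z))\<^sup>2)"
    unfolding complex_norm_square[symmetric] by (simp add: hermite1_norm_sq)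
  then show ?thesis by (subst (asm) integral_gauss1_cmod(2)) auto
qed

lemma abs_mult_le_sum_sq: "\<bar>a * b\<bar> \<le> a\<^sup>2 + b\<^sup>2" for a b :: real
  using mult_le_sum_squares[of "\<bar>a\<bar>" "\<bar>b\<bar>"] by (simp add: abs_mult)

lemma radial_phi_0: "radial_phi 0 r = r"
  by (simp add: radial_phi_def hermite_radial_def hermite1_1_0)

lemma radial_phi_measurable [measurable]: "radial_phi l \<in> borel_measurable borel"
  unfolding radial_phi_def by measurable

lemma radial_phi_integrable:
  assumes [measurable]: "D \<in> borel_measurable borel" and D: "\<And>r. d \<le> D r" and d: "0 < d"
  shows "integrable radial_measure (\<lambda>r. radial_phi l r * radial_phi m r / D r)"
proof (rule Bochner_Integration.integrable_bound)
  show "integrable radial_measure (\<lambda>r. ((radial_phi l r)\<^sup>2 + (radial_phi m r)\<^sup>2) / d)"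
    unfolding radial_phi_def by (intro integrable_divide Bochner_Integration.integrable_add radial_sq_integrable)
  have "\<bar>radial_phi l r * radial_phi m r / D r\<bar> \<le> ((radial_phi l r)\<^sup>2 + (radial_phi m r)\<^sup>2) / d" for r
  proof -
    have "\<bar>radial_phi l r * radial_phi m r / D r\<bar> = \<bar>radial_phi l r * radial_phi m r\<bar> / D r"
      using D[of r] d by (simp add: abs_divide)
    also have "\<dots> \<le> ((radial_phi l r)\<^sup>2 + (radial_phi m r)\<^sup>2) / d"
      by (intro frac_le abs_mult_le_sum_sq d D) auto
    finally show ?thesis .
  qed
  then show "AE r in radial_measure. norm (radial_phi l r * radial_phi m r / D r) \<le> norm (((radial_phi l r)\<^sup>2 + (radial_phi m r)\<^sup>2) / d)"
    using d by (intro AE_I2) simp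
qed measurable

text \<open>The Schur scalar is the value of the quadratic \<open>\<integral>(r - \<Sum> v\<^sub>l \<phi>\<^sub>l)\<^sup>2 / D + \<Sum> v\<^sub>l\<^sup>2 / \<beta>\<^sub>l\<close> at its
  minimiser.\<close>

lemma schur_scalar_attained:
  assumes fin: "finite \<Lambda>" and \<beta>: "\<And>l. l \<in> \<Lambda> \<Longrightarrow> 0 < \<beta> l" and \<rho>: "0 < \<rho>"
    and Dm: "schur_D \<rho> W \<in> borel_measurable borel" and W: "\<And>r. 0 \<le> W (r\<^sup>2)"
  obtains v where "integrable radial_measure (\<lambda>r. (r - (\<Sum>l\<in>\<Lambda>. v l * radial_phi l r))\<^sup>2 / schur_D \<rho> W r)"
    and "(\<integral>r. (r - (\<Sum>l\<in>\<Lambda>. v l * radial_phi l r))\<^sup>2 / schur_D \<rho> W r \<partial>radial_measure) + (\<Sum>l\<in>\<Lambda>. (v l)\<^sup>2 / \<beta> l)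
      = schur_scalar \<rho> \<Lambda> \<beta> W"
proof -
  note [measurable] = Dm
  define D where "D = schur_D \<rho> W"
  have D: "2 * \<rho> \<le> D r" for r using W[of r] by (simp add: D_def schur_D_def)
  have Dpos: "0 < D r" for r using D[of r] \<rho> by linarith
  have int: "integrable radial_measure (\<lambda>r. radial_phi l r * radial_phi m r / D r)" for l m
    using D \<rho> Dm unfolding D_def by (intro radial_phi_integrable[where d = "2 * \<rho>"]) auto
  define G where "G = schur_G \<rho> W"
  define b where "b = schur_b \<rho> W"
  have G: "G l m = (\<integral>r. radial_phi l r * radial_phi m r / D r \<partial>radial_measure)" for l m
    by (simp add: G_def schur_G_def D_def)
  \<comment> \<open>Since \<open>radial_phi 0\<close> is the identity, R, b and G are entries of a
    single Gram matrix with the index 0 added.\<close>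
  have b: "b l = G 0 l" for l by (simp add: b_def schur_b_def G D_def radial_phi_0)
  have R: "schur_R \<rho> W = G 0 0" by (simp add: schur_R_def G D_def radial_phi_0 power2_eq_square)
  have Gsym: "G l m = G m l" for l m by (simp add: G mult.commute)
  have quad_fun: "(r - (\<Sum>l\<in>\<Lambda>. v l * radial_phi l r))\<^sup>2 / D r
     = radial_phi 0 r * radial_phi 0 r / D r - 2 * (\<Sum>l\<in>\<Lambda>. v l * (radial_phi 0 r * radial_phi l r / D r))
       + (\<Sum>l\<in>\<Lambda>. \<Sum>m\<in>\<Lambda>. v l * v m * (radial_phi l r * radial_phi m r / D r))" for v r
  proof -
    define t where "t = (\<Sum>l\<in>\<Lambda>. v l * radial_phi l r)"
    have 1: "(\<Sum>l\<in>\<Lambda>. v l * (radial_phi 0 r * radial_phi l r / D r)) = r * t / D r"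
      unfolding t_def sum_distrib_left sum_divide_distrib by (intro sum.cong refl) (simp add: radial_phi_0)
    have 2: "(\<Sum>l\<in>\<Lambda>. \<Sum>m\<in>\<Lambda>. v l * v m * (radial_phi l r * radial_phi m r / D r))
       = t * t / D r"
      unfolding t_def sum_product sum_divide_distrib by (intro sum.cong refl) simp
    show ?thesis unfolding 1 2 t_def[symmetric] unfolding radial_phi_0
      by (simp add: power2_eq_square add_divide_distrib diff_divide_distrib algebra_simps)
  qed
  have ints: "integrable radial_measure (\<lambda>r. (\<Sum>l\<in>\<Lambda>. v l * (radial_phi 0 r * radial_phi l r / D r)))"
    "integrable radial_measure (\<lambda>r. \<Sum>l\<in>\<Lambda>. \<Sum>m\<in>\<Lambda>. v l * v m * (radial_phi l r * radial_phi m r / D r))" for v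
    by (intro Bochner_Integration.integrable_sum integrable_mult_right int)+
  have quad_int: "integrable radial_measure (\<lambda>r. (r - (\<Sum>l\<in>\<Lambda>. v l * radial_phi l r))\<^sup>2 / D r)" for v
    unfolding quad_fun
    by (intro Bochner_Integration.integrable_add Bochner_Integration.integrable_diff integrable_mult_right int ints)
  have quad: "(\<integral>r. (r - (\<Sum>l\<in>\<Lambda>. v l * radial_phi l r))\<^sup>2 / D r \<partial>radial_measure)
     = G 0 0 - 2 * (\<Sum>l\<in>\<Lambda>. v l * b l) + (\<Sum>l\<in>\<Lambda>. \<Sum>m\<in>\<Lambda>. v l * v m * G l m)" for v
  proof -
    have s1: "(\<integral>r. (\<Sum>l\<in>\<Lambda>. v l * (radial_phi 0 r * radial_phi l r / D r)) \<partial>radial_measure) = (\<Sum>l\<in>\<Lambda>. v l * b l)"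
      unfolding b G
      by (simp only: Bochner_Integration.integral_sum integrable_mult_right int integral_mult_right_zero)
    have s2: "(\<integral>r. (\<Sum>l\<in>\<Lambda>. \<Sum>m\<in>\<Lambda>. v l * v m * (radial_phi l r * radial_phi m r / D r)) \<partial>radial_measure)
       = (\<Sum>l\<in>\<Lambda>. \<Sum>m\<in>\<Lambda>. v l * v m * G l m)"
    proof -
      have "(\<integral>r. (\<Sum>l\<in>\<Lambda>. \<Sum>m\<in>\<Lambda>. v l * v m * (radial_phi l r * radial_phi m r / D r)) \<partial>radial_measure)
        = (\<Sum>l\<in>\<Lambda>. \<integral>r. (\<Sum>m\<in>\<Lambda>. v l * v m * (radial_phi l r * radial_phi m r / D r)) \<partial>radial_measure)"
        by (intro Bochner_Integration.integral_sum Bochner_Integration.integrable_sum integrable_mult_right int)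
      also have "\<dots> = (\<Sum>l\<in>\<Lambda>. \<Sum>m\<in>\<Lambda>. \<integral>r. v l * v m * (radial_phi l r * radial_phi m r / D r) \<partial>radial_measure)"
        by (intro sum.cong refl Bochner_Integration.integral_sum integrable_mult_right int)
      also have "\<dots> = (\<Sum>l\<in>\<Lambda>. \<Sum>m\<in>\<Lambda>. v l * v m * G l m)"
        unfolding G by (intro sum.cong refl integral_mult_right_zero)
      finally show ?thesis .
    qed
    show ?thesis unfolding quad_fun
      by (subst Bochner_Integration.integral_add,
          (intro Bochner_Integration.integrable_diff integrable_mult_right int ints)+,
          subst Bochner_Integration.integral_diff, (intro integrable_mult_right int ints)+)
        (simp only: s1 s2 G integral_mult_right_zero)
  qed
  \<comment> \<open>The Hessian, up to a factor 2, of the quadratic to be minimized. The diagonal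
    part makes it positive definite whether or not G is.\<close>
  define M where "M k k' = mat_inv_on \<Lambda> (diag_mat \<beta>) k k' + G k k'" for k k'
  have M: "M l m = (if l = m then 1 / \<beta> l else 0) + G l m" if "l \<in> \<Lambda>" "m \<in> \<Lambda>" for l m
    unfolding M_def using mat_inv_on_diag[OF fin \<beta> that] by simp
  have Mquad: "(\<Sum>m\<in>\<Lambda>. M l m * x m) = x l / \<beta> l + (\<Sum>m\<in>\<Lambda>. G l m * x m)" if "l \<in> \<Lambda>" for l x
  proof -
    have "(\<Sum>m\<in>\<Lambda>. M l m * x m) = (\<Sum>m\<in>\<Lambda>. (if l = m then x l / \<beta> l else 0) + G l m * x m)"
      using that by (intro sum.cong refl) (simp add: M distrib_right)
    then show ?thesis using fin that by (simp add: sum.distrib)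
  qed
  have Mq: "(\<Sum>l\<in>\<Lambda>. \<Sum>m\<in>\<Lambda>. x l * M l m * x m) = (\<Sum>l\<in>\<Lambda>. (x l)\<^sup>2 / \<beta> l) + (\<Sum>l\<in>\<Lambda>. \<Sum>m\<in>\<Lambda>. x l * x m * G l m)" for x
  proof -
    have "(\<Sum>m\<in>\<Lambda>. x l * M l m * x m) = (x l)\<^sup>2 / \<beta> l + (\<Sum>m\<in>\<Lambda>. x l * x m * G l m)" if "l \<in> \<Lambda>" for l
    proof -
      have "(\<Sum>m\<in>\<Lambda>. x l * M l m * x m) = x l * (\<Sum>m\<in>\<Lambda>. M l m * x m)" by (simp add: sum_distrib_left mult.assoc)
      also have "\<dots> = (x l)\<^sup>2 / \<beta> l + (\<Sum>m\<in>\<Lambda>. x l * x m * G l m)"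
        unfolding Mquad[OF that] by (simp add: distrib_left sum_distrib_left power2_eq_square mult_ac)
      finally show ?thesis .
    qed
    then show ?thesis by (simp add: sum.distrib)
  qed
  have Gpsd: "0 \<le> (\<Sum>l\<in>\<Lambda>. \<Sum>m\<in>\<Lambda>. x l * x m * G l m)" for x
  proof -
    have "(\<Sum>l\<in>\<Lambda>. \<Sum>m\<in>\<Lambda>. x l * x m * G l m) = (\<integral>r. (\<Sum>l\<in>\<Lambda>. \<Sum>m\<in>\<Lambda>. x l * x m * (radial_phi l r * radial_phi m r / D r)) \<partial>radial_measure)"
      unfolding G by (simp only: Bochner_Integration.integral_sum Bochner_Integration.integrable_sum integrable_mult_right int integral_mult_right_zero)
    also have "\<dots> = (\<integral>r. (\<Sum>l\<in>\<Lambda>. x l * radial_phi l r)\<^sup>2 / D r \<partial>radial_measure)"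
      unfolding power2_eq_square sum_product sum_divide_distrib
      by (intro Bochner_Integration.integral_cong refl sum.cong) simp
    also have "\<dots> \<ge> 0" using Dpos by (intro integral_nonneg_AE AE_I2) (auto intro!: divide_nonneg_pos)
    finally show ?thesis .
  qed
  have "posdef_on \<Lambda> M"
    unfolding posdef_on_def
  proof (intro conjI ballI allI impI)
    show "M l m = M m l" if "l \<in> \<Lambda>" "m \<in> \<Lambda>" for l m using that Gsym[of l m] by (simp add: M)
    fix x :: "nat \<Rightarrow> real" assume "\<exists>l\<in>\<Lambda>. x l \<noteq> 0"
    then obtain l where l: "l \<in> \<Lambda>" "x l \<noteq> 0" by blast
    have "0 < (\<Sum>l\<in>\<Lambda>. (x l)\<^sup>2 / \<beta> l)"
      using l \<beta> by (intro sum_pos2[OF fin l(1)]) (auto intro!: divide_nonneg_pos divide_pos_pos)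
    then show "0 < (\<Sum>l\<in>\<Lambda>. \<Sum>m\<in>\<Lambda>. x l * M l m * x m)" unfolding Mq using Gpsd[of x] by linarith
  qed
  note inv = mat_inv_on_posdef[OF fin this]
  \<comment> \<open>The critical point of the quadratic, that is, the solution of M v = b.\<close>
  define v where "v l = (\<Sum>m\<in>\<Lambda>. mat_inv_on \<Lambda> M l m * b m)" for l
  have Mv: "(\<Sum>k\<in>\<Lambda>. M l k * v k) = b l" if "l \<in> \<Lambda>" for l
  proof -
    have "(\<Sum>k\<in>\<Lambda>. M l k * v k) = (\<Sum>k\<in>\<Lambda>. \<Sum>m\<in>\<Lambda>. M l k * mat_inv_on \<Lambda> M k m * b m)"
      unfolding v_def sum_distrib_left by (simp add: mult.assoc)
    also have "\<dots> = (\<Sum>m\<in>\<Lambda>. mat_mult_on \<Lambda> M (mat_inv_on \<Lambda> M) l m * b m)"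
      unfolding mat_mult_on_def sum_distrib_right by (rule sum.swap)
    also have "\<dots> = (\<Sum>m\<in>\<Lambda>. if l = m then b l else 0)"
      using inv that by (intro sum.cong refl) (simp add: id_mat_def diag_mat_def)
    finally show ?thesis using fin that by simp
  qed
  \<comment> \<open>At the critical point the quadratic part equals b \<cdot> v, half of the linear
    part that is subtracted, so the minimum is R - b \<cdot> v.\<close>
  have "(\<Sum>l\<in>\<Lambda>. (v l)\<^sup>2 / \<beta> l) + (\<Sum>l\<in>\<Lambda>. \<Sum>m\<in>\<Lambda>. v l * v m * G l m) = (\<Sum>l\<in>\<Lambda>. v l * b l)"
  proof -
    have "(\<Sum>l\<in>\<Lambda>. \<Sum>m\<in>\<Lambda>. v l * M l m * v m) = (\<Sum>l\<in>\<Lambda>. v l * (\<Sum>m\<in>\<Lambda>. M l m * v m))"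
      by (simp add: sum_distrib_left mult.assoc)
    also have "\<dots> = (\<Sum>l\<in>\<Lambda>. v l * b l)" by (intro sum.cong refl) (simp add: Mv)
    finally show ?thesis unfolding Mq .
  qed
  moreover have "(\<Sum>l\<in>\<Lambda>. v l * b l) = (\<Sum>l\<in>\<Lambda>. \<Sum>m\<in>\<Lambda>. b l * mat_inv_on \<Lambda> M l m * b m)"
    unfolding v_def sum_distrib_right by (simp add: mult_ac)
  moreover have "schur_scalar \<rho> \<Lambda> \<beta> W = G 0 0 - (\<Sum>l\<in>\<Lambda>. \<Sum>m\<in>\<Lambda>. b l * mat_inv_on \<Lambda> M l m * b m)"
    unfolding schur_scalar_def R M_def G_def b_def ..
  ultimately have "(\<integral>r. (r - (\<Sum>l\<in>\<Lambda>. v l * radial_phi l r))\<^sup>2 / D r \<partial>radial_measure) + (\<Sum>l\<in>\<Lambda>. (v l)\<^sup>2 / \<beta> l)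
      = schur_scalar \<rho> \<Lambda> \<beta> W"
    unfolding quad by linarith
  then show ?thesis using that[of v] quad_int[of v] unfolding D_def by blast
qed

section \<open>Squared norms of the levels and integrals with a weight in the first
  coordinate\<close>

definition qsq :: "nat \<Rightarrow> nat \<Rightarrow> ((nat \<Rightarrow> complex) \<Rightarrow> complex) \<Rightarrow> real" where
  "qsq n l f = (\<Sum>\<kappa>\<in>pair_indices n (Suc l) l. (cmod (coef n \<kappa> f))\<^sup>2)"

lemma qsq_nonneg [simp]: "0 \<le> qsq n l f"
  by (simp add: qsq_def sum_nonneg)

lemma qform_self: "qform n l f f = of_real (qsq n l f)"
  unfolding qform_def qsq_def of_real_sum complex_norm_square ..

definition unit_index :: "nat \<Rightarrow> nat \<Rightarrow> nat \<Rightarrow> nat \<Rightarrow> (nat \<Rightarrow> nat) \<times> (nat \<Rightarrow> nat)" where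
  "unit_index n i a b = ((\<lambda>j\<in>{..<n}. if j = i then a else 0), (\<lambda>j\<in>{..<n}. if j = i then b else 0))"

lemma unit_index_in: "i < n \<Longrightarrow> unit_index n i a b \<in> pair_indices n a b"
  by (simp add: pair_indices_iff unit_index_def ext_pairs_def)

lemma herm_unit_index:
  assumes "i < n"
  shows "herm n (unit_index n i a b) = (\<lambda>z. hermite1 a b (z i))"
proof
  fix z
  have "herm n (unit_index n i a b) z = (\<Prod>j<n. if j = i then hermite1 a b (z j) else 1)"
    unfolding hermite_def unit_index_def by (intro prod.cong refl) simp
  then show "herm n (unit_index n i a b) z = hermite1 a b (z i)" using assms by simp
qed

lemma pair_indices_1_0:
  assumes "\<kappa> \<in> pair_indices n (Suc 0) 0"
  obtains i where "i < n" "\<kappa> = unit_index n i (Suc 0) 0"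
proof -
  have e: "fst \<kappa> \<in> extensional {..<n}" "snd \<kappa> \<in> extensional {..<n}"
    using assms by (auto simp: pair_indices_iff ext_pairs_def mem_Times_iff)
  have s: "(\<Sum>j<n. fst \<kappa> j) = Suc 0" "(\<Sum>j<n. snd \<kappa> j) = 0" using assms by (simp_all only: pair_indices_iff)
  obtain i where i: "i < n" "fst \<kappa> i = Suc 0" "\<forall>j\<in>{..<n}. i \<noteq> j \<longrightarrow> fst \<kappa> j = 0"
    using s(1) by (auto simp: sum_eq_Suc0_iff)
  have z: "snd \<kappa> j = 0" if "j < n" for j using s(2) that by simp
  have "fst \<kappa> = (\<lambda>j\<in>{..<n}. if j = i then Suc 0 else 0)"
    by (rule extensionalityI[OF e(1) restrict_extensional]) (use i in auto)
  moreover have "snd \<kappa> = (\<lambda>j\<in>{..<n}. if j = i then 0 else 0)"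
    by (rule extensionalityI[OF e(2) restrict_extensional]) (use z in auto)
  ultimately have "\<kappa> = unit_index n i (Suc 0) 0" by (simp add: unit_index_def prod_eq_iff)
  then show ?thesis using that i(1) by blast
qed

lemma coef_unit_index:
  "i < n \<Longrightarrow> coef n (unit_index n i a b) f = L2_inner n f (\<lambda>z. hermite1 a b (z i))"
  by (simp only: coef_def herm_unit_index)

text \<open>Level 0 is spanned by the coordinate functions, and alignment leaves a nonzero
  coefficient only at the first.\<close>

lemma qsq_0_aligned:
  assumes n: "0 < n" and z: "\<And>j. 0 < j \<Longrightarrow> j < n \<Longrightarrow> L2_inner n h (\<lambda>z. z j) = 0"
  shows "qsq n 0 h = (cmod (L2_inner n h (\<lambda>z. z 0)))\<^sup>2"
proof -
  let ?\<kappa> = "unit_index n 0 (Suc 0) 0"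
  have "qsq n 0 h = (\<Sum>\<kappa>\<in>{?\<kappa>}. (cmod (coef n \<kappa> h))\<^sup>2)"
    unfolding qsq_def
  proof (rule sum.mono_neutral_right)
    show "{?\<kappa>} \<subseteq> pair_indices n (Suc 0) 0" using unit_index_in[OF n, of "Suc 0" 0] by simp
    show "\<forall>\<kappa>\<in>pair_indices n (Suc 0) 0 - {?\<kappa>}. (cmod (coef n \<kappa> h))\<^sup>2 = 0"
    proof
      fix \<kappa> assume k: "\<kappa> \<in> pair_indices n (Suc 0) 0 - {?\<kappa>}"
      then have "\<kappa> \<in> pair_indices n (Suc 0) 0" by blast
      then obtain i where i: "i < n" "\<kappa> = unit_index n i (Suc 0) 0" by (rule pair_indices_1_0)
      have "i \<noteq> 0" using k i(2) by (intro notI) simp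
      then show "(cmod (coef n \<kappa> h))\<^sup>2 = 0" using i z[of i] by (simp add: coef_unit_index hermite1_1_0)
    qed
  qed simp
  then show ?thesis by (simp add: coef_unit_index[OF n] hermite1_1_0)
qed

text \<open>Real and imaginary parts of the vector contribute separately: with real entries the
  mixed products are imaginary.\<close>

lemma psd_complex:
  assumes "psd_on I A"
  shows "0 \<le> Re (\<Sum>l\<in>I. \<Sum>m\<in>I. x l * of_real (A l m) * cnj (x m))"
proof -
  have "Re (\<Sum>l\<in>I. \<Sum>m\<in>I. x l * of_real (A l m) * cnj (x m))
    = (\<Sum>l\<in>I. \<Sum>m\<in>I. Re (x l) * A l m * Re (x m)) + (\<Sum>l\<in>I. \<Sum>m\<in>I. Im (x l) * A l m * Im (x m))"
    by (simp add: sum.distrib)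
  moreover have "0 \<le> (\<Sum>l\<in>I. \<Sum>m\<in>I. y l * A l m * y m)" for y
    using assms unfolding psd_on_def by blast
  ultimately show ?thesis by simp
qed

text \<open>The weight involves \<open>z 0\<close> alone, so every other coordinate integrates to a
  Kronecker delta.\<close>

lemma weighted_herm_inner:
  assumes n: "0 < n" and [measurable]: "F \<in> borel_measurable borel"
    and int: "integrable gauss1 (\<lambda>z. hermite1 (fst \<kappa> 0) (snd \<kappa> 0) z * cnj (hermite1 (fst \<kappa>' 0) (snd \<kappa>' 0) z) * of_real (F (cmod z)))"
  shows "integrable (gauss n) (\<lambda>z. herm n \<kappa> z * cnj (herm n \<kappa>' z) * of_real (F (cmod (z 0))))"
    and "(\<integral>z. herm n \<kappa> z * cnj (herm n \<kappa>' z) * of_real (F (cmod (z 0))) \<partial>gauss n)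
      = (if \<forall>j. 0 < j \<longrightarrow> j < n \<longrightarrow> fst \<kappa> j = fst \<kappa>' j \<and> snd \<kappa> j = snd \<kappa>' j then
          (\<integral>z. hermite1 (fst \<kappa> 0) (snd \<kappa> 0) z * cnj (hermite1 (fst \<kappa>' 0) (snd \<kappa>' 0) z) * of_real (F (cmod z)) \<partial>gauss1) else 0)"
proof -
  define f where "f j z = hermite1 (fst \<kappa> j) (snd \<kappa> j) z * cnj (hermite1 (fst \<kappa>' j) (snd \<kappa>' j) z) * (if j = 0 then of_real (F (cmod z)) else 1)" for j :: nat and z
  have eq: "herm n \<kappa> z * cnj (herm n \<kappa>' z) * of_real (F (cmod (z 0))) = (\<Prod>j<n. f j (z j))" for z
    unfolding hermite_inner_prod f_def prod.distrib using n by simp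
  have fi: "integrable gauss1 (f j)" for j
    unfolding f_def[abs_def] using int hermite1_inner(1) by (cases "j = 0") simp_all
  show "integrable (gauss n) (\<lambda>z. herm n \<kappa> z * cnj (herm n \<kappa>' z) * of_real (F (cmod (z 0))))"
    unfolding eq by (rule integrable_gauss_prod[OF fi])
  define P where "P \<longleftrightarrow> (\<forall>j. 0 < j \<longrightarrow> j < n \<longrightarrow> fst \<kappa> j = fst \<kappa>' j \<and> snd \<kappa> j = snd \<kappa>' j)"
  have fj: "(\<integral>z. f j z \<partial>gauss1) = (if fst \<kappa> j = fst \<kappa>' j \<and> snd \<kappa> j = snd \<kappa>' j then 1 else 0)" if "j \<noteq> 0" for j
    unfolding f_def using that by (simp add: hermite1_inner(2))
  have "(\<integral>z. herm n \<kappa> z * cnj (herm n \<kappa>' z) * of_real (F (cmod (z 0))) \<partial>gauss n) = (\<Prod>j<n. \<integral>z. f j z \<partial>gauss1)"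
    unfolding eq by (rule integral_gauss_prod[OF fi])
  also have "\<dots> = (\<integral>z. f 0 z \<partial>gauss1) * (\<Prod>j\<in>{..<n} - {0}. \<integral>z. f j z \<partial>gauss1)"
    using n by (intro prod.remove) auto
  also have "(\<Prod>j\<in>{..<n} - {0}. \<integral>z. f j z \<partial>gauss1) = (if P then 1 else 0)"
  proof (cases P)
    case True
    then have "(\<Prod>j\<in>{..<n} - {0}. \<integral>z. f j z \<partial>gauss1) = 1"
      by (intro prod.neutral ballI) (simp add: fj P_def)
    then show ?thesis using True by simp
  next
    case False
    then obtain j where j: "0 < j" "j < n" "\<not> (fst \<kappa> j = fst \<kappa>' j \<and> snd \<kappa> j = snd \<kappa>' j)"
      unfolding P_def by blast
    have "(\<Prod>j\<in>{..<n} - {0}. \<integral>z. f j z \<partial>gauss1) = 0"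
      using j by (intro prod_zero bexI[of _ j]) (simp_all add: fj)
    then show ?thesis using False by simp
  qed
  finally show "(\<integral>z. herm n \<kappa> z * cnj (herm n \<kappa>' z) * of_real (F (cmod (z 0))) \<partial>gauss n)
      = (if \<forall>j. 0 < j \<longrightarrow> j < n \<longrightarrow> fst \<kappa> j = fst \<kappa>' j \<and> snd \<kappa> j = snd \<kappa>' j then
          (\<integral>z. hermite1 (fst \<kappa> 0) (snd \<kappa> 0) z * cnj (hermite1 (fst \<kappa>' 0) (snd \<kappa>' 0) z) * of_real (F (cmod z)) \<partial>gauss1) else 0)"
    unfolding P_def[symmetric] by (simp add: f_def)
qed

lemma hermite1_weighted_integrable:
  assumes [measurable]: "F \<in> borel_measurable borel" and F: "\<And>r. 0 \<le> F r"
    and "integrable radial_measure (\<lambda>r. (hermite_radial a b r)\<^sup>2 * F r)" "integrable radial_measure (\<lambda>r. (hermite_radial a' b' r)\<^sup>2 * F r)"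
  shows "integrable gauss1 (\<lambda>z. hermite1 a b z * cnj (hermite1 a' b' z) * of_real (F (cmod z)))"
proof (rule Bochner_Integration.integrable_bound)
  have "integrable radial_measure (\<lambda>r. (hermite_radial a b r)\<^sup>2 * F r + (hermite_radial a' b' r)\<^sup>2 * F r)"
    using assms by (intro Bochner_Integration.integrable_add)
  then show "integrable gauss1 (\<lambda>z. (hermite_radial a b (cmod z))\<^sup>2 * F (cmod z) + (hermite_radial a' b' (cmod z))\<^sup>2 * F (cmod z))"
    by (subst integral_gauss1_cmod(2)) auto
  have "cmod (hermite1 a b z * cnj (hermite1 a' b' z) * of_real (F (cmod z)))
     \<le> (hermite_radial a b (cmod z))\<^sup>2 * F (cmod z) + (hermite_radial a' b' (cmod z))\<^sup>2 * F (cmod z)" (is "?l z \<le> ?r z") for z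
    using mult_right_mono[OF mult_le_sum_squares[of "cmod (hermite1 a b z)" "cmod (hermite1 a' b' z)"] F[of "cmod z"]]
    by (simp add: norm_mult hermite1_norm_sq F distrib_right)
  then show "AE z in gauss1. norm (hermite1 a b z * cnj (hermite1 a' b' z) * of_real (F (cmod z)))
     \<le> norm ((hermite_radial a b (cmod z))\<^sup>2 * F (cmod z) + (hermite_radial a' b' (cmod z))\<^sup>2 * F (cmod z))"
    unfolding real_norm_def by (intro AE_I2 order_trans[OF _ abs_ge_self])
qed measurable

lemma hermite1_weighted_integral:
  assumes [measurable]: "F \<in> borel_measurable borel" and "real a - real b = real a' - real b'"
  shows "(\<integral>z. hermite1 a b z * cnj (hermite1 a' b' z) * of_real (F (cmod z)) \<partial>gauss1)
    = of_real (\<integral>r. hermite_radial a b r * hermite_radial a' b' r * F r \<partial>radial_measure)"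
proof -
  have "(\<integral>z. hermite1 a b z * cnj (hermite1 a' b' z) * of_real (F (cmod z)) \<partial>gauss1)
    = (\<integral>z. complex_of_real (hermite_radial a b (cmod z) * hermite_radial a' b' (cmod z) * F (cmod z)) \<partial>gauss1)"
    unfolding hermite1_mult_cnj[OF assms(2)] by simp
  also have "\<dots> = of_real (\<integral>z. hermite_radial a b (cmod z) * hermite_radial a' b' (cmod z) * F (cmod z) \<partial>gauss1)"
    by (rule integral_complex_of_real)
  also have "(\<integral>z. hermite_radial a b (cmod z) * hermite_radial a' b' (cmod z) * F (cmod z) \<partial>gauss1)
    = (\<integral>r. hermite_radial a b r * hermite_radial a' b' r * F r \<partial>radial_measure)"
    by (rule integral_gauss1_cmod(1)) measurable
  finally show ?thesis .
qed

lemma weighted_bdd_integrable: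
  assumes n: "0 < n" and [measurable]: "w \<in> borel_measurable borel" and w: "\<And>r. 0 \<le> w r" and int: "integrable radial_measure w"
    and f: "bdd_meas n f"
  shows "integrable (gauss n) (\<lambda>z. w (cmod (z 0)) * (cmod (f z))\<^sup>2)"
proof -
  obtain C where C: "0 \<le> C" "\<And>z. z \<in> space (gauss n) \<Longrightarrow> cmod (f z) \<le> C"
    using bdd_meas_bound[OF f] by metis
  have [measurable]: "f \<in> borel_measurable (gauss n)" "(\<lambda>z. z 0) \<in> borel_measurable (gauss n)"
    using bdd_meas_measurable[OF f] gauss_component_measurable[OF n] by auto
  show ?thesis
  proof (rule Bochner_Integration.integrable_bound)
  have "integrable gauss1 (\<lambda>z. w (cmod z))" using int by (subst integral_gauss1_cmod(2)) auto
  then have "integrable (gauss n) (\<lambda>z. w (cmod (z 0)))"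
    by (subst integral_gauss_component(2)[OF n, where f = "\<lambda>z. w (cmod z)"]) auto
  then show "integrable (gauss n) (\<lambda>z. w (cmod (z 0)) * C\<^sup>2)" by simp
  show "AE z in gauss n. norm (w (cmod (z 0)) * (cmod (f z))\<^sup>2) \<le> norm (w (cmod (z 0)) * C\<^sup>2)"
  proof (rule AE_I2)
    fix z assume "z \<in> space (gauss n)"
    then have "w (cmod (z 0)) * (cmod (f z))\<^sup>2 \<le> w (cmod (z 0)) * C\<^sup>2"
      by (intro mult_left_mono power_mono C w) auto
    then show "norm (w (cmod (z 0)) * (cmod (f z))\<^sup>2) \<le> norm (w (cmod (z 0)) * C\<^sup>2)"
      using w by (simp add: abs_mult)
  qed
  show "(\<lambda>z. w (cmod (z 0)) * (cmod (f z))\<^sup>2) \<in> borel_measurable (gauss n)" by measurable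
  qed
qed

text \<open>Pointwise 2xy \<le> wx^2 + y^2/w. The weight goes to the bounded function and its
  reciprocal to the Hermite combination, matching the hypotheses on W and on the Gram
  matrices.\<close>

lemma weighted_am_gm:
  assumes n: "0 < n" and [measurable]: "w \<in> borel_measurable borel" and w: "\<And>r. 0 < w r" and int: "integrable radial_measure w"
    and f: "bdd_meas n f" and g: "g \<in> L2 n"
    and gi: "integrable (gauss n) (\<lambda>z. (cmod (g z))\<^sup>2 / w (cmod (z 0)))"
  shows "2 * Re (L2_inner n f g) \<le> (\<integral>z. w (cmod (z 0)) * (cmod (f z))\<^sup>2 \<partial>gauss n) + (\<integral>z. (cmod (g z))\<^sup>2 / w (cmod (z 0)) \<partial>gauss n)"
proof -
  have fi: "integrable (gauss n) (\<lambda>z. w (cmod (z 0)) * (cmod (f z))\<^sup>2)"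
    using w by (intro weighted_bdd_integrable[OF n _ _ int f]) (auto intro: less_imp_le)
  have fgi: "integrable (gauss n) (\<lambda>z. f z * cnj (g z))"
    by (rule L2_integrable_inner[OF bdd_meas_L2[OF f] g])
  have pw: "2 * Re (f z * cnj (g z)) \<le> w (cmod (z 0)) * (cmod (f z))\<^sup>2 + (cmod (g z))\<^sup>2 / w (cmod (z 0))" for z
  proof -
    define s where "s = w (cmod (z 0))"
    have s: "0 < s" using w by (simp add: s_def)
    have "0 \<le> (sqrt s * cmod (f z) - cmod (g z) / sqrt s)\<^sup>2" by simp
    also have "\<dots> = s * (cmod (f z))\<^sup>2 + (cmod (g z))\<^sup>2 / s - 2 * (cmod (f z) * cmod (g z))"
      using s by (simp add: power2_diff power_mult_distrib power_divide)
    finally have "2 * (cmod (f z) * cmod (g z)) \<le> s * (cmod (f z))\<^sup>2 + (cmod (g z))\<^sup>2 / s" by simp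
    moreover have "Re (f z * cnj (g z)) \<le> cmod (f z) * cmod (g z)"
      using complex_Re_le_cmod[of "f z * cnj (g z)"] by (simp add: norm_mult)
    ultimately show ?thesis unfolding s_def by linarith
  qed
  have "2 * Re (L2_inner n f g) = (\<integral>z. 2 * Re (f z * cnj (g z)) \<partial>gauss n)"
    unfolding L2_inner_def by (simp only: integral_Re[OF fgi, symmetric] integral_mult_right_zero)
  also have "\<dots> \<le> (\<integral>z. w (cmod (z 0)) * (cmod (f z))\<^sup>2 + (cmod (g z))\<^sup>2 / w (cmod (z 0)) \<partial>gauss n)"
    using fi gi fgi pw by (intro integral_mono integrable_mult_right integrable_Re Bochner_Integration.integrable_add) auto
  also have "\<dots> = (\<integral>z. w (cmod (z 0)) * (cmod (f z))\<^sup>2 \<partial>gauss n) + (\<integral>z. (cmod (g z))\<^sup>2 / w (cmod (z 0)) \<partial>gauss n)"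
    using fi gi by (rule Bochner_Integration.integral_add)
  finally show ?thesis .
qed

subsection \<open>Weighted bounds from the Gram matrices and the Schur scalar\<close>

text \<open>The exponents of the coordinates other than \<open>z 0\<close>, kept as an index pair
  with zeros in front. Hermite functions with different tails stay orthogonal under a weight in
  \<open>z 0\<close>.\<close>

definition tail :: "(nat \<Rightarrow> nat) \<times> (nat \<Rightarrow> nat) \<Rightarrow> (nat \<Rightarrow> nat) \<times> (nat \<Rightarrow> nat)" where
  "tail \<kappa> = ((fst \<kappa>)(0 := 0), (snd \<kappa>)(0 := 0))"

definition with_head :: "nat \<Rightarrow> nat \<Rightarrow> (nat \<Rightarrow> nat) \<times> (nat \<Rightarrow> nat) \<Rightarrow> (nat \<Rightarrow> nat) \<times> (nat \<Rightarrow> nat)" where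
  "with_head a b t = ((fst t)(0 := a), (snd t)(0 := b))"

lemma sum_head_tail:
  fixes \<alpha> :: "nat \<Rightarrow> nat"
  assumes "0 < n"
  shows "(\<Sum>j<n. \<alpha> j) = \<alpha> 0 + (\<Sum>j<n. (\<alpha>(0 := 0)) j)"
proof -
  have "(\<Sum>j<n. \<beta> j) = \<beta> 0 + (\<Sum>j\<in>{..<n} - {0}. \<beta> j)" for \<beta> :: "nat \<Rightarrow> nat"
    using assms by (intro sum.remove) auto
  from this[of \<alpha>] this[of "\<alpha>(0 := 0)"] show ?thesis by simp
qed

lemma tail_eq_iff:
  assumes "\<kappa> \<in> ext_pairs n" "\<kappa>' \<in> ext_pairs n" "0 < n"
  shows "tail \<kappa> = tail \<kappa>' \<longleftrightarrow> (\<forall>j. 0 < j \<longrightarrow> j < n \<longrightarrow> fst \<kappa> j = fst \<kappa>' j \<and> snd \<kappa> j = snd \<kappa>' j)" (is "?l \<longleftrightarrow> ?r")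
proof
  assume ?l
  then have "\<And>j. ((fst \<kappa>)(0 := 0)) j = ((fst \<kappa>')(0 := 0)) j" "\<And>j. ((snd \<kappa>)(0 := 0)) j = ((snd \<kappa>')(0 := 0)) j"
    unfolding tail_def by simp_all
  then show ?r by (metis fun_upd_apply less_numeral_extra(3))
next
  assume r: ?r
  have e: "\<And>j. \<not> j < n \<Longrightarrow> fst \<kappa> j = undefined \<and> fst \<kappa>' j = undefined \<and> snd \<kappa> j = undefined \<and> snd \<kappa>' j = undefined"
    using assms by (auto simp: ext_pairs_def mem_Times_iff extensional_def)
  have "((fst \<kappa>)(0 := 0)) j = ((fst \<kappa>')(0 := 0)) j \<and> ((snd \<kappa>)(0 := 0)) j = ((snd \<kappa>')(0 := 0)) j" for j
    using r e[of j] by (cases "j = 0"; cases "j < n") auto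
  then show ?l unfolding tail_def by (simp add: fun_eq_iff)
qed

text \<open>The hypotheses in the form in which W enters the proof, as a weight depending on the
  modulus of one coordinate.\<close>

locale gram_weight =
  fixes \<Lambda> :: "nat set" and \<beta> :: "nat \<Rightarrow> real" and W :: "real \<Rightarrow> real"
  assumes finite_Lambda: "finite \<Lambda>"
    and beta_pos: "\<And>l. l \<in> \<Lambda> \<Longrightarrow> 0 < \<beta> l"
    and W_measurable: "(\<lambda>r. W (r\<^sup>2)) \<in> borel_measurable borel"
    and W_pos: "\<And>r. 0 < W (r\<^sup>2)"
    and W_integrable: "integrable radial_measure (\<lambda>r. W (r\<^sup>2))"
    and gram_integrable: "\<And>p q l m. l \<in> gram_index \<Lambda> p q \<Longrightarrow> m \<in> gram_index \<Lambda> p q \<Longrightarrow>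
      integrable radial_measure (gram_integrand W p q l m)"
    and gram_le: "\<And>p q. gram_index \<Lambda> p q \<noteq> {} \<Longrightarrow> loewner_le_on (gram_index \<Lambda> p q) (gram_mat \<beta> W p q) id_mat"
begin

definition level_indices :: "nat \<Rightarrow> ((nat \<Rightarrow> nat) \<times> (nat \<Rightarrow> nat)) set" where
  "level_indices n = (\<Union>l\<in>\<Lambda>. pair_indices n (Suc l) l)"

text \<open>On \<open>level_indices\<close> the two degrees differ by one, so the degree in the
  conjugates identifies the number l of the level.\<close>

definition level :: "nat \<Rightarrow> (nat \<Rightarrow> nat) \<times> (nat \<Rightarrow> nat) \<Rightarrow> nat" where
  "level n \<kappa> = (\<Sum>j<n. snd \<kappa> j)"

lemma finite_level_indices [simp]: "finite (level_indices n)"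
  by (simp add: level_indices_def finite_Lambda)

lemma level_indices_iff:
  "\<kappa> \<in> level_indices n \<longleftrightarrow> \<kappa> \<in> ext_pairs n \<and> level n \<kappa> \<in> \<Lambda> \<and> (\<Sum>j<n. fst \<kappa> j) = Suc (level n \<kappa>)"
  by (auto simp only: level_indices_def level_def pair_indices_iff UN_iff)

lemma sum_level_indices:
  "(\<Sum>\<kappa>\<in>level_indices n. g (level n \<kappa>) \<kappa>) = (\<Sum>l\<in>\<Lambda>. \<Sum>\<kappa>\<in>pair_indices n (Suc l) l. g l \<kappa>)" for g :: "nat \<Rightarrow> _ \<Rightarrow> real"
proof -
  have "(\<Sum>\<kappa>\<in>level_indices n. g (level n \<kappa>) \<kappa>) = (\<Sum>l\<in>\<Lambda>. \<Sum>\<kappa>\<in>pair_indices n (Suc l) l. g (level n \<kappa>) \<kappa>)"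
    unfolding level_indices_def
  proof (rule sum.UNION_disjoint)
    show "\<forall>i\<in>\<Lambda>. \<forall>j\<in>\<Lambda>. i \<noteq> j \<longrightarrow> pair_indices n (Suc i) i \<inter> pair_indices n (Suc j) j = {}"
      using pair_indices_disjoint by simp
  qed (simp_all add: finite_Lambda)
  also have "\<dots> = (\<Sum>l\<in>\<Lambda>. \<Sum>\<kappa>\<in>pair_indices n (Suc l) l. g l \<kappa>)"
    by (intro sum.cong refl) (simp add: pair_indices_iff level_def)
  finally show ?thesis .
qed

abbreviation block :: "nat \<Rightarrow> (nat \<Rightarrow> nat) \<times> (nat \<Rightarrow> nat) \<Rightarrow> ((nat \<Rightarrow> nat) \<times> (nat \<Rightarrow> nat)) set" where
  "block n t \<equiv> {\<kappa> \<in> level_indices n. tail \<kappa> = t}"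

context
  fixes n :: nat assumes n: "0 < n"
begin

lemma level_head:
  assumes "\<kappa> \<in> level_indices n"
  shows "fst \<kappa> 0 + (\<Sum>j<n. fst (tail \<kappa>) j) = Suc (level n \<kappa>)" and "snd \<kappa> 0 + (\<Sum>j<n. snd (tail \<kappa>) j) = level n \<kappa>"
  using assms sum_head_tail[OF n, of "fst \<kappa>"] sum_head_tail[OF n, of "snd \<kappa>"]
  by (simp_all add: level_indices_iff level_def tail_def)

text \<open>The two degrees of the tail play the part of p and q in the Gram matrices; what remains
  for \<open>z 0\<close> is then l + 1 - p and l - q.\<close>

lemma level_in_gram_index:
  assumes "\<kappa> \<in> level_indices n"
  shows "level n \<kappa> \<in> gram_index \<Lambda> (\<Sum>j<n. fst (tail \<kappa>) j) (\<Sum>j<n. snd (tail \<kappa>) j)"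
  using assms level_head[OF assms] by (simp add: gram_index_def level_indices_iff)

lemma head_eq:
  assumes "\<kappa> \<in> level_indices n"
  shows "fst \<kappa> 0 = level n \<kappa> + 1 - (\<Sum>j<n. fst (tail \<kappa>) j)" and "snd \<kappa> 0 = level n \<kappa> - (\<Sum>j<n. snd (tail \<kappa>) j)"
  using level_head[OF assms] by simp_all

text \<open>Within a block the index is determined by its level, which ranges over the index set of a
  Gram matrix.\<close>

lemma block_bij:
  assumes t: "t = tail \<kappa>0" "\<kappa>0 \<in> level_indices n"
  defines "p \<equiv> \<Sum>j<n. fst t j" and "q \<equiv> \<Sum>j<n. snd t j"
  shows "bij_betw (\<lambda>l. with_head (l + 1 - p) (l - q) t) (gram_index \<Lambda> p q) (block n t)"
proof (rule bij_betw_byWitness[where f' = "level n"])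
  have e: "\<kappa>0 \<in> ext_pairs n" using t by (simp add: level_indices_iff)
  have te: "fst t j = undefined" "snd t j = undefined" if "\<not> j < n" for j
    using that e n by (auto simp: t tail_def ext_pairs_def mem_Times_iff extensional_def)
  have t0: "fst t 0 = 0" "snd t 0 = 0" by (simp_all add: t tail_def)
  have sums: "(\<Sum>j<n. fst (with_head a b t) j) = a + p" "(\<Sum>j<n. snd (with_head a b t) j) = b + q" for a b
    using sum_head_tail[OF n, of "(fst t)(0 := a)"] sum_head_tail[OF n, of "(snd t)(0 := b)"] t0
    by (simp_all add: with_head_def p_def q_def fun_upd_idem)
  have tw: "tail (with_head a b t) = t" for a b
    using t0 by (simp add: tail_def with_head_def fun_upd_idem prod_eq_iff)
  have lev: "level n (with_head (l + 1 - p) (l - q) t) = l" if "l \<in> gram_index \<Lambda> p q" for l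
    using that by (simp add: level_def sums gram_index_def)
  then show "\<forall>l\<in>gram_index \<Lambda> p q. level n (with_head (l + 1 - p) (l - q) t) = l" by blast
  show "\<forall>\<kappa>\<in>block n t. with_head (level n \<kappa> + 1 - p) (level n \<kappa> - q) t = \<kappa>"
  proof
    fix \<kappa> assume "\<kappa> \<in> block n t"
    then have k: "\<kappa> \<in> level_indices n" and kt: "tail \<kappa> = t" by auto
    have h: "fst \<kappa> 0 = level n \<kappa> + 1 - p" "snd \<kappa> 0 = level n \<kappa> - q"
      using head_eq[OF k] by (simp_all add: kt p_def q_def)
    show "with_head (level n \<kappa> + 1 - p) (level n \<kappa> - q) t = \<kappa>"
      unfolding h[symmetric] kt[symmetric] with_head_def tail_def by (simp add: prod_eq_iff)
  qed
  show "(\<lambda>l. with_head (l + 1 - p) (l - q) t) ` gram_index \<Lambda> p q \<subseteq> block n t"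
  proof
    fix \<kappa> assume "\<kappa> \<in> (\<lambda>l. with_head (l + 1 - p) (l - q) t) ` gram_index \<Lambda> p q"
    then obtain l where l: "l \<in> gram_index \<Lambda> p q" and \<kappa>: "\<kappa> = with_head (l + 1 - p) (l - q) t" by blast
    have "\<kappa> \<in> ext_pairs n"
      using te n by (simp add: \<kappa> with_head_def ext_pairs_def extensional_def)
    then have "\<kappa> \<in> level_indices n"
      using l lev[OF l] by (simp add: level_indices_iff \<kappa> sums gram_index_def)
    then show "\<kappa> \<in> block n t" using tw by (simp add: \<kappa>)
  qed
  show "level n ` block n t \<subseteq> gram_index \<Lambda> p q"
  proof
    fix l assume "l \<in> level n ` block n t"
    then obtain \<kappa> where "\<kappa> \<in> level_indices n" "tail \<kappa> = t" "l = level n \<kappa>" by blast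
    then show "l \<in> gram_index \<Lambda> p q" using level_in_gram_index[of \<kappa>] by (simp add: p_def q_def)
  qed
qed

definition weighted_inner :: "(nat \<Rightarrow> nat) \<times> (nat \<Rightarrow> nat) \<Rightarrow> (nat \<Rightarrow> nat) \<times> (nat \<Rightarrow> nat) \<Rightarrow> (nat \<Rightarrow> complex) \<Rightarrow> complex" where
  "weighted_inner \<kappa> \<kappa>' z = herm n \<kappa> z * cnj (herm n \<kappa>' z) * of_real (1 / W ((cmod (z 0))\<^sup>2))"

lemma inverse_W_measurable: "(\<lambda>r. 1 / W (r\<^sup>2)) \<in> borel_measurable borel"
  using W_measurable by measurable

lemma radial_weighted_integrable:
  assumes "\<kappa> \<in> level_indices n"
  shows "integrable radial_measure (\<lambda>r. (hermite_radial (fst \<kappa> 0) (snd \<kappa> 0) r)\<^sup>2 * (1 / W (r\<^sup>2)))"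
proof -
  note l = level_in_gram_index[OF assms]
  show ?thesis using gram_integrable[OF l l]
    unfolding gram_integrand_def head_eq[OF assms, symmetric] by (simp add: power2_eq_square)
qed

lemma weighted_inner_gauss1_integrable:
  assumes "\<kappa> \<in> level_indices n" "\<kappa>' \<in> level_indices n"
  shows "integrable gauss1 (\<lambda>z. hermite1 (fst \<kappa> 0) (snd \<kappa> 0) z * cnj (hermite1 (fst \<kappa>' 0) (snd \<kappa>' 0) z) * of_real (1 / W ((cmod z)\<^sup>2)))"
  by (rule hermite1_weighted_integrable[OF inverse_W_measurable _ radial_weighted_integrable[OF assms(1)] radial_weighted_integrable[OF assms(2)]])
    (simp add: less_imp_le[OF W_pos])

lemma weighted_inner_integrable:
  assumes "\<kappa> \<in> level_indices n" "\<kappa>' \<in> level_indices n"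
  shows "integrable (gauss n) (weighted_inner \<kappa> \<kappa>')"
  unfolding weighted_inner_def[abs_def]
  by (rule weighted_herm_inner(1)[OF n inverse_W_measurable weighted_inner_gauss1_integrable[OF assms]])

text \<open>For equal tails the two factors in \<open>z 0\<close> have the same angular degree, so
  the integral is radial and gives an entry of the Gram matrix of that tail.\<close>

lemma weighted_inner_integral:
  assumes k: "\<kappa> \<in> level_indices n" "\<kappa>' \<in> level_indices n"
  shows "(\<integral>z. weighted_inner \<kappa> \<kappa>' z \<partial>gauss n) = (if tail \<kappa> = tail \<kappa>' then
     of_real (\<integral>r. gram_integrand W (\<Sum>j<n. fst (tail \<kappa>) j) (\<Sum>j<n. snd (tail \<kappa>) j) (level n \<kappa>) (level n \<kappa>') r \<partial>radial_measure) else 0)"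
proof -
  have e: "\<kappa> \<in> ext_pairs n" "\<kappa>' \<in> ext_pairs n" using k by (simp_all add: level_indices_iff)
  have "(\<integral>z. weighted_inner \<kappa> \<kappa>' z \<partial>gauss n) = (if tail \<kappa> = tail \<kappa>' then
      (\<integral>z. hermite1 (fst \<kappa> 0) (snd \<kappa> 0) z * cnj (hermite1 (fst \<kappa>' 0) (snd \<kappa>' 0) z) * of_real (1 / W ((cmod z)\<^sup>2)) \<partial>gauss1) else 0)"
    unfolding weighted_inner_def tail_eq_iff[OF e n]
    by (rule weighted_herm_inner(2)[OF n inverse_W_measurable weighted_inner_gauss1_integrable[OF k]])
  also have "\<dots> = (if tail \<kappa> = tail \<kappa>' then
     of_real (\<integral>r. gram_integrand W (\<Sum>j<n. fst (tail \<kappa>) j) (\<Sum>j<n. snd (tail \<kappa>) j) (level n \<kappa>) (level n \<kappa>') r \<partial>radial_measure) else 0)"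
  proof (cases "tail \<kappa> = tail \<kappa>'")
    case True
    have "real (fst \<kappa> 0) - real (snd \<kappa> 0) = real (fst \<kappa>' 0) - real (snd \<kappa>' 0)"
      using level_head[OF k(1)] level_head[OF k(2)] True by simp
    from hermite1_weighted_integral[OF inverse_W_measurable this]
    show ?thesis unfolding if_P[OF True] gram_integrand_def
      using head_eq[OF k(1)] head_eq[OF k(2)] True by simp
  qed simp
  finally show ?thesis .
qed

lemma block_gram_bound:
  assumes t: "t = tail \<kappa>0" "\<kappa>0 \<in> level_indices n"
  shows "Re (\<Sum>\<kappa>\<in>block n t. \<Sum>\<kappa>'\<in>block n t. (of_real (\<beta> (level n \<kappa>)) * c \<kappa>) * cnj (of_real (\<beta> (level n \<kappa>')) * c \<kappa>') * (\<integral>z. weighted_inner \<kappa> \<kappa>' z \<partial>gauss n))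
    \<le> (\<Sum>\<kappa>\<in>block n t. \<beta> (level n \<kappa>) * (cmod (c \<kappa>))\<^sup>2)"
proof -
  define p q where "p = (\<Sum>j<n. fst t j)" and "q = (\<Sum>j<n. snd t j)"
  define I where "I = gram_index \<Lambda> p q"
  define K where "K l = with_head (l + 1 - p) (l - q) t" for l
  have bij: "bij_betw K I (block n t)"
    unfolding K_def[abs_def] I_def p_def q_def by (rule block_bij[OF t])
  have I: "finite I" "I \<subseteq> \<Lambda>" using finite_Lambda by (auto simp: I_def gram_index_def)
  have Ine: "I \<noteq> {}" using level_in_gram_index[OF t(2)] by (auto simp: I_def p_def q_def t(1))
  have KB: "K l \<in> level_indices n" "tail (K l) = t" if "l \<in> I" for l
    using bij_betwE[OF bij] that by auto
  have lev: "level n (K l) = l" if "l \<in> I" for l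
  proof -
    have h: "snd (K l) 0 = l - q" by (simp add: K_def with_head_def)
    have "q \<le> l" using that by (simp add: I_def gram_index_def)
    then show ?thesis using level_head(2)[OF KB(1)[OF that]] h by (simp add: KB(2)[OF that] q_def)
  qed
  have re: "(\<Sum>\<kappa>\<in>block n t. F \<kappa>) = (\<Sum>l\<in>I. F (K l))" for F :: "_ \<Rightarrow> 'z::comm_monoid_add"
    by (rule sum.reindex_bij_betw[OF bij, symmetric])
  \<comment> \<open>One square root of \<beta> goes into \<open>gram_mat\<close>; the other is left
    in the vector, so that the Gram condition returns the form \<Sum> \<beta> |c|^2.\<close>
  define x where "x l = of_real (sqrt (\<beta> l)) * c (K l)" for l
  have b: "0 < \<beta> l" if "l \<in> I" for l using beta_pos I that by blast
  have e1: "(\<Sum>\<kappa>\<in>block n t. \<Sum>\<kappa>'\<in>block n t. (of_real (\<beta> (level n \<kappa>)) * c \<kappa>) * cnj (of_real (\<beta> (level n \<kappa>')) * c \<kappa>') * (\<integral>z. weighted_inner \<kappa> \<kappa>' z \<partial>gauss n))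
    = (\<Sum>l\<in>I. \<Sum>m\<in>I. x l * of_real (gram_mat \<beta> W p q l m) * cnj (x m))"
    unfolding re
  proof (intro sum.cong refl)
    fix l m assume l: "l \<in> I" and m: "m \<in> I"
    define g where "g = (\<integral>r. gram_integrand W p q l m r \<partial>radial_measure)"
    have "(\<integral>z. weighted_inner (K l) (K m) z \<partial>gauss n) = of_real g"
      unfolding weighted_inner_integral[OF KB(1)[OF l] KB(1)[OF m]] g_def KB(2)[OF l] KB(2)[OF m] lev[OF l] lev[OF m] p_def q_def by simp
    moreover have "complex_of_real (\<beta> l) = of_real (sqrt (\<beta> l)) * of_real (sqrt (\<beta> l))" "complex_of_real (\<beta> m) = of_real (sqrt (\<beta> m)) * of_real (sqrt (\<beta> m))"
      using b[OF l] b[OF m] unfolding of_real_mult[symmetric] by simp_all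
    moreover have "gram_mat \<beta> W p q l m = sqrt (\<beta> l) * sqrt (\<beta> m) * g"
      by (simp add: gram_mat_def g_def real_sqrt_mult)
    ultimately show "(of_real (\<beta> (level n (K l))) * c (K l)) * cnj (of_real (\<beta> (level n (K m))) * c (K m)) * (\<integral>z. weighted_inner (K l) (K m) z \<partial>gauss n)
      = x l * of_real (gram_mat \<beta> W p q l m) * cnj (x m)"
      unfolding lev[OF l] lev[OF m] x_def by (simp add: mult_ac)
  qed
  have e2: "0 \<le> Re (\<Sum>l\<in>I. \<Sum>m\<in>I. x l * of_real (id_mat l m - gram_mat \<beta> W p q l m) * cnj (x m))"
    using gram_le[of p q] Ine unfolding loewner_le_on_def I_def by (intro psd_complex) blast
  have e3: "(\<Sum>l\<in>I. \<Sum>m\<in>I. x l * of_real (id_mat l m - gram_mat \<beta> W p q l m) * cnj (x m))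
    = (\<Sum>l\<in>I. \<Sum>m\<in>I. x l * of_real (id_mat l m) * cnj (x m)) - (\<Sum>l\<in>I. \<Sum>m\<in>I. x l * of_real (gram_mat \<beta> W p q l m) * cnj (x m))"
    by (simp add: right_diff_distrib left_diff_distrib sum_subtractf)
  have e4: "(\<Sum>l\<in>I. \<Sum>m\<in>I. x l * of_real (id_mat l m) * cnj (x m)) = of_real (\<Sum>\<kappa>\<in>block n t. \<beta> (level n \<kappa>) * (cmod (c \<kappa>))\<^sup>2)"
  proof -
    have "(\<Sum>m\<in>I. x l * of_real (id_mat l m) * cnj (x m)) = of_real (\<beta> l * (cmod (c (K l)))\<^sup>2)" if l: "l \<in> I" for l
    proof -
      have "(\<Sum>m\<in>I. x l * of_real (id_mat l m) * cnj (x m)) = (\<Sum>m\<in>I. if l = m then x l * cnj (x l) else 0)"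
        by (intro sum.cong refl) (simp add: id_mat_def diag_mat_def)
      also have "\<dots> = x l * cnj (x l)" using I l by simp
      also have "\<dots> = of_real ((cmod (x l))\<^sup>2)" by (simp only: complex_norm_square)
      also have "(cmod (x l))\<^sup>2 = \<beta> l * (cmod (c (K l)))\<^sup>2"
        using b[OF l] by (simp add: x_def norm_mult power_mult_distrib)
      finally show ?thesis .
    qed
    then show ?thesis unfolding re by (simp add: lev)
  qed
  show ?thesis
    unfolding e1 using e2[unfolded e3 e4 minus_complex.simps Re_complex_of_real] by linarith
qed

text \<open>Duality with g = \<Sum> \<beta>_l Q_l k. The inner product of \<open>k\<close> and
  \<open>g\<close> is the left side X, the Gram condition bounds the integral of |g|^2/W by X as
  well, and weighted Cauchy--Schwarz gives 2X \<le> \<integral> W |k|^2 + X.\<close>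

lemma gram_bound:
  assumes k: "bdd_meas n k"
  shows "(\<Sum>l\<in>\<Lambda>. \<beta> l * qsq n l k) \<le> (\<integral>z. W ((cmod (z 0))\<^sup>2) * (cmod (k z))\<^sup>2 \<partial>gauss n)"
proof -
  define c where "c \<kappa> = coef n \<kappa> k" for \<kappa>
  define d where "d \<kappa> = of_real (\<beta> (level n \<kappa>)) * c \<kappa>" for \<kappa>
  define X where "X = (\<Sum>\<kappa>\<in>level_indices n. \<beta> (level n \<kappa>) * (cmod (c \<kappa>))\<^sup>2)"
  define g where "g = hermite_comb n (level_indices n) d"
  have X: "X = (\<Sum>l\<in>\<Lambda>. \<beta> l * qsq n l k)"
    unfolding X_def qsq_def sum_distrib_left c_def
    by (rule sum_level_indices[where g = "\<lambda>l \<kappa>. \<beta> l * (cmod (coef n \<kappa> k))\<^sup>2"])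
  have kg: "L2_inner n k g = of_real X"
    unfolding g_def L2_inner_hermite_comb_right[OF bdd_meas_L2[OF k]] X_def of_real_sum
    unfolding d_def c_def of_real_mult complex_norm_square by (intro sum.cong refl) (simp add: mult_ac)
  have g2: "complex_of_real ((cmod (g z))\<^sup>2 / W ((cmod (z 0))\<^sup>2))
    = (\<Sum>\<kappa>\<in>level_indices n. \<Sum>\<kappa>'\<in>level_indices n. d \<kappa> * cnj (d \<kappa>') * weighted_inner \<kappa> \<kappa>' z)" for z
  proof -
    have e: "complex_of_real ((cmod (g z))\<^sup>2 / W ((cmod (z 0))\<^sup>2)) = g z * cnj (g z) * of_real (1 / W ((cmod (z 0))\<^sup>2))"
      unfolding complex_norm_square[symmetric] by simp
    have p: "g z * cnj (g z) = (\<Sum>\<kappa>\<in>level_indices n. \<Sum>\<kappa>'\<in>level_indices n. (d \<kappa> * herm n \<kappa> z) * cnj (d \<kappa>' * herm n \<kappa>' z))"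
      unfolding g_def hermite_comb_def cnj_sum sum_product ..
    show ?thesis unfolding e p sum_distrib_right weighted_inner_def
      by (intro sum.cong refl) (simp only: complex_cnj_mult mult_ac)
  qed
  have gi': "integrable (gauss n) (\<lambda>z. \<Sum>\<kappa>\<in>level_indices n. \<Sum>\<kappa>'\<in>level_indices n. d \<kappa> * cnj (d \<kappa>') * weighted_inner \<kappa> \<kappa>' z)"
    by (intro Bochner_Integration.integrable_sum integrable_mult_right weighted_inner_integrable)
  have gi: "integrable (gauss n) (\<lambda>z. (cmod (g z))\<^sup>2 / W ((cmod (z 0))\<^sup>2))"
    using integrable_Re[OF gi'] unfolding g2[symmetric] by simp
  define Z where "Z = (\<integral>z. (cmod (g z))\<^sup>2 / W ((cmod (z 0))\<^sup>2) \<partial>gauss n)"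
  have "complex_of_real Z = (\<integral>z. (\<Sum>\<kappa>\<in>level_indices n. \<Sum>\<kappa>'\<in>level_indices n. d \<kappa> * cnj (d \<kappa>') * weighted_inner \<kappa> \<kappa>' z) \<partial>gauss n)"
    unfolding g2[symmetric] Z_def by (rule integral_complex_of_real[symmetric])
  also have "\<dots> = (\<Sum>\<kappa>\<in>level_indices n. \<Sum>\<kappa>'\<in>level_indices n. d \<kappa> * cnj (d \<kappa>') * (\<integral>z. weighted_inner \<kappa> \<kappa>' z \<partial>gauss n))"
    by (subst Bochner_Integration.integral_sum, intro Bochner_Integration.integrable_sum integrable_mult_right weighted_inner_integrable, assumption+,
        intro sum.cong refl, subst Bochner_Integration.integral_sum, intro integrable_mult_right weighted_inner_integrable, assumption+,
        intro sum.cong refl integral_mult_right_zero)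
  \<comment> \<open>Different tails do not interact, so the form splits into blocks, one for each
    tail.\<close>
  also have "\<dots> = (\<Sum>\<kappa>\<in>level_indices n. \<Sum>\<kappa>'\<in>block n (tail \<kappa>). d \<kappa> * cnj (d \<kappa>') * (\<integral>z. weighted_inner \<kappa> \<kappa>' z \<partial>gauss n))"
  proof (rule sum.cong[OF refl])
    fix \<kappa> assume "\<kappa> \<in> level_indices n"
    then show "(\<Sum>\<kappa>'\<in>level_indices n. d \<kappa> * cnj (d \<kappa>') * (\<integral>z. weighted_inner \<kappa> \<kappa>' z \<partial>gauss n))
      = (\<Sum>\<kappa>'\<in>block n (tail \<kappa>). d \<kappa> * cnj (d \<kappa>') * (\<integral>z. weighted_inner \<kappa> \<kappa>' z \<partial>gauss n))"
      by (intro sum.mono_neutral_right) (auto simp: weighted_inner_integral)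
  qed
  also have "\<dots> = (\<Sum>t\<in>tail ` level_indices n. \<Sum>\<kappa>\<in>block n t. \<Sum>\<kappa>'\<in>block n (tail \<kappa>). d \<kappa> * cnj (d \<kappa>') * (\<integral>z. weighted_inner \<kappa> \<kappa>' z \<partial>gauss n))"
    by (rule sum.image_gen[OF finite_level_indices])
  also have "\<dots> = (\<Sum>t\<in>tail ` level_indices n. \<Sum>\<kappa>\<in>block n t. \<Sum>\<kappa>'\<in>block n t. d \<kappa> * cnj (d \<kappa>') * (\<integral>z. weighted_inner \<kappa> \<kappa>' z \<partial>gauss n))"
    by (intro sum.cong refl) simp
  finally have "Z = (\<Sum>t\<in>tail ` level_indices n. Re (\<Sum>\<kappa>\<in>block n t. \<Sum>\<kappa>'\<in>block n t. d \<kappa> * cnj (d \<kappa>') * (\<integral>z. weighted_inner \<kappa> \<kappa>' z \<partial>gauss n)))"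
    by (metis Re_complex_of_real Re_sum)
  also have "\<dots> \<le> (\<Sum>t\<in>tail ` level_indices n. \<Sum>\<kappa>\<in>block n t. \<beta> (level n \<kappa>) * (cmod (c \<kappa>))\<^sup>2)"
  proof (rule sum_mono)
    fix t assume "t \<in> tail ` level_indices n"
    then obtain \<kappa>0 where "t = tail \<kappa>0" "\<kappa>0 \<in> level_indices n" by blast
    from block_gram_bound[OF this, of c]
    show "Re (\<Sum>\<kappa>\<in>block n t. \<Sum>\<kappa>'\<in>block n t. d \<kappa> * cnj (d \<kappa>') * (\<integral>z. weighted_inner \<kappa> \<kappa>' z \<partial>gauss n))
      \<le> (\<Sum>\<kappa>\<in>block n t. \<beta> (level n \<kappa>) * (cmod (c \<kappa>))\<^sup>2)" unfolding d_def .
  qed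
  also have "\<dots> = X"
    unfolding X_def by (rule sum.image_gen[OF finite_level_indices, symmetric])
  finally have "Z \<le> X" .
  moreover have "2 * X \<le> (\<integral>z. W ((cmod (z 0))\<^sup>2) * (cmod (k z))\<^sup>2 \<partial>gauss n) + Z"
    using weighted_am_gm[OF n W_measurable W_pos W_integrable k _ gi] unfolding kg Z_def
    by (simp add: g_def)
  ultimately show ?thesis unfolding X by linarith
qed

text \<open>Here \<open>h\<close> is tested against \<open>z\<^sub>0 - \<Sum> v\<^sub>l h\<^sub>l(z\<^sub>0)\<close> with the minimiser \<open>v\<close> of the Schur quadratic.\<close>

lemma schur_bound:
  assumes h: "bdd_meas n h" and z: "\<And>j. 0 < j \<Longrightarrow> j < n \<Longrightarrow> L2_inner n h (\<lambda>z. z j) = 0"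
    and \<rho>: "0 < \<rho>" and S: "schur_scalar \<rho> \<Lambda> \<beta> W \<le> 1"
  shows "qsq n 0 h \<le> (\<integral>z. (2 * \<rho> + W ((cmod (z 0))\<^sup>2)) * (cmod (h z))\<^sup>2 \<partial>gauss n) + (\<Sum>l\<in>\<Lambda>. \<beta> l * qsq n l h)"
proof -
  have Dm: "schur_D \<rho> W \<in> borel_measurable borel" unfolding schur_D_def[abs_def] using W_measurable by measurable
  note [measurable] = Dm
  have Dpos: "0 < schur_D \<rho> W r" for r using W_pos[of r] \<rho> by (simp add: schur_D_def add_pos_pos)
  have Dint: "integrable radial_measure (schur_D \<rho> W)"
    unfolding schur_D_def[abs_def] using W_integrable by (intro Bochner_Integration.integrable_add) auto
  obtain v where vi: "integrable radial_measure (\<lambda>r. (r - (\<Sum>l\<in>\<Lambda>. v l * radial_phi l r))\<^sup>2 / schur_D \<rho> W r)"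
    and v: "(\<integral>r. (r - (\<Sum>l\<in>\<Lambda>. v l * radial_phi l r))\<^sup>2 / schur_D \<rho> W r \<partial>radial_measure) + (\<Sum>l\<in>\<Lambda>. (v l)\<^sup>2 / \<beta> l)
      = schur_scalar \<rho> \<Lambda> \<beta> W"
    using schur_scalar_attained[where \<beta> = \<beta>, OF finite_Lambda beta_pos \<rho> Dm less_imp_le[OF W_pos]] by blast
  have hL: "h \<in> L2 n" by (rule bdd_meas_L2[OF h])
  define a where "a = L2_inner n h (\<lambda>z. z 0)"
  define c where "c l = coef n (unit_index n 0 (Suc l) l) h" for l
  define \<psi> where "\<psi> w = w - (\<Sum>l\<in>\<Lambda>. of_real (v l) * hermite1 (Suc l) l w)" for w
  define \<Phi> where "\<Phi> r = (r - (\<Sum>l\<in>\<Lambda>. v l * radial_phi l r))\<^sup>2 / schur_D \<rho> W r" for r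
  have [measurable]: "\<psi> \<in> borel_measurable borel" "\<Phi> \<in> borel_measurable borel"
    unfolding \<psi>_def[abs_def] \<Phi>_def[abs_def] by measurable
  \<comment> \<open>All terms of \<psi> have angular degree one, so a common phase factors out and
    its modulus is radial.\<close>
  have \<psi>_norm: "(cmod (\<psi> w))\<^sup>2 / schur_D \<rho> W (cmod w) = \<Phi> (cmod w)" for w
  proof -
    have w: "w = of_real (cmod w) * cis (Arg w)" using rcis_cmod_Arg[of w] by (simp add: rcis_def)
    have e: "hermite1 (Suc l) l w = cis (Arg w) * of_real (radial_phi l (cmod w))" for l
      using hermite1_polar[of "Suc l" l "cmod w" "Arg w"] w by (simp add: radial_phi_def)
    have "\<psi> w = cis (Arg w) * of_real (cmod w - (\<Sum>l\<in>\<Lambda>. v l * radial_phi l (cmod w)))"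
      unfolding \<psi>_def e by (subst (1) w) (simp add: right_diff_distrib sum_distrib_left mult_ac)
    then have "cmod (\<psi> w) = \<bar>cmod w - (\<Sum>l\<in>\<Lambda>. v l * radial_phi l (cmod w))\<bar>"
      by (simp only: norm_mult norm_cis norm_of_real mult_1)
    then show ?thesis by (simp add: \<Phi>_def)
  qed
  have herm0: "(\<lambda>z. hermite1 (Suc l) l (z 0)) = herm n (unit_index n 0 (Suc l) l)" for l
    by (rule herm_unit_index[OF n, symmetric])
  have hermL: "(\<lambda>z. hermite1 (Suc l) l (z 0)) \<in> L2 n" for l unfolding herm0 by simp
  have \<psi>L: "(\<lambda>z. \<psi> (z 0)) \<in> L2 n"
    unfolding \<psi>_def by (intro L2_diff L2_sum L2_cmult hermL coord_L2 n)
  have split: "a = L2_inner n h (\<lambda>z. \<psi> (z 0)) + (\<Sum>l\<in>\<Lambda>. of_real (v l) * c l)"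
  proof -
    have "L2_inner n h (\<lambda>z. \<psi> (z 0)) = a - L2_inner n h (\<lambda>z. \<Sum>l\<in>\<Lambda>. of_real (v l) * hermite1 (Suc l) l (z 0))"
      unfolding \<psi>_def a_def by (intro L2_inner_diff_right L2_sum L2_cmult hermL coord_L2 n hL)
    also have "L2_inner n h (\<lambda>z. \<Sum>l\<in>\<Lambda>. of_real (v l) * hermite1 (Suc l) l (z 0))
      = (\<Sum>l\<in>\<Lambda>. L2_inner n h (\<lambda>z. of_real (v l) * hermite1 (Suc l) l (z 0)))"
      by (intro L2_inner_sum_right L2_cmult hermL hL)
    also have "\<dots> = (\<Sum>l\<in>\<Lambda>. of_real (v l) * c l)"
      unfolding c_def coef_unit_index[OF n] L2_inner_cmult_right by simp
    finally show ?thesis by simp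
  qed
  have gi: "integrable (gauss n) (\<lambda>z. (cmod (a * \<psi> (z 0)))\<^sup>2 / schur_D \<rho> W (cmod (z 0)))"
    and gv: "(\<integral>z. (cmod (a * \<psi> (z 0)))\<^sup>2 / schur_D \<rho> W (cmod (z 0)) \<partial>gauss n) = (cmod a)\<^sup>2 * (\<integral>r. \<Phi> r \<partial>radial_measure)"
  proof -
    have eq: "(cmod (a * \<psi> (z 0)))\<^sup>2 / schur_D \<rho> W (cmod (z 0)) = (cmod a)\<^sup>2 * \<Phi> (cmod (z 0))" for z :: "nat \<Rightarrow> complex"
      unfolding norm_mult power_mult_distrib \<psi>_norm[symmetric] by simp
    have vi': "integrable radial_measure \<Phi>" unfolding \<Phi>_def[abs_def] by (rule vi)
    have "integrable gauss1 (\<lambda>w. \<Phi> (cmod w))" using vi' by (subst integral_gauss1_cmod(2)) auto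
    then have "integrable (gauss n) (\<lambda>z. \<Phi> (cmod (z 0)))"
      by (subst integral_gauss_component(2)[OF n, where f = "\<lambda>w. \<Phi> (cmod w)"]) auto
    then show "integrable (gauss n) (\<lambda>z. (cmod (a * \<psi> (z 0)))\<^sup>2 / schur_D \<rho> W (cmod (z 0)))"
      unfolding eq by (rule integrable_mult_right)
    have "(\<integral>z. \<Phi> (cmod (z 0)) \<partial>gauss n) = (\<integral>w. \<Phi> (cmod w) \<partial>gauss1)"
      by (rule integral_gauss_component(1)[OF n]) measurable
    also have "\<dots> = (\<integral>r. \<Phi> r \<partial>radial_measure)" by (rule integral_gauss1_cmod(1)) measurable
    finally show "(\<integral>z. (cmod (a * \<psi> (z 0)))\<^sup>2 / schur_D \<rho> W (cmod (z 0)) \<partial>gauss n) = (cmod a)\<^sup>2 * (\<integral>r. \<Phi> r \<partial>radial_measure)"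
      unfolding eq by simp
  qed
  \<comment> \<open>The test function is scaled by \<open>a\<close>, so that both sides are
    quadratic and \<open>a\<close> enters only through its modulus.\<close>
  have 1: "2 * Re (cnj a * L2_inner n h (\<lambda>z. \<psi> (z 0)))
     \<le> (\<integral>z. schur_D \<rho> W (cmod (z 0)) * (cmod (h z))\<^sup>2 \<partial>gauss n) + (cmod a)\<^sup>2 * (\<integral>r. \<Phi> r \<partial>radial_measure)"
    using weighted_am_gm[OF n Dm Dpos Dint h L2_cmult[OF \<psi>L] gi] unfolding gv L2_inner_cmult_right .
  have 2: "2 * Re (cnj a * (of_real (v l) * c l)) \<le> \<beta> l * (cmod (c l))\<^sup>2 + (cmod a)\<^sup>2 * ((v l)\<^sup>2 / \<beta> l)" if l: "l \<in> \<Lambda>" for l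
  proof -
    define s where "s = sqrt (\<beta> l)"
    have s: "0 < s" "s\<^sup>2 = \<beta> l" using beta_pos[OF l] by (simp_all add: s_def)
    have "Re (cnj a * (of_real (v l) * c l)) \<le> cmod (cnj a * (of_real (v l) * c l))" by (rule complex_Re_le_cmod)
    also have "\<dots> = (s * cmod (c l)) * (cmod a * \<bar>v l\<bar> / s)" using s by (simp add: norm_mult)
    finally have "2 * Re (cnj a * (of_real (v l) * c l)) \<le> 2 * ((s * cmod (c l)) * (cmod a * \<bar>v l\<bar> / s))" by (rule mult_left_mono) simp
    also have "\<dots> = 2 * (s * cmod (c l)) * (cmod a * \<bar>v l\<bar> / s)" by (rule mult.assoc[symmetric])
    also have "\<dots> \<le> (s * cmod (c l))\<^sup>2 + (cmod a * \<bar>v l\<bar> / s)\<^sup>2" by (rule sum_squares_bound)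
    also have "\<dots> = \<beta> l * (cmod (c l))\<^sup>2 + (cmod a)\<^sup>2 * ((v l)\<^sup>2 / \<beta> l)"
      by (simp add: power_mult_distrib power_divide s(2))
    finally show ?thesis .
  qed
  \<comment> \<open>Of level l only the function of \<open>z 0\<close> alone is used; its
    coefficient is one term of the sum.\<close>
  have cq: "(cmod (c l))\<^sup>2 \<le> qsq n l h" for l
    unfolding qsq_def c_def using unit_index_in[OF n, of "Suc l" l]
    by (intro member_le_sum) auto
  \<comment> \<open>The left side is 2|a|^2, while the right side will contain |a|^2 times the Schur
    scalar. With the scalar at most 1, one |a|^2 is left over, and this is the claim.\<close>
  have "2 * (cmod a)\<^sup>2 = 2 * Re (cnj a * a)"
    unfolding cmod_power2 by (simp add: power2_eq_square)
  also have "\<dots> = 2 * Re (cnj a * L2_inner n h (\<lambda>z. \<psi> (z 0))) + (\<Sum>l\<in>\<Lambda>. 2 * Re (cnj a * (of_real (v l) * c l)))"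
    by (subst (2) split) (simp only: distrib_left sum_distrib_left plus_complex.simps Re_sum)
  also have "\<dots> \<le> (\<integral>z. schur_D \<rho> W (cmod (z 0)) * (cmod (h z))\<^sup>2 \<partial>gauss n) + (cmod a)\<^sup>2 * (\<integral>r. \<Phi> r \<partial>radial_measure)
     + (\<Sum>l\<in>\<Lambda>. \<beta> l * (cmod (c l))\<^sup>2 + (cmod a)\<^sup>2 * ((v l)\<^sup>2 / \<beta> l))"
    by (intro add_mono 1 sum_mono 2)
  also have "\<dots> = (\<integral>z. schur_D \<rho> W (cmod (z 0)) * (cmod (h z))\<^sup>2 \<partial>gauss n) + (\<Sum>l\<in>\<Lambda>. \<beta> l * (cmod (c l))\<^sup>2)
     + (cmod a)\<^sup>2 * schur_scalar \<rho> \<Lambda> \<beta> W"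
    unfolding v[symmetric] \<Phi>_def by (simp add: sum.distrib sum_distrib_left distrib_left)
  also have "\<dots> \<le> (\<integral>z. schur_D \<rho> W (cmod (z 0)) * (cmod (h z))\<^sup>2 \<partial>gauss n) + (\<Sum>l\<in>\<Lambda>. \<beta> l * qsq n l h) + (cmod a)\<^sup>2 * 1"
    using S by (intro add_mono sum_mono mult_left_mono cq order_refl) (auto intro: less_imp_le beta_pos)
  finally have "(cmod a)\<^sup>2 \<le> (\<integral>z. schur_D \<rho> W (cmod (z 0)) * (cmod (h z))\<^sup>2 \<partial>gauss n) + (\<Sum>l\<in>\<Lambda>. \<beta> l * qsq n l h)" by simp
  moreover have "qsq n 0 h = (cmod a)\<^sup>2"
    unfolding a_def by (rule qsq_0_aligned[OF n]) (rule z)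
  ultimately show ?thesis unfolding schur_D_def by simp
qed

end

end

section \<open>Polarization and the bound on the form of T\<close>

lemma re_mult_cnj_polarize: "4 * Re (a * cnj b) = (cmod (a + b))\<^sup>2 - (cmod (a - b))\<^sup>2"
  unfolding cmod_power2 by (simp add: power2_eq_square algebra_simps)

lemma qform_polarize:
  assumes "f \<in> L2 n" "g \<in> L2 n"
  shows "4 * Re (qform n l f g) = qsq n l (\<lambda>z. f z + g z) - qsq n l (\<lambda>z. f z - g z)"
  unfolding qform_def qsq_def coef_add[OF assms] coef_diff[OF assms] Re_sum sum_distrib_left re_mult_cnj_polarize
  by (rule sum_subtractf)

lemma L2_inner_polarize:
  assumes "f \<in> L2 n" "g \<in> L2 n"
  shows "4 * Re (L2_inner n f g) = sqnorm n (\<lambda>z. f z + g z) - sqnorm n (\<lambda>z. f z - g z)"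
proof -
  have i: "integrable (gauss n) (\<lambda>z. f z * cnj (g z))" by (rule L2_integrable_inner[OF assms])
  have "4 * Re (L2_inner n f g) = (\<integral>z. 4 * Re (f z * cnj (g z)) \<partial>gauss n)"
    unfolding L2_inner_def by (simp only: integral_Re[OF i, symmetric] integral_mult_right_zero)
  also have "\<dots> = sqnorm n (\<lambda>z. f z + g z) - sqnorm n (\<lambda>z. f z - g z)"
    unfolding re_mult_cnj_polarize sqnorm_def
    using L2_integrable[OF L2_add[OF assms]] L2_integrable[OF L2_diff[OF assms]] by (rule Bochner_Integration.integral_diff)
  finally show ?thesis .
qed

lemma parallelogram: "(cmod (a + b))\<^sup>2 + (cmod (a - b))\<^sup>2 = 2 * (cmod a)\<^sup>2 + 2 * (cmod b)\<^sup>2"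
  unfolding cmod_power2 by (simp add: power2_eq_square algebra_simps)

lemma weight_expectation:
  fixes w :: "real \<Rightarrow> real"
  assumes n: "0 < n" and [measurable]: "w \<in> borel_measurable borel"
  shows "(\<integral>z. w (cmod (z 0)) \<partial>gauss n) = (\<integral>r. w r \<partial>radial_measure)"
proof -
  have "(\<integral>z. w (cmod (z 0)) \<partial>gauss n) = (\<integral>z. w (cmod z) \<partial>gauss1)"
    by (rule integral_gauss_component(1)[OF n]) measurable
  also have "\<dots> = (\<integral>r. w r \<partial>radial_measure)" by (rule integral_gauss1_cmod(1)) measurable
  finally show ?thesis .
qed

lemma (in gram_weight) T_op_bound_Re:
  assumes n: "0 < n" and \<rho>: "0 < \<rho>" and S: "schur_scalar \<rho> \<Lambda> \<beta> W \<le> 1"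
    and f: "f \<in> borel_measurable (gauss n)" "\<And>z. z \<in> space (gauss n) \<Longrightarrow> cmod (f z) \<le> 1"
    and g: "g \<in> borel_measurable (gauss n)" "\<And>z. z \<in> space (gauss n) \<Longrightarrow> cmod (g z) \<le> 1"
  shows "Re (L2_inner n (T_op \<rho> \<Lambda> \<beta> n f) g) \<le> \<rho> + mu_W W"
proof -
  have fb: "bdd_meas n f" and gb: "bdd_meas n g" using f g by (auto intro: bdd_measI)
  have eb: "bdd_meas n (E1 n f)" "bdd_meas n (E1 n g)" using E1_bdd_meas fb gb by auto
  have eL: "E1 n f \<in> L2 n" "E1 n g \<in> L2 n" using bdd_meas_L2 eb by auto
  \<comment> \<open>The coordinates are fitted to the sum of the two averages; the difference is
    taken in the same coordinates, since \<open>gram_bound\<close> requires no alignment.\<close>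
  obtain U V where U: "unitary_map n U V"
    and z: "\<And>j. 0 < j \<Longrightarrow> j < n \<Longrightarrow> L2_inner n (\<lambda>z. E1 n f (U z) + E1 n g (U z)) (\<lambda>z. z j) = 0"
  proof -
    obtain U V where UV: "unitary_map n U V \<and> (\<forall>j. 0 < j \<longrightarrow> j < n \<longrightarrow> L2_inner n (\<lambda>z. E1 n f (U z) + E1 n g (U z)) (\<lambda>z. z j) = 0)"
      using align_linear_part[OF L2_add[OF eL] order_refl] by (elim exE)
    show thesis by (rule that[of U V]) (use UV in simp_all)
  qed
  define F G where "F z = E1 n f (U z)" and "G z = E1 n g (U z)" for z
  define h k where "h z = F z + G z" and "k z = F z - G z" for z
  have Fb: "bdd_meas n F" and Gb: "bdd_meas n G"
    unfolding F_def[abs_def] G_def[abs_def] using unitary_bdd_meas[OF U] eb by auto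
  have FL: "F \<in> L2 n" and GL: "G \<in> L2 n" using bdd_meas_L2 Fb Gb by auto
  have hb: "bdd_meas n h" and kb: "bdd_meas n k"
    unfolding h_def[abs_def] k_def[abs_def] using Fb Gb bdd_meas_add bdd_meas_diff by auto
  have F1: "cmod (F z) \<le> 1" and G1: "cmod (G z) \<le> 1" for z
    unfolding F_def G_def using E1_bound[OF fb f(2)] E1_bound[OF gb g(2)] by auto
  \<comment> \<open>By the parallelogram law the sum is at most 4, where separate bounds would give
    8.\<close>
  have hk: "(cmod (h z))\<^sup>2 + (cmod (k z))\<^sup>2 \<le> 4" for z
  proof -
    have "(cmod (F z))\<^sup>2 \<le> 1" "(cmod (G z))\<^sup>2 \<le> 1" using F1[of z] G1[of z] by (simp_all add: power_le_one)
    then show ?thesis unfolding h_def k_def parallelogram by linarith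
  qed
  have q: "4 * Re (qform n l f g) = qsq n l h - qsq n l k" for l
  proof -
    have "qform n l f g = qform n l F G"
      unfolding qform_E1[OF fb gb] F_def[abs_def] G_def[abs_def] by (rule unitary_qform[OF U eL, symmetric])
    then show ?thesis unfolding h_def[abs_def] k_def[abs_def] using qform_polarize[OF FL GL] by simp
  qed
  have e: "4 * Re (L2_inner n (E1 n f) g) = sqnorm n h - sqnorm n k"
  proof -
    have "L2_inner n (E1 n f) g = L2_inner n F G"
      unfolding E1_inner[OF fb gb] F_def[abs_def] G_def[abs_def] by (rule unitary_L2_inner[OF U eL, symmetric])
    then show ?thesis unfolding h_def[abs_def] k_def[abs_def] using L2_inner_polarize[OF FL GL] by simp
  qed
  define w where "w r = W (r\<^sup>2)" for r
  have wm: "w \<in> borel_measurable borel" and w0: "0 \<le> w r" and wi: "integrable radial_measure w" for r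
    unfolding w_def using W_measurable W_pos W_integrable by (auto intro: less_imp_le)
  note wint = weighted_bdd_integrable[OF n wm w0 wi]
  have I1: "qsq n 0 h \<le> 2 * \<rho> * sqnorm n h + (\<integral>z. w (cmod (z 0)) * (cmod (h z))\<^sup>2 \<partial>gauss n) + (\<Sum>l\<in>\<Lambda>. \<beta> l * qsq n l h)"
  proof -
    have "(\<integral>z. (2 * \<rho> + W ((cmod (z 0))\<^sup>2)) * (cmod (h z))\<^sup>2 \<partial>gauss n)
      = (\<integral>z. 2 * \<rho> * (cmod (h z))\<^sup>2 + w (cmod (z 0)) * (cmod (h z))\<^sup>2 \<partial>gauss n)"
      by (simp add: w_def distrib_right)
    also have "\<dots> = (\<integral>z. 2 * \<rho> * (cmod (h z))\<^sup>2 \<partial>gauss n) + (\<integral>z. w (cmod (z 0)) * (cmod (h z))\<^sup>2 \<partial>gauss n)"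
      by (intro Bochner_Integration.integral_add integrable_mult_right L2_integrable bdd_meas_L2 hb wint)
    also have "(\<integral>z. 2 * \<rho> * (cmod (h z))\<^sup>2 \<partial>gauss n) = 2 * \<rho> * sqnorm n h"
      unfolding sqnorm_def by (rule integral_mult_right_zero)
    finally show ?thesis
      using schur_bound[OF n hb _ \<rho> S] z unfolding h_def[abs_def] F_def[abs_def] G_def[abs_def] by simp
  qed
  have I2: "(\<Sum>l\<in>\<Lambda>. \<beta> l * qsq n l k) \<le> (\<integral>z. w (cmod (z 0)) * (cmod (k z))\<^sup>2 \<partial>gauss n)"
    unfolding w_def by (rule gram_bound[OF n kb])
  have hk1: "sqnorm n h + sqnorm n k \<le> 4"
  proof -
    have "sqnorm n h + sqnorm n k = (\<integral>z. (cmod (h z))\<^sup>2 + (cmod (k z))\<^sup>2 \<partial>gauss n)"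
      unfolding sqnorm_def by (intro Bochner_Integration.integral_add[symmetric] L2_integrable bdd_meas_L2 hb kb)
    also have "\<dots> \<le> (\<integral>z. 4 \<partial>gauss n)"
      by (intro integral_mono Bochner_Integration.integrable_add L2_integrable bdd_meas_L2 hb kb hk) simp
    finally show ?thesis using gauss.prob_space[of n] by simp
  qed
  have hk2: "(\<integral>z. w (cmod (z 0)) * (cmod (h z))\<^sup>2 \<partial>gauss n) + (\<integral>z. w (cmod (z 0)) * (cmod (k z))\<^sup>2 \<partial>gauss n) \<le> 4 * mu_W W"
  proof -
    have wi': "integrable (gauss n) (\<lambda>z. w (cmod (z 0)) * (cmod (1 :: complex))\<^sup>2)"
      by (rule wint[OF bdd_meas_const])
    have "(\<integral>z. w (cmod (z 0)) * (cmod (h z))\<^sup>2 \<partial>gauss n) + (\<integral>z. w (cmod (z 0)) * (cmod (k z))\<^sup>2 \<partial>gauss n)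
      = (\<integral>z. w (cmod (z 0)) * (cmod (h z))\<^sup>2 + w (cmod (z 0)) * (cmod (k z))\<^sup>2 \<partial>gauss n)"
      by (intro Bochner_Integration.integral_add[symmetric] wint hb kb)
    also have "\<dots> \<le> (\<integral>z. 4 * w (cmod (z 0)) \<partial>gauss n)"
    proof (intro integral_mono Bochner_Integration.integrable_add wint hb kb)
      show "integrable (gauss n) (\<lambda>z. 4 * w (cmod (z 0)))" using wi' by simp
      show "w (cmod (z 0)) * (cmod (h z))\<^sup>2 + w (cmod (z 0)) * (cmod (k z))\<^sup>2 \<le> 4 * w (cmod (z 0))" for z
        using mult_left_mono[OF hk[of z] w0[of "cmod (z 0)"]] by (simp add: distrib_left)
    qed
    also have "\<dots> = 4 * mu_W W"
      unfolding integral_mult_right_zero weight_expectation[OF n wm] by (simp add: mu_W_def w_def[abs_def])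
    finally show ?thesis .
  qed
  have "4 * Re (L2_inner n (T_op \<rho> \<Lambda> \<beta> n f) g)
    = 4 * Re (qform n 0 f g) - \<rho> * (4 * Re (L2_inner n (E1 n f) g)) - (\<Sum>l\<in>\<Lambda>. \<beta> l * (4 * Re (qform n l f g)))"
    unfolding T_op_inner[OF fb gb finite_Lambda] by (simp add: sum_distrib_left mult_ac right_diff_distrib)
  also have "\<dots> = qsq n 0 h - qsq n 0 k - \<rho> * (sqnorm n h - sqnorm n k) - ((\<Sum>l\<in>\<Lambda>. \<beta> l * qsq n l h) - (\<Sum>l\<in>\<Lambda>. \<beta> l * qsq n l k))"
    unfolding q e by (simp add: right_diff_distrib sum_subtractf)
  \<comment> \<open>\<open>I1\<close> has 2\<rho> times the squared norm of \<open>h\<close>, of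
    which one \<rho> is cancelled. The level-0 part of \<open>k\<close> has a favourable sign and is
    dropped.\<close>
  also have "\<dots> \<le> \<rho> * (sqnorm n h + sqnorm n k) + ((\<integral>z. w (cmod (z 0)) * (cmod (h z))\<^sup>2 \<partial>gauss n) + (\<integral>z. w (cmod (z 0)) * (cmod (k z))\<^sup>2 \<partial>gauss n))"
    using I1 I2 qsq_nonneg[of n 0 k] unfolding right_diff_distrib distrib_left mult.assoc by linarith
  also have "\<dots> \<le> \<rho> * 4 + 4 * mu_W W"
    using \<rho> by (intro add_mono mult_left_mono hk1 hk2) auto
  finally show ?thesis by simp
qed

text \<open>The second function is multiplied by the phase of the inner product, which makes the
  inner product equal to its modulus. If it is zero, the factor is zero and the bound 1 still
  holds.\<close>

lemma (in gram_weight) T_op_bound: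
  assumes n: "0 < n" and \<rho>: "0 < \<rho>" and S: "schur_scalar \<rho> \<Lambda> \<beta> W \<le> 1"
    and f: "f \<in> borel_measurable (gauss n)" "\<And>z. z \<in> space (gauss n) \<Longrightarrow> cmod (f z) \<le> 1"
    and g: "g \<in> borel_measurable (gauss n)" "\<And>z. z \<in> space (gauss n) \<Longrightarrow> cmod (g z) \<le> 1"
  shows "cmod (L2_inner n (T_op \<rho> \<Lambda> \<beta> n f) g) \<le> \<rho> + mu_W W"
proof -
  define a where "a = L2_inner n (T_op \<rho> \<Lambda> \<beta> n f) g"
  have "Re (L2_inner n (T_op \<rho> \<Lambda> \<beta> n f) (\<lambda>z. sgn a * g z)) \<le> \<rho> + mu_W W"
  proof (rule T_op_bound_Re[OF n \<rho> S f])
    show "(\<lambda>z. sgn a * g z) \<in> borel_measurable (gauss n)" using g(1) by measurable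
    show "cmod (sgn a * g z) \<le> 1" if "z \<in> space (gauss n)" for z
      unfolding norm_mult using cmod_sgn[of a] g(2)[OF that] by (simp add: mult_le_one)
  qed
  moreover have "cnj (sgn a) * a = of_real (cmod a)"
  proof (cases "a = 0")
    case False
    have "cnj (sgn a) * a = cnj a * a / of_real (cmod a)" by (simp add: sgn_eq)
    also have "cnj a * a = of_real (cmod a) * of_real (cmod a)"
      using complex_norm_square[of a] by (simp add: power2_eq_square mult.commute)
    finally show ?thesis using False by simp
  qed simp
  ultimately show ?thesis unfolding L2_inner_cmult_right a_def[symmetric] by simp
qed

subsection \<open>The lower bound for the Grothendieck constant\<close>

text \<open>Tested on the 1 by 1 matrix with entry 1. It yields the nonnegativity of K needed when
  the unimodular maximum is replaced by an upper bound.\<close>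

lemma grothendieck_bound_ge_1:
  assumes "grothendieck_bound K"
  shows "1 \<le> K"
proof -
  have u: "unimodular_max (Suc 0) (Suc 0) (\<lambda>_ _. 1) = 1"
  proof -
    have "{cmod (\<Sum>i<Suc 0. \<Sum>j<Suc 0. 1 * \<epsilon> i * cnj (\<delta> j)) | \<epsilon> \<delta>.
       (\<forall>i<Suc 0. cmod (\<epsilon> i) = 1) \<and> (\<forall>j<Suc 0. cmod (\<delta> j) = 1)} = {1}"
      by (auto simp: norm_mult intro!: exI[of _ "\<lambda>_. 1"])
    then show ?thesis unfolding unimodular_max_def by simp
  qed
  have "cmod (\<Sum>i<Suc 0. \<Sum>j<Suc 0. 1 * cvec_inner (Suc 0) (\<lambda>_. 1) (\<lambda>_. 1)) \<le> K * unimodular_max (Suc 0) (Suc 0) (\<lambda>_ _. 1)"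
    using assms[unfolded grothendieck_bound_def, rule_format, of "Suc 0" "Suc 0" "Suc 0" "\<lambda>_ _. 1" "\<lambda>_ _. 1" "\<lambda>_ _. 1"]
    by (simp add: unit_cvec_def)
  then show ?thesis unfolding u by (simp add: cvec_inner_def)
qed

text \<open>The operators choose representatives, so linearity is established on the level of inner
  products, through the formula of \<open>T_op_inner\<close>.\<close>

lemma T_op_sesquilinear:
  assumes f: "\<And>i. i \<in> I \<Longrightarrow> bdd_meas n (f i)" and fin: "finite \<Lambda>"
  shows "L2_inner n (T_op \<rho> \<Lambda> \<beta> n (\<lambda>z. \<Sum>i\<in>I. c i * f i z)) (\<lambda>z. \<Sum>j\<in>I. d j * f j z)
    = (\<Sum>i\<in>I. \<Sum>j\<in>I. c i * cnj (d j) * L2_inner n (T_op \<rho> \<Lambda> \<beta> n (f i)) (f j))"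
proof -
  have fL: "f i \<in> L2 n" if "i \<in> I" for i using bdd_meas_L2[OF f[OF that]] .
  have eL: "E1 n (f i) \<in> L2 n" if "i \<in> I" for i using bdd_meas_L2[OF E1_bdd_meas[OF f[OF that]]] .
  have sb: "bdd_meas n (\<lambda>z. \<Sum>i\<in>J. c i * f i z)" if "J \<subseteq> I" for c J
    using that
  proof (induction J rule: infinite_finite_induct)
    case (insert i J)
    then show ?case using bdd_meas_add[OF bdd_meas_cmult[OF f, of i "c i"], of "\<lambda>z. \<Sum>i\<in>J. c i * f i z"] by simp
  qed (simp_all add: bdd_meas_const)
  have cf: "coef n \<kappa> (\<lambda>z. \<Sum>i\<in>I. c i * f i z) = (\<Sum>i\<in>I. c i * coef n \<kappa> (f i))" for \<kappa> c
    by (subst coef_sum) (auto intro: L2_cmult fL simp: coef_cmult)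
  have q: "qform n l (\<lambda>z. \<Sum>i\<in>I. c i * f i z) (\<lambda>z. \<Sum>j\<in>I. d j * f j z) = (\<Sum>i\<in>I. \<Sum>j\<in>I. c i * cnj (d j) * qform n l (f i) (f j))" for l
  proof -
    have "qform n l (\<lambda>z. \<Sum>i\<in>I. c i * f i z) (\<lambda>z. \<Sum>j\<in>I. d j * f j z)
      = (\<Sum>\<kappa>\<in>pair_indices n (Suc l) l. \<Sum>i\<in>I. \<Sum>j\<in>I. c i * cnj (d j) * (coef n \<kappa> (f i) * cnj (coef n \<kappa> (f j))))"
      unfolding qform_def cf cnj_sum sum_product complex_cnj_mult by (intro sum.cong refl) (simp only: mult_ac)
    also have "\<dots> = (\<Sum>i\<in>I. \<Sum>\<kappa>\<in>pair_indices n (Suc l) l. \<Sum>j\<in>I. c i * cnj (d j) * (coef n \<kappa> (f i) * cnj (coef n \<kappa> (f j))))"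
      by (rule sum.swap)
    also have "\<dots> = (\<Sum>i\<in>I. \<Sum>j\<in>I. \<Sum>\<kappa>\<in>pair_indices n (Suc l) l. c i * cnj (d j) * (coef n \<kappa> (f i) * cnj (coef n \<kappa> (f j))))"
      by (intro sum.cong refl sum.swap)
    finally show ?thesis unfolding qform_def sum_distrib_left .
  qed
  have e: "L2_inner n (E1 n (\<lambda>z. \<Sum>i\<in>I. c i * f i z)) (\<lambda>z. \<Sum>j\<in>I. d j * f j z) = (\<Sum>i\<in>I. \<Sum>j\<in>I. c i * cnj (d j) * L2_inner n (E1 n (f i)) (f j))"
  proof -
    have "E1 n (\<lambda>z. \<Sum>i\<in>I. c i * f i z) = (\<lambda>z. \<Sum>i\<in>I. c i * E1 n (f i) z)"
      by (rule ext) (rule E1_sum[OF f])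
    then have "L2_inner n (E1 n (\<lambda>z. \<Sum>i\<in>I. c i * f i z)) (\<lambda>z. \<Sum>j\<in>I. d j * f j z)
      = (\<Sum>i\<in>I. L2_inner n (\<lambda>z. c i * E1 n (f i) z) (\<lambda>z. \<Sum>j\<in>I. d j * f j z))"
      by (simp only:) (intro L2_inner_sum_left L2_cmult eL L2_sum fL; assumption)
    also have "\<dots> = (\<Sum>i\<in>I. \<Sum>j\<in>I. L2_inner n (\<lambda>z. c i * E1 n (f i) z) (\<lambda>z. d j * f j z))"
      by (intro sum.cong refl L2_inner_sum_right L2_cmult eL fL)
    finally show ?thesis by (simp only: L2_inner_cmult_left L2_inner_cmult_right mult_ac)
  qed
  have s: "(\<Sum>l\<in>\<Lambda>. of_real (\<beta> l) * (\<Sum>i\<in>I. \<Sum>j\<in>I. c i * cnj (d j) * qform n l (f i) (f j)))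
    = (\<Sum>i\<in>I. \<Sum>j\<in>I. c i * cnj (d j) * (\<Sum>l\<in>\<Lambda>. of_real (\<beta> l) * qform n l (f i) (f j)))"
  proof -
    have "(\<Sum>l\<in>\<Lambda>. of_real (\<beta> l) * (\<Sum>i\<in>I. \<Sum>j\<in>I. c i * cnj (d j) * qform n l (f i) (f j)))
      = (\<Sum>l\<in>\<Lambda>. \<Sum>i\<in>I. \<Sum>j\<in>I. c i * cnj (d j) * (of_real (\<beta> l) * qform n l (f i) (f j)))"
      unfolding sum_distrib_left by (intro sum.cong refl) (simp only: mult_ac)
    also have "\<dots> = (\<Sum>i\<in>I. \<Sum>l\<in>\<Lambda>. \<Sum>j\<in>I. c i * cnj (d j) * (of_real (\<beta> l) * qform n l (f i) (f j)))"
      by (rule sum.swap)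
    also have "\<dots> = (\<Sum>i\<in>I. \<Sum>j\<in>I. \<Sum>l\<in>\<Lambda>. c i * cnj (d j) * (of_real (\<beta> l) * qform n l (f i) (f j)))"
      by (intro sum.cong refl sum.swap)
    finally show ?thesis unfolding sum_distrib_left .
  qed
  have r: "of_real \<rho> * (\<Sum>i\<in>I. \<Sum>j\<in>I. c i * cnj (d j) * L2_inner n (E1 n (f i)) (f j))
    = (\<Sum>i\<in>I. \<Sum>j\<in>I. c i * cnj (d j) * (of_real \<rho> * L2_inner n (E1 n (f i)) (f j)))"
    unfolding sum_distrib_left by (intro sum.cong refl) (simp only: mult_ac)
  have t: "L2_inner n (T_op \<rho> \<Lambda> \<beta> n (f i)) (f j) = qform n 0 (f i) (f j) - of_real \<rho> * L2_inner n (E1 n (f i)) (f j)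
      - (\<Sum>l\<in>\<Lambda>. of_real (\<beta> l) * qform n l (f i) (f j))" if "i \<in> I" "j \<in> I" for i j
    by (rule T_op_inner[OF f[OF that(1)] f[OF that(2)] fin])
  have "L2_inner n (T_op \<rho> \<Lambda> \<beta> n (\<lambda>z. \<Sum>i\<in>I. c i * f i z)) (\<lambda>z. \<Sum>j\<in>I. d j * f j z)
    = (\<Sum>i\<in>I. \<Sum>j\<in>I. c i * cnj (d j) * (qform n 0 (f i) (f j) - of_real \<rho> * L2_inner n (E1 n (f i)) (f j)
      - (\<Sum>l\<in>\<Lambda>. of_real (\<beta> l) * qform n l (f i) (f j))))"
    unfolding T_op_inner[OF sb[OF order_refl] sb[OF order_refl] fin] q e s r
    by (simp only: right_diff_distrib sum_subtractf)
  also have "\<dots> = (\<Sum>i\<in>I. \<Sum>j\<in>I. c i * cnj (d j) * L2_inner n (T_op \<rho> \<Lambda> \<beta> n (f i)) (f j))"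
    by (intro sum.cong refl) (simp only: t)
  finally show ?thesis .
qed

lemma hermite1_1_1: "hermite1 (Suc 0) (Suc 0) z = of_real ((cmod z)\<^sup>2 - 1)"
  unfolding hermite1_def of_real_diff complex_norm_square by (simp add: numeral_2_eq_2)

text \<open>The normalized square \<open>x z\<close> has mean 1 and variance 1/n. A quadratic
  minorant of the square root touching it at 1 turns this into the deficit 1/(2n).\<close>

lemma expectation_norm_ge:
  assumes n: "0 < n"
  shows "integrable (gauss n) (\<lambda>z. sqrt (\<Sum>k<n. (cmod (z k))\<^sup>2))"
    and "sqrt (real n) * (1 - 1 / (2 * real n)) \<le> (\<integral>z. sqrt (\<Sum>k<n. (cmod (z k))\<^sup>2) \<partial>gauss n)"
proof -
  define x where "x z = (\<Sum>k<n. (cmod (z k))\<^sup>2) / real n" for z :: "nat \<Rightarrow> complex"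
  have zi: "integrable (gauss n) (\<lambda>z. (cmod (z k))\<^sup>2)" if "k < n" for k by (rule L2_integrable[OF coord_L2[OF that]])
  have z1: "(\<integral>z. (cmod (z k))\<^sup>2 \<partial>gauss n) = 1" if "k < n" for k
    using sqnorm_coord_power[OF that, of 1] by (simp add: sqnorm_def)
  have xi: "integrable (gauss n) x" unfolding x_def[abs_def] by (intro integrable_divide Bochner_Integration.integrable_sum) (simp add: zi)
  have x1: "(\<integral>z. x z \<partial>gauss n) = 1"
    unfolding x_def using n by (simp add: Bochner_Integration.integral_sum zi z1)
  have [measurable]: "x \<in> borel_measurable (gauss n)" using xi by auto
  define K where "K = (\<lambda>k. unit_index n k (Suc 0) (Suc 0)) ` {..<n}"
  have inj: "inj_on (\<lambda>k. unit_index n k (Suc 0) (Suc 0)) {..<n}"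
  proof (rule inj_onI)
    fix i j assume i: "i \<in> {..<n}" and e: "unit_index n i (Suc 0) (Suc 0) = unit_index n j (Suc 0) (Suc 0)"
    then have "fst (unit_index n i (Suc 0) (Suc 0)) i = fst (unit_index n j (Suc 0) (Suc 0)) i" by simp
    then show "i = j" using i by (simp add: unit_index_def split: if_splits)
  qed
  have K: "finite K" "K \<subseteq> ext_pairs n"
    unfolding K_def using unit_index_in[of _ n "Suc 0" "Suc 0"] pair_indices_ext by blast+
  \<comment> \<open>Centring \<open>x\<close> leaves a combination of the orthonormal functions
    \<open>hermite1 (Suc 0) (Suc 0)\<close> of single coordinates, so the variance is a sum of
    squared coefficients.\<close>
  have comb: "hermite_comb n K (\<lambda>_. of_real (1 / real n)) z = of_real (x z - 1)" for z
  proof -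
    have "hermite_comb n K (\<lambda>_. of_real (1 / real n)) z = (\<Sum>k<n. of_real (1 / real n) * herm n (unit_index n k (Suc 0) (Suc 0)) z)"
      unfolding hermite_comb_def K_def sum.reindex[OF inj] comp_def ..
    also have "\<dots> = (\<Sum>k<n. of_real (1 / real n * ((cmod (z k))\<^sup>2 - 1)))"
    proof (rule sum.cong[OF refl])
      fix k assume "k \<in> {..<n}"
      then have "herm n (unit_index n k (Suc 0) (Suc 0)) z = of_real ((cmod (z k))\<^sup>2 - 1)"
        by (simp only: herm_unit_index hermite1_1_1 lessThan_iff)
      then show "of_real (1 / real n) * herm n (unit_index n k (Suc 0) (Suc 0)) z = of_real (1 / real n * ((cmod (z k))\<^sup>2 - 1))"
        by (simp only: of_real_mult)
    qed
    also have "\<dots> = of_real (\<Sum>k<n. 1 / real n * ((cmod (z k))\<^sup>2 - 1))" by (rule of_real_sum[symmetric])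
    also have "(\<Sum>k<n. 1 / real n * ((cmod (z k))\<^sup>2 - 1)) = x z - 1"
      using n by (simp add: x_def sum_subtractf sum_divide_distrib[symmetric] diff_divide_distrib)
    finally show ?thesis .
  qed
  have vi: "integrable (gauss n) (\<lambda>z. (x z - 1)\<^sup>2)"
    using L2_integrable[OF hermite_comb_L2[of n K "\<lambda>_. of_real (1 / real n)"]] unfolding comb norm_of_real by simp
  have v: "(\<integral>z. (x z - 1)\<^sup>2 \<partial>gauss n) = 1 / real n"
  proof -
    have "sqnorm n (hermite_comb n K (\<lambda>_. of_real (1 / real n))) = (\<integral>z. (x z - 1)\<^sup>2 \<partial>gauss n)"
      unfolding sqnorm_def comb norm_of_real by simp
    moreover have "sqnorm n (hermite_comb n K (\<lambda>_. of_real (1 / real n))) = (\<Sum>\<kappa>\<in>K. (1 / real n)\<^sup>2)"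
      unfolding sqnorm_hermite_comb[OF K] norm_of_real by simp
    moreover have "card K = n" unfolding K_def using card_image[OF inj] by simp
    ultimately show ?thesis using n by (simp add: power2_eq_square)
  qed
  have sq: "sqrt (\<Sum>k<n. (cmod (z k))\<^sup>2) = sqrt (real n) * sqrt (x z)" for z :: "nat \<Rightarrow> complex"
    using n by (simp add: x_def real_sqrt_mult[symmetric])
  have x0: "0 \<le> x z" for z by (simp add: x_def sum_nonneg)
  have si: "integrable (gauss n) (\<lambda>z. sqrt (x z))"
  proof (rule Bochner_Integration.integrable_bound)
    show "integrable (gauss n) (\<lambda>z. 1 + x z)" using xi by simp
    have "sqrt t \<le> 1 + t" if "0 \<le> t" for t :: real
    proof (rule real_le_lsqrt)
      show "t \<le> (1 + t)\<^sup>2" using that by (simp add: power2_eq_square algebra_simps)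
    qed (use that in auto)
    then show "AE z in gauss n. norm (sqrt (x z)) \<le> norm (1 + x z)" using x0 by (intro AE_I2) simp
  qed measurable
  then show "integrable (gauss n) (\<lambda>z. sqrt (\<Sum>k<n. (cmod (z k))\<^sup>2))" unfolding sq by simp
  have tangent: "(1 + t) / 2 - (t - 1)\<^sup>2 / 2 \<le> sqrt t" if "0 \<le> t" for t :: real
  proof -
    define s where "s = sqrt t"
    have s: "0 \<le> s" "t = s\<^sup>2" using that by (simp_all add: s_def)
    \<comment> \<open>With s the square root of t, this product is twice the difference of the two
      sides.\<close>
    have "0 \<le> (s - 1)\<^sup>2 * (s\<^sup>2 + 2 * s)" using s(1) by (intro mult_nonneg_nonneg) auto
    also have "\<dots> = 2 * s - (1 + s\<^sup>2) + (s\<^sup>2 - 1)\<^sup>2" by (simp add: power2_eq_square algebra_simps)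
    finally have "0 \<le> 2 * s - (1 + s\<^sup>2) + (s\<^sup>2 - 1)\<^sup>2" .
    moreover have "(1 + u) / 2 - v / 2 \<le> s" if "0 \<le> 2 * s - (1 + u) + v" for u v :: real
      using that by (simp add: field_simps)
    ultimately show ?thesis unfolding s_def[symmetric] unfolding s(2) by blast
  qed
  have "1 - 1 / (2 * real n) = (\<integral>z. (1 + x z) / 2 - (x z - 1)\<^sup>2 / 2 \<partial>gauss n)"
  proof -
    have "(\<integral>z. (1 + x z) / 2 - (x z - 1)\<^sup>2 / 2 \<partial>gauss n) = (\<integral>z. (1 + x z) / 2 \<partial>gauss n) - (\<integral>z. (x z - 1)\<^sup>2 / 2 \<partial>gauss n)"
      using xi vi by (intro Bochner_Integration.integral_diff) auto
    also have "(\<integral>z. (1 + x z) / 2 \<partial>gauss n) = 1"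
      using xi x1 gauss.prob_space[of n] by simp
    also have "(\<integral>z. (x z - 1)\<^sup>2 / 2 \<partial>gauss n) = 1 / real n / 2" using v by simp
    finally show ?thesis by simp
  qed
  also have "\<dots> \<le> (\<integral>z. sqrt (x z) \<partial>gauss n)"
    using xi vi si tangent x0 by (intro integral_mono) auto
  finally show "sqrt (real n) * (1 - 1 / (2 * real n)) \<le> (\<integral>z. sqrt (\<Sum>k<n. (cmod (z k))\<^sup>2) \<partial>gauss n)"
    unfolding sq by (simp add: mult_left_mono)
qed

text \<open>The field z/\<parallel>z\<parallel> is approximated coordinatewise by simple functions,
  which are then normalized. Finitely many values are needed for a finite matrix, and exact unit
  length for the Grothendieck inequality.\<close>

lemma unit_vector_approximation:
  assumes n: "0 < n"
  obtains F :: "nat \<Rightarrow> nat \<Rightarrow> (nat \<Rightarrow> complex) \<Rightarrow> complex"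
  where "\<And>m k. simple_function (gauss n) (F m k)"
    and "\<And>m z. (\<Sum>k<n. (cmod (F m k z))\<^sup>2) = 1"
    and "(\<lambda>m. \<integral>z. (\<Sum>k<n. F m k z * cnj (z k)) \<partial>gauss n) \<longlonglongrightarrow> of_real (\<integral>z. sqrt (\<Sum>k<n. (cmod (z k))\<^sup>2) \<partial>gauss n)"
proof -
  define r where "r z = sqrt (\<Sum>k<n. (cmod (z k))\<^sup>2)" for z :: "nat \<Rightarrow> complex"
  define u where "u k z = (if k < n then z k / of_real (r z) else 0)" for k and z :: "nat \<Rightarrow> complex"
  have rm [measurable]: "r \<in> borel_measurable (gauss n)"
    unfolding r_def[abs_def] using expectation_norm_ge(1)[OF n] by simp
  have um: "u k \<in> borel_measurable (gauss n)" for k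
    unfolding u_def[abs_def] using gauss_component_measurable[of k n] by (cases "k < n") simp_all
  have "\<exists>s. \<forall>k. (\<forall>m. simple_function (gauss n) (s k m)) \<and> (\<forall>z\<in>space (gauss n). (\<lambda>m. s k m z) \<longlonglongrightarrow> u k z)"
  proof (rule choice, rule allI)
    fix k
    show "\<exists>s. (\<forall>m. simple_function (gauss n) (s m)) \<and> (\<forall>z\<in>space (gauss n). (\<lambda>m. s m z) \<longlonglongrightarrow> u k z)"
      using borel_measurable_implies_sequence_metric[OF um[of k], of 0] by blast
  qed
  then obtain s where s: "\<And>k m. simple_function (gauss n) (s k m)"
      "\<And>k z. z \<in> space (gauss n) \<Longrightarrow> (\<lambda>m. s k m z) \<longlonglongrightarrow> u k z" by blast
  define N where "N m z = sqrt (\<Sum>k<n. (cmod (s k m z))\<^sup>2)" for m z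
  \<comment> \<open>Where the approximant vanishes the first basis vector is used, so the field has
    unit length everywhere.\<close>
  define F where "F m k z = (if N m z = 0 then (if k = 0 then 1 else 0) else s k m z / of_real (N m z))" for m k z
  have Ns: "simple_function (gauss n) (N m)" for m
  proof -
    have "simple_function (gauss n) (\<lambda>z. \<Sum>k<n. (cmod (s k m z))\<^sup>2)"
      by (intro simple_function_sum simple_function_compose1[OF s(1), where g = "\<lambda>x. (cmod x)\<^sup>2"])
    from simple_function_compose1[OF this, of sqrt] show ?thesis by (simp add: N_def[abs_def])
  qed
  have Fs: "simple_function (gauss n) (F m k)" for m k
    unfolding F_def[abs_def]
    by (rule simple_function_compose2[OF Ns[of m] s(1)[of k m], where h = "\<lambda>x y. if x = 0 then (if k = 0 then 1 else 0) else y / of_real x"])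
  have F1: "(\<Sum>k<n. (cmod (F m k z))\<^sup>2) = 1" for m z
  proof (cases "N m z = 0")
    case True
    have "(\<Sum>k<n. (cmod (F m k z))\<^sup>2) = (\<Sum>k<n. if k = 0 then 1 else 0)"
      using True by (intro sum.cong refl) (simp add: F_def)
    then show ?thesis using n by simp
  next
    case False
    have sq: "(N m z)\<^sup>2 = (\<Sum>k<n. (cmod (s k m z))\<^sup>2)" by (simp add: N_def sum_nonneg)
    have "(\<Sum>k<n. (cmod (F m k z))\<^sup>2) = (\<Sum>k<n. (cmod (s k m z))\<^sup>2 / (N m z)\<^sup>2)"
      using False by (intro sum.cong refl) (simp add: F_def norm_divide power_divide)
    also have "\<dots> = (\<Sum>k<n. (cmod (s k m z))\<^sup>2) / (N m z)\<^sup>2" by (rule sum_divide_distrib[symmetric])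
    finally show ?thesis using False unfolding sq[symmetric] by simp
  qed
  have Fle: "cmod (F m k z) \<le> 1" if "k < n" for m k z
  proof -
    have "(cmod (F m k z))\<^sup>2 \<le> (\<Sum>k<n. (cmod (F m k z))\<^sup>2)"
      using that by (intro member_le_sum) auto
    then show ?thesis unfolding F1 using power2_le_imp_le[of "cmod (F m k z)" 1] by simp
  qed
  have [measurable]: "F m k \<in> borel_measurable (gauss n)" for m k
    by (rule borel_measurable_simple_function[OF Fs])
  have lim: "(\<lambda>m. \<Sum>k<n. F m k z * cnj (z k)) \<longlonglongrightarrow> of_real (r z)" if z: "z \<in> space (gauss n)" for z
  proof (cases "r z = 0")
    case True
    then have "(\<Sum>k<n. (cmod (z k))\<^sup>2) = 0" by (simp add: r_def)
    then have "z k = 0" if "k < n" for k using that by (simp add: sum_nonneg_eq_0_iff)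
    then show ?thesis using True by simp
  next
    case False
    have r2: "(r z)\<^sup>2 = (\<Sum>k<n. (cmod (z k))\<^sup>2)" by (simp add: r_def sum_nonneg)
    have "(\<Sum>k<n. (cmod (u k z))\<^sup>2) = (\<Sum>k<n. (cmod (z k))\<^sup>2 / (r z)\<^sup>2)"
      by (intro sum.cong refl) (simp add: u_def norm_divide power_divide)
    also have "\<dots> = (\<Sum>k<n. (cmod (z k))\<^sup>2) / (r z)\<^sup>2" by (rule sum_divide_distrib[symmetric])
    also have "\<dots> = 1" using False unfolding r2[symmetric] by simp
    finally have u1: "(\<Sum>k<n. (cmod (u k z))\<^sup>2) = 1" .
    have "(\<lambda>m. N m z) \<longlonglongrightarrow> sqrt (\<Sum>k<n. (cmod (u k z))\<^sup>2)"
      unfolding N_def by (intro tendsto_intros s(2) z)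
    then have N1: "(\<lambda>m. N m z) \<longlonglongrightarrow> 1" unfolding u1 by simp
    have ev: "eventually (\<lambda>m. 0 < N m z) sequentially" using N1 by (rule order_tendstoD) simp
    have Flim: "(\<lambda>m. F m k z) \<longlonglongrightarrow> u k z" for k
    proof (rule Lim_transform_eventually)
      have "(\<lambda>m. s k m z / of_real (N m z)) \<longlonglongrightarrow> u k z / of_real 1"
        by (intro tendsto_intros s(2) z N1) simp
      then show "(\<lambda>m. s k m z / of_real (N m z)) \<longlonglongrightarrow> u k z" by simp
      show "eventually (\<lambda>m. s k m z / of_real (N m z) = F m k z) sequentially"
        using ev by eventually_elim (simp add: F_def)
    qed
    have "(\<lambda>m. \<Sum>k<n. F m k z * cnj (z k)) \<longlonglongrightarrow> (\<Sum>k<n. u k z * cnj (z k))"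
      by (intro tendsto_intros Flim)
    also have "(\<Sum>k<n. u k z * cnj (z k)) = (\<Sum>k<n. of_real ((cmod (z k))\<^sup>2) / of_real (r z))"
      unfolding complex_norm_square by (intro sum.cong refl) (simp add: u_def)
    also have "\<dots> = of_real ((\<Sum>k<n. (cmod (z k))\<^sup>2) / r z)"
      by (simp add: sum_divide_distrib)
    also have "(\<Sum>k<n. (cmod (z k))\<^sup>2) / r z = r z" unfolding r2[symmetric] using False by (simp add: power2_eq_square)
    finally show ?thesis .
  qed
  have zi: "integrable (gauss n) (\<lambda>z. cmod (z k))" if "k < n" for k
    using integrable_norm[OF L2_integrable_inner[OF coord_L2[OF that] const_L2[of 1]]] by simp
  have Gm: "(\<lambda>z. \<Sum>k<n. F m k z * cnj (z k)) \<in> borel_measurable (gauss n)" for m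
    by (intro borel_measurable_sum borel_measurable_times measurable_compose[OF gauss_component_measurable cnj_measurable]) auto
  have "(\<lambda>m. \<integral>z. (\<Sum>k<n. F m k z * cnj (z k)) \<partial>gauss n) \<longlonglongrightarrow> (\<integral>z. complex_of_real (r z) \<partial>gauss n)"
  proof (rule integral_dominated_convergence[where w = "\<lambda>z. \<Sum>k<n. cmod (z k)"])
    show "(\<lambda>z. complex_of_real (r z)) \<in> borel_measurable (gauss n)" by measurable
    show "(\<lambda>z. \<Sum>k<n. F m k z * cnj (z k)) \<in> borel_measurable (gauss n)" for m by (rule Gm)
    show "integrable (gauss n) (\<lambda>z. \<Sum>k<n. cmod (z k))" by (intro Bochner_Integration.integrable_sum) (simp add: zi)
    show "AE z in gauss n. (\<lambda>m. \<Sum>k<n. F m k z * cnj (z k)) \<longlonglongrightarrow> of_real (r z)"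
      by (intro AE_I2 lim)
    show "AE z in gauss n. norm (\<Sum>k<n. F m k z * cnj (z k)) \<le> (\<Sum>k<n. cmod (z k))" for m
    proof (rule AE_I2)
      fix z
      have "norm (F m k z * cnj (z k)) \<le> cmod (z k)" if "k < n" for k
        unfolding norm_mult complex_mod_cnj using Fle[OF that, of m z] by (intro mult_left_le_one_le) auto
      then show "norm (\<Sum>k<n. F m k z * cnj (z k)) \<le> (\<Sum>k<n. cmod (z k))"
        by (intro order_trans[OF norm_sum] sum_mono) simp
    qed
  qed
  also have "(\<integral>z. complex_of_real (r z) \<partial>gauss n) = of_real (\<integral>z. r z \<partial>gauss n)" by (rule integral_complex_of_real)
  finally show ?thesis using that[of F] Fs F1 unfolding r_def by blast
qed

section \<open>Discretization of vector fields and passage to the limit\<close>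

context gram_weight
begin

text \<open>The field has finitely many values, which serve both as the x's and as the y's. The
  matrix holds the form of T on the indicators of the level sets: unimodular combinations of these
  are bounded by 1, so \<open>T_op_bound\<close> controls the maximum.\<close>

lemma grothendieck_discretization:
  assumes n: "0 < n" and \<rho>: "0 < \<rho>" and S: "schur_scalar \<rho> \<Lambda> \<beta> W \<le> 1" and K: "grothendieck_bound K"
    and F: "\<And>k. simple_function (gauss n) (F k)" and F1: "\<And>z. (\<Sum>k<n. (cmod (F k z))\<^sup>2) = 1"
  obtains G where "\<And>k. bdd_meas n (G k)" and "\<And>k z. k < n \<Longrightarrow> z \<in> space (gauss n) \<Longrightarrow> G k z = F k z"
    and "cmod (\<Sum>k<n. L2_inner n (T_op \<rho> \<Lambda> \<beta> n (G k)) (G k)) \<le> K * (\<rho> + mu_W W)"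
proof -
  define \<Phi> where "\<Phi> z = (\<lambda>k\<in>{..<n}. F k z)" for z
  define V where "V = \<Phi> ` space (gauss n)"
  have Vz: "\<exists>z\<in>space (gauss n). v = \<Phi> z" if "v \<in> V" for v using that by (auto simp: V_def)
  have "V \<subseteq> Pi\<^sub>E {..<n} (\<lambda>k. F k ` space (gauss n))"
  proof
    fix v assume "v \<in> V"
    then obtain z where "z \<in> space (gauss n)" "v = \<Phi> z" using Vz by blast
    then show "v \<in> Pi\<^sub>E {..<n} (\<lambda>k. F k ` space (gauss n))" by (simp add: \<Phi>_def PiE_iff)
  qed
  then have finV: "finite V"
    by (rule finite_subset) (intro finite_PiE simple_functionD(1)[OF F], simp)
  have "V \<noteq> {}" using gauss.not_empty by (simp add: V_def)
  define N where "N = card V"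
  have N: "0 < N" unfolding N_def using finV \<open>V \<noteq> {}\<close> by (simp add: card_gt_0_iff)
  obtain e where e: "bij_betw e {..<N} V"
    using ex_bij_betw_nat_finite[OF finV] unfolding N_def atLeast0LessThan by blast
  define E where "E v = (\<Inter>k\<in>{..<n}. F k -` {v k} \<inter> space (gauss n))" for v
  have Em: "E v \<in> sets (gauss n)" for v
    unfolding E_def using n by (intro sets.finite_INT simple_functionD(2)[OF F]) auto
  have E_iff: "z \<in> E v \<longleftrightarrow> \<Phi> z = v" if zs: "z \<in> space (gauss n)" and vV: "v \<in> V" for z v
  proof -
    obtain y where "v = \<Phi> y" using Vz[OF vV] by blast
    then have ve: "v \<in> extensional {..<n}" by (simp add: \<Phi>_def)
    have "\<Phi> z = v \<longleftrightarrow> (\<forall>k<n. F k z = v k)"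
    proof
      assume "\<Phi> z = v"
      then have "v = \<Phi> z" by (rule sym)
      then show "\<forall>k<n. F k z = v k" by (simp add: \<Phi>_def)
    next
      assume a: "\<forall>k<n. F k z = v k"
      show "\<Phi> z = v" unfolding \<Phi>_def
        by (rule extensionalityI[OF restrict_extensional ve]) (simp add: a)
    qed
    then show ?thesis using zs n by (auto simp: E_def)
  qed
  define f where "f i = (indicator (E (e i)) :: _ \<Rightarrow> complex)" for i
  have fb: "bdd_meas n (f i)" for i
    unfolding f_def by (rule bdd_measI[where C = 1]) (use Em in \<open>auto simp: indicator_def\<close>)
  \<comment> \<open>Each point lies in exactly one level set, so a combination of the indicators
    takes one of the coefficients as its value.\<close>
  have pick: "\<exists>i<N. e i = \<Phi> z \<and> (\<forall>c. (\<Sum>i<N. c i * f i z) = c i)" if z: "z \<in> space (gauss n)" for z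
  proof -
    have "\<Phi> z \<in> e ` {..<N}" using z bij_betw_imp_surj_on[OF e] by (simp add: V_def)
    then obtain i where i: "i < N" "e i = \<Phi> z" by auto
    have "f j z = (if j = i then 1 else 0)" if "j < N" for j
    proof -
      have "e j \<in> V" using bij_betwE[OF e] that by simp
      then have "z \<in> E (e j) \<longleftrightarrow> e j = e i" using E_iff[OF z] i(2) by auto
      also have "\<dots> \<longleftrightarrow> j = i" using inj_on_eq_iff[OF bij_betw_imp_inj_on[OF e]] that i(1) by simp
      finally show ?thesis by (simp add: f_def indicator_def)
    qed
    then have "(\<Sum>j<N. c j * f j z) = (\<Sum>j<N. if j = i then c i else 0)" for c
      by (intro sum.cong refl) simp
    then show ?thesis using i by (intro exI[of _ i]) simp
  qed
  have fL: "f i \<in> borel_measurable (gauss n)" for i by (rule bdd_meas_measurable[OF fb])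
  define A where "A i j = L2_inner n (T_op \<rho> \<Lambda> \<beta> n (f i)) (f j)" for i j
  have sesq: "L2_inner n (T_op \<rho> \<Lambda> \<beta> n (\<lambda>z. \<Sum>i<N. c i * f i z)) (\<lambda>z. \<Sum>j<N. d j * f j z)
     = (\<Sum>i<N. \<Sum>j<N. c i * cnj (d j) * A i j)" for c d
    unfolding A_def by (rule T_op_sesquilinear[OF fb finite_Lambda])
  have max: "unimodular_max N N A \<le> \<rho> + mu_W W"
    unfolding unimodular_max_def
  proof (rule cSup_least)
    show "{cmod (\<Sum>i<N. \<Sum>j<N. A i j * \<epsilon> i * cnj (\<delta> j)) | \<epsilon> \<delta>.
       (\<forall>i<N. cmod (\<epsilon> i) = 1) \<and> (\<forall>j<N. cmod (\<delta> j) = 1)} \<noteq> {}"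
      using norm_one by (auto intro!: exI[of _ "\<lambda>_. 1"])
    fix x assume "x \<in> {cmod (\<Sum>i<N. \<Sum>j<N. A i j * \<epsilon> i * cnj (\<delta> j)) | \<epsilon> \<delta>.
       (\<forall>i<N. cmod (\<epsilon> i) = 1) \<and> (\<forall>j<N. cmod (\<delta> j) = 1)}"
    then obtain \<epsilon> \<delta> where x: "x = cmod (\<Sum>i<N. \<Sum>j<N. A i j * \<epsilon> i * cnj (\<delta> j))"
      and \<epsilon>: "\<And>i. i < N \<Longrightarrow> cmod (\<epsilon> i) = 1" and \<delta>: "\<And>j. j < N \<Longrightarrow> cmod (\<delta> j) = 1" by blast
    have "x = cmod (L2_inner n (T_op \<rho> \<Lambda> \<beta> n (\<lambda>z. \<Sum>i<N. \<epsilon> i * f i z)) (\<lambda>z. \<Sum>j<N. \<delta> j * f j z))"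
      unfolding x sesq by (simp only: mult_ac)
    also have "\<dots> \<le> \<rho> + mu_W W"
    proof (rule T_op_bound[OF n \<rho> S])
      show "(\<lambda>z. \<Sum>i<N. \<epsilon> i * f i z) \<in> borel_measurable (gauss n)" "(\<lambda>z. \<Sum>i<N. \<delta> i * f i z) \<in> borel_measurable (gauss n)"
        using fL by measurable
      show "cmod (\<Sum>i<N. \<epsilon> i * f i z) \<le> 1" if "z \<in> space (gauss n)" for z
        using pick[OF that] \<epsilon> by fastforce
      show "cmod (\<Sum>i<N. \<delta> i * f i z) \<le> 1" if "z \<in> space (gauss n)" for z
        using pick[OF that] \<delta> by fastforce
    qed
    finally show "x \<le> \<rho> + mu_W W" .
  qed
  have unit: "unit_cvec n (e i)" if "i < N" for i
  proof -
    have "e i \<in> V" using bij_betwE[OF e] that by simp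
    then obtain z where "e i = \<Phi> z" by (auto simp: V_def)
    then have "(\<Sum>k<n. (cmod (e i k))\<^sup>2) = (\<Sum>k<n. (cmod (F k z))\<^sup>2)" by (simp add: \<Phi>_def)
    then show ?thesis by (simp add: unit_cvec_def F1)
  qed
  \<comment> \<open>The coordinate \<open>F k\<close> rewritten as a combination of the indicators,
    the form to which sesquilinearity applies. The two agree on the space of the measure.\<close>
  define G where "G k z = (\<Sum>i<N. e i k * f i z)" for k z
  have Gb: "bdd_meas n (G k)" for k
  proof -
    have "multiplier n (\<lambda>z. \<Sum>i<N. e i k * f i z)"
      by (intro multiplier_sum multiplier_cmult bdd_meas_multiplier fb)
    then show ?thesis unfolding G_def[abs_def] by (rule multiplier_bdd)
  qed
  have GF: "G k z = F k z" if kn: "k < n" and zs: "z \<in> space (gauss n)" for k z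
  proof -
    obtain i where "e i = \<Phi> z" and c: "\<And>c. (\<Sum>i<N. c i * f i z) = c i" using pick[OF zs] by auto
    moreover have "(\<Sum>i<N. e i k * f i z) = e i k" by (rule c)
    ultimately show ?thesis using kn by (simp add: G_def \<Phi>_def)
  qed
  have "(\<Sum>k<n. L2_inner n (T_op \<rho> \<Lambda> \<beta> n (G k)) (G k)) = (\<Sum>k<n. \<Sum>i<N. \<Sum>j<N. e i k * cnj (e j k) * A i j)"
    unfolding G_def[abs_def] sesq ..
  also have "\<dots> = (\<Sum>i<N. \<Sum>k<n. \<Sum>j<N. e i k * cnj (e j k) * A i j)" by (rule sum.swap)
  also have "\<dots> = (\<Sum>i<N. \<Sum>j<N. \<Sum>k<n. e i k * cnj (e j k) * A i j)" by (intro sum.cong refl sum.swap)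
  also have "\<dots> = (\<Sum>i<N. \<Sum>j<N. A i j * cvec_inner n (e i) (e j))"
    unfolding cvec_inner_def sum_distrib_left by (intro sum.cong refl) (rule mult.commute)
  finally have eq: "(\<Sum>k<n. L2_inner n (T_op \<rho> \<Lambda> \<beta> n (G k)) (G k)) = (\<Sum>i<N. \<Sum>j<N. A i j * cvec_inner n (e i) (e j))" .
  have "cmod (\<Sum>i<N. \<Sum>j<N. A i j * cvec_inner n (e i) (e j)) \<le> K * unimodular_max N N A"
    by (rule K[unfolded grothendieck_bound_def, rule_format]) (use N n unit in simp_all)
  also have "\<dots> \<le> K * (\<rho> + mu_W W)"
    using grothendieck_bound_ge_1[OF K] max by (intro mult_left_mono) auto
  finally have le: "cmod (\<Sum>k<n. L2_inner n (T_op \<rho> \<Lambda> \<beta> n (G k)) (G k)) \<le> K * (\<rho> + mu_W W)" unfolding eq .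
  show ?thesis by (rule that[of G]) (fact Gb, erule (1) GF, rule le)
qed

text \<open>With Q the total mass in level 0, every other level carries at most 1 - Q, so the form
  is at least Q - \<rho> - b(1 - Q). The test against the identity field bounds Q from
  below.\<close>

lemma vector_lower_bound:
  assumes n: "0 < n" and \<rho>: "0 < \<rho>" and \<Lambda>: "\<And>l. l \<in> \<Lambda> \<Longrightarrow> 1 \<le> l"
    and G: "\<And>k. bdd_meas n (G k)" and G1: "\<And>z. z \<in> space (gauss n) \<Longrightarrow> (\<Sum>k<n. (cmod (G k z))\<^sup>2) = 1"
  defines "b \<equiv> \<Sum>l\<in>\<Lambda>. \<beta> l"
  shows "(1 + b) * ((cmod (\<integral>z. (\<Sum>k<n. G k z * cnj (z k)) \<partial>gauss n))\<^sup>2 / real n) - \<rho> - b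
    \<le> Re (\<Sum>k<n. L2_inner n (T_op \<rho> \<Lambda> \<beta> n (G k)) (G k))"
proof -
  have GL: "G k \<in> L2 n" for k by (rule bdd_meas_L2[OF G])
  define Q where "Q = (\<Sum>k<n. qsq n 0 (G k))"
  have b0: "0 \<le> b" unfolding b_def using beta_pos by (intro sum_nonneg) (auto intro: less_imp_le)
  have one: "(\<Sum>k<n. sqnorm n (G k)) = 1"
  proof -
    have "(\<Sum>k<n. sqnorm n (G k)) = (\<integral>z. (\<Sum>k<n. (cmod (G k z))\<^sup>2) \<partial>gauss n)"
      unfolding sqnorm_def by (rule Bochner_Integration.integral_sum[symmetric]) (rule L2_integrable[OF GL])
    also have "\<dots> = (\<integral>z. 1 \<partial>gauss n)" by (rule Bochner_Integration.integral_cong[OF refl]) (rule G1)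
    finally show ?thesis using gauss.prob_space[of n] by simp
  qed
  \<comment> \<open>Bessel's inequality over two disjoint index sets; they are disjoint because l is
    at least 1.\<close>
  have lev: "(\<Sum>k<n. qsq n l (G k)) \<le> 1 - Q" if l: "l \<in> \<Lambda>" for l
  proof -
    have "qsq n 0 (G k) + qsq n l (G k) \<le> sqnorm n (G k)" for k
    proof -
      have "qsq n 0 (G k) + qsq n l (G k) = (\<Sum>\<kappa>\<in>pair_indices n (Suc 0) 0 \<union> pair_indices n (Suc l) l. (cmod (coef n \<kappa> (G k)))\<^sup>2)"
        unfolding qsq_def using \<Lambda>[OF l] pair_indices_disjoint[of "Suc 0" 0 "Suc l" l]
        by (intro sum.union_disjoint[symmetric]) auto
      also have "\<dots> \<le> sqnorm n (G k)"
        by (intro bessel GL Un_least pair_indices_ext) simp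
      finally show ?thesis .
    qed
    then have "(\<Sum>k<n. qsq n 0 (G k) + qsq n l (G k)) \<le> (\<Sum>k<n. sqnorm n (G k))" by (intro sum_mono)
    then show ?thesis unfolding one Q_def sum.distrib by linarith
  qed
  have "Re (L2_inner n (T_op \<rho> \<Lambda> \<beta> n (G k)) (G k))
      = qsq n 0 (G k) - \<rho> * sqnorm n (E1 n (G k)) - (\<Sum>l\<in>\<Lambda>. \<beta> l * qsq n l (G k))" for k
    unfolding T_op_inner[OF G G finite_Lambda] E1_inner[OF G G] L2_inner_self qform_self by simp
  then have "Re (\<Sum>k<n. L2_inner n (T_op \<rho> \<Lambda> \<beta> n (G k)) (G k))
    = Q - \<rho> * (\<Sum>k<n. sqnorm n (E1 n (G k))) - (\<Sum>k<n. \<Sum>l\<in>\<Lambda>. \<beta> l * qsq n l (G k))"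
    by (simp add: Q_def sum_subtractf sum_distrib_left)
  moreover have "\<rho> * (\<Sum>k<n. sqnorm n (E1 n (G k))) \<le> \<rho> * 1"
    using \<rho> unfolding one[symmetric] by (intro mult_left_mono sum_mono sqnorm_E1_le G) auto
  moreover have "(\<Sum>k<n. \<Sum>l\<in>\<Lambda>. \<beta> l * qsq n l (G k)) \<le> b * (1 - Q)"
  proof -
    have "(\<Sum>k<n. \<Sum>l\<in>\<Lambda>. \<beta> l * qsq n l (G k)) = (\<Sum>l\<in>\<Lambda>. \<beta> l * (\<Sum>k<n. qsq n l (G k)))"
      unfolding sum_distrib_left by (rule sum.swap)
    also have "\<dots> \<le> (\<Sum>l\<in>\<Lambda>. \<beta> l * (1 - Q))"
      using beta_pos by (intro sum_mono mult_left_mono lev) (auto intro: less_imp_le)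
    finally show ?thesis by (simp add: b_def sum_distrib_right)
  qed
  ultimately have main: "(1 + b) * Q - \<rho> - b \<le> Re (\<Sum>k<n. L2_inner n (T_op \<rho> \<Lambda> \<beta> n (G k)) (G k))"
    by (simp add: algebra_simps)
  have "(cmod (\<integral>z. (\<Sum>k<n. G k z * cnj (z k)) \<partial>gauss n))\<^sup>2 / real n \<le> Q"
  proof -
    define a where "a k = L2_inner n (G k) (\<lambda>z. z k)" for k
    have ak: "(cmod (a k))\<^sup>2 \<le> qsq n 0 (G k)" if k: "k < n" for k
    proof -
      have "(cmod (coef n (unit_index n k (Suc 0) 0) (G k)))\<^sup>2 \<le> qsq n 0 (G k)"
        unfolding qsq_def using unit_index_in[OF k, of "Suc 0" 0] by (intro member_le_sum) auto
      then show ?thesis by (simp add: coef_unit_index[OF k] hermite1_1_0 a_def)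
    qed
    have "(\<integral>z. (\<Sum>k<n. G k z * cnj (z k)) \<partial>gauss n) = (\<Sum>k<n. a k)"
      unfolding a_def L2_inner_def by (rule Bochner_Integration.integral_sum) (simp add: L2_integrable_inner[OF GL coord_L2])
    then have "(cmod (\<integral>z. (\<Sum>k<n. G k z * cnj (z k)) \<partial>gauss n))\<^sup>2 \<le> (\<Sum>k<n. cmod (a k))\<^sup>2"
      by (simp add: norm_sum power_mono)
    \<comment> \<open>Cauchy--Schwarz over the \<open>n\<close> coordinates, which is the origin of
      the division by \<open>real n\<close>.\<close>
    also have "\<dots> \<le> real n * (\<Sum>k<n. (cmod (a k))\<^sup>2)"
      using Cauchy_Schwarz_ineq_sum[of "\<lambda>_. 1" "\<lambda>k. cmod (a k)" "{..<n}"] by simp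
    also have "\<dots> \<le> real n * Q"
      unfolding Q_def by (intro mult_left_mono sum_mono ak) auto
    finally show ?thesis using n by (simp add: field_simps)
  qed
  from mult_left_mono[OF this, of "1 + b"] main b0 show ?thesis by linarith
qed

text \<open>Two limits: the simple fields converge to z/\<parallel>z\<parallel> for fixed dimension,
  and then the dimension grows. In the second limit (1 + b)(1 - 1/n) - \<rho> - b tends to 1 -
  \<rho>, so b disappears.\<close>

lemma grothendieck_lower_bound:
  assumes \<rho>: "0 < \<rho>" and S: "schur_scalar \<rho> \<Lambda> \<beta> W \<le> 1" and \<Lambda>: "\<And>l. l \<in> \<Lambda> \<Longrightarrow> 1 \<le> l"
    and K: "grothendieck_bound K"
  shows "1 - \<rho> \<le> K * (\<rho> + mu_W W)"
proof -
  define b where "b = (\<Sum>l\<in>\<Lambda>. \<beta> l)"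
  have b0: "0 \<le> b" unfolding b_def using beta_pos by (intro sum_nonneg) (auto intro: less_imp_le)
  have bound: "(1 + b) * (1 - 1 / real n) - \<rho> - b \<le> K * (\<rho> + mu_W W)" if n: "0 < n" for n
  proof -
    define R where "R = (\<integral>z. sqrt (\<Sum>k<n. (cmod (z k))\<^sup>2) \<partial>gauss n)"
    obtain F where F: "\<And>m k. simple_function (gauss n) (F m k)"
      and F1: "\<And>m z. (\<Sum>k<n. (cmod (F m k z))\<^sup>2) = 1"
      and lim0: "(\<lambda>m. \<integral>z. (\<Sum>k<n. F m k z * cnj (z k)) \<partial>gauss n) \<longlonglongrightarrow> of_real (\<integral>z. sqrt (\<Sum>k<n. (cmod (z k))\<^sup>2) \<partial>gauss n)"
      by (rule unit_vector_approximation[OF n]; rule that)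
    note lim = lim0[folded R_def]
    have each: "(1 + b) * ((cmod (\<integral>z. (\<Sum>k<n. F m k z * cnj (z k)) \<partial>gauss n))\<^sup>2 / real n) - \<rho> - b \<le> K * (\<rho> + mu_W W)" for m
    proof -
      obtain G where G: "\<And>k. bdd_meas n (G k)" and GF: "\<And>k z. k < n \<Longrightarrow> z \<in> space (gauss n) \<Longrightarrow> G k z = F m k z"
        and le: "cmod (\<Sum>k<n. L2_inner n (T_op \<rho> \<Lambda> \<beta> n (G k)) (G k)) \<le> K * (\<rho> + mu_W W)"
        using grothendieck_discretization[OF n \<rho> S K F F1] by blast
      have G1: "(\<Sum>k<n. (cmod (G k z))\<^sup>2) = 1" if "z \<in> space (gauss n)" for z
        using F1[of m z] GF[OF _ that] by simp
      have "(\<integral>z. (\<Sum>k<n. G k z * cnj (z k)) \<partial>gauss n) = (\<integral>z. (\<Sum>k<n. F m k z * cnj (z k)) \<partial>gauss n)"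
        by (intro Bochner_Integration.integral_cong refl sum.cong) (simp add: GF)
      then show ?thesis
        using vector_lower_bound[OF n \<rho> \<Lambda> G G1] order_trans[OF complex_Re_le_cmod le] unfolding b_def by simp
    qed
    have "(\<lambda>m. (1 + b) * ((cmod (\<integral>z. (\<Sum>k<n. F m k z * cnj (z k)) \<partial>gauss n))\<^sup>2 / real n) - \<rho> - b)
      \<longlonglongrightarrow> (1 + b) * ((cmod (of_real R))\<^sup>2 / real n) - \<rho> - b"
      using n by (intro tendsto_intros lim) auto
    then have "(1 + b) * ((cmod (of_real R))\<^sup>2 / real n) - \<rho> - b \<le> K * (\<rho> + mu_W W)"
      by (rule LIMSEQ_le_const2) (use each in auto)
    moreover have "1 - 1 / real n \<le> (cmod (of_real R))\<^sup>2 / real n"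
    proof -
      define t where "t = 1 - 1 / (2 * real n)"
      have t0: "0 \<le> t" using n by (simp add: t_def field_simps)
      have "(sqrt (real n) * t)\<^sup>2 \<le> R\<^sup>2"
        using expectation_norm_ge(2)[OF n] t0 unfolding R_def t_def by (intro power_mono) auto
      then have "t\<^sup>2 \<le> R\<^sup>2 / real n" using n by (simp add: power_mult_distrib field_simps)
      moreover have "1 - 1 / real n \<le> t\<^sup>2"
      proof -
        have "t\<^sup>2 = 1 - 1 / real n + (1 / (2 * real n))\<^sup>2"
          using n by (simp add: t_def power2_eq_square field_simps)
        then show ?thesis by simp
      qed
      ultimately show ?thesis by simp
    qed
    from mult_left_mono[OF this, of "1 + b"] calculation b0 show ?thesis by linarith
  qed
  have "(\<lambda>n. (1 + b) * (1 - inverse (real (Suc n))) - \<rho> - b) \<longlonglongrightarrow> (1 + b) * (1 - 0) - \<rho> - b"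
    by (intro tendsto_intros LIMSEQ_inverse_real_of_nat)
  then have "(1 + b) * (1 - 0) - \<rho> - b \<le> K * (\<rho> + mu_W W)"
  proof (rule LIMSEQ_le_const2)
    show "\<exists>N. \<forall>n\<ge>N. (1 + b) * (1 - inverse (real (Suc n))) - \<rho> - b \<le> K * (\<rho> + mu_W W)"
      using bound[of "Suc _"] by (auto simp: inverse_eq_divide)
  qed
  then show ?thesis by simp
qed

end

theorem theorem3p1:
  fixes \<rho> :: real and \<Lambda> :: "nat set" and \<beta> :: "nat \<Rightarrow> real" and W :: "real \<Rightarrow> real"
  assumes "0 < \<rho>" and "\<rho> < 1"
    and "finite \<Lambda>" and "\<forall>l\<in>\<Lambda>. 1 \<le> l"
    and "\<forall>l\<in>\<Lambda>. 0 < \<beta> l"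
    and "W \<in> borel_measurable (restrict_space borel {0..})"
    and "\<forall>t\<ge>0. 0 < W t"
    and "integrable radial_measure (\<lambda>r. W (r\<^sup>2))"
    and "\<forall>p q. \<forall>l\<in>gram_index \<Lambda> p q. \<forall>m\<in>gram_index \<Lambda> p q.
           integrable radial_measure (gram_integrand W p q l m)"
    and "\<forall>p q. gram_index \<Lambda> p q \<noteq> {} \<longrightarrow>
           loewner_le_on (gram_index \<Lambda> p q) (gram_mat \<beta> W p q) id_mat"
    and "schur_scalar \<rho> \<Lambda> \<beta> W \<le> 1"
  shows "(\<forall>n\<ge>1. inf_one_norm n (T_op \<rho> \<Lambda> \<beta> n) \<le> ereal (\<rho> + mu_W W)) \<and>
         complex_grothendieck_constant \<ge> ereal ((1 - \<rho>) / (\<rho> + mu_W W))"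
proof -
  \<comment> \<open>W is measurable on the half-line only, which is where squares lie.\<close>
  have "(\<lambda>r::real. r\<^sup>2) \<in> measurable borel (restrict_space borel {0..})"
    by (intro measurable_restrict_space2) auto
  from measurable_compose[OF this assms(6)]
  have Wm: "(\<lambda>r. W (r\<^sup>2)) \<in> borel_measurable borel" .
  interpret gram_weight \<Lambda> \<beta> W
    by unfold_locales (use assms Wm in auto)
  have mu: "0 \<le> mu_W W" unfolding mu_W_def by (intro integral_nonneg_AE AE_I2) (simp add: less_imp_le[OF W_pos])
  have part1: "inf_one_norm n (T_op \<rho> \<Lambda> \<beta> n) \<le> ereal (\<rho> + mu_W W)" if n: "1 \<le> n" for n
    unfolding inf_one_norm_def
  proof (rule Sup_least)
    fix x assume "x \<in> {ereal (cmod (L2_inner n (T_op \<rho> \<Lambda> \<beta> n f) g)) | f g.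
     f \<in> borel_measurable (gauss n) \<and> g \<in> borel_measurable (gauss n) \<and>
     (\<forall>z\<in>space (gauss n). cmod (f z) \<le> 1) \<and> (\<forall>z\<in>space (gauss n). cmod (g z) \<le> 1)}"
    then obtain f g where x: "x = ereal (cmod (L2_inner n (T_op \<rho> \<Lambda> \<beta> n f) g))"
      and fg: "f \<in> borel_measurable (gauss n)" "\<And>z. z \<in> space (gauss n) \<Longrightarrow> cmod (f z) \<le> 1"
        "g \<in> borel_measurable (gauss n)" "\<And>z. z \<in> space (gauss n) \<Longrightarrow> cmod (g z) \<le> 1" by blast
    have "0 < n" using n by simp
    from T_op_bound[OF this assms(1) assms(11) fg] show "x \<le> ereal (\<rho> + mu_W W)" by (simp add: x)
  qed
  have part2: "ereal ((1 - \<rho>) / (\<rho> + mu_W W)) \<le> complex_grothendieck_constant"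
    unfolding complex_grothendieck_constant_def
  proof (rule Inf_greatest)
    fix x assume "x \<in> {ereal K | K. grothendieck_bound K}"
    then obtain K where x: "x = ereal K" and K: "grothendieck_bound K" by blast
    have "1 - \<rho> \<le> K * (\<rho> + mu_W W)"
      by (rule grothendieck_lower_bound[OF assms(1) assms(11) _ K]) (use assms(4) in blast)
    moreover have "0 < \<rho> + mu_W W" using assms(1) mu by linarith
    ultimately show "ereal ((1 - \<rho>) / (\<rho> + mu_W W)) \<le> x" by (simp add: x divide_le_eq)
  qed
  show ?thesis using part1 part2 by blast
qed

end
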